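(* Let $D:\mathbf{C}^{\mathrm{op}}\to\mathbf{IntAlg}$ be a topological modal doctrine on a small cartesian category $\mathbf{C}$. Equip the syntactic category $\mathrm{Synt}_{S4}(D)$ with the factorization system $(\mathcal{E},\mathcal{M})$ described in the context and, for each object $\varphi\in D(X)$, equip the poset of $\mathcal{M}$-subobjects of $\varphi$, identified with ${\downarrow}\varphi=\{\psi\in D(X):\psi\le\varphi\}$, with the modality $\Diamond_\varphi\psi=\varphi\wedge\Diamond_X\psi$, where $\Diamond_X$ is the modality of $D(X)$. Then $\mathrm{Synt}_{S4}(D)$ is a topological modal category.
   Context: **Topological modal categories.** An f-Boolean category is a category $\mathbf{E}$ with finite limits and an orthogonal factorization system $(\mathcal{E},\mathcal{M})$ such that: every arrow of $\mathcal{M}$ is a monomorphism and every regular monomorphism is in $\mathcal{M}$; $\mathcal{E}$ and $\mathcal{M}$ are stable under pullback; for each object $X$ the poset $\mathrm{Sub}(X)$ of isomorphism classes of $\mathcal{M}$-arrows into $X$ is a (small) Boolean algebra; for each arrow $f:X\to Y$ the pullback map $f^*=f^{-1}:\mathrm{Sub}(Y)\to\mathrm{Sub}(X)$ is a morphism of Boolean algebras. Its left adjoint (image) is $\exists_f$. Arrows of $\mathcal{M}$ are called embeddings; $A\subseteq X$ means $A\in\mathrm{Sub}(X)$. A modal algebra is a Boolean algebra with an operator $\Diamond$ preserving finite joins. A modal category is an f-Boolean category in which each $\mathrm{Sub}(X)$ carries a modal algebra structure with $\Diamond f^*A\le f^*\Diamond A$ for all $f:X\to Y$, $A\subseteq Y$,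 and $\Diamond A=m^*\Diamond\exists_mA$ for all embeddings $m:X\hookrightarrow Y$, $A\subseteq X$. In a modal category, a relation from $X$ to $Y$ is $R\subseteq X\times Y$; $RA=\exists_{\pi_Y}(R\wedge\pi_X^{-1}A)$ for $A\subseteq X$; $R^{-1}\subseteq Y\times X$ is the reciprocal relation; products of relations are the evident ones. A partial map $f:X\rightharpoonup Y$ is an embedding $d_f:\mathrm{dom}(f)\hookrightarrow X$ with an arrow $t_f:\mathrm{dom}(f)\to Y$, identified with the relation $(d_f,t_f):\mathrm{dom}(f)\hookrightarrow X\times Y$. A loop is a sequence $R_1,\dots,R_n$ where $R_i$ is a relation from $X_i$ to $X_{i-1}$ and $X_0=X_n$ (the anchor). Acceptable loops are defined inductively: (A1) the empty loop on any anchor is acceptable; (A2) inserting identity relations anywhere in an acceptable loop gives an acceptable loop; (A3) concatenations of acceptable loops with the same anchor are acceptable; (A4) if $w$ is acceptable with anchor $X$ and $f:X\rightharpoonup Y$ is a partial map, then $f,w,f^{-1}$ is acceptable; (A5) if $R_1,\dots,R_n$ and $S_1,\dots,S_n$ are acceptable, so is $R_1\times S_1,\dots,R_n\times S_n$. A modal category is topological if: (S4) $S\le\Diamond S=\Diamond\Diamond S$ for all subobjects $S$; (PI) $\pi_X^{-1}\Diamond A\wedge\pi_Y^{-1}\Diamond B\le\Diamond(\pi_X^{-1}A\wedge\pi_Y^{-1}B)$ for all $A\subseteq X$, $B\subseteq Y$; (LC) $\Diamond R_1\Diamond R_2\cdots\Diamond R_nA\le\Diamond A$ for every acceptable loop and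 every subobject $A$ of its anchor. **Boolean doctrines.** Cartesian means having (preserving) finite products. A Boolean doctrine on a small cartesian category $\mathbf{C}$ is a functor $D:\mathbf{C}^{\mathrm{op}}\to\mathbf{BoolAlg}$ such that each $D(f)$ has a left adjoint $\exists_f$; $\exists_f(D(f)(\varphi)\wedge\psi)=\varphi\wedge\exists_f\psi$; and for all objects $X$ and arrows $f:Y\to Z$, $D(f)\circ\exists_{\pi_Z}=\exists_{\pi_Y}\circ D(X\times f)$ (with $\pi_Y:X\times Y\to Y$, $\pi_Z:X\times Z\to Z$) and $D(X\times X\times f)\circ\exists_{\Delta_X\times Z}=\exists_{\Delta_X\times Y}\circ D(X\times f)$ (with $\Delta_X$ the diagonal). Elements of $D(X)$ are treated as formulas $\varphi(x)$ of first-order logic with equality ($D(f)$ is substitution, $\exists_{\pi}$ along projections is existential quantification, equality on $X$ is $\exists_{\Delta_X}(\top)$); we also write $\varphi\subseteq X$. For $R\in D(X\times Y)$ and $A\in D(X)$, $RA=\exists_{\pi_Y}(R\wedge D(\pi_X)A)\in D(Y)$; reciprocals, composites and products of relations are defined by the usual formulas. A partial map $f:X\rightharpoonup Y$ (relative to $D$) is $R\in D(X\times Y)$ with $R(x,y)\wedge R(x,y')\vdash y=y'$; one writes $f(x)=y$ for $R(x,y)$, $\mathrm{dom}(f)=[\exists y: f(x)=y]\in D(X)$, $\mathrm{im}(f)=[\exists x: f(x)=y]\in D(Y)$. For $\varphi\le\mathrm{dom}(f)$ the restriction $f|_\varphi$ is given by $\varphi(x)\wedge(f(x)=y)$. An arrow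 $f$ of $\mathbf{C}$ is regarded as a partial map via its graph $\exists_{(\mathrm{id},f)}(\top)$. **Topological modal doctrines.** $\mathbf{IntAlg}$ is the category of S4 modal algebras (modal algebras with $S\le\Diamond S=\Diamond\Diamond S$) and lax morphisms (Boolean morphisms $h$ with $\Diamond h(x)\le h(\Diamond x)$). A topological modal doctrine on a small cartesian category $\mathbf{C}$ is a functor $D:\mathbf{C}^{\mathrm{op}}\to\mathbf{IntAlg}$ such that: (1) its composite with the forgetful functor to $\mathbf{BoolAlg}$ is a Boolean doctrine; (2) $D(\pi_X)(\Diamond A)\wedge D(\pi_Y)(\Diamond B)\le\Diamond(D(\pi_X)A\wedge D(\pi_Y)B)$ for all objects $X,Y$ of $\mathbf{C}$, $A\in D(X)$, $B\in D(Y)$; (3) there is a distinguished set $\mathcal{C}(D)$ of partial maps, closed under composition and products and containing all arrows of $\mathbf{C}$; (4) $\Diamond R_1\Diamond R_2\cdots\Diamond R_nA\le\Diamond A$ for every acceptable loop $R_1,\dots,R_n$ of relations (elements $R_i\in D(X_i\times X_{i-1})$, with $X_0=X_n$ the anchor) and every $A\in D(X_0)$, where acceptable loops of relations relative to $D$ are defined inductively as follows: the empty loop on any anchor (object of $\mathbf{C}$) is acceptable; inserting identity relations anywhere in an acceptable loop gives an acceptable loop; concatenations of acceptable loops with the same anchor are acceptable; if $w$ is acceptable with anchor $X$ and $f:X\rightharpoonup Y$ is a partial map in $\mathcal{C}(D)$, then $f,w,f^{-1}$ is acceptable; if $R_1,\dots,R_n$ and $S_1,\dots,S_n$ are acceptable,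 so is $R_1\times S_1,\dots,R_n\times S_n$. **Syntactic categories.** $\mathrm{Synt}_{BA}(D)$ is the Boolean category whose objects are the elements $\varphi\in D(X)$ ($X\in\mathbf{C}$) and whose morphisms $\varphi\to\psi$ ($\varphi\in D(X)$, $\psi\in D(Y)$), called maps, are the partial maps $f:X\rightharpoonup Y$ with $\mathrm{dom}(f)=\varphi$ and $\mathrm{im}(f)\le\psi$, with composition of relations. A map is continuous if it is a restriction of a partial map in $\mathcal{C}(D)$. $\mathrm{Synt}_{S4}(D)$ is the wide subcategory of $\mathrm{Synt}_{BA}(D)$ of continuous maps. $\mathcal{E}$ is the class of continuous maps that are surjections, i.e. regular epimorphisms in $\mathrm{Synt}_{BA}(D)$ (for $f:\varphi\to\psi$: $\mathrm{im}(f)=\psi$). $\mathcal{M}$ is the closure under isomorphism in $\mathrm{Synt}_{S4}(D)$ of the class of maps $\varphi\to\psi$, for $\varphi\le\psi$ in some $D(X)$, that are restrictions of the identity of $X$; each $\psi\le\varphi$ is identified with the $\mathcal{M}$-subobject of $\varphi$ given by this inclusion map. *)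

theory Defs
  imports "HOL-Algebra.Lattice"
begin

section \<open>Boolean algebras and modal algebras\<close>

locale boolean_lattice = bounded_lattice L for L (structure) +
  assumes meet_join_distrib:
      "\<lbrakk>x \<in> carrier L; y \<in> carrier L; z \<in> carrier L\<rbrakk>
        \<Longrightarrow> x \<sqinter> (y \<squnion> z) = (x \<sqinter> y) \<squnion> (x \<sqinter> z)"
    and complement_exists:
      "x \<in> carrier L \<Longrightarrow> \<exists>y\<in>carrier L. x \<sqinter> y = \<bottom> \<and> x \<squnion> y = \<top>"

text \<open>Complements are preserved automatically.\<close>

definition boolean_hom ::
    "('d, 'm) gorder_scheme \<Rightarrow> ('e, 'n) gorder_scheme \<Rightarrow> ('d \<Rightarrow> 'e) \<Rightarrow> bool" where
  "boolean_hom L K h \<longleftrightarrow>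
     h \<in> carrier L \<rightarrow> carrier K \<and>
     h \<top>\<^bsub>L\<^esub> = \<top>\<^bsub>K\<^esub> \<and> h \<bottom>\<^bsub>L\<^esub> = \<bottom>\<^bsub>K\<^esub> \<and>
     (\<forall>x\<in>carrier L. \<forall>y\<in>carrier L.
        h (x \<sqinter>\<^bsub>L\<^esub> y) = h x \<sqinter>\<^bsub>K\<^esub> h y \<and> h (x \<squnion>\<^bsub>L\<^esub> y) = h x \<squnion>\<^bsub>K\<^esub> h y)"

record 'd modal_order = "'d gorder" +
  dia :: "'d \<Rightarrow> 'd" (\<open>\<diamond>\<index>_\<close> [90] 90)

locale modal_algebra = boolean_lattice L for L (structure) +
  assumes dia_closed: "x \<in> carrier L \<Longrightarrow> \<diamond>x \<in> carrier L"
    and dia_bottom: "\<diamond>\<bottom> = \<bottom>"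
    and dia_join: "\<lbrakk>x \<in> carrier L; y \<in> carrier L\<rbrakk> \<Longrightarrow> \<diamond>(x \<squnion> y) = \<diamond>x \<squnion> \<diamond>y"

locale S4_modal_algebra = modal_algebra L for L (structure) +
  assumes dia_increasing: "x \<in> carrier L \<Longrightarrow> x \<sqsubseteq> \<diamond>x"
    and dia_idem: "x \<in> carrier L \<Longrightarrow> \<diamond>(\<diamond>x) = \<diamond>x"


section \<open>Categories\<close>

record ('o, 'a) cat =
  Ob :: "'o set"
  Arr :: "'a set"
  Dom :: "'a \<Rightarrow> 'o"
  Cod :: "'a \<Rightarrow> 'o"
  ide :: "'o \<Rightarrow> 'a"
  Comp :: "'a \<Rightarrow> 'a \<Rightarrow> 'a" (infixr \<open>\<cdot>\<index>\<close> 75)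

definition hom :: "('o, 'a) cat \<Rightarrow> 'o \<Rightarrow> 'o \<Rightarrow> 'a set" where
  "hom C X Y = {f \<in> Arr C. Dom C f = X \<and> Cod C f = Y}"

locale category =
  fixes C :: "('o, 'a) cat" (structure)
  assumes Dom_Ob: "f \<in> Arr C \<Longrightarrow> Dom C f \<in> Ob C"
    and Cod_Ob: "f \<in> Arr C \<Longrightarrow> Cod C f \<in> Ob C"
    and ide_hom: "X \<in> Ob C \<Longrightarrow> ide C X \<in> hom C X X"
    and Comp_hom: "\<lbrakk>f \<in> hom C X Y; g \<in> hom C Y Z\<rbrakk> \<Longrightarrow> g \<cdot> f \<in> hom C X Z"
    and Comp_ide_left: "f \<in> hom C X Y \<Longrightarrow> ide C Y \<cdot> f = f"
    and Comp_ide_right: "f \<in> hom C X Y \<Longrightarrow> f \<cdot> ide C X = f"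
    and Comp_assoc: "\<lbrakk>f \<in> hom C W X; g \<in> hom C X Y; h \<in> hom C Y Z\<rbrakk>
          \<Longrightarrow> h \<cdot> (g \<cdot> f) = (h \<cdot> g) \<cdot> f"

definition iso :: "('o, 'a) cat \<Rightarrow> 'a \<Rightarrow> bool" where
  "iso C f \<longleftrightarrow> f \<in> Arr C \<and>
     (\<exists>g\<in>hom C (Cod C f) (Dom C f).
        g \<cdot>\<^bsub>C\<^esub> f = ide C (Dom C f) \<and> f \<cdot>\<^bsub>C\<^esub> g = ide C (Cod C f))"

definition monomorphism :: "('o, 'a) cat \<Rightarrow> 'a \<Rightarrow> bool" where
  "monomorphism C m \<longleftrightarrow> m \<in> Arr C \<and>
     (\<forall>W. \<forall>g\<in>hom C W (Dom C m). \<forall>h\<in>hom C W (Dom C m). m \<cdot>\<^bsub>C\<^esub> g = m \<cdot>\<^bsub>C\<^esub> h \<longrightarrow> g = h)"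

definition is_equalizer :: "('o, 'a) cat \<Rightarrow> 'a \<Rightarrow> 'a \<Rightarrow> 'a \<Rightarrow> bool" where
  "is_equalizer C f g m \<longleftrightarrow>
     m \<in> Arr C \<and> f \<in> Arr C \<and> g \<in> Arr C \<and>
     Dom C f = Cod C m \<and> Dom C g = Cod C m \<and> Cod C f = Cod C g \<and>
     f \<cdot>\<^bsub>C\<^esub> m = g \<cdot>\<^bsub>C\<^esub> m \<and>
     (\<forall>W. \<forall>h\<in>hom C W (Cod C m). f \<cdot>\<^bsub>C\<^esub> h = g \<cdot>\<^bsub>C\<^esub> h \<longrightarrow>
        (\<exists>!k. k \<in> hom C W (Dom C m) \<and> m \<cdot>\<^bsub>C\<^esub> k = h))"

definition regular_mono :: "('o, 'a) cat \<Rightarrow> 'a \<Rightarrow> bool" where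
  "regular_mono C m \<longleftrightarrow> (\<exists>f g. is_equalizer C f g m)"

text \<open>\<^term>\<open>is_pullback C f g p q\<close>: the pullback of the cospan \<open>(f, g)\<close> is the span \<open>(p, q)\<close>,
  so that \<open>p\<close> is the pullback of \<open>g\<close> along \<open>f\<close>.\<close>

definition is_pullback :: "('o, 'a) cat \<Rightarrow> 'a \<Rightarrow> 'a \<Rightarrow> 'a \<Rightarrow> 'a \<Rightarrow> bool" where
  "is_pullback C f g p q \<longleftrightarrow>
     f \<in> Arr C \<and> g \<in> Arr C \<and> p \<in> Arr C \<and> q \<in> Arr C \<and>
     Cod C f = Cod C g \<and> Cod C p = Dom C f \<and> Cod C q = Dom C g \<and> Dom C p = Dom C q \<and>
     f \<cdot>\<^bsub>C\<^esub> p = g \<cdot>\<^bsub>C\<^esub> q \<and>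
     (\<forall>W. \<forall>h\<in>hom C W (Dom C f). \<forall>k\<in>hom C W (Dom C g). f \<cdot>\<^bsub>C\<^esub> h = g \<cdot>\<^bsub>C\<^esub> k \<longrightarrow>
        (\<exists>!u. u \<in> hom C W (Dom C p) \<and> p \<cdot>\<^bsub>C\<^esub> u = h \<and> q \<cdot>\<^bsub>C\<^esub> u = k))"

definition is_functor ::
    "('i, 'u) cat \<Rightarrow> ('o, 'a) cat \<Rightarrow> ('i \<Rightarrow> 'o) \<Rightarrow> ('u \<Rightarrow> 'a) \<Rightarrow> bool" where
  "is_functor J C Fo Fa \<longleftrightarrow>
     (\<forall>i\<in>Ob J. Fo i \<in> Ob C \<and> Fa (ide J i) = ide C (Fo i)) \<and>
     (\<forall>u\<in>Arr J. Fa u \<in> hom C (Fo (Dom J u)) (Fo (Cod J u))) \<and>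
     (\<forall>u\<in>Arr J. \<forall>v\<in>Arr J. Dom J v = Cod J u \<longrightarrow> Fa (v \<cdot>\<^bsub>J\<^esub> u) = Fa v \<cdot>\<^bsub>C\<^esub> Fa u)"

definition is_cone ::
    "('i, 'u) cat \<Rightarrow> ('o, 'a) cat \<Rightarrow> ('i \<Rightarrow> 'o) \<Rightarrow> ('u \<Rightarrow> 'a) \<Rightarrow> 'o \<Rightarrow> ('i \<Rightarrow> 'a) \<Rightarrow> bool" where
  "is_cone J C Fo Fa P p \<longleftrightarrow>
     P \<in> Ob C \<and> (\<forall>i\<in>Ob J. p i \<in> hom C P (Fo i)) \<and>
     (\<forall>u\<in>Arr J. Fa u \<cdot>\<^bsub>C\<^esub> p (Dom J u) = p (Cod J u))"

definition is_limit ::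
    "('i, 'u) cat \<Rightarrow> ('o, 'a) cat \<Rightarrow> ('i \<Rightarrow> 'o) \<Rightarrow> ('u \<Rightarrow> 'a) \<Rightarrow> 'o \<Rightarrow> ('i \<Rightarrow> 'a) \<Rightarrow> bool" where
  "is_limit J C Fo Fa P p \<longleftrightarrow>
     is_cone J C Fo Fa P p \<and>
     (\<forall>Q q. is_cone J C Fo Fa Q q \<longrightarrow>
        (\<exists>!h. h \<in> hom C Q P \<and> (\<forall>i\<in>Ob J. p i \<cdot>\<^bsub>C\<^esub> h = q i)))"

text \<open>Every finite category is isomorphic to one whose objects and arrows are natural numbers,
  so index categories of that type suffice.\<close>

definition has_finite_limits :: "('o, 'a) cat \<Rightarrow> bool" where
  "has_finite_limits C \<longleftrightarrow>
     (\<forall>(J :: (nat, nat) cat) Fo Fa.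
        category J \<and> finite (Ob J) \<and> finite (Arr J) \<and> is_functor J C Fo Fa \<longrightarrow>
        (\<exists>P p. is_limit J C Fo Fa P p))"

definition has_finite_products :: "('o, 'a) cat \<Rightarrow> bool" where
  "has_finite_products C \<longleftrightarrow>
     (\<forall>(n :: nat) X. (\<forall>i<n. X i \<in> Ob C) \<longrightarrow>
        (\<exists>P p. P \<in> Ob C \<and> (\<forall>i<n. p i \<in> hom C P (X i)) \<and>
           (\<forall>Q q. Q \<in> Ob C \<and> (\<forall>i<n. q i \<in> hom C Q (X i)) \<longrightarrow>
              (\<exists>!h. h \<in> hom C Q P \<and> (\<forall>i<n. p i \<cdot>\<^bsub>C\<^esub> h = q i)))))"

definition is_product :: "('o, 'a) cat \<Rightarrow> 'o \<Rightarrow> 'o \<Rightarrow> 'o \<Rightarrow> 'a \<Rightarrow> 'a \<Rightarrow> bool" where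
  "is_product C X Y P p q \<longleftrightarrow>
     p \<in> hom C P X \<and> q \<in> hom C P Y \<and>
     (\<forall>W. \<forall>f\<in>hom C W X. \<forall>g\<in>hom C W Y.
        (\<exists>!h. h \<in> hom C W P \<and> p \<cdot>\<^bsub>C\<^esub> h = f \<and> q \<cdot>\<^bsub>C\<^esub> h = g))"

text \<open>An arbitrary choice of binary products; nothing below depends on it up to canonical
  isomorphism.\<close>

definition prod_cone :: "('o, 'a) cat \<Rightarrow> 'o \<Rightarrow> 'o \<Rightarrow> 'o \<times> 'a \<times> 'a" where
  "prod_cone C X Y = (SOME (P, p, q). is_product C X Y P p q)"

definition prod_ob :: "('o, 'a) cat \<Rightarrow> 'o \<Rightarrow> 'o \<Rightarrow> 'o" where
  "prod_ob C X Y = fst (prod_cone C X Y)"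

definition pr1 :: "('o, 'a) cat \<Rightarrow> 'o \<Rightarrow> 'o \<Rightarrow> 'a" where
  "pr1 C X Y = fst (snd (prod_cone C X Y))"

definition pr2 :: "('o, 'a) cat \<Rightarrow> 'o \<Rightarrow> 'o \<Rightarrow> 'a" where
  "pr2 C X Y = snd (snd (prod_cone C X Y))"

definition pair :: "('o, 'a) cat \<Rightarrow> 'a \<Rightarrow> 'a \<Rightarrow> 'a" where
  "pair C f g = (THE h. h \<in> hom C (Dom C f) (prod_ob C (Cod C f) (Cod C g)) \<and>
     pr1 C (Cod C f) (Cod C g) \<cdot>\<^bsub>C\<^esub> h = f \<and> pr2 C (Cod C f) (Cod C g) \<cdot>\<^bsub>C\<^esub> h = g)"

definition prod_arr :: "('o, 'a) cat \<Rightarrow> 'a \<Rightarrow> 'a \<Rightarrow> 'a" where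
  "prod_arr C f g = pair C (f \<cdot>\<^bsub>C\<^esub> pr1 C (Dom C f) (Dom C g)) (g \<cdot>\<^bsub>C\<^esub> pr2 C (Dom C f) (Dom C g))"

definition diag :: "('o, 'a) cat \<Rightarrow> 'o \<Rightarrow> 'a" where
  "diag C X = pair C (ide C X) (ide C X)"


section \<open>Indexed orders and the calculus of relations\<close>

text \<open>The data of a contravariant functor from \<open>Base\<close> to ordered sets with a modality. It serves
  both for doctrines and for the subobjects of a modal category, so that relations and acceptable
  loops are defined once for the two settings.\<close>

record ('o, 'a, 'd) doctrine =
  Base :: "('o, 'a) cat"
  Fib :: "'o \<Rightarrow> 'd modal_order"
  Sub :: "'a \<Rightarrow> 'd \<Rightarrow> 'd"

definition is_left_adjoint_value :: "('o, 'a, 'd) doctrine \<Rightarrow> 'a \<Rightarrow> 'd \<Rightarrow> 'd \<Rightarrow> bool" where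
  "is_left_adjoint_value D f x y \<longleftrightarrow>
     y \<in> carrier (Fib D (Cod (Base D) f)) \<and>
     (\<forall>z\<in>carrier (Fib D (Cod (Base D) f)).
        y \<sqsubseteq>\<^bsub>Fib D (Cod (Base D) f)\<^esub> z \<longleftrightarrow> x \<sqsubseteq>\<^bsub>Fib D (Dom (Base D) f)\<^esub> Sub D f z)"

definition Ex :: "('o, 'a, 'd) doctrine \<Rightarrow> 'a \<Rightarrow> 'd \<Rightarrow> 'd" where
  "Ex D f x = (THE y. is_left_adjoint_value D f x y)"

text \<open>A relation \<open>(X, Y, R)\<close> from \<open>X\<close> to \<open>Y\<close> is an element \<open>R\<close> of the fibre over \<open>X \<times> Y\<close>.\<close>

type_synonym ('o, 'd) rel = "'o \<times> 'o \<times> 'd"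

definition is_rel :: "('o, 'a, 'd) doctrine \<Rightarrow> ('o, 'd) rel \<Rightarrow> bool" where
  "is_rel D = (\<lambda>(X, Y, R). X \<in> Ob (Base D) \<and> Y \<in> Ob (Base D) \<and>
     R \<in> carrier (Fib D (prod_ob (Base D) X Y)))"

definition rel_image :: "('o, 'a, 'd) doctrine \<Rightarrow> ('o, 'd) rel \<Rightarrow> 'd \<Rightarrow> 'd" where
  "rel_image D = (\<lambda>(X, Y, R) A.
     Ex D (pr2 (Base D) X Y)
       (R \<sqinter>\<^bsub>Fib D (prod_ob (Base D) X Y)\<^esub> Sub D (pr1 (Base D) X Y) A))"

definition rel_dom :: "('o, 'a, 'd) doctrine \<Rightarrow> ('o, 'd) rel \<Rightarrow> 'd" where
  "rel_dom D = (\<lambda>(X, Y, R). Ex D (pr1 (Base D) X Y) R)"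

definition rel_im :: "('o, 'a, 'd) doctrine \<Rightarrow> ('o, 'd) rel \<Rightarrow> 'd" where
  "rel_im D = (\<lambda>(X, Y, R). Ex D (pr2 (Base D) X Y) R)"

definition rel_graph :: "('o, 'a, 'd) doctrine \<Rightarrow> 'a \<Rightarrow> ('o, 'd) rel" where
  "rel_graph D f = (let X = Dom (Base D) f in
     (X, Cod (Base D) f, Ex D (pair (Base D) (ide (Base D) X) f) \<top>\<^bsub>Fib D X\<^esub>))"

definition rel_id :: "('o, 'a, 'd) doctrine \<Rightarrow> 'o \<Rightarrow> ('o, 'd) rel" where
  "rel_id D X = (X, X, Ex D (diag (Base D) X) \<top>\<^bsub>Fib D X\<^esub>)"

definition rel_conv :: "('o, 'a, 'd) doctrine \<Rightarrow> ('o, 'd) rel \<Rightarrow> ('o, 'd) rel" where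
  "rel_conv D = (\<lambda>(X, Y, R).
     (Y, X, Sub D (pair (Base D) (pr2 (Base D) Y X) (pr1 (Base D) Y X)) R))"

definition rel_prod ::
    "('o, 'a, 'd) doctrine \<Rightarrow> ('o, 'd) rel \<Rightarrow> ('o, 'd) rel \<Rightarrow> ('o, 'd) rel" where
  "rel_prod D = (\<lambda>(X, X', R) (Y, Y', S).
     let C = Base D; P = prod_ob C X Y; P' = prod_ob C X' Y' in
       (P, P',
        Sub D (prod_arr C (pr1 C X Y) (pr1 C X' Y')) R
          \<sqinter>\<^bsub>Fib D (prod_ob C P P')\<^esub>
        Sub D (prod_arr C (pr2 C X Y) (pr2 C X' Y')) S))"

text \<open>\<^term>\<open>rel_comp D s r\<close> is \<open>r\<close> followed by \<open>s\<close>: with \<open>r = (X, Y, R)\<close> and \<open>s = (Y, Z, S)\<close> it is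
  \<open>\<exists>y. R(x,y) \<and> S(y,z)\<close>, computed over \<open>Y \<times> (X \<times> Z)\<close>.\<close>

definition rel_comp ::
    "('o, 'a, 'd) doctrine \<Rightarrow> ('o, 'd) rel \<Rightarrow> ('o, 'd) rel \<Rightarrow> ('o, 'd) rel" where
  "rel_comp D = (\<lambda>(Y, Z, S) (X, _, R).
     let C = Base D; XZ = prod_ob C X Z; y = pr1 C Y XZ;
         x = pr1 C X Z \<cdot>\<^bsub>C\<^esub> pr2 C Y XZ; z = pr2 C X Z \<cdot>\<^bsub>C\<^esub> pr2 C Y XZ in
       (X, Z, Ex D (pr2 C Y XZ)
          (Sub D (pair C x y) R \<sqinter>\<^bsub>Fib D (prod_ob C Y XZ)\<^esub> Sub D (pair C y z) S)))"

definition rel_restrict :: "('o, 'a, 'd) doctrine \<Rightarrow> ('o, 'd) rel \<Rightarrow> 'd \<Rightarrow> ('o, 'd) rel" where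
  "rel_restrict D = (\<lambda>(X, Y, R) A.
     (X, Y, Sub D (pr1 (Base D) X Y) A \<sqinter>\<^bsub>Fib D (prod_ob (Base D) X Y)\<^esub> R))"

text \<open>A loop \<open>R\<^sub>1, \<dots>, R\<^sub>n\<close> with \<open>R\<^sub>i\<close> from \<open>X\<^sub>i\<close> to \<open>X\<^sub>i\<^sub>-\<^sub>1\<close> is the list of these relations. The first
  argument \<open>P\<close> below is the class of partial maps allowed in the conjugation rule, the second the
  anchor \<open>X\<^sub>0 = X\<^sub>n\<close>.\<close>

inductive acceptable_loop ::
    "('o, 'a, 'd) doctrine \<Rightarrow> ('o, 'd) rel set \<Rightarrow> 'o \<Rightarrow> ('o, 'd) rel list \<Rightarrow> bool"
  for D P where
  empty: "X \<in> Ob (Base D) \<Longrightarrow> acceptable_loop D P X []"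
| identity: "acceptable_loop D P X (u @ v) \<Longrightarrow>
    acceptable_loop D P X (u @ [rel_id D (if u = [] then X else fst (last u))] @ v)"
| concat: "\<lbrakk>acceptable_loop D P X u; acceptable_loop D P X v\<rbrakk> \<Longrightarrow> acceptable_loop D P X (u @ v)"
| conjugate: "\<lbrakk>acceptable_loop D P X w; (X, Y, f) \<in> P\<rbrakk> \<Longrightarrow>
    acceptable_loop D P Y ([(X, Y, f)] @ w @ [rel_conv D (X, Y, f)])"
| product: "\<lbrakk>acceptable_loop D P X u; acceptable_loop D P Y v; length u = length v\<rbrakk> \<Longrightarrow>
    acceptable_loop D P (prod_ob (Base D) X Y) (map2 (rel_prod D) u v)"

definition dia_loop :: "('o, 'a, 'd) doctrine \<Rightarrow> ('o, 'd) rel list \<Rightarrow> 'd \<Rightarrow> 'd" where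
  "dia_loop D w A = foldr (\<lambda>r B. \<diamond>\<^bsub>Fib D (fst (snd r))\<^esub> (rel_image D r B)) w A"

definition loop_condition :: "('o, 'a, 'd) doctrine \<Rightarrow> ('o, 'd) rel set \<Rightarrow> bool" where
  "loop_condition D P \<longleftrightarrow>
     (\<forall>X w. acceptable_loop D P X w \<longrightarrow>
        (\<forall>A\<in>carrier (Fib D X). dia_loop D w A \<sqsubseteq>\<^bsub>Fib D X\<^esub> \<diamond>\<^bsub>Fib D X\<^esub> A))"

definition product_condition :: "('o, 'a, 'd) doctrine \<Rightarrow> bool" where
  "product_condition D \<longleftrightarrow>
     (\<forall>X\<in>Ob (Base D). \<forall>Y\<in>Ob (Base D). \<forall>A\<in>carrier (Fib D X). \<forall>B\<in>carrier (Fib D Y).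
        let p = pr1 (Base D) X Y; q = pr2 (Base D) X Y; L = Fib D (prod_ob (Base D) X Y) in
          Sub D p (\<diamond>\<^bsub>Fib D X\<^esub> A) \<sqinter>\<^bsub>L\<^esub> Sub D q (\<diamond>\<^bsub>Fib D Y\<^esub> B)
            \<sqsubseteq>\<^bsub>L\<^esub> \<diamond>\<^bsub>L\<^esub> (Sub D p A \<sqinter>\<^bsub>L\<^esub> Sub D q B))"


section \<open>Topological modal categories\<close>

locale orthogonal_factorization_system = category C for C :: "('o, 'a) cat" (structure) +
  fixes E M :: "'a set"
  assumes E_Arr: "E \<subseteq> Arr C"
    and M_Arr: "M \<subseteq> Arr C"
    and iso_E: "iso C f \<Longrightarrow> f \<in> E"
    and iso_M: "iso C f \<Longrightarrow> f \<in> M"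
    and Comp_E: "\<lbrakk>f \<in> E; g \<in> E; Dom C g = Cod C f\<rbrakk> \<Longrightarrow> g \<cdot> f \<in> E"
    and Comp_M: "\<lbrakk>f \<in> M; g \<in> M; Dom C g = Cod C f\<rbrakk> \<Longrightarrow> g \<cdot> f \<in> M"
    and factorization: "f \<in> Arr C \<Longrightarrow> \<exists>e\<in>E. \<exists>m\<in>M. Dom C m = Cod C e \<and> f = m \<cdot> e"
    and orthogonality:
      "\<lbrakk>e \<in> E; m \<in> M; f \<in> hom C (Dom C e) (Dom C m); g \<in> hom C (Cod C e) (Cod C m);
        m \<cdot> f = g \<cdot> e\<rbrakk>
        \<Longrightarrow> \<exists>!d. d \<in> hom C (Cod C e) (Dom C m) \<and> d \<cdot> e = f \<and> m \<cdot> d = g"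

text \<open>An element of the poset of \<open>M\<close>-subobjects of \<open>X\<close> is an isomorphism class of \<open>M\<close>-arrows
  into \<open>X\<close>, represented as the set of its members.\<close>

definition subobj_class :: "('o, 'a) cat \<Rightarrow> 'a set \<Rightarrow> 'a \<Rightarrow> 'a set" where
  "subobj_class C M m =
     {n \<in> M. Cod C n = Cod C m \<and>
        (\<exists>u\<in>hom C (Dom C m) (Dom C n). iso C u \<and> n \<cdot>\<^bsub>C\<^esub> u = m)}"

definition subobj_order :: "('o, 'a) cat \<Rightarrow> 'a set \<Rightarrow> 'o \<Rightarrow> 'a set gorder" where
  "subobj_order C M X =
     \<lparr>carrier = subobj_class C M ` {m \<in> M. Cod C m = X},
      eq = (=),
      le = (\<lambda>A B. \<exists>m\<in>A. \<exists>n\<in>B. \<exists>u\<in>hom C (Dom C m) (Dom C n). n \<cdot>\<^bsub>C\<^esub> u = m)\<rparr>"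

text \<open>The set of all pullbacks along \<open>f\<close> of members of \<open>A\<close> is again an isomorphism class.\<close>

definition subobj_pullback :: "('o, 'a) cat \<Rightarrow> 'a \<Rightarrow> 'a set \<Rightarrow> 'a set" where
  "subobj_pullback C f A = {n. \<exists>m\<in>A. \<exists>q. is_pullback C f m n q}"

locale f_boolean_category =
  orthogonal_factorization_system C E M
  for C :: "('o, 'a) cat" (structure) and E M :: "'a set" +
  assumes finite_limits: "has_finite_limits C"
    and M_mono: "m \<in> M \<Longrightarrow> monomorphism C m"
    and regular_mono_M: "regular_mono C m \<Longrightarrow> m \<in> M"
    and E_stable: "\<lbrakk>e \<in> E; is_pullback C f e p q\<rbrakk> \<Longrightarrow> p \<in> E"
    and M_stable: "\<lbrakk>m \<in> M; is_pullback C f m p q\<rbrakk> \<Longrightarrow> p \<in> M"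
    and subobj_boolean: "X \<in> Ob C \<Longrightarrow> boolean_lattice (subobj_order C M X)"
    and pullback_boolean_hom:
      "f \<in> hom C X Y \<Longrightarrow>
        boolean_hom (subobj_order C M Y) (subobj_order C M X) (subobj_pullback C f)"

definition subobj_doctrine ::
    "('o, 'a) cat \<Rightarrow> 'a set \<Rightarrow> ('o \<Rightarrow> 'a set \<Rightarrow> 'a set) \<Rightarrow> ('o, 'a, 'a set) doctrine" where
  "subobj_doctrine C M dm =
     \<lparr>Base = C,
      Fib = (\<lambda>X. \<lparr>carrier = carrier (subobj_order C M X), eq = (=),
                 le = le (subobj_order C M X), dia = dm X\<rparr>),
      Sub = subobj_pullback C\<rparr>"

locale modal_category =
  f_boolean_category C E M
  for C :: "('o, 'a) cat" (structure) and E M :: "'a set" +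
  fixes dm :: "'o \<Rightarrow> 'a set \<Rightarrow> 'a set"
  assumes subobj_modal: "X \<in> Ob C \<Longrightarrow> modal_algebra (Fib (subobj_doctrine C M dm) X)"
    and dia_continuous:
      "\<lbrakk>f \<in> hom C X Y; A \<in> carrier (subobj_order C M Y)\<rbrakk> \<Longrightarrow>
        dm X (subobj_pullback C f A) \<sqsubseteq>\<^bsub>subobj_order C M X\<^esub> subobj_pullback C f (dm Y A)"
    and dia_embedding:
      "\<lbrakk>m \<in> M; m \<in> hom C X Y; A \<in> carrier (subobj_order C M X)\<rbrakk> \<Longrightarrow>
        dm X A = subobj_pullback C m (dm Y (Ex (subobj_doctrine C M dm) m A))"

definition span_partial_maps :: "('o, 'a) cat \<Rightarrow> 'a set \<Rightarrow> ('o, 'a set) rel set" where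
  "span_partial_maps C M =
     {(Cod C d, Cod C t, subobj_class C M (pair C d t)) | d t.
        d \<in> M \<and> t \<in> Arr C \<and> Dom C d = Dom C t}"

locale topological_modal_category =
  modal_category C E M dm
  for C :: "('o, 'a) cat" (structure) and E M :: "'a set"
    and dm :: "'o \<Rightarrow> 'a set \<Rightarrow> 'a set" +
  assumes S4: "X \<in> Ob C \<Longrightarrow> S4_modal_algebra (Fib (subobj_doctrine C M dm) X)"
    and PI: "product_condition (subobj_doctrine C M dm)"
    and LC: "loop_condition (subobj_doctrine C M dm) (span_partial_maps C M)"


section \<open>Topological modal doctrines\<close>

locale boolean_doctrine =
  fixes D :: "('o, 'a, 'd) doctrine"
  assumes Base_category: "category (Base D)"
    and Base_cartesian: "has_finite_products (Base D)"
    and Fib_boolean: "X \<in> Ob (Base D) \<Longrightarrow> boolean_lattice (Fib D X)"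
    and Sub_boolean_hom:
      "f \<in> hom (Base D) X Y \<Longrightarrow> boolean_hom (Fib D Y) (Fib D X) (Sub D f)"
    and Sub_ide: "\<lbrakk>X \<in> Ob (Base D); A \<in> carrier (Fib D X)\<rbrakk> \<Longrightarrow> Sub D (ide (Base D) X) A = A"
    and Sub_Comp:
      "\<lbrakk>f \<in> hom (Base D) X Y; g \<in> hom (Base D) Y Z; A \<in> carrier (Fib D Z)\<rbrakk> \<Longrightarrow>
        Sub D (g \<cdot>\<^bsub>Base D\<^esub> f) A = Sub D f (Sub D g A)"
    and left_adjoint:
      "\<lbrakk>f \<in> hom (Base D) X Y; A \<in> carrier (Fib D X)\<rbrakk> \<Longrightarrow> \<exists>B. is_left_adjoint_value D f A B"
    and Frobenius:
      "\<lbrakk>f \<in> hom (Base D) X Y; A \<in> carrier (Fib D Y); B \<in> carrier (Fib D X)\<rbrakk> \<Longrightarrow>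
        Ex D f (Sub D f A \<sqinter>\<^bsub>Fib D X\<^esub> B) = A \<sqinter>\<^bsub>Fib D Y\<^esub> Ex D f B"
    and Beck_Chevalley_projection:
      "\<lbrakk>X \<in> Ob (Base D); f \<in> hom (Base D) Y Z; A \<in> carrier (Fib D (prod_ob (Base D) X Z))\<rbrakk> \<Longrightarrow>
        Sub D f (Ex D (pr2 (Base D) X Z) A) =
        Ex D (pr2 (Base D) X Y) (Sub D (prod_arr (Base D) (ide (Base D) X) f) A)"
    and Beck_Chevalley_diagonal:
      "\<lbrakk>X \<in> Ob (Base D); f \<in> hom (Base D) Y Z; A \<in> carrier (Fib D (prod_ob (Base D) X Z))\<rbrakk> \<Longrightarrow>
        Sub D (prod_arr (Base D) (ide (Base D) (prod_ob (Base D) X X)) f)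
          (Ex D (prod_arr (Base D) (diag (Base D) X) (ide (Base D) Z)) A) =
        Ex D (prod_arr (Base D) (diag (Base D) X) (ide (Base D) Y))
          (Sub D (prod_arr (Base D) (ide (Base D) X) f) A)"

text \<open>Single-valuedness \<open>R(x,y) \<and> R(x,y') \<turnstile> y = y'\<close> is expressed over \<open>(X \<times> Y) \<times> Y\<close>.\<close>

definition partial_map :: "('o, 'a, 'd) doctrine \<Rightarrow> ('o, 'd) rel \<Rightarrow> bool" where
  "partial_map D r \<longleftrightarrow> is_rel D r \<and>
     (case r of (X, Y, R) \<Rightarrow>
        let C = Base D; XY = prod_ob C X Y; L = Fib D (prod_ob C XY Y);
            xy = pr1 C XY Y; x = pr1 C X Y \<cdot>\<^bsub>C\<^esub> xy; y = pr2 C X Y \<cdot>\<^bsub>C\<^esub> xy; y' = pr2 C XY Y in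
          Sub D xy R \<sqinter>\<^bsub>L\<^esub> Sub D (pair C x y') R
            \<sqsubseteq>\<^bsub>L\<^esub> Sub D (pair C y y') (Ex D (diag C Y) \<top>\<^bsub>Fib D Y\<^esub>))"

locale topological_modal_doctrine = boolean_doctrine D
  for D :: "('o, 'a, 'd) doctrine" +
  fixes CD :: "('o, 'd) rel set"
  assumes Fib_S4: "X \<in> Ob (Base D) \<Longrightarrow> S4_modal_algebra (Fib D X)"
    and Sub_lax:
      "\<lbrakk>f \<in> hom (Base D) X Y; A \<in> carrier (Fib D Y)\<rbrakk> \<Longrightarrow>
        \<diamond>\<^bsub>Fib D X\<^esub> (Sub D f A) \<sqsubseteq>\<^bsub>Fib D X\<^esub> Sub D f (\<diamond>\<^bsub>Fib D Y\<^esub> A)"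
    and PI: "product_condition D"
    and CD_partial_map: "r \<in> CD \<Longrightarrow> partial_map D r"
    and CD_graph: "f \<in> Arr (Base D) \<Longrightarrow> rel_graph D f \<in> CD"
    and CD_comp: "\<lbrakk>(X, Y, R) \<in> CD; (Y, Z, S) \<in> CD\<rbrakk> \<Longrightarrow> rel_comp D (Y, Z, S) (X, Y, R) \<in> CD"
    and CD_prod: "\<lbrakk>r \<in> CD; s \<in> CD\<rbrakk> \<Longrightarrow> rel_prod D r s \<in> CD"
    and LC: "loop_condition D CD"


section \<open>Syntactic categories\<close>

text \<open>A formula \<open>\<phi> \<in> D(X)\<close> is the pair \<open>(X, \<phi>)\<close>; an arrow is \<open>(source, target, R)\<close> with \<open>R\<close> the
  underlying element of \<open>D(X \<times> Y)\<close>.\<close>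

type_synonym ('o, 'd) formula = "'o \<times> 'd"
type_synonym ('o, 'd) synt_map = "('o, 'd) formula \<times> ('o, 'd) formula \<times> 'd"

definition map_rel :: "('o, 'd) synt_map \<Rightarrow> ('o, 'd) rel" where
  "map_rel = (\<lambda>((X, _), (Y, _), R). (X, Y, R))"

definition formulas :: "('o, 'a, 'd) doctrine \<Rightarrow> ('o, 'd) formula set" where
  "formulas D = {(X, \<phi>). X \<in> Ob (Base D) \<and> \<phi> \<in> carrier (Fib D X)}"

definition Synt_BA ::
    "('o, 'a, 'd) doctrine \<Rightarrow> (('o, 'd) formula, ('o, 'd) synt_map) cat" where
  "Synt_BA D =
     \<lparr>Ob = formulas D,
      Arr = {((X, \<phi>), (Y, \<psi>), R) | X \<phi> Y \<psi> R.
               (X, \<phi>) \<in> formulas D \<and> (Y, \<psi>) \<in> formulas D \<and> partial_map D (X, Y, R) \<and>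
               rel_dom D (X, Y, R) = \<phi> \<and> rel_im D (X, Y, R) \<sqsubseteq>\<^bsub>Fib D Y\<^esub> \<psi>},
      Dom = fst,
      Cod = (\<lambda>f. fst (snd f)),
      ide = (\<lambda>(X, \<phi>). ((X, \<phi>), (X, \<phi>), snd (snd (rel_restrict D (rel_id D X) \<phi>)))),
      Comp = (\<lambda>g f. (fst f, fst (snd g), snd (snd (rel_comp D (map_rel g) (map_rel f)))))\<rparr>"

definition continuous_map ::
    "('o, 'a, 'd) doctrine \<Rightarrow> ('o, 'd) rel set \<Rightarrow> ('o, 'd) synt_map \<Rightarrow> bool" where
  "continuous_map D CD f \<longleftrightarrow>
     (\<exists>r\<in>CD. \<exists>\<phi>\<in>carrier (Fib D (fst r)). \<phi> \<sqsubseteq>\<^bsub>Fib D (fst r)\<^esub> rel_dom D r \<and>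
        map_rel f = rel_restrict D r \<phi>)"

definition Synt_S4 ::
    "('o, 'a, 'd) doctrine \<Rightarrow> ('o, 'd) rel set \<Rightarrow>
      (('o, 'd) formula, ('o, 'd) synt_map) cat" where
  "Synt_S4 D CD = (Synt_BA D)\<lparr>Arr := {f \<in> Arr (Synt_BA D). continuous_map D CD f}\<rparr>"

text \<open>The surjections: a map into \<open>(Y, \<psi>)\<close> is a regular epimorphism of \<open>Synt_BA D\<close> iff its image
  is \<open>\<psi>\<close>.\<close>

definition Synt_E ::
    "('o, 'a, 'd) doctrine \<Rightarrow> ('o, 'd) rel set \<Rightarrow> ('o, 'd) synt_map set" where
  "Synt_E D CD = {f \<in> Arr (Synt_S4 D CD). rel_im D (map_rel f) = snd (Cod (Synt_S4 D CD) f)}"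

definition inclusion_map :: "('o, 'a, 'd) doctrine \<Rightarrow> 'o \<Rightarrow> 'd \<Rightarrow> 'd \<Rightarrow> ('o, 'd) synt_map" where
  "inclusion_map D X \<phi> \<psi> = ((X, \<phi>), (X, \<psi>), snd (snd (rel_restrict D (rel_id D X) \<phi>)))"

definition inclusion_maps :: "('o, 'a, 'd) doctrine \<Rightarrow> ('o, 'd) synt_map set" where
  "inclusion_maps D =
     {inclusion_map D X \<phi> \<psi> | X \<phi> \<psi>.
        X \<in> Ob (Base D) \<and> \<phi> \<in> carrier (Fib D X) \<and> \<psi> \<in> carrier (Fib D X) \<and> \<phi> \<sqsubseteq>\<^bsub>Fib D X\<^esub> \<psi>}"

definition Synt_M ::
    "('o, 'a, 'd) doctrine \<Rightarrow> ('o, 'd) rel set \<Rightarrow> ('o, 'd) synt_map set" where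
  "Synt_M D CD = (let S = Synt_S4 D CD in
     {m \<in> Arr S. \<exists>i\<in>inclusion_maps D. \<exists>u v.
        u \<in> hom S (Dom S i) (Dom S m) \<and> iso S u \<and> v \<in> hom S (Cod S i) (Cod S m) \<and> iso S v \<and>
        m \<cdot>\<^bsub>S\<^esub> u = v \<cdot>\<^bsub>S\<^esub> i})"

text \<open>\<open>\<psi> \<le> \<phi>\<close> is identified with the class of its inclusion into \<open>\<phi>\<close>; along this identification
  the modality on subobjects of \<open>\<phi>\<close> is \<open>\<psi> \<mapsto> \<phi> \<and> \<diamond>\<psi>\<close>.\<close>

definition inclusion_subobj ::
    "('o, 'a, 'd) doctrine \<Rightarrow> ('o, 'd) rel set \<Rightarrow> ('o, 'd) formula \<Rightarrow> 'd \<Rightarrow>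
      ('o, 'd) synt_map set" where
  "inclusion_subobj D CD = (\<lambda>(X, \<phi>) \<psi>.
     subobj_class (Synt_S4 D CD) (Synt_M D CD) (inclusion_map D X \<psi> \<phi>))"

definition Synt_dia ::
    "('o, 'a, 'd) doctrine \<Rightarrow> ('o, 'd) rel set \<Rightarrow> ('o, 'd) formula \<Rightarrow>
      ('o, 'd) synt_map set \<Rightarrow> ('o, 'd) synt_map set" where
  "Synt_dia D CD = (\<lambda>(X, \<phi>) A.
     let \<psi> = (THE \<psi>. \<psi> \<in> carrier (Fib D X) \<and> \<psi> \<sqsubseteq>\<^bsub>Fib D X\<^esub> \<phi> \<and>
                inclusion_subobj D CD (X, \<phi>) \<psi> = A) in
       inclusion_subobj D CD (X, \<phi>) (\<phi> \<sqinter>\<^bsub>Fib D X\<^esub> \<diamond>\<^bsub>Fib D X\<^esub> \<psi>))"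

end

theory Submission imports Defs begin

text \<open>A Boolean doctrine has a jointly conservative family of set-valued models. They are built by
  Henkin's method, as ultraproducts of partial term interpretations by generalized elements, with an
  ultrafilter on the fibre deciding truth. Hence identities between relations may be checked on
  points. An arrow of the syntactic category becomes a definable function contained in the graph of
  a member of \<open>CD\<close> (\<open>tame\<close> below); it is surjective iff it lies in \<open>\<E>\<close>, and it lies in \<open>\<M>\<close> iff
  its converse is single-valued and tame. Finite limits and the Boolean algebras of subobjects are
  then computed as for sets.

  The loop condition of the doctrine for the loop \<open>R, R\<^sup>-\<^sup>1\<close> shows that continuous maps, and inverses
  of embeddings, respect closure. The loop condition of the syntactic category follows since each of
  its acceptable loops is dominated by an acceptable loop of the doctrine.\<close>

section \<open>Ultrafilters and fields of sets\<close>

text \<open>Adjoining a witness enlarges the stage from \<open>U\<close> to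
  \<open>X \<times> U\<close>, and a category with finite products offers no common stage for
  infinitely many witnesses. Nodes are therefore built by finitely many enlargements, enough for a
  given finite set of terms, and an ultrafilter on the nodes supplies all terms at once. An object
  may have no global elements, so a witness is available only where the existential formula is true;
  this is why terms are partial. The semantic locale is abstract because it is instantiated twice:
  by the models for the doctrine \<open>D\<close>, and by the points of formulas for the subobject
  doctrine of the syntactic category. Both sides of the loop argument then speak about sets of
  pairs. Containment in a member of \<open>CD\<close> is used instead of membership because it
  passes to subsets, while \<open>CD\<close> is closed under composition and products only. The
  remaining mismatch is that the chosen product of the syntactic category is isomorphic, not equal,
  to the product formula; the inverse of the isomorphism is tame, so it can be brought into a loop
  by conjugation.\<close>

lemma boolean_lattice_of_field_of_sets:
  fixes L :: "('d, 'm) gorder_scheme" and s :: "'d \<Rightarrow> 'p set"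
  assumes eq: "eq L = (=)"
    and le: "\<And>A B. \<lbrakk>A \<in> carrier L; B \<in> carrier L\<rbrakk> \<Longrightarrow> A \<sqsubseteq>\<^bsub>L\<^esub> B \<longleftrightarrow> s A \<subseteq> s B"
    and inj: "\<And>A B. \<lbrakk>A \<in> carrier L; B \<in> carrier L; s A = s B\<rbrakk> \<Longrightarrow> A = B"
    and top: "T \<in> carrier L" "\<And>A. A \<in> carrier L \<Longrightarrow> s A \<subseteq> s T"
    and Int: "\<And>A B. \<lbrakk>A \<in> carrier L; B \<in> carrier L\<rbrakk> \<Longrightarrow> \<exists>C\<in>carrier L. s C = s A \<inter> s B"
    and compl: "\<And>A. A \<in> carrier L \<Longrightarrow> \<exists>C\<in>carrier L. s C = s T - s A"
  shows "boolean_lattice L"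
    and "\<And>A B. \<lbrakk>A \<in> carrier L; B \<in> carrier L\<rbrakk> \<Longrightarrow> s (A \<sqinter>\<^bsub>L\<^esub> B) = s A \<inter> s B"
    and "\<And>A B. \<lbrakk>A \<in> carrier L; B \<in> carrier L\<rbrakk> \<Longrightarrow> s (A \<squnion>\<^bsub>L\<^esub> B) = s A \<union> s B"
    and "s \<top>\<^bsub>L\<^esub> = s T" and "s \<bottom>\<^bsub>L\<^esub> = {}"
proof -
  \<comment> \<open>De Morgan: intersections and complements relative to \<open>s T\<close> yield
    unions. So \<open>s\<close> is an isomorphism onto a field of subsets of \<open>s T\<close>, and
    since meets and joins are unique, the lattice operations have to be the set operations.\<close>
  have Un: "\<exists>C\<in>carrier L. s C = s A \<union> s B" if A: "A \<in> carrier L" and B: "B \<in> carrier L" for A B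
  proof -
    obtain A' where A': "A' \<in> carrier L" "s A' = s T - s A" using compl[OF A] by blast
    obtain B' where B': "B' \<in> carrier L" "s B' = s T - s B" using compl[OF B] by blast
    obtain C where C: "C \<in> carrier L" "s C = s A' \<inter> s B'" using Int[OF A'(1) B'(1)] by blast
    obtain E where E: "E \<in> carrier L" "s E = s T - s C" using compl[OF C(1)] by blast
    have "s E = s A \<union> s B" using E C A' B' top(2)[OF A] top(2)[OF B] by blast
    with E show ?thesis by blast
  qed
  obtain Z where Z: "Z \<in> carrier L" "s Z = {}" using compl[OF top(1)] by auto
  interpret partial_order L
    by unfold_locales (use le inj in \<open>auto simp: eq\<close>)
  have gr: "greatest L C (Lower L {A, B})"
    if "A \<in> carrier L" "B \<in> carrier L" "C \<in> carrier L" "s C = s A \<inter> s B" for A B C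
  proof (rule greatest_LowerI)
    fix y assume "y \<in> Lower L {A, B}"
    then have "y \<in> carrier L" "y \<sqsubseteq>\<^bsub>L\<^esub> A" "y \<sqsubseteq>\<^bsub>L\<^esub> B" using that by (auto simp: Lower_def)
    then show "y \<sqsubseteq>\<^bsub>L\<^esub> C" using that by (simp add: le)
  qed (use that in \<open>auto simp: le\<close>)
  have ls: "least L C (Upper L {A, B})"
    if "A \<in> carrier L" "B \<in> carrier L" "C \<in> carrier L" "s C = s A \<union> s B" for A B C
  proof (rule least_UpperI)
    fix y assume "y \<in> Upper L {A, B}"
    then have "y \<in> carrier L" "A \<sqsubseteq>\<^bsub>L\<^esub> y" "B \<sqsubseteq>\<^bsub>L\<^esub> y" using that by (auto simp: Upper_def)
    then show "C \<sqsubseteq>\<^bsub>L\<^esub> y" using that by (simp add: le)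
  qed (use that in \<open>auto simp: le\<close>)
  have gt: "greatest L T (carrier L)"
    unfolding greatest_def using top le by auto
  have lb: "least L Z (carrier L)"
    unfolding least_def using Z le by auto
  interpret bounded_lattice L
  proof
    fix A B assume AB: "A \<in> carrier L" "B \<in> carrier L"
    show "\<exists>E. least L E (Upper L {A, B})" using Un[OF AB] ls[OF AB] by blast
    show "\<exists>E. greatest L E (Lower L {A, B})" using Int[OF AB] gr[OF AB] by blast
  qed (use gt lb in blast)+
  show m: "s (A \<sqinter>\<^bsub>L\<^esub> B) = s A \<inter> s B" if AB: "A \<in> carrier L" "B \<in> carrier L" for A B
  proof -
    obtain C where C: "C \<in> carrier L" "s C = s A \<inter> s B" using Int[OF AB] by blast
    have "A \<sqinter>\<^bsub>L\<^esub> B = C"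
      by (rule meetI) (use greatest_unique gr[OF AB C] AB in auto)
    then show ?thesis using C by simp
  qed
  show j: "s (A \<squnion>\<^bsub>L\<^esub> B) = s A \<union> s B" if AB: "A \<in> carrier L" "B \<in> carrier L" for A B
  proof -
    obtain C where C: "C \<in> carrier L" "s C = s A \<union> s B" using Un[OF AB] by blast
    have "A \<squnion>\<^bsub>L\<^esub> B = C"
      by (rule joinI) (use least_unique ls[OF AB C] AB in auto)
    then show ?thesis using C by simp
  qed
  show t: "s \<top>\<^bsub>L\<^esub> = s T"
    using greatest_unique[OF gt top_greatest] by simp
  show b: "s \<bottom>\<^bsub>L\<^esub> = {}"
    using least_unique[OF lb bottom_least] Z by simp
  show "boolean_lattice L"
  proof
    fix A B E assume AB: "A \<in> carrier L" "B \<in> carrier L" "E \<in> carrier L"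
    show "A \<sqinter>\<^bsub>L\<^esub> (B \<squnion>\<^bsub>L\<^esub> E) = (A \<sqinter>\<^bsub>L\<^esub> B) \<squnion>\<^bsub>L\<^esub> (A \<sqinter>\<^bsub>L\<^esub> E)"
      by (rule inj) (use AB m j in auto)
  next
    fix A assume A: "A \<in> carrier L"
    then obtain C where C: "C \<in> carrier L" "s C = s T - s A" using compl by blast
    have "A \<sqinter>\<^bsub>L\<^esub> C = \<bottom>\<^bsub>L\<^esub>" by (rule inj) (use A C m b in auto)
    moreover have "A \<squnion>\<^bsub>L\<^esub> C = \<top>\<^bsub>L\<^esub>"
      by (rule inj) (use A C j t top(2)[OF A] in auto)
    ultimately show "\<exists>y\<in>carrier L. A \<sqinter>\<^bsub>L\<^esub> y = \<bottom>\<^bsub>L\<^esub> \<and> A \<squnion>\<^bsub>L\<^esub> y = \<top>\<^bsub>L\<^esub>"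
      using C by blast
  qed
qed

lemma (in weak_lower_semilattice) meet_mono:
  assumes "x \<sqsubseteq> x'" "y \<sqsubseteq> y'" "x \<in> carrier L" "x' \<in> carrier L" "y \<in> carrier L" "y' \<in> carrier L"
  shows "x \<sqinter> y \<sqsubseteq> x' \<sqinter> y'"
proof (rule meet_le)
  show "x \<sqinter> y \<sqsubseteq> x'" using le_trans[OF meet_left[of x y] assms(1)] assms by simp
  show "x \<sqinter> y \<sqsubseteq> y'" using le_trans[OF meet_right[of x y] assms(2)] assms by simp
qed (use assms in auto)

text \<open>The two equivalences make membership a Boolean homomorphism to the two-element algebra.
  The one for joins is primeness, by which a point decides every formula.\<close>

definition ultrafilter :: "('d, 'm) gorder_scheme \<Rightarrow> 'd set \<Rightarrow> bool" where
  "ultrafilter L F \<longleftrightarrow> F \<subseteq> carrier L \<and> \<top>\<^bsub>L\<^esub> \<in> F \<and> \<bottom>\<^bsub>L\<^esub> \<notin> F \<and>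
     (\<forall>x\<in>carrier L. \<forall>y\<in>carrier L. x \<sqinter>\<^bsub>L\<^esub> y \<in> F \<longleftrightarrow> x \<in> F \<and> y \<in> F) \<and>
     (\<forall>x\<in>carrier L. \<forall>y\<in>carrier L. x \<squnion>\<^bsub>L\<^esub> y \<in> F \<longleftrightarrow> x \<in> F \<or> y \<in> F)"

lemma ultrafilter_up:
  assumes "boolean_lattice L" "ultrafilter L F" "x \<in> F" "x \<sqsubseteq>\<^bsub>L\<^esub> y" "y \<in> carrier L"
  shows "y \<in> F"
proof -
  interpret boolean_lattice L by fact
  have x: "x \<in> carrier L" using assms(2,3) by (auto simp: ultrafilter_def)
  then have "x = x \<sqinter>\<^bsub>L\<^esub> y" using assms le_iff_join by blast
  then show ?thesis using assms x unfolding ultrafilter_def by metis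
qed

text \<open>Zorn's lemma for the meet-closed sets that contain \<open>G\<close> and avoid bottom.
  Upward closure is not imposed on the competitors; like primeness, it is derived from
  maximality.\<close>

lemma ultrafilter_exists:
  assumes "boolean_lattice L" and G: "G \<subseteq> carrier L" "G \<noteq> {}" "\<bottom>\<^bsub>L\<^esub> \<notin> G"
    and closed: "\<And>x y. \<lbrakk>x \<in> G; y \<in> G\<rbrakk> \<Longrightarrow> x \<sqinter>\<^bsub>L\<^esub> y \<in> G"
  obtains F where "ultrafilter L F" "G \<subseteq> F"
proof -
  interpret boolean_lattice L by fact
  note le_trans = local.le_trans
  let ?P = "{H. H \<subseteq> carrier L \<and> G \<subseteq> H \<and> \<bottom>\<^bsub>L\<^esub> \<notin> H \<and> (\<forall>x\<in>H. \<forall>y\<in>H. x \<sqinter>\<^bsub>L\<^esub> y \<in> H)}"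
  have "\<exists>H\<in>?P. \<forall>K\<in>?P. H \<subseteq> K \<longrightarrow> K = H"
  proof (rule subset_Zorn_nonempty)
    show "?P \<noteq> {}" using assms by auto
  next
    fix \<C> assume ne: "\<C> \<noteq> {}" and ch: "subset.chain ?P \<C>"
    have sub: "\<C> \<subseteq> ?P" using ch by (simp add: subset.chain_def)
    have "x \<sqinter>\<^bsub>L\<^esub> y \<in> \<Union>\<C>" if "x \<in> \<Union>\<C>" "y \<in> \<Union>\<C>" for x y
    proof -
      from that obtain H K where HK: "H \<in> \<C>" "x \<in> H" "K \<in> \<C>" "y \<in> K" by auto
      have "H \<subseteq> K \<or> K \<subseteq> H" using ch HK unfolding subset.chain_def by auto
      then show ?thesis using HK sub by blast
    qed
    moreover have "G \<subseteq> \<Union>\<C>" using ne sub by blast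
    ultimately show "\<Union>\<C> \<in> ?P" using sub by blast
  qed
  then obtain H where HP: "H \<in> ?P" and max0: "\<forall>K\<in>?P. H \<subseteq> K \<longrightarrow> K = H"
    by (rule bexE)
  have max: "K = H" if "K \<in> ?P" "H \<subseteq> K" for K
    using max0[THEN bspec, OF that(1)] that(2) by (rule mp)
  from HP have H: "H \<subseteq> carrier L" "G \<subseteq> H" "\<bottom>\<^bsub>L\<^esub> \<notin> H"
      and Hm: "\<And>x y. \<lbrakk>x \<in> H; y \<in> H\<rbrakk> \<Longrightarrow> x \<sqinter>\<^bsub>L\<^esub> y \<in> H"
    by simp_all
  \<comment> \<open>An element compatible with every member of \<open>H\<close> already belongs to
    \<open>H\<close>: the elements above some \<open>h \<sqinter> x\<close> form a competitor
    \<open>?K\<close> that includes \<open>H\<close>, so maximality gives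
    \<open>?K = H\<close>.\<close>
  have key: "x \<in> H" if x: "x \<in> carrier L" and nz: "\<And>h. h \<in> H \<Longrightarrow> h \<sqinter>\<^bsub>L\<^esub> x \<noteq> \<bottom>\<^bsub>L\<^esub>" for x
  proof -
    let ?K = "{y \<in> carrier L. \<exists>h\<in>H. h \<sqinter>\<^bsub>L\<^esub> x \<sqsubseteq>\<^bsub>L\<^esub> y}"
    have HK: "H \<subseteq> ?K"
    proof
      fix h assume "h \<in> H"
      then show "h \<in> ?K" using H(1) x meet_left by blast
    qed
    have K1: "y \<sqinter>\<^bsub>L\<^esub> z \<in> ?K" if "y \<in> ?K" "z \<in> ?K" for y z
    proof -
      from that obtain h k where hk: "h \<in> H" "k \<in> H" "h \<sqinter>\<^bsub>L\<^esub> x \<sqsubseteq>\<^bsub>L\<^esub> y" "k \<sqinter>\<^bsub>L\<^esub> x \<sqsubseteq>\<^bsub>L\<^esub> z"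
        and yz: "y \<in> carrier L" "z \<in> carrier L" by auto
      have c: "h \<in> carrier L" "k \<in> carrier L" using hk H by auto
      have "(h \<sqinter>\<^bsub>L\<^esub> k) \<sqinter>\<^bsub>L\<^esub> x \<sqsubseteq>\<^bsub>L\<^esub> h \<sqinter>\<^bsub>L\<^esub> x"
        using c x by (intro meet_mono) (auto intro: meet_left meet_right)
      moreover have "(h \<sqinter>\<^bsub>L\<^esub> k) \<sqinter>\<^bsub>L\<^esub> x \<sqsubseteq>\<^bsub>L\<^esub> k \<sqinter>\<^bsub>L\<^esub> x"
        using c x by (intro meet_mono) (auto intro: meet_left meet_right)
      ultimately have "(h \<sqinter>\<^bsub>L\<^esub> k) \<sqinter>\<^bsub>L\<^esub> x \<sqsubseteq>\<^bsub>L\<^esub> y \<sqinter>\<^bsub>L\<^esub> z"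
        using c x yz hk by (intro meet_le) (blast intro: le_trans meet_closed)+
      then show ?thesis using Hm[OF hk(1,2)] meet_closed[OF yz] by auto
    qed
    have K2: "\<bottom>\<^bsub>L\<^esub> \<notin> ?K"
    proof
      assume "\<bottom>\<^bsub>L\<^esub> \<in> ?K"
      then obtain h where h: "h \<in> H" "h \<sqinter>\<^bsub>L\<^esub> x \<sqsubseteq>\<^bsub>L\<^esub> \<bottom>\<^bsub>L\<^esub>" by auto
      then have "h \<sqinter>\<^bsub>L\<^esub> x = \<bottom>\<^bsub>L\<^esub>" using x h H(1) by (intro le_antisym) auto
      then show False using nz h by blast
    qed
    have "?K \<in> ?P"
    proof (rule CollectI, intro conjI)
      show "?K \<subseteq> carrier L" by simp
      show "G \<subseteq> ?K" using HK H(2) by (rule order_trans[rotated])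
      show "\<forall>y\<in>?K. \<forall>z\<in>?K. y \<sqinter>\<^bsub>L\<^esub> z \<in> ?K" by (intro ballI) (rule K1)
    qed (rule K2)
    then have "?K = H" using HK by (rule max)
    moreover obtain h where "h \<in> H" using G(2) H(2) by blast
    moreover have "h \<sqinter>\<^bsub>L\<^esub> x \<sqsubseteq>\<^bsub>L\<^esub> x" using \<open>h \<in> H\<close> H(1) x meet_right by blast
    ultimately show ?thesis using x by blast
  qed
  have up: "y \<in> H" if "x \<in> H" "x \<sqsubseteq>\<^bsub>L\<^esub> y" "y \<in> carrier L" for x y
  proof (rule key)
    fix h assume h: "h \<in> H"
    have c: "h \<in> carrier L" "x \<in> carrier L" using h that H by auto
    show "h \<sqinter>\<^bsub>L\<^esub> y \<noteq> \<bottom>\<^bsub>L\<^esub>"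
    proof
      assume e: "h \<sqinter>\<^bsub>L\<^esub> y = \<bottom>\<^bsub>L\<^esub>"
      have "h \<sqinter>\<^bsub>L\<^esub> x \<sqsubseteq>\<^bsub>L\<^esub> h \<sqinter>\<^bsub>L\<^esub> y"
        using c that by (intro meet_mono) auto
      then have "h \<sqinter>\<^bsub>L\<^esub> x = \<bottom>\<^bsub>L\<^esub>" using e c by (intro le_antisym) auto
      then show False using Hm[OF h that(1)] H(3) by simp
    qed
  qed (rule that)
  have "ultrafilter L H" unfolding ultrafilter_def
  proof (intro conjI ballI)
    obtain h where h: "h \<in> H" using G(2) H(2) by blast
    then show "\<top>\<^bsub>L\<^esub> \<in> H" using up[OF h, of "\<top>\<^bsub>L\<^esub>"] H(1) by blast
  next
    fix x y assume xy: "x \<in> carrier L" "y \<in> carrier L"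
    show "x \<sqinter>\<^bsub>L\<^esub> y \<in> H \<longleftrightarrow> x \<in> H \<and> y \<in> H"
      using Hm[of x y] up[of "x \<sqinter>\<^bsub>L\<^esub> y"] xy meet_left[of x y] meet_right[of x y] by metis
    show "x \<squnion>\<^bsub>L\<^esub> y \<in> H \<longleftrightarrow> x \<in> H \<or> y \<in> H"
    proof
      assume "x \<in> H \<or> y \<in> H"
      then show "x \<squnion>\<^bsub>L\<^esub> y \<in> H" using up xy join_left join_right join_closed by metis
    next
      assume j: "x \<squnion>\<^bsub>L\<^esub> y \<in> H"
      show "x \<in> H \<or> y \<in> H"
      proof (rule ccontr)
        assume "\<not> (x \<in> H \<or> y \<in> H)"
        \<comment> \<open>By \<open>key\<close>, the absence of \<open>x\<close> and of
          \<open>y\<close> is witnessed by members of \<open>H\<close> disjoint from them. The meet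
          of these two members lies in \<open>H\<close> and is disjoint from the join.\<close>
        then obtain h k where hk: "h \<in> H" "k \<in> H" "h \<sqinter>\<^bsub>L\<^esub> x = \<bottom>\<^bsub>L\<^esub>" "k \<sqinter>\<^bsub>L\<^esub> y = \<bottom>\<^bsub>L\<^esub>"
          using key xy by metis
        have c: "h \<in> carrier L" "k \<in> carrier L" using hk H by auto
        let ?l = "h \<sqinter>\<^bsub>L\<^esub> k"
        have l: "?l \<in> H" "?l \<in> carrier L" using Hm hk c by auto
        have "?l \<sqinter>\<^bsub>L\<^esub> x \<sqsubseteq>\<^bsub>L\<^esub> h \<sqinter>\<^bsub>L\<^esub> x" "?l \<sqinter>\<^bsub>L\<^esub> y \<sqsubseteq>\<^bsub>L\<^esub> k \<sqinter>\<^bsub>L\<^esub> y"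
          using c xy by (auto intro!: meet_mono meet_left meet_right)
        then have "?l \<sqinter>\<^bsub>L\<^esub> x = \<bottom>\<^bsub>L\<^esub>" "?l \<sqinter>\<^bsub>L\<^esub> y = \<bottom>\<^bsub>L\<^esub>"
          using hk l c xy by (auto intro!: le_antisym)
        then have "?l \<sqinter>\<^bsub>L\<^esub> (x \<squnion>\<^bsub>L\<^esub> y) = \<bottom>\<^bsub>L\<^esub> \<squnion>\<^bsub>L\<^esub> \<bottom>\<^bsub>L\<^esub>"
          using meet_join_distrib l xy by simp
        also have "\<dots> = \<bottom>\<^bsub>L\<^esub>" using bottom_join[of "\<bottom>\<^bsub>L\<^esub>"] by (simp add: eq_is_equal)
        finally show False using Hm[OF l(1) j] H(3) by simp
      qed
    qed
  qed (use H in auto)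
  then show ?thesis using that H by blast
qed

text \<open>Packaged as an order record so that ultrafilters on the set of nodes and ultrafilters of
  a fibre are instances of one notion, and \<open>ultrafilter_exists\<close> serves both.\<close>

definition powerset_lattice :: "'i set gorder" where
  "powerset_lattice = \<lparr>carrier = UNIV, eq = (=), le = (\<subseteq>)\<rparr>"

lemma powerset_lattice_simps:
  fixes A B :: "'i set"
  shows
  "boolean_lattice (powerset_lattice :: 'i set gorder)"
  "carrier (powerset_lattice :: 'i set gorder) = UNIV"
  "A \<sqsubseteq>\<^bsub>powerset_lattice\<^esub> B \<longleftrightarrow> A \<subseteq> B"
  "A \<sqinter>\<^bsub>powerset_lattice\<^esub> B = A \<inter> B"
  "A \<squnion>\<^bsub>powerset_lattice\<^esub> B = A \<union> B"
  "\<top>\<^bsub>powerset_lattice\<^esub> = (UNIV :: 'i set)"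
  "\<bottom>\<^bsub>powerset_lattice\<^esub> = ({} :: 'i set)"
proof -
  note * = boolean_lattice_of_field_of_sets[of "powerset_lattice :: 'i set gorder" "\<lambda>A. A" UNIV]
  show "boolean_lattice (powerset_lattice :: 'i set gorder)"
    by (rule *) (auto simp: powerset_lattice_def)
  show "carrier (powerset_lattice :: 'i set gorder) = UNIV" "A \<sqsubseteq>\<^bsub>powerset_lattice\<^esub> B \<longleftrightarrow> A \<subseteq> B"
    by (auto simp: powerset_lattice_def)
  show "A \<sqinter>\<^bsub>powerset_lattice\<^esub> B = A \<inter> B"
    by (rule *) (auto simp: powerset_lattice_def)
  show "A \<squnion>\<^bsub>powerset_lattice\<^esub> B = A \<union> B"
    by (rule *) (auto simp: powerset_lattice_def)
  show "\<top>\<^bsub>powerset_lattice\<^esub> = (UNIV :: 'i set)"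
    by (rule *) (auto simp: powerset_lattice_def)
  show "\<bottom>\<^bsub>powerset_lattice\<^esub> = ({} :: 'i set)"
    by (rule *) (auto simp: powerset_lattice_def)
qed

section \<open>Cartesian categories\<close>

context category
begin

lemma Comp_simps [simp]:
  assumes "f \<in> Arr C" "g \<in> Arr C" "Dom C g = Cod C f"
  shows "g \<cdot> f \<in> Arr C" "Dom C (g \<cdot> f) = Dom C f" "Cod C (g \<cdot> f) = Cod C g"
  using Comp_hom[of f "Dom C f" "Cod C f" g "Cod C g"] assms by (auto simp: hom_def)

lemma ide_simps [simp]:
  assumes "X \<in> Ob C"
  shows "ide C X \<in> Arr C" "Dom C (ide C X) = X" "Cod C (ide C X) = X"
  using ide_hom assms by (auto simp: hom_def)

lemma Ob_simps [simp]: "f \<in> Arr C \<Longrightarrow> Dom C f \<in> Ob C" "f \<in> Arr C \<Longrightarrow> Cod C f \<in> Ob C"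
  by (auto intro: Dom_Ob Cod_Ob)

lemma Comp_ide_simps [simp]:
  "\<lbrakk>f \<in> Arr C; Cod C f = Y\<rbrakk> \<Longrightarrow> ide C Y \<cdot> f = f"
  "\<lbrakk>f \<in> Arr C; Dom C f = X\<rbrakk> \<Longrightarrow> f \<cdot> ide C X = f"
  by (auto intro: Comp_ide_left Comp_ide_right simp: hom_def)

text \<open>Composites are normalized to the right, and by \<open>pair_Comp\<close> pairings are
  pulled outwards. Equations between arrows built from projections and pairings are then left to the
  simplifier throughout.\<close>

lemma Comp_assoc_right [simp]:
  assumes "f \<in> Arr C" "g \<in> Arr C" "h \<in> Arr C" "Dom C g = Cod C f" "Dom C h = Cod C g"
  shows "(h \<cdot> g) \<cdot> f = h \<cdot> g \<cdot> f"
  using Comp_assoc[of f "Dom C f" "Cod C f" g "Cod C g" h "Cod C h"] assms by (simp add: hom_def)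

end

locale cartesian_category = category C for C :: "('o, 'a) cat" (structure) +
  assumes binary_product: "\<lbrakk>X \<in> Ob C; Y \<in> Ob C\<rbrakk> \<Longrightarrow> \<exists>P p q. is_product C X Y P p q"
begin

lemma prod_is_product:
  assumes "X \<in> Ob C" "Y \<in> Ob C"
  shows "is_product C X Y (prod_ob C X Y) (pr1 C X Y) (pr2 C X Y)"
proof -
  have "\<exists>t. case t of (P, p, q) \<Rightarrow> is_product C X Y P p q" using binary_product[OF assms] by auto
  from someI_ex[OF this] show ?thesis
    by (simp add: prod_ob_def pr1_def pr2_def prod_cone_def case_prod_unfold)
qed

lemma pr_simps [simp]:
  assumes "X \<in> Ob C" "Y \<in> Ob C"
  shows "prod_ob C X Y \<in> Ob C"
    "pr1 C X Y \<in> Arr C" "Dom C (pr1 C X Y) = prod_ob C X Y" "Cod C (pr1 C X Y) = X"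
    "pr2 C X Y \<in> Arr C" "Dom C (pr2 C X Y) = prod_ob C X Y" "Cod C (pr2 C X Y) = Y"
proof -
  have *: "pr1 C X Y \<in> hom C (prod_ob C X Y) X" "pr2 C X Y \<in> hom C (prod_ob C X Y) Y"
    using prod_is_product[OF assms] by (auto simp: is_product_def)
  then show "pr1 C X Y \<in> Arr C" "Dom C (pr1 C X Y) = prod_ob C X Y" "Cod C (pr1 C X Y) = X"
    "pr2 C X Y \<in> Arr C" "Dom C (pr2 C X Y) = prod_ob C X Y" "Cod C (pr2 C X Y) = Y"
    by (auto simp: hom_def)
  then show "prod_ob C X Y \<in> Ob C" using Dom_Ob by metis
qed

lemma pair_all:
  assumes "f \<in> Arr C" "g \<in> Arr C" "Dom C f = Dom C g"
  shows "pair C f g \<in> hom C (Dom C f) (prod_ob C (Cod C f) (Cod C g)) \<and>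
    pr1 C (Cod C f) (Cod C g) \<cdot> pair C f g = f \<and> pr2 C (Cod C f) (Cod C g) \<cdot> pair C f g = g"
  unfolding pair_def
proof (rule theI')
  have "f \<in> hom C (Dom C f) (Cod C f)" "g \<in> hom C (Dom C f) (Cod C g)"
    using assms by (auto simp: hom_def)
  then show "\<exists>!h. h \<in> hom C (Dom C f) (prod_ob C (Cod C f) (Cod C g)) \<and>
      pr1 C (Cod C f) (Cod C g) \<cdot> h = f \<and> pr2 C (Cod C f) (Cod C g) \<cdot> h = g"
    using prod_is_product[of "Cod C f" "Cod C g"] assms unfolding is_product_def by simp
qed

lemma pair_simps [simp]:
  assumes "f \<in> Arr C" "g \<in> Arr C" "Dom C f = Dom C g"
  shows "pair C f g \<in> Arr C" "Dom C (pair C f g) = Dom C g"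
    "Cod C (pair C f g) = prod_ob C (Cod C f) (Cod C g)"
    "\<lbrakk>Cod C f = X; Cod C g = Y\<rbrakk> \<Longrightarrow> pr1 C X Y \<cdot> pair C f g = f"
    "\<lbrakk>Cod C f = X; Cod C g = Y\<rbrakk> \<Longrightarrow> pr2 C X Y \<cdot> pair C f g = g"
  using pair_all[OF assms] assms by (auto simp: hom_def)

text \<open>Association to the right hides the redex \<open>pr1 \<cdot> pair\<close> inside
  \<open>pr1 \<cdot> (pair \<cdot> h)\<close>; these rules recover it.\<close>

lemma pair_simps2 [simp]:
  assumes "f \<in> Arr C" "g \<in> Arr C" "Dom C f = Dom C g" "h \<in> Arr C" "Dom C g = Cod C h"
    "Cod C f = X" "Cod C g = Y"
  shows "pr1 C X Y \<cdot> pair C f g \<cdot> h = f \<cdot> h" "pr2 C X Y \<cdot> pair C f g \<cdot> h = g \<cdot> h"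
proof -
  have "pr1 C X Y \<cdot> pair C f g \<cdot> h = (pr1 C X Y \<cdot> pair C f g) \<cdot> h"
    by (subst Comp_assoc_right) (use assms in auto)
  then show "pr1 C X Y \<cdot> pair C f g \<cdot> h = f \<cdot> h" using assms by simp
  have "pr2 C X Y \<cdot> pair C f g \<cdot> h = (pr2 C X Y \<cdot> pair C f g) \<cdot> h"
    by (subst Comp_assoc_right) (use assms in auto)
  then show "pr2 C X Y \<cdot> pair C f g \<cdot> h = g \<cdot> h" using assms by simp
qed

lemma prod_arr_eq_ext:
  assumes "f \<in> Arr C" "g \<in> Arr C" "Dom C f = Dom C g" "Cod C f = prod_ob C X Y"
    "Cod C g = prod_ob C X Y" "X \<in> Ob C" "Y \<in> Ob C"
    "pr1 C X Y \<cdot> f = pr1 C X Y \<cdot> g" "pr2 C X Y \<cdot> f = pr2 C X Y \<cdot> g"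
  shows "f = g"
proof -
  have "pr1 C X Y \<cdot> f \<in> hom C (Dom C f) X" "pr2 C X Y \<cdot> f \<in> hom C (Dom C f) Y"
    using assms by (auto simp: hom_def)
  then have "\<exists>!h. h \<in> hom C (Dom C f) (prod_ob C X Y) \<and> pr1 C X Y \<cdot> h = pr1 C X Y \<cdot> f \<and>
      pr2 C X Y \<cdot> h = pr2 C X Y \<cdot> f"
    using prod_is_product[OF assms(6,7)] unfolding is_product_def by blast
  moreover have "f \<in> hom C (Dom C f) (prod_ob C X Y)" "g \<in> hom C (Dom C f) (prod_ob C X Y)"
    using assms by (auto simp: hom_def)
  ultimately show ?thesis using assms by metis
qed

lemma pair_Comp [simp]:
  assumes "f \<in> Arr C" "g \<in> Arr C" "Dom C f = Dom C g" "h \<in> Arr C" "Dom C g = Cod C h"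
  shows "pair C f g \<cdot> h = pair C (f \<cdot> h) (g \<cdot> h)"
  by (rule prod_arr_eq_ext[where X="Cod C f" and Y="Cod C g"]) (use assms in auto)

lemma pair_pr_Comp [simp]:
  assumes "h \<in> Arr C" "Cod C h = prod_ob C X Y" "X \<in> Ob C" "Y \<in> Ob C"
  shows "pair C (pr1 C X Y \<cdot> h) (pr2 C X Y \<cdot> h) = h"
  by (rule prod_arr_eq_ext[where X=X and Y=Y]) (use assms in auto)

lemma pair_pr [simp]:
  assumes "X \<in> Ob C" "Y \<in> Ob C"
  shows "pair C (pr1 C X Y) (pr2 C X Y) = ide C (prod_ob C X Y)"
  by (rule prod_arr_eq_ext[where X=X and Y=Y]) (use assms in auto)

end

lemma (in category) cartesian_category_if_has_finite_products:
  assumes "has_finite_products C"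
  shows "cartesian_category C"
proof
  fix X Y assume XY: "X \<in> Ob C" "Y \<in> Ob C"
  let ?X = "\<lambda>i::nat. if i = 0 then X else Y"
  have "\<forall>i<2. ?X i \<in> Ob C" using XY by simp
  from assms[unfolded has_finite_products_def, THEN spec, of 2, THEN spec, of ?X, THEN mp, OF this]
  obtain P p where P: "P \<in> Ob C" "\<forall>i<2. p i \<in> hom C P (?X i)"
    and u: "\<forall>Q q. Q \<in> Ob C \<and> (\<forall>i<2. q i \<in> hom C Q (?X i)) \<longrightarrow>
              (\<exists>!h. h \<in> hom C Q P \<and> (\<forall>i<2. p i \<cdot> h = q i))"
    by (elim exE conjE) (rule that)
  have two: "(\<forall>i<2::nat. R i) \<longleftrightarrow> R 0 \<and> R 1" for R
    by (auto simp: less_2_cases_iff)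
  have "is_product C X Y P (p 0) (p 1)"
    unfolding is_product_def
  proof (intro conjI allI ballI)
    fix W f g assume fg: "f \<in> hom C W X" "g \<in> hom C W Y"
    have "\<exists>!h. h \<in> hom C W P \<and> (\<forall>i<2. p i \<cdot> h = (if i = 0 then f else g))"
    proof (rule u[THEN spec, THEN spec, THEN mp])
      have "W \<in> Ob C" using fg by (auto simp: hom_def)
      then show "W \<in> Ob C \<and> (\<forall>i<2. (if i = 0 then f else g) \<in> hom C W (?X i))" using fg by simp
    qed
    then show "\<exists>!h. h \<in> hom C W P \<and> p 0 \<cdot> h = f \<and> p 1 \<cdot> h = g"
      unfolding two by simp
  qed (use P(2) in \<open>auto simp: two\<close>)
  then show "\<exists>P p q. is_product C X Y P p q" by blast
qed

section \<open>Logic in a Boolean doctrine\<close>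

sublocale boolean_doctrine \<subseteq> base: cartesian_category "Base D"
  using category.cartesian_category_if_has_finite_products[OF Base_category Base_cartesian] .

context boolean_doctrine
begin

lemma Fib_le_refl [simp]: "\<lbrakk>X \<in> Ob (Base D); A \<in> carrier (Fib D X)\<rbrakk> \<Longrightarrow> A \<sqsubseteq>\<^bsub>Fib D X\<^esub> A"
proof -
  assume *: "X \<in> Ob (Base D)" "A \<in> carrier (Fib D X)"
  interpret boolean_lattice "Fib D X" using * Fib_boolean by blast
  show ?thesis using * by simp
qed

lemma Fib_le_trans:
  assumes "A \<sqsubseteq>\<^bsub>Fib D X\<^esub> B" "B \<sqsubseteq>\<^bsub>Fib D X\<^esub> E" "X \<in> Ob (Base D)"
    "A \<in> carrier (Fib D X)" "B \<in> carrier (Fib D X)" "E \<in> carrier (Fib D X)"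
  shows "A \<sqsubseteq>\<^bsub>Fib D X\<^esub> E"
proof -
  interpret boolean_lattice "Fib D X" using assms Fib_boolean by blast
  show ?thesis using le_trans assms by simp
qed

lemma Fib_le_antisym:
  assumes "A \<sqsubseteq>\<^bsub>Fib D X\<^esub> B" "B \<sqsubseteq>\<^bsub>Fib D X\<^esub> A" "X \<in> Ob (Base D)"
    "A \<in> carrier (Fib D X)" "B \<in> carrier (Fib D X)"
  shows "A = B"
proof -
  interpret boolean_lattice "Fib D X" using assms Fib_boolean by blast
  show ?thesis using le_antisym assms by simp
qed

lemma Fib_meet [simp]:
  assumes "X \<in> Ob (Base D)" "A \<in> carrier (Fib D X)" "B \<in> carrier (Fib D X)"
  shows "A \<sqinter>\<^bsub>Fib D X\<^esub> B \<in> carrier (Fib D X)"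
    "A \<sqinter>\<^bsub>Fib D X\<^esub> B \<sqsubseteq>\<^bsub>Fib D X\<^esub> A" "A \<sqinter>\<^bsub>Fib D X\<^esub> B \<sqsubseteq>\<^bsub>Fib D X\<^esub> B"
    "A \<squnion>\<^bsub>Fib D X\<^esub> B \<in> carrier (Fib D X)"
proof -
  interpret boolean_lattice "Fib D X" using assms Fib_boolean by blast
  show "A \<sqinter>\<^bsub>Fib D X\<^esub> B \<in> carrier (Fib D X)" "A \<squnion>\<^bsub>Fib D X\<^esub> B \<in> carrier (Fib D X)" using assms by auto
  show "A \<sqinter>\<^bsub>Fib D X\<^esub> B \<sqsubseteq>\<^bsub>Fib D X\<^esub> A" by (rule meet_left) (use assms in auto)
  show "A \<sqinter>\<^bsub>Fib D X\<^esub> B \<sqsubseteq>\<^bsub>Fib D X\<^esub> B" by (rule meet_right) (use assms in auto)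
qed

lemma Fib_meet_le:
  assumes "X \<in> Ob (Base D)" "A \<in> carrier (Fib D X)" "B \<in> carrier (Fib D X)" "E \<in> carrier (Fib D X)"
    "E \<sqsubseteq>\<^bsub>Fib D X\<^esub> A" "E \<sqsubseteq>\<^bsub>Fib D X\<^esub> B"
  shows "E \<sqsubseteq>\<^bsub>Fib D X\<^esub> A \<sqinter>\<^bsub>Fib D X\<^esub> B"
proof -
  interpret boolean_lattice "Fib D X" using assms Fib_boolean by blast
  show ?thesis by (rule meet_le) (use assms in auto)
qed

lemma Fib_top [simp]:
  assumes "X \<in> Ob (Base D)"
  shows "\<top>\<^bsub>Fib D X\<^esub> \<in> carrier (Fib D X)" "\<bottom>\<^bsub>Fib D X\<^esub> \<in> carrier (Fib D X)"
    "A \<in> carrier (Fib D X) \<Longrightarrow> A \<sqsubseteq>\<^bsub>Fib D X\<^esub> \<top>\<^bsub>Fib D X\<^esub>"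
    "A \<in> carrier (Fib D X) \<Longrightarrow> \<bottom>\<^bsub>Fib D X\<^esub> \<sqsubseteq>\<^bsub>Fib D X\<^esub> A"
    "A \<in> carrier (Fib D X) \<Longrightarrow> A \<sqinter>\<^bsub>Fib D X\<^esub> \<top>\<^bsub>Fib D X\<^esub> = A"
    "A \<in> carrier (Fib D X) \<Longrightarrow> \<top>\<^bsub>Fib D X\<^esub> \<sqinter>\<^bsub>Fib D X\<^esub> A = A"
proof -
  interpret boolean_lattice "Fib D X" using assms Fib_boolean by blast
  show "\<top>\<^bsub>Fib D X\<^esub> \<in> carrier (Fib D X)" "\<bottom>\<^bsub>Fib D X\<^esub> \<in> carrier (Fib D X)" by auto
  show "A \<in> carrier (Fib D X) \<Longrightarrow> A \<sqsubseteq>\<^bsub>Fib D X\<^esub> \<top>\<^bsub>Fib D X\<^esub>"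
    "A \<in> carrier (Fib D X) \<Longrightarrow> \<bottom>\<^bsub>Fib D X\<^esub> \<sqsubseteq>\<^bsub>Fib D X\<^esub> A" by auto
  show "A \<in> carrier (Fib D X) \<Longrightarrow> \<top>\<^bsub>Fib D X\<^esub> \<sqinter>\<^bsub>Fib D X\<^esub> A = A"
    using top_meet by (simp add: eq_is_equal)
  then show "A \<in> carrier (Fib D X) \<Longrightarrow> A \<sqinter>\<^bsub>Fib D X\<^esub> \<top>\<^bsub>Fib D X\<^esub> = A"
    by (metis meet_comm)
qed

lemma Sub_simps [simp]:
  assumes f: "f \<in> Arr (Base D)"
  shows "\<lbrakk>Dom (Base D) f = X; A \<in> carrier (Fib D (Cod (Base D) f))\<rbrakk> \<Longrightarrow> Sub D f A \<in> carrier (Fib D X)"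
    "Cod (Base D) f = Y \<Longrightarrow> Sub D f \<top>\<^bsub>Fib D Y\<^esub> = \<top>\<^bsub>Fib D (Dom (Base D) f)\<^esub>"
    "Cod (Base D) f = Y \<Longrightarrow> Sub D f \<bottom>\<^bsub>Fib D Y\<^esub> = \<bottom>\<^bsub>Fib D (Dom (Base D) f)\<^esub>"
    "\<lbrakk>Cod (Base D) f = Y; A \<in> carrier (Fib D Y); B \<in> carrier (Fib D Y)\<rbrakk> \<Longrightarrow>
       Sub D f (A \<sqinter>\<^bsub>Fib D Y\<^esub> B) = Sub D f A \<sqinter>\<^bsub>Fib D (Dom (Base D) f)\<^esub> Sub D f B"
    "\<lbrakk>Cod (Base D) f = Y; A \<in> carrier (Fib D Y); B \<in> carrier (Fib D Y)\<rbrakk> \<Longrightarrow>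
       Sub D f (A \<squnion>\<^bsub>Fib D Y\<^esub> B) = Sub D f A \<squnion>\<^bsub>Fib D (Dom (Base D) f)\<^esub> Sub D f B"
  using Sub_boolean_hom[of f "Dom (Base D) f" "Cod (Base D) f"] f
  by (auto simp: boolean_hom_def hom_def)

lemma Sub_Comp_right [simp]:
  assumes "f \<in> Arr (Base D)" "g \<in> Arr (Base D)" "Dom (Base D) g = Cod (Base D) f"
    "A \<in> carrier (Fib D (Cod (Base D) g))"
  shows "Sub D f (Sub D g A) = Sub D (g \<cdot>\<^bsub>Base D\<^esub> f) A"
  using Sub_Comp[of f "Dom (Base D) f" "Cod (Base D) f" g] assms by (auto simp: hom_def)

declare Sub_ide [simp]

lemma Sub_mono:
  assumes "A \<sqsubseteq>\<^bsub>Fib D Y\<^esub> B" "f \<in> Arr (Base D)" "Cod (Base D) f = Y" "Dom (Base D) f = X"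
    "A \<in> carrier (Fib D Y)" "B \<in> carrier (Fib D Y)"
  shows "Sub D f A \<sqsubseteq>\<^bsub>Fib D X\<^esub> Sub D f B"
proof -
  have XY: "X \<in> Ob (Base D)" "Y \<in> Ob (Base D)" using assms by auto
  interpret Y: boolean_lattice "Fib D Y" using XY Fib_boolean by blast
  interpret X: boolean_lattice "Fib D X" using XY Fib_boolean by blast
  have "A = A \<sqinter>\<^bsub>Fib D Y\<^esub> B" using assms Y.le_iff_join by blast
  then have "Sub D f A = Sub D f (A \<sqinter>\<^bsub>Fib D Y\<^esub> B)" by simp
  also have "\<dots> = Sub D f A \<sqinter>\<^bsub>Fib D X\<^esub> Sub D f B" using assms by simp
  finally show ?thesis
    using X.le_iff_join[of "Sub D f A" "Sub D f B"] assms by simp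
qed

lemma Ex_is_left_adjoint:
  assumes "f \<in> Arr (Base D)" "A \<in> carrier (Fib D (Dom (Base D) f))"
  shows "is_left_adjoint_value D f A (Ex D f A)"
proof -
  let ?Y = "Cod (Base D) f"
  have Y: "?Y \<in> Ob (Base D)" using assms by auto
  obtain B where B: "is_left_adjoint_value D f A B"
    using left_adjoint[of f "Dom (Base D) f" ?Y A] assms by (auto simp: hom_def)
  show ?thesis unfolding Ex_def
  proof (rule theI[where a=B])
    show "is_left_adjoint_value D f A B" by fact
    fix B' assume B': "is_left_adjoint_value D f A B'"
    have c: "B \<in> carrier (Fib D ?Y)" "B' \<in> carrier (Fib D ?Y)"
      using B B' by (auto simp: is_left_adjoint_value_def)
    have "B \<sqsubseteq>\<^bsub>Fib D ?Y\<^esub> B" "B' \<sqsubseteq>\<^bsub>Fib D ?Y\<^esub> B'" using c Y by auto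
    then have "B \<sqsubseteq>\<^bsub>Fib D ?Y\<^esub> B'" "B' \<sqsubseteq>\<^bsub>Fib D ?Y\<^esub> B"
      using B B' c by (auto simp: is_left_adjoint_value_def)
    then show "B' = B" using Fib_le_antisym Y c by blast
  qed
qed

lemma Ex_closed [simp]:
  assumes "f \<in> Arr (Base D)" "Cod (Base D) f = Y" "A \<in> carrier (Fib D (Dom (Base D) f))"
  shows "Ex D f A \<in> carrier (Fib D Y)"
  using Ex_is_left_adjoint[of f A] assms by (auto simp: is_left_adjoint_value_def)

lemma Ex_le_iff:
  assumes "f \<in> Arr (Base D)" "Cod (Base D) f = Y" "Dom (Base D) f = X"
    "A \<in> carrier (Fib D X)" "B \<in> carrier (Fib D Y)"
  shows "Ex D f A \<sqsubseteq>\<^bsub>Fib D Y\<^esub> B \<longleftrightarrow> A \<sqsubseteq>\<^bsub>Fib D X\<^esub> Sub D f B"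
  using Ex_is_left_adjoint[of f A] assms by (auto simp: is_left_adjoint_value_def)

lemma le_Sub_Ex:
  assumes "f \<in> Arr (Base D)" "Dom (Base D) f = X" "A \<in> carrier (Fib D X)"
  shows "A \<sqsubseteq>\<^bsub>Fib D X\<^esub> Sub D f (Ex D f A)"
  using Ex_le_iff[of f "Cod (Base D) f" X A "Ex D f A"] assms by simp

section \<open>Equality predicates and substitution of equals\<close>

definition delta :: "'o \<Rightarrow> 'd" where
  "delta X = Ex D (diag (Base D) X) \<top>\<^bsub>Fib D X\<^esub>"

lemma delta_closed [simp]: "X \<in> Ob (Base D) \<Longrightarrow> delta X \<in> carrier (Fib D (prod_ob (Base D) X X))"
  unfolding delta_def diag_def by simp

lemma delta_refl [simp]:
  assumes "y \<in> Arr (Base D)" "Cod (Base D) y = Y"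
  shows "Sub D (pair (Base D) y y) (delta Y) = \<top>\<^bsub>Fib D (Dom (Base D) y)\<^esub>"
proof -
  let ?d = "pair (Base D) (ide (Base D) Y) (ide (Base D) Y)"
  have Y: "Y \<in> Ob (Base D)" using assms by auto
  have "\<top>\<^bsub>Fib D Y\<^esub> \<sqsubseteq>\<^bsub>Fib D Y\<^esub> Sub D ?d (delta Y)"
    unfolding delta_def diag_def by (rule le_Sub_Ex) (use Y in auto)
  then have "Sub D ?d (delta Y) = \<top>\<^bsub>Fib D Y\<^esub>"
    by (intro Fib_le_antisym[where X=Y]) (use Y in auto)
  then have "Sub D y (Sub D ?d (delta Y)) = \<top>\<^bsub>Fib D (Dom (Base D) y)\<^esub>" using assms by simp
  then show ?thesis using assms Y by simp
qed

text \<open>Substitution of equals with a parameter \<open>w\<close>. For the diagonal of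
  \<open>Y\<close> with a parameter in \<open>W\<close> it follows from Frobenius, since the two
  readings of \<open>\<phi>\<close> coincide on that diagonal. Beck-Chevalley for diagonals, applied
  to the arrow from \<open>W\<close> to a terminal object, shows that plain equality
  \<open>delta Y\<close> implies the image \<open>?E\<close> of the parametrized diagonal.\<close>

lemma leibniz:
  assumes y: "y \<in> Arr (Base D)" "y' \<in> Arr (Base D)" "w \<in> Arr (Base D)"
    and U: "Dom (Base D) y = U" "Dom (Base D) y' = U" "Dom (Base D) w = U"
    and Y: "Cod (Base D) y = Y" "Cod (Base D) y' = Y" "Cod (Base D) w = W"
    and \<phi>: "\<phi> \<in> carrier (Fib D (prod_ob (Base D) Y W))"
  shows "Sub D (pair (Base D) y y') (delta Y) \<sqinter>\<^bsub>Fib D U\<^esub> Sub D (pair (Base D) y w) \<phi>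
    \<sqsubseteq>\<^bsub>Fib D U\<^esub> Sub D (pair (Base D) y' w) \<phi>"
proof -
  let ?B = "Base D" let ?YY = "prod_ob ?B Y Y" let ?V = "prod_ob ?B ?YY W"
  have O [simp]: "U \<in> Ob ?B" "Y \<in> Ob ?B" "W \<in> Ob ?B" using assms by auto
  \<comment> \<open>The empty product is a terminal object \<open>I\<close>.
    \<open>Beck_Chevalley_diagonal\<close> speaks of diagonals with a parameter, and with parameter
    in \<open>I\<close> this is the plain diagonal up to isomorphism.\<close>
  have "\<exists>P. P \<in> Ob ?B \<and> (\<forall>Q. Q \<in> Ob ?B \<longrightarrow> (\<exists>!h. h \<in> hom ?B Q P))"
    using Base_cartesian[unfolded has_finite_products_def, THEN spec, of 0] by auto
  then obtain I where I [simp]: "I \<in> Ob ?B" and un: "\<And>Q. Q \<in> Ob ?B \<Longrightarrow> \<exists>!h. h \<in> hom ?B Q I" by blast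
  define tt where "tt Q = (THE h. h \<in> hom ?B Q I)" for Q
  have tt: "tt Q \<in> hom ?B Q I" if "Q \<in> Ob ?B" for Q
    unfolding tt_def using theI'[OF un[OF that]] .
  then have tts [simp]: "tt Q \<in> Arr ?B" "Dom ?B (tt Q) = Q" "Cod ?B (tt Q) = I" if "Q \<in> Ob ?B" for Q
    using that by (auto simp: hom_def)
  have ttu: "h = tt Q" if "h \<in> Arr ?B" "Dom ?B h = Q" "Cod ?B h = I" for h Q
  proof -
    have "Q \<in> Ob ?B" using that by auto
    from un[OF this] tt[OF this] show ?thesis using that by (auto simp: hom_def)
  qed
  let ?g = "\<lambda>W. pair ?B (diag ?B Y \<cdot>\<^bsub>?B\<^esub> pr1 ?B Y W) (pr2 ?B Y W)"
  let ?j = "pair ?B (ide ?B ?YY) (tt ?YY)"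
  have d: "diag ?B Y \<in> Arr ?B" "Dom ?B (diag ?B Y) = Y" "Cod ?B (diag ?B Y) = ?YY"
    by (simp_all add: diag_def)
  have pg: "prod_arr ?B (diag ?B Y) (ide ?B W) = ?g W" if "W \<in> Ob ?B" for W
    using that d by (simp add: prod_arr_def)
  let ?E1 = "Ex D (?g I) \<top>\<^bsub>Fib D (prod_ob ?B Y I)\<^esub>"
  let ?E = "Ex D (?g W) \<top>\<^bsub>Fib D (prod_ob ?B Y W)\<^esub>"
  have E1c: "?E1 \<in> carrier (Fib D (prod_ob ?B ?YY I))" and Ec: "?E \<in> carrier (Fib D ?V)"
    using d by auto
  let ?f = "pair ?B (pr1 ?B ?YY W) (tt W \<cdot>\<^bsub>?B\<^esub> pr2 ?B ?YY W)"
  \<comment> \<open>Base change along \<open>tt W\<close> moves the parametrized diagonal from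
    parameter \<open>I\<close> to parameter \<open>W\<close>.\<close>
  have E: "?E = Sub D ?f ?E1"
  proof -
    have "Sub D (prod_arr ?B (ide ?B ?YY) (tt W)) (Ex D (prod_arr ?B (diag ?B Y) (ide ?B I)) \<top>\<^bsub>Fib D (prod_ob ?B Y I)\<^esub>)
       = Ex D (prod_arr ?B (diag ?B Y) (ide ?B W)) (Sub D (prod_arr ?B (ide ?B Y) (tt W)) \<top>\<^bsub>Fib D (prod_ob ?B Y I)\<^esub>)"
      by (rule Beck_Chevalley_diagonal) (use tt in auto)
    moreover have "prod_arr ?B (ide ?B ?YY) (tt W) = ?f" by (simp add: prod_arr_def)
    moreover have "Sub D (prod_arr ?B (ide ?B Y) (tt W)) \<top>\<^bsub>Fib D (prod_ob ?B Y I)\<^esub> = \<top>\<^bsub>Fib D (prod_ob ?B Y W)\<^esub>"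
      by (simp add: prod_arr_def)
    ultimately show ?thesis by (simp add: pg)
  qed
  \<comment> \<open>By adjunction it suffices to compare along the diagonal of \<open>Y\<close>,
    where \<open>?j\<close> and \<open>?g I\<close> agree because arrows into \<open>I\<close> are
    unique.\<close>
  have "delta Y \<sqsubseteq>\<^bsub>Fib D ?YY\<^esub> Sub D ?j ?E1"
  proof -
    let ?j' = "pair ?B (ide ?B Y) (tt Y)"
    have j: "?j \<cdot>\<^bsub>?B\<^esub> diag ?B Y = ?g I \<cdot>\<^bsub>?B\<^esub> ?j'"
      using d ttu[of "tt ?YY \<cdot>\<^bsub>?B\<^esub> diag ?B Y" Y] by simp
    have "\<top>\<^bsub>Fib D (prod_ob ?B Y I)\<^esub> \<sqsubseteq>\<^bsub>Fib D (prod_ob ?B Y I)\<^esub> Sub D (?g I) ?E1"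
      by (rule le_Sub_Ex) (use d in auto)
    then have "Sub D ?j' \<top>\<^bsub>Fib D (prod_ob ?B Y I)\<^esub> \<sqsubseteq>\<^bsub>Fib D Y\<^esub> Sub D ?j' (Sub D (?g I) ?E1)"
      by (rule Sub_mono) (use d E1c in auto)
    also have "Sub D ?j' (Sub D (?g I) ?E1) = Sub D (?g I \<cdot>\<^bsub>?B\<^esub> ?j') ?E1"
      by (rule Sub_Comp_right) (use d E1c in auto)
    also have "\<dots> = Sub D (diag ?B Y) (Sub D ?j ?E1)"
      unfolding j[symmetric] by (rule Sub_Comp_right[symmetric]) (use d E1c in auto)
    finally show ?thesis unfolding delta_def using Ex_le_iff[of "diag ?B Y" ?YY Y] d E1c by simp
  qed
  then have "Sub D (pr1 ?B ?YY W) (delta Y) \<sqsubseteq>\<^bsub>Fib D ?V\<^esub> Sub D (pr1 ?B ?YY W) (Sub D ?j ?E1)"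
    by (rule Sub_mono) (use E1c in auto)
  also have "Sub D (pr1 ?B ?YY W) (Sub D ?j ?E1) = Sub D (?j \<cdot>\<^bsub>?B\<^esub> pr1 ?B ?YY W) ?E1"
    by (rule Sub_Comp_right) (use E1c in auto)
  also have "?j \<cdot>\<^bsub>?B\<^esub> pr1 ?B ?YY W = ?f"
    using ttu[of "tt ?YY \<cdot>\<^bsub>?B\<^esub> pr1 ?B ?YY W" ?V] ttu[of "tt W \<cdot>\<^bsub>?B\<^esub> pr2 ?B ?YY W" ?V] by simp
  finally have 1: "Sub D (pr1 ?B ?YY W) (delta Y) \<sqsubseteq>\<^bsub>Fib D ?V\<^esub> ?E" unfolding E .
  let ?a = "pair ?B (pr1 ?B Y Y \<cdot>\<^bsub>?B\<^esub> pr1 ?B ?YY W) (pr2 ?B ?YY W)"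
  let ?b = "pair ?B (pr2 ?B Y Y \<cdot>\<^bsub>?B\<^esub> pr1 ?B ?YY W) (pr2 ?B ?YY W)"
  have ab: "?a \<cdot>\<^bsub>?B\<^esub> ?g W = ide ?B (prod_ob ?B Y W)" "?b \<cdot>\<^bsub>?B\<^esub> ?g W = ide ?B (prod_ob ?B Y W)"
    using d by (simp_all add: diag_def)
  \<comment> \<open>\<open>?a\<close> and \<open>?b\<close> read \<open>\<phi>\<close> at the first
    and at the second copy of \<open>Y\<close>. Both are retractions of \<open>?g W\<close>, so
    Frobenius collapses the left side to \<open>Ex D (?g W) \<phi>\<close>, and the adjunction puts
    this below the reading at \<open>?b\<close>.\<close>
  have "Sub D ?a \<phi> \<sqinter>\<^bsub>Fib D ?V\<^esub> ?E = Ex D (?g W) (Sub D (?g W) (Sub D ?a \<phi>) \<sqinter>\<^bsub>Fib D (prod_ob ?B Y W)\<^esub> \<top>\<^bsub>Fib D (prod_ob ?B Y W)\<^esub>)"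
    by (rule Frobenius[symmetric]) (use d \<phi> in \<open>auto simp: hom_def\<close>)
  also have "Sub D (?g W) (Sub D ?a \<phi>) = \<phi>" by (subst Sub_Comp_right) (use d \<phi> ab in auto)
  also have "\<phi> \<sqinter>\<^bsub>Fib D (prod_ob ?B Y W)\<^esub> \<top>\<^bsub>Fib D (prod_ob ?B Y W)\<^esub> = \<phi>" using \<phi> by simp
  also have "Ex D (?g W) \<phi> \<sqsubseteq>\<^bsub>Fib D ?V\<^esub> Sub D ?b \<phi>"
  proof -
    have "Sub D (?g W) (Sub D ?b \<phi>) = \<phi>" by (subst Sub_Comp_right) (use d \<phi> ab in auto)
    then show ?thesis using Ex_le_iff[of "?g W" ?V "prod_ob ?B Y W" \<phi> "Sub D ?b \<phi>"] d \<phi> by simp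
  qed
  finally have 2: "Sub D ?a \<phi> \<sqinter>\<^bsub>Fib D ?V\<^esub> ?E \<sqsubseteq>\<^bsub>Fib D ?V\<^esub> Sub D ?b \<phi>" .
  let ?u = "pair ?B (pair ?B y y') w"
  have u: "?u \<in> Arr ?B" "Dom ?B ?u = U" "Cod ?B ?u = ?V" using assms by auto
  have c: "Sub D (pair ?B y y') (delta Y) \<in> carrier (Fib D U)" "Sub D (pair ?B y w) \<phi> \<in> carrier (Fib D U)"
    "Sub D ?u ?E \<in> carrier (Fib D U)" "Sub D (pair ?B y' w) \<phi> \<in> carrier (Fib D U)"
    using assms u Ec by auto
  have "Sub D ?u (Sub D (pr1 ?B ?YY W) (delta Y)) \<sqsubseteq>\<^bsub>Fib D U\<^esub> Sub D ?u ?E"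
    by (rule Sub_mono[OF 1]) (use u Ec in auto)
  moreover have "Sub D ?u (Sub D (pr1 ?B ?YY W) (delta Y)) = Sub D (pair ?B y y') (delta Y)"
    using assms by simp
  ultimately have 3: "Sub D (pair ?B y y') (delta Y) \<sqsubseteq>\<^bsub>Fib D U\<^esub> Sub D ?u ?E" by simp
  have "Sub D ?u (Sub D ?a \<phi> \<sqinter>\<^bsub>Fib D ?V\<^esub> ?E) \<sqsubseteq>\<^bsub>Fib D U\<^esub> Sub D ?u (Sub D ?b \<phi>)"
    by (rule Sub_mono[OF 2]) (use u Ec \<phi> in auto)
  moreover have "Sub D ?u (Sub D ?a \<phi> \<sqinter>\<^bsub>Fib D ?V\<^esub> ?E) = Sub D ?u (Sub D ?a \<phi>) \<sqinter>\<^bsub>Fib D U\<^esub> Sub D ?u ?E"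
    using u Ec \<phi> Sub_simps(4)[of ?u ?V "Sub D ?a \<phi>" ?E] by simp
  moreover have "Sub D ?u (Sub D ?a \<phi>) = Sub D (pair ?B y w) \<phi>" "Sub D ?u (Sub D ?b \<phi>) = Sub D (pair ?B y' w) \<phi>"
    using assms by auto
  ultimately have 4: "Sub D (pair ?B y w) \<phi> \<sqinter>\<^bsub>Fib D U\<^esub> Sub D ?u ?E \<sqsubseteq>\<^bsub>Fib D U\<^esub> Sub D (pair ?B y' w) \<phi>"
    by simp
  have "Sub D (pair ?B y y') (delta Y) \<sqinter>\<^bsub>Fib D U\<^esub> Sub D (pair ?B y w) \<phi>
    \<sqsubseteq>\<^bsub>Fib D U\<^esub> Sub D (pair ?B y w) \<phi> \<sqinter>\<^bsub>Fib D U\<^esub> Sub D ?u ?E"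
    using c by (intro Fib_meet_le Fib_le_trans[OF Fib_meet(2) 3]) auto
  then show ?thesis by (rule Fib_le_trans[OF _ 4]) (use c in auto)
qed

section \<open>Generalized elements of a stage, identified by an ultrafilter\<close>

context
  fixes U F
  assumes U: "U \<in> Ob (Base D)" and F: "ultrafilter (Fib D U) F"
begin

abbreviation (input) eq_at :: "'o \<Rightarrow> 'a \<Rightarrow> 'a \<Rightarrow> bool" where
  "eq_at Y y y' \<equiv> y \<in> hom (Base D) U Y \<and> y' \<in> hom (Base D) U Y \<and> Sub D (pair (Base D) y y') (delta Y) \<in> F"

lemma uf_up: "\<lbrakk>A \<in> F; A \<sqsubseteq>\<^bsub>Fib D U\<^esub> B; B \<in> carrier (Fib D U)\<rbrakk> \<Longrightarrow> B \<in> F"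
  using ultrafilter_up[OF Fib_boolean[OF U] F] .

lemma uf_top: "\<top>\<^bsub>Fib D U\<^esub> \<in> F"
  using F by (simp add: ultrafilter_def)

text \<open>The laws of \<open>eq_at\<close> that follow reflexivity are instances of this one, for
  formulas built from \<open>delta\<close>; the parameter \<open>w\<close> carries whatever is to
  stay fixed during the substitution.\<close>

lemma eq_at_subst2:
  assumes "eq_at Y y y'" "w \<in> hom (Base D) U W" "\<phi> \<in> carrier (Fib D (prod_ob (Base D) Y W))"
    "Sub D (pair (Base D) y w) \<phi> \<in> F"
  shows "Sub D (pair (Base D) y' w) \<phi> \<in> F"
proof -
  have h: "y \<in> Arr (Base D)" "y' \<in> Arr (Base D)" "w \<in> Arr (Base D)" "Dom (Base D) y = U"
    "Dom (Base D) y' = U" "Dom (Base D) w = U" "Cod (Base D) y = Y" "Cod (Base D) y' = Y"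
    "Cod (Base D) w = W" using assms by (auto simp: hom_def)
  then have Y: "Y \<in> Ob (Base D)" by auto
  have "Sub D (pair (Base D) y y') (delta Y) \<sqinter>\<^bsub>Fib D U\<^esub> Sub D (pair (Base D) y w) \<phi> \<in> F"
    using assms F h Y unfolding ultrafilter_def by simp
  then show ?thesis
    by (rule uf_up) (use leibniz[of y y' w U Y W \<phi>] assms h Y in auto)
qed

lemma eq_at_refl: "y \<in> hom (Base D) U Y \<Longrightarrow> eq_at Y y y"
  using uf_top by (auto simp: hom_def)

lemma eq_at_sym: assumes "eq_at Y y y'" shows "eq_at Y y' y"
proof -
  have "Y \<in> Ob (Base D)" using assms by (auto simp: hom_def)
  then show ?thesis using eq_at_subst2[OF assms, where w=y and W=Y and \<phi>="delta Y"] eq_at_refl[where y=y and Y=Y] assms by auto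
qed

lemma eq_at_trans: assumes "eq_at Y y y'" "eq_at Y y' y''" shows "eq_at Y y y''"
proof -
  have "Y \<in> Ob (Base D)" using assms by (auto simp: hom_def)
  then show ?thesis using eq_at_subst2[OF eq_at_sym[OF assms(1)], where w=y'' and W=Y and \<phi>="delta Y"] assms by auto
qed

lemma eq_at_subst:
  assumes "eq_at Y y y'" "\<phi> \<in> carrier (Fib D Y)" "Sub D y \<phi> \<in> F"
  shows "Sub D y' \<phi> \<in> F"
  \<comment> \<open>A formula in one variable is read over \<open>Y \<times> Y\<close>, with
    \<open>y\<close> itself as a dummy parameter.\<close>
  using eq_at_subst2[where y=y and y'=y' and Y=Y and w=y and W=Y and \<phi>="Sub D (pr1 (Base D) Y Y) \<phi>"] assms by (auto simp: hom_def)

lemma eq_at_Comp: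
  assumes "eq_at Y y y'" "f \<in> hom (Base D) Y Z"
  shows "eq_at Z (f \<cdot>\<^bsub>Base D\<^esub> y) (f \<cdot>\<^bsub>Base D\<^esub> y')"
proof -
  have h: "y \<in> Arr (Base D)" "y' \<in> Arr (Base D)" "f \<in> Arr (Base D)" "Dom (Base D) y = U"
    "Dom (Base D) y' = U" "Dom (Base D) f = Y" "Cod (Base D) y = Y" "Cod (Base D) y' = Y"
    "Cod (Base D) f = Z" using assms by (auto simp: hom_def)
  then have O: "Y \<in> Ob (Base D)" "Z \<in> Ob (Base D)" by auto
  let ?\<phi> = "Sub D (pair (Base D) (f \<cdot>\<^bsub>Base D\<^esub> pr1 (Base D) Y Y) (f \<cdot>\<^bsub>Base D\<^esub> pr2 (Base D) Y Y)) (delta Z)"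
  have "Sub D (pair (Base D) y y) ?\<phi> \<in> F" using h O U uf_top by simp
  then have "Sub D (pair (Base D) y' y) ?\<phi> \<in> F"
    using eq_at_subst2[OF assms(1), where w=y and W=Y and \<phi>="?\<phi>"] assms h O by auto
  then have "eq_at Z (f \<cdot>\<^bsub>Base D\<^esub> y') (f \<cdot>\<^bsub>Base D\<^esub> y)" using h O by (simp add: hom_def)
  then show ?thesis by (rule eq_at_sym)
qed

lemma eq_at_pair:
  assumes x: "eq_at X x x'" and y: "eq_at Y y y'"
  shows "eq_at (prod_ob (Base D) X Y) (pair (Base D) x y) (pair (Base D) x' y')"
proof -
  let ?B = "Base D" let ?P = "prod_ob (Base D) X Y"
  have h: "x \<in> Arr ?B" "x' \<in> Arr ?B" "Dom ?B x = U" "Dom ?B x' = U" "Cod ?B x = X" "Cod ?B x' = X"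
    "y \<in> Arr ?B" "y' \<in> Arr ?B" "Dom ?B y = U" "Dom ?B y' = U" "Cod ?B y = Y" "Cod ?B y' = Y"
    using assms by (auto simp: hom_def)
  then have O: "X \<in> Ob ?B" "Y \<in> Ob ?B" by auto
  let ?c = "pair ?B x y"
  have c: "?c \<in> hom ?B U ?P" "?c \<in> Arr ?B" using h by (simp_all add: hom_def)
  \<comment> \<open>\<open>?\<phi>(x, c)\<close> says \<open>(x, pr2 c) = c\<close>. With
    \<open>c = (x, y)\<close> held fixed as the parameter, it is true at \<open>x\<close> by
    reflexivity and so at \<open>x'\<close>. The formula \<open>?\<psi>\<close> below exchanges the
    second coordinate in the same way, its parameter being the pair of \<open>x'\<close> and
    \<open>c\<close>.\<close>
  let ?\<phi> = "Sub D (pair ?B (pair ?B (pr1 ?B X ?P) (pr2 ?B X Y \<cdot>\<^bsub>?B\<^esub> pr2 ?B X ?P)) (pr2 ?B X ?P)) (delta ?P)"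
  have "Sub D (pair ?B x ?c) ?\<phi> \<in> F" using h O U c uf_top by simp
  then have "Sub D (pair ?B x' ?c) ?\<phi> \<in> F"
    using eq_at_subst2[OF x c(1), where \<phi>="?\<phi>"] h O by auto
  then have 1: "Sub D (pair ?B (pair ?B x' y) ?c) (delta ?P) \<in> F" using h O by simp
  let ?Q = "prod_ob ?B X ?P" let ?w = "pair ?B x' ?c"
  have w: "?w \<in> hom ?B U ?Q" "?w \<in> Arr ?B" using h by (simp_all add: hom_def)
  let ?\<psi> = "Sub D (pair ?B (pair ?B (pr1 ?B X ?P \<cdot>\<^bsub>?B\<^esub> pr2 ?B Y ?Q) (pr1 ?B Y ?Q)) (pr2 ?B X ?P \<cdot>\<^bsub>?B\<^esub> pr2 ?B Y ?Q)) (delta ?P)"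
  have "Sub D (pair ?B y ?w) ?\<psi> \<in> F" using h O 1 by simp
  then have "Sub D (pair ?B y' ?w) ?\<psi> \<in> F"
    using eq_at_subst2[OF y w(1), where \<phi>="?\<psi>"] h O by auto
  then have "eq_at ?P (pair ?B x' y') ?c" using h O by (simp add: hom_def)
  then show ?thesis by (rule eq_at_sym)
qed

text \<open>The extension is generated by the preimage of \<open>F\<close> together with the required instance.\<close>

lemma uf_witness:
  assumes z: "z \<in> hom (Base D) U Z" and X: "X \<in> Ob (Base D)"
    and A: "A \<in> carrier (Fib D (prod_ob (Base D) X Z))"
    and ex: "Sub D z (Ex D (pr2 (Base D) X Z) A) \<in> F"
  obtains G where "ultrafilter (Fib D (prod_ob (Base D) X U)) G"
    "\<And>p. p \<in> carrier (Fib D U) \<Longrightarrow> Sub D (pr2 (Base D) X U) p \<in> G \<longleftrightarrow> p \<in> F"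
    "Sub D (pair (Base D) (pr1 (Base D) X U) (z \<cdot>\<^bsub>Base D\<^esub> pr2 (Base D) X U)) A \<in> G"
proof -
  let ?B = "Base D" let ?V = "prod_ob ?B X U" let ?q = "pr2 ?B X U"
  have h: "z \<in> Arr ?B" "Dom ?B z = U" "Cod ?B z = Z" using z by (auto simp: hom_def)
  then have Z: "Z \<in> Ob ?B" by auto
  have V: "?V \<in> Ob ?B" using X U by simp
  interpret U: boolean_lattice "Fib D U" using Fib_boolean[OF U] .
  interpret V: boolean_lattice "Fib D ?V" using Fib_boolean[OF V] .
  let ?A = "Sub D (pair ?B (pr1 ?B X U) (z \<cdot>\<^bsub>?B\<^esub> ?q)) A"
  have Ac: "?A \<in> carrier (Fib D ?V)" using h X U A by simp
  \<comment> \<open>Beck-Chevalley for the projection turns the instance at \<open>z\<close> of the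
    existential formula into an existential over \<open>X \<times> U\<close>, which is the stage of
    the witness.\<close>
  have bc: "Sub D z (Ex D (pr2 ?B X Z) A) = Ex D ?q ?A"
    using Beck_Chevalley_projection[OF X z A] h X U by (simp add: prod_arr_def)
  have Fc: "p \<in> carrier (Fib D U)" if "p \<in> F" for p using F that by (auto simp: ultrafilter_def)
  let ?G = "(\<lambda>p. Sub D ?q p \<sqinter>\<^bsub>Fib D ?V\<^esub> ?A) ` F"
  have "\<exists>G. ultrafilter (Fib D ?V) G \<and> ?G \<subseteq> G"
  proof (rule ultrafilter_exists[OF Fib_boolean[OF V], of ?G])
    show "?G \<subseteq> carrier (Fib D ?V)" using Fc Ac X U V by auto
    show "?G \<noteq> {}" using uf_top by blast
    show "\<bottom>\<^bsub>Fib D ?V\<^esub> \<notin> ?G"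
    proof
      assume "\<bottom>\<^bsub>Fib D ?V\<^esub> \<in> ?G"
      then obtain p where p: "p \<in> F" "Sub D ?q p \<sqinter>\<^bsub>Fib D ?V\<^esub> ?A = \<bottom>\<^bsub>Fib D ?V\<^esub>" by auto
      \<comment> \<open>Frobenius pushes a contradiction over \<open>X \<times> U\<close> forward to
        \<open>U\<close>, where it would put bottom into \<open>F\<close>.\<close>
      have "p \<sqinter>\<^bsub>Fib D U\<^esub> Ex D ?q ?A = Ex D ?q \<bottom>\<^bsub>Fib D ?V\<^esub>"
        using Frobenius[of ?q ?V U p ?A] p Fc Ac X U by (simp add: hom_def)
      moreover have "Ex D ?q \<bottom>\<^bsub>Fib D ?V\<^esub> \<sqsubseteq>\<^bsub>Fib D U\<^esub> \<bottom>\<^bsub>Fib D U\<^esub>"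
        using Ex_le_iff[of ?q U ?V "\<bottom>\<^bsub>Fib D ?V\<^esub>" "\<bottom>\<^bsub>Fib D U\<^esub>"] X U V by simp
      moreover have "p \<sqinter>\<^bsub>Fib D U\<^esub> Ex D ?q ?A \<in> F"
        using ex p F Fc unfolding bc ultrafilter_def by simp
      ultimately have "\<bottom>\<^bsub>Fib D U\<^esub> \<in> F" using uf_up U by simp
      then show False using F by (simp add: ultrafilter_def)
    qed
    fix a b assume "a \<in> ?G" "b \<in> ?G"
    then obtain p r where pr: "p \<in> F" "r \<in> F" "a = Sub D ?q p \<sqinter>\<^bsub>Fib D ?V\<^esub> ?A" "b = Sub D ?q r \<sqinter>\<^bsub>Fib D ?V\<^esub> ?A"
      by blast
    have c: "p \<in> carrier (Fib D U)" "r \<in> carrier (Fib D U)" using Fc pr by auto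
    have s: "Sub D ?q p \<in> carrier (Fib D ?V)" "Sub D ?q r \<in> carrier (Fib D ?V)" using c X U by auto
    have "a \<sqinter>\<^bsub>Fib D ?V\<^esub> b = Sub D ?q (p \<sqinter>\<^bsub>Fib D U\<^esub> r) \<sqinter>\<^bsub>Fib D ?V\<^esub> ?A"
    proof (rule V.le_antisym)
      have "Sub D ?q (p \<sqinter>\<^bsub>Fib D U\<^esub> r) = Sub D ?q p \<sqinter>\<^bsub>Fib D ?V\<^esub> Sub D ?q r" using c X U by simp
      moreover have "a \<sqinter>\<^bsub>Fib D ?V\<^esub> b \<sqsubseteq>\<^bsub>Fib D ?V\<^esub> (Sub D ?q p \<sqinter>\<^bsub>Fib D ?V\<^esub> Sub D ?q r) \<sqinter>\<^bsub>Fib D ?V\<^esub> ?A"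
        unfolding pr(3,4) using s Ac
        by (intro V.meet_le V.meet_mono V.meet_left) (auto intro: V.le_trans[OF V.meet_left V.meet_right])
      ultimately show "a \<sqinter>\<^bsub>Fib D ?V\<^esub> b \<sqsubseteq>\<^bsub>Fib D ?V\<^esub> Sub D ?q (p \<sqinter>\<^bsub>Fib D U\<^esub> r) \<sqinter>\<^bsub>Fib D ?V\<^esub> ?A" by simp
      show "Sub D ?q (p \<sqinter>\<^bsub>Fib D U\<^esub> r) \<sqinter>\<^bsub>Fib D ?V\<^esub> ?A \<sqsubseteq>\<^bsub>Fib D ?V\<^esub> a \<sqinter>\<^bsub>Fib D ?V\<^esub> b"
        unfolding \<open>Sub D ?q (p \<sqinter>\<^bsub>Fib D U\<^esub> r) = Sub D ?q p \<sqinter>\<^bsub>Fib D ?V\<^esub> Sub D ?q r\<close> pr(3,4) using s Ac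
        by (intro V.meet_le[of "_ \<sqinter>\<^bsub>Fib D ?V\<^esub> _" "_ \<sqinter>\<^bsub>Fib D ?V\<^esub> _" "_ \<sqinter>\<^bsub>Fib D ?V\<^esub> _"] V.meet_mono V.meet_left V.meet_right) auto
    qed (use s Ac pr c X U in auto)
    moreover have "p \<sqinter>\<^bsub>Fib D U\<^esub> r \<in> F" using pr c F by (simp add: ultrafilter_def)
    ultimately show "a \<sqinter>\<^bsub>Fib D ?V\<^esub> b \<in> ?G" by blast
  qed blast
  then obtain G where G: "ultrafilter (Fib D ?V) G" "?G \<subseteq> G" by blast
  have mem: "Sub D ?q p \<in> G \<and> ?A \<in> G" if "p \<in> F" for p
  proof -
    have "Sub D ?q p \<sqinter>\<^bsub>Fib D ?V\<^esub> ?A \<in> G" using that G by blast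
    then show ?thesis using G(1) Fc[OF that] Ac X U by (simp add: ultrafilter_def)
  qed
  show ?thesis
  proof (rule that[OF G(1)])
    show "?A \<in> G" using mem uf_top by blast
    fix p assume p: "p \<in> carrier (Fib D U)"
    show "Sub D ?q p \<in> G \<longleftrightarrow> p \<in> F"
    proof
      assume g: "Sub D ?q p \<in> G"
      obtain r where r: "r \<in> carrier (Fib D U)" "p \<sqinter>\<^bsub>Fib D U\<^esub> r = \<bottom>\<^bsub>Fib D U\<^esub>" "p \<squnion>\<^bsub>Fib D U\<^esub> r = \<top>\<^bsub>Fib D U\<^esub>"
        using U.complement_exists[OF p] by blast
      show "p \<in> F"
      proof (rule ccontr)
        assume "p \<notin> F"
        \<comment> \<open>One direction holds because the generators are in \<open>G\<close>. For
          the other, if \<open>p\<close> were missing from \<open>F\<close>, its complement would be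
          in \<open>F\<close> and so pull back into \<open>G\<close>.\<close>
        then have "r \<in> F" using F r p uf_top unfolding ultrafilter_def by metis
        then have "Sub D ?q r \<in> G" using mem by blast
        then have "Sub D ?q p \<sqinter>\<^bsub>Fib D ?V\<^esub> Sub D ?q r \<in> G"
          using g G(1) p r X U by (simp add: ultrafilter_def)
        moreover have "Sub D ?q (p \<sqinter>\<^bsub>Fib D U\<^esub> r) = Sub D ?q p \<sqinter>\<^bsub>Fib D ?V\<^esub> Sub D ?q r" using p r(1) X U by simp
        moreover have "Sub D ?q (p \<sqinter>\<^bsub>Fib D U\<^esub> r) = \<bottom>\<^bsub>Fib D ?V\<^esub>" unfolding r(2) using X U by simp
        ultimately show False using G(1) by (simp add: ultrafilter_def)
      qed
    qed (use mem in blast)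
  qed
qed

end

end

section \<open>The Henkin construction\<close>

text \<open>Points of the models are named by these terms;
  the sorts in a tuple make the sorts of its components recoverable.\<close>

datatype ('o, 'a, 'd) henkin_term =
    Generic
  | Apply 'a "('o, 'a, 'd) henkin_term"
  | Tuple 'o 'o "('o, 'a, 'd) henkin_term" "('o, 'a, 'd) henkin_term"
  | Witness 'o 'o 'd "('o, 'a, 'd) henkin_term"

text \<open>A node \<open>(U, F, T, \<rho>)\<close> interprets a set \<open>T\<close> of terms, closed under subterms, by generalized
  elements of stage \<open>U\<close>, truth being decided by the ultrafilter \<open>F\<close>. Terms may fail to denote.\<close>

type_synonym ('o, 'a, 'd) henkin_node =
  "'o \<times> 'd set \<times> ('o, 'a, 'd) henkin_term set \<times> (('o, 'a, 'd) henkin_term \<Rightarrow> 'a option)"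

text \<open>\<open>th X t\<close> is the complete type of \<open>t\<close> at sort \<open>X\<close>:
  it is empty if \<open>t\<close> has no value of that sort, and an ultrafilter otherwise, so
  \<open>\<top>\<close> being in it means that \<open>t\<close> denotes. Equality of
  \<open>s\<close> and \<open>t\<close> is membership of \<open>delta X\<close> in the type of their
  tuple. The axioms say that the denoting terms modulo this equality form a set-valued model in
  which \<open>Witness\<close> acts as a Skolem function.\<close>

locale henkin_theory = boolean_doctrine D
  for D :: "('o, 'a, 'd) doctrine" +
  fixes th :: "'o \<Rightarrow> ('o, 'a, 'd) henkin_term \<Rightarrow> 'd set"
  assumes th_ultrafilter: "\<phi> \<in> th X t \<Longrightarrow> X \<in> Ob (Base D) \<and> ultrafilter (Fib D X) (th X t)"
    and th_Apply: "\<lbrakk>f \<in> hom (Base D) X Y; \<top>\<^bsub>Fib D X\<^esub> \<in> th X t\<rbrakk> \<Longrightarrow>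
      \<phi> \<in> th Y (Apply f t) \<longleftrightarrow> \<phi> \<in> carrier (Fib D Y) \<and> Sub D f \<phi> \<in> th X t"
    and th_Tuple: "\<lbrakk>\<top>\<^bsub>Fib D X\<^esub> \<in> th X s; \<top>\<^bsub>Fib D Y\<^esub> \<in> th Y t\<rbrakk> \<Longrightarrow>
      \<top>\<^bsub>Fib D (prod_ob (Base D) X Y)\<^esub> \<in> th (prod_ob (Base D) X Y) (Tuple X Y s t)"
    and th_TupleD: "\<phi> \<in> th (prod_ob (Base D) X Y) (Tuple X Y s t) \<Longrightarrow>
      \<top>\<^bsub>Fib D X\<^esub> \<in> th X s \<and> \<top>\<^bsub>Fib D Y\<^esub> \<in> th Y t"
    and eqv_refl: "\<top>\<^bsub>Fib D X\<^esub> \<in> th X t \<Longrightarrow> delta X \<in> th (prod_ob (Base D) X X) (Tuple X X t t)"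
    and eqv_sym: "delta X \<in> th (prod_ob (Base D) X X) (Tuple X X s t) \<Longrightarrow>
      delta X \<in> th (prod_ob (Base D) X X) (Tuple X X t s)"
    and eqv_trans: "\<lbrakk>delta X \<in> th (prod_ob (Base D) X X) (Tuple X X s t);
      delta X \<in> th (prod_ob (Base D) X X) (Tuple X X t u)\<rbrakk> \<Longrightarrow>
      delta X \<in> th (prod_ob (Base D) X X) (Tuple X X s u)"
    and eqv_subst: "\<lbrakk>delta X \<in> th (prod_ob (Base D) X X) (Tuple X X s t); \<phi> \<in> th X s\<rbrakk> \<Longrightarrow> \<phi> \<in> th X t"
    and eqv_Apply: "\<lbrakk>delta X \<in> th (prod_ob (Base D) X X) (Tuple X X s t); f \<in> hom (Base D) X Y\<rbrakk> \<Longrightarrow>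
      delta Y \<in> th (prod_ob (Base D) Y Y) (Tuple Y Y (Apply f s) (Apply f t))"
    and eqv_Comp: "\<lbrakk>f \<in> hom (Base D) X Y; g \<in> hom (Base D) Y Z; \<top>\<^bsub>Fib D X\<^esub> \<in> th X t\<rbrakk> \<Longrightarrow>
      delta Z \<in> th (prod_ob (Base D) Z Z) (Tuple Z Z (Apply (g \<cdot>\<^bsub>Base D\<^esub> f) t) (Apply g (Apply f t)))"
    and eqv_ide: "\<top>\<^bsub>Fib D X\<^esub> \<in> th X t \<Longrightarrow>
      delta X \<in> th (prod_ob (Base D) X X) (Tuple X X (Apply (ide (Base D) X) t) t)"
    and eqv_pr1: "\<lbrakk>\<top>\<^bsub>Fib D X\<^esub> \<in> th X s; \<top>\<^bsub>Fib D Y\<^esub> \<in> th Y t\<rbrakk> \<Longrightarrow>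
      delta X \<in> th (prod_ob (Base D) X X) (Tuple X X (Apply (pr1 (Base D) X Y) (Tuple X Y s t)) s)"
    and eqv_pr2: "\<lbrakk>\<top>\<^bsub>Fib D X\<^esub> \<in> th X s; \<top>\<^bsub>Fib D Y\<^esub> \<in> th Y t\<rbrakk> \<Longrightarrow>
      delta Y \<in> th (prod_ob (Base D) Y Y) (Tuple Y Y (Apply (pr2 (Base D) X Y) (Tuple X Y s t)) t)"
    and eqv_prod: "\<lbrakk>X \<in> Ob (Base D); Y \<in> Ob (Base D);
      \<top>\<^bsub>Fib D (prod_ob (Base D) X Y)\<^esub> \<in> th (prod_ob (Base D) X Y) s;
      \<top>\<^bsub>Fib D (prod_ob (Base D) X Y)\<^esub> \<in> th (prod_ob (Base D) X Y) t;
      delta X \<in> th (prod_ob (Base D) X X) (Tuple X X (Apply (pr1 (Base D) X Y) s) (Apply (pr1 (Base D) X Y) t));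
      delta Y \<in> th (prod_ob (Base D) Y Y) (Tuple Y Y (Apply (pr2 (Base D) X Y) s) (Apply (pr2 (Base D) X Y) t))\<rbrakk> \<Longrightarrow>
      delta (prod_ob (Base D) X Y) \<in> th (prod_ob (Base D) (prod_ob (Base D) X Y) (prod_ob (Base D) X Y))
        (Tuple (prod_ob (Base D) X Y) (prod_ob (Base D) X Y) s t)"
    and th_Witness: "\<lbrakk>X \<in> Ob (Base D); A \<in> carrier (Fib D (prod_ob (Base D) X Z));
      Ex D (pr2 (Base D) X Z) A \<in> th Z t\<rbrakk> \<Longrightarrow>
      A \<in> th (prod_ob (Base D) X Z) (Tuple X Z (Witness X Z A t) t)"

section \<open>Nodes: partial interpretations of terms at a stage\<close>

context boolean_doctrine
begin

context
  fixes X0 F0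
  assumes X0: "X0 \<in> Ob (Base D)" and F0: "ultrafilter (Fib D X0) F0"
begin

text \<open>\<open>Apply\<close> and \<open>Tuple\<close> are strict: they have a value exactly if
  their arguments have values of fitting sorts. \<open>Generic\<close> realizes the prescribed
  \<open>F0\<close>. The value of a \<open>Witness\<close> is constrained where the existential
  formula is true of its argument, and is otherwise left open.\<close>

definition node_clause ::
    "'o \<Rightarrow> 'd set \<Rightarrow> ('o, 'a, 'd) henkin_term set \<Rightarrow> (('o, 'a, 'd) henkin_term \<Rightarrow> 'a option) \<Rightarrow>
      ('o, 'a, 'd) henkin_term \<Rightarrow> bool" where
  "node_clause U F T \<rho> r \<longleftrightarrow> (\<forall>x. \<rho> r = Some x \<longrightarrow> x \<in> Arr (Base D) \<and> Dom (Base D) x = U) \<and>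
     (case r of
       Generic \<Rightarrow> \<exists>g\<in>hom (Base D) U X0. \<rho> r = Some g \<and>
         (\<forall>\<phi>\<in>carrier (Fib D X0). Sub D g \<phi> \<in> F \<longleftrightarrow> \<phi> \<in> F0)
     | Apply f t \<Rightarrow> t \<in> T \<and> \<rho> r =
         (case \<rho> t of None \<Rightarrow> None
          | Some x \<Rightarrow> if f \<in> Arr (Base D) \<and> Dom (Base D) f = Cod (Base D) x then Some (f \<cdot>\<^bsub>Base D\<^esub> x) else None)
     | Tuple X Y s t \<Rightarrow> s \<in> T \<and> t \<in> T \<and> \<rho> r =
         (case \<rho> s of None \<Rightarrow> None | Some x \<Rightarrow> (case \<rho> t of None \<Rightarrow> None
          | Some y \<Rightarrow> if Cod (Base D) x = X \<and> Cod (Base D) y = Y then Some (pair (Base D) x y) else None))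
     | Witness X Z A t \<Rightarrow> t \<in> T \<and>
         (\<forall>z. \<rho> t = Some z \<and> Cod (Base D) z = Z \<and> X \<in> Ob (Base D) \<and>
            A \<in> carrier (Fib D (prod_ob (Base D) X Z)) \<and> Sub D z (Ex D (pr2 (Base D) X Z) A) \<in> F \<longrightarrow>
            (\<exists>x\<in>hom (Base D) U X. \<rho> r = Some x \<and> Sub D (pair (Base D) x z) A \<in> F)))"

definition node :: "('o, 'a, 'd) henkin_node \<Rightarrow> bool" where
  "node = (\<lambda>(U, F, T, \<rho>). U \<in> Ob (Base D) \<and> ultrafilter (Fib D U) F \<and>
     Generic \<in> T \<and> (\<forall>t\<in>T. node_clause U F T \<rho> t))"

text \<open>This makes room for a witness. Precomposition with \<open>f\<close> changes the value of
  every term but not the truth of any formula at it, because \<open>G\<close> restricts to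
  \<open>F\<close> along \<open>f\<close>.\<close>

lemma node_base_change:
  assumes n: "node (U, F, T, \<rho>)" and f: "f \<in> hom (Base D) V U" and G: "ultrafilter (Fib D V) G"
    and FG: "\<And>p. p \<in> carrier (Fib D U) \<Longrightarrow> Sub D f p \<in> G \<longleftrightarrow> p \<in> F"
  shows "node (V, G, T, \<lambda>t. map_option (\<lambda>x. x \<cdot>\<^bsub>Base D\<^esub> f) (\<rho> t))" (is "node (V, G, T, ?\<rho>)")
proof -
  have ff: "f \<in> Arr (Base D)" "Dom (Base D) f = V" "Cod (Base D) f = U" using f by (auto simp: hom_def)
  have FG': "Sub D (x \<cdot>\<^bsub>Base D\<^esub> f) \<phi> \<in> G \<longleftrightarrow> Sub D x \<phi> \<in> F"
    if "x \<in> Arr (Base D)" "Dom (Base D) x = U" "\<phi> \<in> carrier (Fib D (Cod (Base D) x))" for x \<phi>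
    using FG[of "Sub D x \<phi>"] that ff by simp
  have "node_clause V G T ?\<rho> r" if r: "r \<in> T" for r
  proof -
    have c: "node_clause U F T \<rho> s" if "s \<in> T" for s using n that by (simp add: node_def)
    have arr: "x \<in> Arr (Base D) \<and> Dom (Base D) x = U" if "\<rho> s = Some x" "s \<in> T" for s x
      using c[OF that(2)] that(1) by (simp add: node_clause_def)
    have a: "\<forall>x. ?\<rho> r = Some x \<longrightarrow> x \<in> Arr (Base D) \<and> Dom (Base D) x = V"
      using arr r ff by auto
    show ?thesis
    proof (cases r)
      case Generic
      with c[OF r] obtain g where g: "g \<in> hom (Base D) U X0" "\<rho> r = Some g"
        "\<forall>\<phi>\<in>carrier (Fib D X0). Sub D g \<phi> \<in> F \<longleftrightarrow> \<phi> \<in> F0" by (auto simp: node_clause_def)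
      have "g \<cdot>\<^bsub>Base D\<^esub> f \<in> hom (Base D) V X0" using g ff by (simp add: hom_def)
      moreover have "\<forall>\<phi>\<in>carrier (Fib D X0). Sub D (g \<cdot>\<^bsub>Base D\<^esub> f) \<phi> \<in> G \<longleftrightarrow> \<phi> \<in> F0"
        using g FG'[of g] by (auto simp: hom_def)
      ultimately show ?thesis using a g unfolding node_clause_def by (simp add: Generic)
    next
      case (Apply h t)
      with c[OF r] have t: "t \<in> T" and e: "\<rho> r = (case \<rho> t of None \<Rightarrow> None
          | Some x \<Rightarrow> if h \<in> Arr (Base D) \<and> Dom (Base D) h = Cod (Base D) x then Some (h \<cdot>\<^bsub>Base D\<^esub> x) else None)"
        by (auto simp: node_clause_def)
      have "?\<rho> r = (case ?\<rho> t of None \<Rightarrow> None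
          | Some x \<Rightarrow> if h \<in> Arr (Base D) \<and> Dom (Base D) h = Cod (Base D) x then Some (h \<cdot>\<^bsub>Base D\<^esub> x) else None)"
        using arr[OF _ t] ff unfolding e by (cases "\<rho> t") auto
      then show ?thesis using a t unfolding node_clause_def by (simp add: Apply)
    next
      case (Tuple X Y s t)
      with c[OF r] have st: "s \<in> T" "t \<in> T" and e: "\<rho> r =
         (case \<rho> s of None \<Rightarrow> None | Some x \<Rightarrow> (case \<rho> t of None \<Rightarrow> None
          | Some y \<Rightarrow> if Cod (Base D) x = X \<and> Cod (Base D) y = Y then Some (pair (Base D) x y) else None))"
        by (auto simp: node_clause_def)
      have "?\<rho> r = (case ?\<rho> s of None \<Rightarrow> None | Some x \<Rightarrow> (case ?\<rho> t of None \<Rightarrow> None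
          | Some y \<Rightarrow> if Cod (Base D) x = X \<and> Cod (Base D) y = Y then Some (pair (Base D) x y) else None))"
        using arr[OF _ st(1)] arr[OF _ st(2)] ff unfolding e by (cases "\<rho> s"; cases "\<rho> t") auto
      then show ?thesis using a st unfolding node_clause_def by (simp add: Tuple)
    next
      case (Witness X Z A t)
      with c[OF r] have t: "t \<in> T" and e: "\<And>z. \<lbrakk>\<rho> t = Some z; Cod (Base D) z = Z; X \<in> Ob (Base D);
            A \<in> carrier (Fib D (prod_ob (Base D) X Z)); Sub D z (Ex D (pr2 (Base D) X Z) A) \<in> F\<rbrakk> \<Longrightarrow>
            \<exists>x\<in>hom (Base D) U X. \<rho> r = Some x \<and> Sub D (pair (Base D) x z) A \<in> F"
        by (auto simp: node_clause_def)
      have "\<exists>x\<in>hom (Base D) V X. ?\<rho> r = Some x \<and> Sub D (pair (Base D) x y) A \<in> G"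
        if y: "?\<rho> t = Some y" "Cod (Base D) y = Z" and X: "X \<in> Ob (Base D)"
          and A: "A \<in> carrier (Fib D (prod_ob (Base D) X Z))"
          and g: "Sub D y (Ex D (pr2 (Base D) X Z) A) \<in> G" for y
      proof -
        obtain z where z: "\<rho> t = Some z" "y = z \<cdot>\<^bsub>Base D\<^esub> f" using y by auto
        have zz: "z \<in> Arr (Base D)" "Dom (Base D) z = U" using arr z t by auto
        have cz: "Cod (Base D) z = Z" using y(2) z zz ff by simp
        have Z: "Z \<in> Ob (Base D)" using zz cz by auto
        have "Sub D z (Ex D (pr2 (Base D) X Z) A) \<in> F"
          using g FG'[of z "Ex D (pr2 (Base D) X Z) A"] zz cz X Z A unfolding z(2) by simp
        from e[OF z(1) cz X A this] obtain x where x: "x \<in> hom (Base D) U X" "\<rho> r = Some x"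
          "Sub D (pair (Base D) x z) A \<in> F" by blast
        have "Sub D (pair (Base D) (x \<cdot>\<^bsub>Base D\<^esub> f) y) A \<in> G"
          using x FG'[of "pair (Base D) x z" A] zz cz A ff unfolding z(2) by (simp add: hom_def)
        moreover have "x \<cdot>\<^bsub>Base D\<^esub> f \<in> hom (Base D) V X" using x ff by (simp add: hom_def)
        ultimately show ?thesis using x by auto
      qed
      then show ?thesis using a t unfolding node_clause_def by (simp add: Witness)
    qed
  qed
  then show ?thesis using n G ff unfolding node_def by auto
qed

lemma node_clause_cong:
  assumes "node_clause U F T \<rho> r" "r \<in> T'" "T \<subseteq> T'" "\<And>t. t \<in> insert r T \<Longrightarrow> \<rho>' t = \<rho> t"
  shows "node_clause U F T' \<rho>' r"
  using assms unfolding node_clause_def by (cases r) (auto split: option.splits)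

text \<open>The clause of a term in \<open>T\<close> mentions that term and its immediate subterms,
  which are again in \<open>T\<close>. A value for a new term therefore disturbs nothing.\<close>

lemma node_insert:
  assumes n: "node (U, F, T, \<rho>)" and r: "r \<notin> T"
    and c: "node_clause U F (insert r T) (\<rho>(r := v)) r"
  shows "node (U, F, insert r T, \<rho>(r := v))"
proof -
  have "node_clause U F (insert r T) (\<rho>(r := v)) t" if t: "t \<in> T" for t
    by (rule node_clause_cong[where T=T and \<rho>=\<rho>]) (use n r t in \<open>auto simp: node_def\<close>)
  with c n show ?thesis by (simp add: node_def)
qed

text \<open>Induction on the term, the subterms being interpreted first. The stage changes in one
  case only: at a witness whose existential formula is true.\<close>

lemma node_extend:
  "node (U, F, T, \<rho>) \<Longrightarrow> \<exists>U' F' T' \<rho>'. node (U', F', T', \<rho>') \<and> insert r T \<subseteq> T'"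
proof (induction r arbitrary: U F T \<rho>)
  case Generic
  then have "insert Generic T \<subseteq> T" by (simp add: node_def)
  with Generic show ?case by blast
next
  case (Apply f t)
  from Apply.IH[OF Apply.prems] obtain U F T' \<rho> where n: "node (U, F, T', \<rho>)" and T: "insert t T \<subseteq> T'" by (elim exE conjE)
  show ?case
  proof (cases "Apply f t \<in> T'")
    case True then show ?thesis using n T by blast
  next
    case False
    have "\<exists>v. node (U, F, insert (Apply f t) T', \<rho>(Apply f t := v))"
    proof (rule exI, rule node_insert[OF n False])
      have "node_clause U F T' \<rho> t" using n T by (simp add: node_def)
      then show "node_clause U F (insert (Apply f t) T') (\<rho>(Apply f t := (case \<rho> t of None \<Rightarrow> None
          | Some x \<Rightarrow> if f \<in> Arr (Base D) \<and> Dom (Base D) f = Cod (Base D) x then Some (f \<cdot>\<^bsub>Base D\<^esub> x) else None))) (Apply f t)"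
        using T False unfolding node_clause_def by (auto split: option.splits if_splits)
    qed
    then show ?thesis using T by blast
  qed
next
  case (Tuple X Y s t)
  from Tuple.IH(1)[OF Tuple.prems] obtain U F T1 \<rho> where n: "node (U, F, T1, \<rho>)" and T1: "insert s T \<subseteq> T1"
    by (elim exE conjE)
  from Tuple.IH(2)[OF n] obtain U F T' \<rho> where n: "node (U, F, T', \<rho>)" and T: "insert t T1 \<subseteq> T'"
    by (elim exE conjE)
  show ?case
  proof (cases "Tuple X Y s t \<in> T'")
    case True then show ?thesis using n T T1 by blast
  next
    case False
    have "\<exists>v. node (U, F, insert (Tuple X Y s t) T', \<rho>(Tuple X Y s t := v))"
    proof (rule exI, rule node_insert[OF n False])
      have "node_clause U F T' \<rho> s" "node_clause U F T' \<rho> t" using n T T1 by (auto simp: node_def)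
      then show "node_clause U F (insert (Tuple X Y s t) T') (\<rho>(Tuple X Y s t :=
         (case \<rho> s of None \<Rightarrow> None | Some x \<Rightarrow> (case \<rho> t of None \<Rightarrow> None
          | Some y \<Rightarrow> if Cod (Base D) x = X \<and> Cod (Base D) y = Y then Some (pair (Base D) x y) else None)))) (Tuple X Y s t)"
        using T T1 False unfolding node_clause_def by (auto split: option.splits if_splits)
    qed
    then show ?thesis using T T1 by blast
  qed
next
  case (Witness X Z A t)
  from Witness.IH[OF Witness.prems] obtain U F T' \<rho> where n: "node (U, F, T', \<rho>)" and T: "insert t T \<subseteq> T'" by (elim exE conjE)
  let ?r = "Witness X Z A t"
  show ?case
  proof (cases "?r \<in> T'")
    case True then show ?thesis using n T by blast
  next
    case False
    have UF: "U \<in> Ob (Base D)" "ultrafilter (Fib D U) F" and tc: "node_clause U F T' \<rho> t"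
      using n T by (auto simp: node_def)
    show ?thesis
    proof (cases "\<exists>z. \<rho> t = Some z \<and> Cod (Base D) z = Z \<and> X \<in> Ob (Base D) \<and>
            A \<in> carrier (Fib D (prod_ob (Base D) X Z)) \<and> Sub D z (Ex D (pr2 (Base D) X Z) A) \<in> F")
      \<comment> \<open>The clause demands nothing here, so the witness term gets no value.\<close>
      case no: False
      have "node (U, F, insert ?r T', \<rho>(?r := None))"
      proof (rule node_insert[OF n False])
        show "node_clause U F (insert ?r T') (\<rho>(?r := None)) ?r"
          using T False no unfolding node_clause_def by auto
      qed
      then show ?thesis using T by blast
    next
      case True
      then obtain z where z: "\<rho> t = Some z" "Cod (Base D) z = Z" and X: "X \<in> Ob (Base D)"
        and A: "A \<in> carrier (Fib D (prod_ob (Base D) X Z))"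
        and ex: "Sub D z (Ex D (pr2 (Base D) X Z) A) \<in> F" by blast
      have zz: "z \<in> hom (Base D) U Z" using z tc by (simp add: node_clause_def hom_def)
      \<comment> \<open>The new stage is \<open>X \<times> U\<close>. Old values are pulled back
        along the second projection, and the first projection is the value of the witness term;
        \<open>uf_witness\<close> provides an ultrafilter under which it satisfies
        \<open>A\<close>.\<close>
      let ?V = "prod_ob (Base D) X U" let ?q = "pr2 (Base D) X U"
      have q: "?q \<in> hom (Base D) ?V U" using X UF by (simp add: hom_def)
      obtain G where G: "ultrafilter (Fib D ?V) G"
        "\<And>p. p \<in> carrier (Fib D U) \<Longrightarrow> Sub D ?q p \<in> G \<longleftrightarrow> p \<in> F"
        "Sub D (pair (Base D) (pr1 (Base D) X U) (z \<cdot>\<^bsub>Base D\<^esub> ?q)) A \<in> G"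
        using uf_witness[OF UF zz X A ex] by metis
      let ?\<rho> = "\<lambda>t. map_option (\<lambda>x. x \<cdot>\<^bsub>Base D\<^esub> ?q) (\<rho> t)"
      have n': "node (?V, G, T', ?\<rho>)" by (rule node_base_change[OF n q G(1,2)])
      have "node (?V, G, insert ?r T', ?\<rho>(?r := Some (pr1 (Base D) X U)))"
      proof (rule node_insert[OF n' False])
        have "pr1 (Base D) X U \<in> hom (Base D) ?V X" using X UF by (simp add: hom_def)
        moreover have "t \<noteq> ?r" using T False by auto
        ultimately show "node_clause ?V G (insert ?r T') (?\<rho>(?r := Some (pr1 (Base D) X U))) ?r"
          using T G(3) z X UF unfolding node_clause_def by auto
      qed
      then show ?thesis using T by blast
    qed
  qed
qed

lemma node_exists:
  assumes "finite S"
  shows "\<exists>U F T \<rho>. node (U, F, T, \<rho>) \<and> S \<subseteq> T"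
  using assms
proof induction
  case empty
  \<comment> \<open>The generic element of stage \<open>X0\<close> is the identity. The constant
    interpretation is a default: values outside \<open>{Generic}\<close> are never
    consulted.\<close>
  have "node (X0, F0, {Generic}, \<lambda>_. Some (ide (Base D) X0))"
    using X0 F0 by (simp add: node_def node_clause_def hom_def)
  then show ?case by blast
next
  case (insert r S)
  then obtain U F T \<rho> where n: "node (U, F, T, \<rho>)" and S: "S \<subseteq> T" by (elim exE conjE)
  from node_extend[OF n, of r] obtain U' F' T' \<rho>' where "node (U', F', T', \<rho>')" "insert r T \<subseteq> T'"
    by (elim exE conjE)
  then show ?case using S by (intro exI conjI) (assumption, simp, blast)
qed

section \<open>Truth at a node and in the ultraproduct\<close>

definition val :: "('o, 'a, 'd) henkin_node \<Rightarrow> 'o \<Rightarrow> ('o, 'a, 'd) henkin_term \<Rightarrow> 'a \<Rightarrow> bool" where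
  "val = (\<lambda>(U, F, T, \<rho>) X t x. t \<in> T \<and> \<rho> t = Some x \<and> x \<in> hom (Base D) U X)"

definition holds :: "('o, 'a, 'd) henkin_node \<Rightarrow> 'o \<Rightarrow> 'd \<Rightarrow> ('o, 'a, 'd) henkin_term \<Rightarrow> bool" where
  "holds = (\<lambda>n X \<phi> t. \<phi> \<in> carrier (Fib D X) \<and> (\<exists>x. val n X t x \<and> Sub D x \<phi> \<in> fst (snd n)))"

text \<open>The theorem of Los taken as a definition: a formula is true of \<open>t\<close> in the
  ultraproduct if it holds at almost all nodes, in the sense of \<open>W\<close>. The elements of
  the ultraproduct are never formed; terms stand for them.\<close>

definition henkin_th ::
    "('o, 'a, 'd) henkin_node set set \<Rightarrow> 'o \<Rightarrow> ('o, 'a, 'd) henkin_term \<Rightarrow> 'd set" where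
  "henkin_th W X t = {\<phi>. {n. node n \<and> holds n X \<phi> t} \<in> W}"

context
  fixes n U F T \<rho>
  assumes n: "node n" and n_eq: "n = (U, F, T, \<rho>)"
begin

lemma node_stage: "U \<in> Ob (Base D)" "ultrafilter (Fib D U) F"
  using n by (auto simp: n_eq node_def)

lemma node_clause_in: "r \<in> T \<Longrightarrow> node_clause U F T \<rho> r"
  using n by (simp add: n_eq node_def)

lemma val_hom: "val n X t x \<Longrightarrow> x \<in> hom (Base D) U X"
  by (simp add: val_def n_eq)

lemma val_in: "val n X t x \<Longrightarrow> t \<in> T"
  by (simp add: val_def n_eq)

lemma val_unique: "\<lbrakk>val n X t x; val n Y t y\<rbrakk> \<Longrightarrow> x = y"
  by (simp add: val_def n_eq)

lemma val_Apply:
  assumes "Apply f t \<in> T" "f \<in> hom (Base D) X Y"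
  shows "val n Y (Apply f t) y \<longleftrightarrow> (\<exists>x. val n X t x \<and> y = f \<cdot>\<^bsub>Base D\<^esub> x)"
proof -
  note c = node_clause_in[OF assms(1)] node_clause_in[of t]
  from c(1) have t: "t \<in> T" and e: "\<rho> (Apply f t) = (case \<rho> t of None \<Rightarrow> None
          | Some x \<Rightarrow> if f \<in> Arr (Base D) \<and> Dom (Base D) f = Cod (Base D) x then Some (f \<cdot>\<^bsub>Base D\<^esub> x) else None)"
    by (auto simp: node_clause_def)
  have a: "x \<in> Arr (Base D) \<and> Dom (Base D) x = U" if "\<rho> t = Some x" for x
    using c(2)[OF t] that by (simp add: node_clause_def)
  show ?thesis using assms t a e
    by (auto simp: val_def n_eq hom_def split: option.splits if_splits)
qed

lemma val_Tuple:
  assumes "Tuple X Y s t \<in> T"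
  shows "val n (prod_ob (Base D) X Y) (Tuple X Y s t) c \<longleftrightarrow>
    (\<exists>x y. val n X s x \<and> val n Y t y \<and> c = pair (Base D) x y)"
proof -
  note c = node_clause_in[OF assms(1)] node_clause_in[of s] node_clause_in[of t]
  from c(1) have st: "s \<in> T" "t \<in> T" and e: "\<rho> (Tuple X Y s t) =
         (case \<rho> s of None \<Rightarrow> None | Some x \<Rightarrow> (case \<rho> t of None \<Rightarrow> None
          | Some y \<Rightarrow> if Cod (Base D) x = X \<and> Cod (Base D) y = Y then Some (pair (Base D) x y) else None))"
    by (auto simp: node_clause_def)
  have a: "\<rho> s = Some x \<Longrightarrow> x \<in> Arr (Base D) \<and> Dom (Base D) x = U"
    "\<rho> t = Some x \<Longrightarrow> x \<in> Arr (Base D) \<and> Dom (Base D) x = U" for x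
    using c(2)[OF st(1)] c(3)[OF st(2)] by (simp_all add: node_clause_def)
  show ?thesis using assms st a e
    by (auto simp: val_def n_eq hom_def split: option.splits if_splits)
qed

lemma holds_iff: "holds n X \<phi> t \<longleftrightarrow> \<phi> \<in> carrier (Fib D X) \<and> (\<exists>x. val n X t x \<and> Sub D x \<phi> \<in> F)"
  by (simp add: holds_def n_eq)

lemma holds_top: "holds n X \<top>\<^bsub>Fib D X\<^esub> t \<longleftrightarrow> (\<exists>x. val n X t x)"
proof -
  have "Sub D x \<top>\<^bsub>Fib D X\<^esub> \<in> F" "X \<in> Ob (Base D)" if "val n X t x" for x
    using val_hom[OF that] node_stage by (auto simp: hom_def ultrafilter_def)
  then show ?thesis by (auto simp: holds_iff)
qed

lemma holds_eqv:
  assumes "Tuple X X s t \<in> T"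
  shows "holds n (prod_ob (Base D) X X) (delta X) (Tuple X X s t) \<longleftrightarrow>
    (\<exists>x y. val n X s x \<and> val n X t y \<and> Sub D (pair (Base D) x y) (delta X) \<in> F)"
proof -
  have "X \<in> Ob (Base D)" if "val n X t x" for x using val_hom[OF that] by (auto simp: hom_def)
  then show ?thesis unfolding holds_iff val_Tuple[OF assms] by auto
qed

lemma holds_in: "holds n X \<phi> t \<Longrightarrow> t \<in> T"
  by (auto simp: holds_iff val_in)

lemma Tuple_in: "Tuple X Y s t \<in> T \<Longrightarrow> s \<in> T \<and> t \<in> T"
  using node_clause_in[of "Tuple X Y s t"] by (simp add: node_clause_def)

lemma Apply_in: "Apply f t \<in> T \<Longrightarrow> t \<in> T"
  using node_clause_in[of "Apply f t"] by (simp add: node_clause_def)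

end

context
  fixes W
  assumes W: "ultrafilter powerset_lattice W"
    and W_terms: "\<And>r. {n. node n \<and> r \<in> fst (snd (snd n))} \<in> W"
begin

text \<open>Carries an inference with two premises from the nodes to the ultraproduct. By
  \<open>W_terms\<close> almost all nodes interpret the term \<open>s\<close> of the conclusion, so
  the argument at a node may assume \<open>s \<in> T\<close>; truth of the premises at a node need
  not bring a compound term such as a tuple into \<open>T\<close>.\<close>

lemma henkin_th_mono:
  assumes "\<And>n U F T \<rho>. \<lbrakk>node n; n = (U, F, T, \<rho>); s \<in> T; holds n X \<phi> t; holds n X' \<phi>' t'\<rbrakk> \<Longrightarrow> holds n Y \<psi> s"
    and "\<phi> \<in> henkin_th W X t" "\<phi>' \<in> henkin_th W X' t'"
  shows "\<psi> \<in> henkin_th W Y s"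
proof -
  let ?I = "{n. node n \<and> s \<in> fst (snd (snd n))} \<inter> ({n. node n \<and> holds n X \<phi> t} \<inter> {n. node n \<and> holds n X' \<phi>' t'})"
  have "?I \<in> W"
    using W W_terms[of s] assms(2,3) by (simp add: ultrafilter_def powerset_lattice_simps henkin_th_def)
  moreover have "?I \<subseteq> {n. node n \<and> holds n Y \<psi> s}"
    using assms(1) by auto
  ultimately show ?thesis unfolding henkin_th_def
    using ultrafilter_up[OF powerset_lattice_simps(1) W, of ?I] by (simp add: powerset_lattice_simps)
qed

lemma henkin_th_mono1:
  assumes "\<And>n U F T \<rho>. \<lbrakk>node n; n = (U, F, T, \<rho>); s \<in> T; holds n X \<phi> t\<rbrakk> \<Longrightarrow> holds n Y \<psi> s"
    and "\<phi> \<in> henkin_th W X t"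
  shows "\<psi> \<in> henkin_th W Y s"
  by (rule henkin_th_mono[OF _ assms(2,2)]) (rule assms(1))

lemma henkin_th_closed: "\<phi> \<in> henkin_th W X t \<Longrightarrow> X \<in> Ob (Base D) \<and> \<phi> \<in> carrier (Fib D X)"
proof -
  assume "\<phi> \<in> henkin_th W X t"
  then have "{n. node n \<and> holds n X \<phi> t} \<noteq> {}"
    using W unfolding henkin_th_def ultrafilter_def by (auto simp: powerset_lattice_simps simp del: Collect_empty_eq)
  then obtain n where "node n" "holds n X \<phi> t" by auto
  then show ?thesis by (auto simp: holds_def val_def hom_def split: prod.splits)
qed

lemma henkin_th_ultrafilter:
  assumes t: "\<phi> \<in> henkin_th W X t"
  shows "ultrafilter (Fib D X) (henkin_th W X t)"
proof -
  have X: "X \<in> Ob (Base D)" using henkin_th_closed[OF t] by blast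
  show ?thesis unfolding ultrafilter_def
  proof (intro conjI ballI)
    show "henkin_th W X t \<subseteq> carrier (Fib D X)" using henkin_th_closed by blast
    show "\<top>\<^bsub>Fib D X\<^esub> \<in> henkin_th W X t"
    proof (rule henkin_th_mono1[OF _ t])
      fix n U F T \<rho> assume nn: "node n" "n = (U, F, T, \<rho>)" and "holds n X \<phi> t"
      then have "\<exists>x. val n X t x" unfolding holds_iff[OF nn] by blast
      then show "holds n X \<top>\<^bsub>Fib D X\<^esub> t" unfolding holds_top[OF nn] .
    qed
    show "\<bottom>\<^bsub>Fib D X\<^esub> \<notin> henkin_th W X t"
    proof
      assume "\<bottom>\<^bsub>Fib D X\<^esub> \<in> henkin_th W X t"
      then have "{n. node n \<and> holds n X \<bottom>\<^bsub>Fib D X\<^esub> t} \<in> W" by (simp add: henkin_th_def)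
      moreover have "{n. node n \<and> holds n X \<bottom>\<^bsub>Fib D X\<^esub> t} = {}"
        by (auto simp: node_def holds_def val_def hom_def ultrafilter_def split: prod.splits)
      ultimately show False using W by (simp add: ultrafilter_def powerset_lattice_simps)
    qed
    fix \<phi> \<psi> assume c: "\<phi> \<in> carrier (Fib D X)" "\<psi> \<in> carrier (Fib D X)"
    have *: "Sub D x (\<phi> \<sqinter>\<^bsub>Fib D X\<^esub> \<psi>) \<in> F \<longleftrightarrow> Sub D x \<phi> \<in> F \<and> Sub D x \<psi> \<in> F"
      "Sub D x (\<phi> \<squnion>\<^bsub>Fib D X\<^esub> \<psi>) \<in> F \<longleftrightarrow> Sub D x \<phi> \<in> F \<or> Sub D x \<psi> \<in> F"
      if "node n" "n = (U, F, T, \<rho>)" "val n X t x" for n U F T \<rho> x t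
      using val_hom[OF that] node_stage[OF that(1,2)] c by (auto simp: hom_def ultrafilter_def)
    have m: "holds n X (\<phi> \<sqinter>\<^bsub>Fib D X\<^esub> \<psi>) t \<longleftrightarrow> holds n X \<phi> t \<and> holds n X \<psi> t"
      "holds n X (\<phi> \<squnion>\<^bsub>Fib D X\<^esub> \<psi>) t \<longleftrightarrow> holds n X \<phi> t \<or> holds n X \<psi> t"
      if nn: "node n" for n
    proof -
      obtain U F T \<rho> where e: "n = (U, F, T, \<rho>)" by (cases n)
      show "holds n X (\<phi> \<sqinter>\<^bsub>Fib D X\<^esub> \<psi>) t \<longleftrightarrow> holds n X \<phi> t \<and> holds n X \<psi> t"
        \<comment> \<open>Both conjuncts have to be read at the same value of \<open>t\<close>,
          hence \<open>val_unique\<close>.\<close>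
        using c X *(1)[OF nn e] val_unique[OF nn e] Fib_meet(1)[OF X c] unfolding holds_iff[OF nn e] by metis
      show "holds n X (\<phi> \<squnion>\<^bsub>Fib D X\<^esub> \<psi>) t \<longleftrightarrow> holds n X \<phi> t \<or> holds n X \<psi> t"
        using c X *(2)[OF nn e] Fib_meet(4)[OF X c] unfolding holds_iff[OF nn e] by metis
    qed
    show "\<phi> \<sqinter>\<^bsub>Fib D X\<^esub> \<psi> \<in> henkin_th W X t \<longleftrightarrow> \<phi> \<in> henkin_th W X t \<and> \<psi> \<in> henkin_th W X t"
    proof (intro iffI conjI; (elim conjE)?)
      assume a: "\<phi> \<sqinter>\<^bsub>Fib D X\<^esub> \<psi> \<in> henkin_th W X t"
      show "\<phi> \<in> henkin_th W X t" by (rule henkin_th_mono1[OF _ a]) (simp add: m)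
      show "\<psi> \<in> henkin_th W X t" by (rule henkin_th_mono1[OF _ a]) (simp add: m)
    next
      assume "\<phi> \<in> henkin_th W X t" "\<psi> \<in> henkin_th W X t"
      then show "\<phi> \<sqinter>\<^bsub>Fib D X\<^esub> \<psi> \<in> henkin_th W X t"
        by (rule henkin_th_mono[rotated]) (simp add: m)
    qed
    \<comment> \<open>At a single node primeness is that of its own ultrafilter; to pass to almost
      all nodes the primeness of \<open>W\<close> is used as well.\<close>
    have "{n. node n \<and> holds n X (\<phi> \<squnion>\<^bsub>Fib D X\<^esub> \<psi>) t} =
        {n. node n \<and> holds n X \<phi> t} \<union> {n. node n \<and> holds n X \<psi> t}"
      using m(2) by blast
    then show "\<phi> \<squnion>\<^bsub>Fib D X\<^esub> \<psi> \<in> henkin_th W X t \<longleftrightarrow> \<phi> \<in> henkin_th W X t \<or> \<psi> \<in> henkin_th W X t"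
      using W by (simp add: henkin_th_def ultrafilter_def powerset_lattice_simps)
  qed
qed

text \<open>Apart from the ultrafilter axiom, every axiom consists of implications with at most two
  premises about types. Each holds at every node that interprets the term of its conclusion, and
  \<open>henkin_th_mono\<close> lifts it.\<close>

lemma henkin_theory_henkin_th: "henkin_theory D (henkin_th W)"
proof
  fix \<phi> X t assume "\<phi> \<in> henkin_th W X t"
  then show "X \<in> Ob (Base D) \<and> ultrafilter (Fib D X) (henkin_th W X t)"
    using henkin_th_closed henkin_th_ultrafilter by blast
next
  fix f X Y t \<phi> assume f: "f \<in> hom (Base D) X Y" and t: "\<top>\<^bsub>Fib D X\<^esub> \<in> henkin_th W X t"
  have ff: "f \<in> Arr (Base D)" "Dom (Base D) f = X" "Cod (Base D) f = Y" using f by (auto simp: hom_def)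
  have *: "holds n Y \<phi> (Apply f t) \<longleftrightarrow> \<phi> \<in> carrier (Fib D Y) \<and> holds n X (Sub D f \<phi>) t"
    if nn: "node n" "n = (U, F, T, \<rho>)" "Apply f t \<in> T" for n U F T \<rho>
  proof -
    have "Sub D (f \<cdot>\<^bsub>Base D\<^esub> x) \<phi> = Sub D x (Sub D f \<phi>)" if "val n X t x" "\<phi> \<in> carrier (Fib D Y)" for x
      using val_hom[OF nn(1,2) that(1)] that(2) ff by (simp add: hom_def)
    then show ?thesis unfolding holds_iff[OF nn(1,2)] val_Apply[OF nn f] using ff by auto
  qed
  show "\<phi> \<in> henkin_th W Y (Apply f t) \<longleftrightarrow> \<phi> \<in> carrier (Fib D Y) \<and> Sub D f \<phi> \<in> henkin_th W X t"
  proof (intro iffI conjI; (elim conjE)?)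
    assume a: "\<phi> \<in> henkin_th W Y (Apply f t)"
    then show "\<phi> \<in> carrier (Fib D Y)" using henkin_th_closed by blast
    show "Sub D f \<phi> \<in> henkin_th W X t"
    proof (rule henkin_th_mono1[OF _ a])
      fix n U F T \<rho> assume nn: "node n" "n = (U, F, T, \<rho>)" and h: "holds n Y \<phi> (Apply f t)"
      show "holds n X (Sub D f \<phi>) t" using *[OF nn holds_in[OF nn h]] h by simp
    qed
  next
    assume c: "\<phi> \<in> carrier (Fib D Y)" and a: "Sub D f \<phi> \<in> henkin_th W X t"
    show "\<phi> \<in> henkin_th W Y (Apply f t)"
    proof (rule henkin_th_mono1[OF _ a])
      fix n U F T \<rho> assume nn: "node n" "n = (U, F, T, \<rho>)" "Apply f t \<in> T" and h: "holds n X (Sub D f \<phi>) t"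
      show "holds n Y \<phi> (Apply f t)" using *[OF nn] c h by simp
    qed
  qed
next
  fix X s Y t assume "\<top>\<^bsub>Fib D X\<^esub> \<in> henkin_th W X s" "\<top>\<^bsub>Fib D Y\<^esub> \<in> henkin_th W Y t"
  then show "\<top>\<^bsub>Fib D (prod_ob (Base D) X Y)\<^esub> \<in> henkin_th W (prod_ob (Base D) X Y) (Tuple X Y s t)"
  proof (rule henkin_th_mono[rotated])
    fix n U F T \<rho> assume nn: "node n" "n = (U, F, T, \<rho>)" "Tuple X Y s t \<in> T"
      and h: "holds n X \<top>\<^bsub>Fib D X\<^esub> s" "holds n Y \<top>\<^bsub>Fib D Y\<^esub> t"
    from h show "holds n (prod_ob (Base D) X Y) \<top>\<^bsub>Fib D (prod_ob (Base D) X Y)\<^esub> (Tuple X Y s t)"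
      unfolding holds_top[OF nn(1,2)] val_Tuple[OF nn] by blast
  qed
next
  fix \<phi> X Y s t assume a: "\<phi> \<in> henkin_th W (prod_ob (Base D) X Y) (Tuple X Y s t)"
  have *: "(\<exists>x. val n X s x) \<and> (\<exists>y. val n Y t y)"
    if nn: "node n" "n = (U, F, T, \<rho>)" "holds n (prod_ob (Base D) X Y) \<phi> (Tuple X Y s t)" for n U F T \<rho>
    using nn(3) holds_in[OF nn] val_Tuple[OF nn(1,2)] by (auto simp: holds_iff[OF nn(1,2)])
  have "holds n X \<top>\<^bsub>Fib D X\<^esub> s \<and> holds n Y \<top>\<^bsub>Fib D Y\<^esub> t"
    if nn: "node n" "n = (U, F, T, \<rho>)" "holds n (prod_ob (Base D) X Y) \<phi> (Tuple X Y s t)" for n U F T \<rho>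
    unfolding holds_top[OF nn(1,2)] by (rule *[OF nn])
  then show "\<top>\<^bsub>Fib D X\<^esub> \<in> henkin_th W X s \<and> \<top>\<^bsub>Fib D Y\<^esub> \<in> henkin_th W Y t"
    by (intro conjI henkin_th_mono1[OF _ a]) simp_all
next
  fix X t assume "\<top>\<^bsub>Fib D X\<^esub> \<in> henkin_th W X t"
  then show "delta X \<in> henkin_th W (prod_ob (Base D) X X) (Tuple X X t t)"
  proof (rule henkin_th_mono1[rotated])
    fix n U F T \<rho> assume nn: "node n" "n = (U, F, T, \<rho>)" "Tuple X X t t \<in> T" "holds n X \<top>\<^bsub>Fib D X\<^esub> t"
    from nn(4) obtain x where "val n X t x" unfolding holds_top[OF nn(1,2)] by blast
    then show "holds n (prod_ob (Base D) X X) (delta X) (Tuple X X t t)"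
      unfolding holds_eqv[OF nn(1,2,3)]
      using eq_at_refl[OF node_stage[OF nn(1,2)] val_hom[OF nn(1,2)]] by blast
  qed
next
  fix X s t assume a: "delta X \<in> henkin_th W (prod_ob (Base D) X X) (Tuple X X s t)"
  then show "delta X \<in> henkin_th W (prod_ob (Base D) X X) (Tuple X X t s)"
  proof (rule henkin_th_mono1[rotated])
    fix n U F T \<rho> assume nn: "node n" "n = (U, F, T, \<rho>)" "Tuple X X t s \<in> T"
      "holds n (prod_ob (Base D) X X) (delta X) (Tuple X X s t)"
    from nn(4) obtain x y where x: "val n X s x" "val n X t y" "Sub D (pair (Base D) x y) (delta X) \<in> F"
      unfolding holds_eqv[OF nn(1,2) holds_in[OF nn(1,2,4)]] by blast
    then show "holds n (prod_ob (Base D) X X) (delta X) (Tuple X X t s)"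
      using eq_at_sym[OF node_stage[OF nn(1,2)]] val_hom[OF nn(1,2)]
      unfolding holds_eqv[OF nn(1,2,3)] by blast
  qed
  fix \<phi> assume b: "\<phi> \<in> henkin_th W X s"
  show "\<phi> \<in> henkin_th W X t"
    using b a
  proof (rule henkin_th_mono[rotated])
    fix n U F T \<rho> assume nn: "node n" "n = (U, F, T, \<rho>)" "t \<in> T" "holds n X \<phi> s"
      "holds n (prod_ob (Base D) X X) (delta X) (Tuple X X s t)"
    from nn(4) obtain x where x: "val n X s x" "Sub D x \<phi> \<in> F" "\<phi> \<in> carrier (Fib D X)" unfolding holds_iff[OF nn(1,2)] by blast
    from nn(5) obtain y where y: "val n X t y" "Sub D (pair (Base D) x y) (delta X) \<in> F"
      using val_unique[OF nn(1,2) x(1)] unfolding holds_eqv[OF nn(1,2) holds_in[OF nn(1,2,5)]] by blast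
    have "Sub D y \<phi> \<in> F"
      using eq_at_subst[OF node_stage[OF nn(1,2)] _ x(3) x(2)] val_hom[OF nn(1,2)] x y by blast
    then show "holds n X \<phi> t" using y x unfolding holds_iff[OF nn(1,2)] by blast
  qed
next
  fix X s t u assume a: "delta X \<in> henkin_th W (prod_ob (Base D) X X) (Tuple X X s t)"
    "delta X \<in> henkin_th W (prod_ob (Base D) X X) (Tuple X X t u)"
  then show "delta X \<in> henkin_th W (prod_ob (Base D) X X) (Tuple X X s u)"
  proof (rule henkin_th_mono[rotated])
    fix n U F T \<rho> assume nn: "node n" "n = (U, F, T, \<rho>)" "Tuple X X s u \<in> T"
      "holds n (prod_ob (Base D) X X) (delta X) (Tuple X X s t)"
      "holds n (prod_ob (Base D) X X) (delta X) (Tuple X X t u)"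
    from nn(4) obtain x y where x: "val n X s x" "val n X t y" "Sub D (pair (Base D) x y) (delta X) \<in> F"
      unfolding holds_eqv[OF nn(1,2) holds_in[OF nn(1,2,4)]] by blast
    from nn(5) obtain z where y: "val n X u z" "Sub D (pair (Base D) y z) (delta X) \<in> F"
      using val_unique[OF nn(1,2) x(2)] unfolding holds_eqv[OF nn(1,2) holds_in[OF nn(1,2,5)]] by blast
    have "Sub D (pair (Base D) x z) (delta X) \<in> F"
      using eq_at_trans[OF node_stage[OF nn(1,2)]] val_hom[OF nn(1,2)] x y by blast
    then show "holds n (prod_ob (Base D) X X) (delta X) (Tuple X X s u)"
      using x y unfolding holds_eqv[OF nn(1,2,3)] by blast
  qed
next
  fix X s t f Y assume a: "delta X \<in> henkin_th W (prod_ob (Base D) X X) (Tuple X X s t)"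
    and f: "f \<in> hom (Base D) X Y"
  from a show "delta Y \<in> henkin_th W (prod_ob (Base D) Y Y) (Tuple Y Y (Apply f s) (Apply f t))"
  proof (rule henkin_th_mono1[rotated])
    fix n U F T \<rho> assume nn: "node n" "n = (U, F, T, \<rho>)" "Tuple Y Y (Apply f s) (Apply f t) \<in> T"
      "holds n (prod_ob (Base D) X X) (delta X) (Tuple X X s t)"
    from nn(4) obtain x y where x: "val n X s x" "val n X t y" "Sub D (pair (Base D) x y) (delta X) \<in> F"
      unfolding holds_eqv[OF nn(1,2) holds_in[OF nn(1,2,4)]] by blast
    have "Sub D (pair (Base D) (f \<cdot>\<^bsub>Base D\<^esub> x) (f \<cdot>\<^bsub>Base D\<^esub> y)) (delta Y) \<in> F"
      using eq_at_Comp[OF node_stage[OF nn(1,2)] _ f] val_hom[OF nn(1,2)] x by blast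
    then show "holds n (prod_ob (Base D) Y Y) (delta Y) (Tuple Y Y (Apply f s) (Apply f t))"
      using x val_Apply[OF nn(1,2) _ f] Tuple_in[OF nn(1-3)] unfolding holds_eqv[OF nn(1,2,3)] by blast
  qed
next
  fix f X Y g Z t assume f: "f \<in> hom (Base D) X Y" and g: "g \<in> hom (Base D) Y Z"
    and a: "\<top>\<^bsub>Fib D X\<^esub> \<in> henkin_th W X t"
  have gf: "g \<cdot>\<^bsub>Base D\<^esub> f \<in> hom (Base D) X Z" using f g by (simp add: hom_def)
  from a show "delta Z \<in> henkin_th W (prod_ob (Base D) Z Z) (Tuple Z Z (Apply (g \<cdot>\<^bsub>Base D\<^esub> f) t) (Apply g (Apply f t)))"
  proof (rule henkin_th_mono1[rotated])
    fix n U F T \<rho> assume nn: "node n" "n = (U, F, T, \<rho>)"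
      "Tuple Z Z (Apply (g \<cdot>\<^bsub>Base D\<^esub> f) t) (Apply g (Apply f t)) \<in> T" "holds n X \<top>\<^bsub>Fib D X\<^esub> t"
    from nn(4) obtain x where x: "val n X t x" unfolding holds_top[OF nn(1,2)] by blast
    have e: "(g \<cdot>\<^bsub>Base D\<^esub> f) \<cdot>\<^bsub>Base D\<^esub> x = g \<cdot>\<^bsub>Base D\<^esub> f \<cdot>\<^bsub>Base D\<^esub> x"
      using val_hom[OF nn(1,2) x] f g by (simp add: hom_def)
    have T: "Apply (g \<cdot>\<^bsub>Base D\<^esub> f) t \<in> T" "Apply g (Apply f t) \<in> T" "Apply f t \<in> T"
      using Tuple_in[OF nn(1-3)] Apply_in[OF nn(1,2)] by auto
    have "val n Z (Apply (g \<cdot>\<^bsub>Base D\<^esub> f) t) (g \<cdot>\<^bsub>Base D\<^esub> f \<cdot>\<^bsub>Base D\<^esub> x)"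
      "val n Z (Apply g (Apply f t)) (g \<cdot>\<^bsub>Base D\<^esub> f \<cdot>\<^bsub>Base D\<^esub> x)"
      using x e val_Apply[OF nn(1,2) T(1) gf] val_Apply[OF nn(1,2) T(2) g] val_Apply[OF nn(1,2) T(3) f] by auto
    then show "holds n (prod_ob (Base D) Z Z) (delta Z) (Tuple Z Z (Apply (g \<cdot>\<^bsub>Base D\<^esub> f) t) (Apply g (Apply f t)))"
      unfolding holds_eqv[OF nn(1,2,3)]
      using eq_at_refl[OF node_stage[OF nn(1,2)] val_hom[OF nn(1,2)]] by blast
  qed
next
  fix X t assume a: "\<top>\<^bsub>Fib D X\<^esub> \<in> henkin_th W X t"
  then have i: "ide (Base D) X \<in> hom (Base D) X X" using henkin_th_closed by (simp add: hom_def)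
  from a show "delta X \<in> henkin_th W (prod_ob (Base D) X X) (Tuple X X (Apply (ide (Base D) X) t) t)"
  proof (rule henkin_th_mono1[rotated])
    fix n U F T \<rho> assume nn: "node n" "n = (U, F, T, \<rho>)"
      "Tuple X X (Apply (ide (Base D) X) t) t \<in> T" "holds n X \<top>\<^bsub>Fib D X\<^esub> t"
    from nn(4) obtain x where x: "val n X t x" unfolding holds_top[OF nn(1,2)] by blast
    then have "ide (Base D) X \<cdot>\<^bsub>Base D\<^esub> x = x" using val_hom[OF nn(1,2) x] by (simp add: hom_def)
    then have "val n X (Apply (ide (Base D) X) t) x"
      using x val_Apply[OF nn(1,2) _ i] Tuple_in[OF nn(1-3)] by metis
    then show "holds n (prod_ob (Base D) X X) (delta X) (Tuple X X (Apply (ide (Base D) X) t) t)"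
      unfolding holds_eqv[OF nn(1,2,3)]
      using x eq_at_refl[OF node_stage[OF nn(1,2)] val_hom[OF nn(1,2)]] by blast
  qed
next
  fix X s Y t assume a: "\<top>\<^bsub>Fib D X\<^esub> \<in> henkin_th W X s" "\<top>\<^bsub>Fib D Y\<^esub> \<in> henkin_th W Y t"
  then have p: "pr1 (Base D) X Y \<in> hom (Base D) (prod_ob (Base D) X Y) X"
    "pr2 (Base D) X Y \<in> hom (Base D) (prod_ob (Base D) X Y) Y"
    using henkin_th_closed by (simp_all add: hom_def)
  from a show "delta X \<in> henkin_th W (prod_ob (Base D) X X) (Tuple X X (Apply (pr1 (Base D) X Y) (Tuple X Y s t)) s)"
  proof (rule henkin_th_mono[rotated])
    fix n U F T \<rho> assume nn: "node n" "n = (U, F, T, \<rho>)"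
      "Tuple X X (Apply (pr1 (Base D) X Y) (Tuple X Y s t)) s \<in> T"
      "holds n X \<top>\<^bsub>Fib D X\<^esub> s" "holds n Y \<top>\<^bsub>Fib D Y\<^esub> t"
    from nn(4,5) obtain x y where xy: "val n X s x" "val n Y t y" unfolding holds_top[OF nn(1,2)] by blast
    have T: "Apply (pr1 (Base D) X Y) (Tuple X Y s t) \<in> T" "Tuple X Y s t \<in> T"
      using Tuple_in[OF nn(1-3)] Apply_in[OF nn(1,2)] by auto
    have "pr1 (Base D) X Y \<cdot>\<^bsub>Base D\<^esub> pair (Base D) x y = x"
      using val_hom[OF nn(1,2) xy(1)] val_hom[OF nn(1,2) xy(2)] by (simp add: hom_def)
    then have "val n X (Apply (pr1 (Base D) X Y) (Tuple X Y s t)) x"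
      using xy val_Apply[OF nn(1,2) T(1) p(1)] val_Tuple[OF nn(1,2) T(2)] by metis
    then show "holds n (prod_ob (Base D) X X) (delta X) (Tuple X X (Apply (pr1 (Base D) X Y) (Tuple X Y s t)) s)"
      unfolding holds_eqv[OF nn(1,2,3)]
      using xy eq_at_refl[OF node_stage[OF nn(1,2)] val_hom[OF nn(1,2)]] by blast
  qed
  from a show "delta Y \<in> henkin_th W (prod_ob (Base D) Y Y) (Tuple Y Y (Apply (pr2 (Base D) X Y) (Tuple X Y s t)) t)"
  proof (rule henkin_th_mono[rotated])
    fix n U F T \<rho> assume nn: "node n" "n = (U, F, T, \<rho>)"
      "Tuple Y Y (Apply (pr2 (Base D) X Y) (Tuple X Y s t)) t \<in> T"
      "holds n X \<top>\<^bsub>Fib D X\<^esub> s" "holds n Y \<top>\<^bsub>Fib D Y\<^esub> t"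
    from nn(4,5) obtain x y where xy: "val n X s x" "val n Y t y" unfolding holds_top[OF nn(1,2)] by blast
    have T: "Apply (pr2 (Base D) X Y) (Tuple X Y s t) \<in> T" "Tuple X Y s t \<in> T"
      using Tuple_in[OF nn(1-3)] Apply_in[OF nn(1,2)] by auto
    have "pr2 (Base D) X Y \<cdot>\<^bsub>Base D\<^esub> pair (Base D) x y = y"
      using val_hom[OF nn(1,2) xy(1)] val_hom[OF nn(1,2) xy(2)] by (simp add: hom_def)
    then have "val n Y (Apply (pr2 (Base D) X Y) (Tuple X Y s t)) y"
      using xy val_Apply[OF nn(1,2) T(1) p(2)] val_Tuple[OF nn(1,2) T(2)] by metis
    then show "holds n (prod_ob (Base D) Y Y) (delta Y) (Tuple Y Y (Apply (pr2 (Base D) X Y) (Tuple X Y s t)) t)"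
      unfolding holds_eqv[OF nn(1,2,3)]
      using xy eq_at_refl[OF node_stage[OF nn(1,2)] val_hom[OF nn(1,2)]] by blast
  qed
next
  fix X Y s t
  let ?P = "prod_ob (Base D) X Y" let ?p = "pr1 (Base D) X Y" let ?q = "pr2 (Base D) X Y"
  assume O: "X \<in> Ob (Base D)" "Y \<in> Ob (Base D)"
    and "\<top>\<^bsub>Fib D ?P\<^esub> \<in> henkin_th W ?P s" "\<top>\<^bsub>Fib D ?P\<^esub> \<in> henkin_th W ?P t"
    and a: "delta X \<in> henkin_th W (prod_ob (Base D) X X) (Tuple X X (Apply ?p s) (Apply ?p t))"
    "delta Y \<in> henkin_th W (prod_ob (Base D) Y Y) (Tuple Y Y (Apply ?q s) (Apply ?q t))"
  from a show "delta ?P \<in> henkin_th W (prod_ob (Base D) ?P ?P) (Tuple ?P ?P s t)"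
  proof (rule henkin_th_mono[rotated])
    fix n U F T \<rho> assume nn: "node n" "n = (U, F, T, \<rho>)" "Tuple ?P ?P s t \<in> T"
      and h: "holds n (prod_ob (Base D) X X) (delta X) (Tuple X X (Apply ?p s) (Apply ?p t))"
      "holds n (prod_ob (Base D) Y Y) (delta Y) (Tuple Y Y (Apply ?q s) (Apply ?q t))"
    have pq: "?p \<in> hom (Base D) ?P X" "?q \<in> hom (Base D) ?P Y" using O by (simp_all add: hom_def)
    have T1: "Apply ?p s \<in> T \<and> Apply ?p t \<in> T" using Tuple_in[OF nn(1,2) holds_in[OF nn(1,2) h(1)]] .
    have T2: "Apply ?q s \<in> T \<and> Apply ?q t \<in> T" using Tuple_in[OF nn(1,2) holds_in[OF nn(1,2) h(2)]] .
    obtain c d where c: "val n ?P s c" "val n ?P t d" "Sub D (pair (Base D) (?p \<cdot>\<^bsub>Base D\<^esub> c) (?p \<cdot>\<^bsub>Base D\<^esub> d)) (delta X) \<in> F"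
      using h(1) unfolding holds_eqv[OF nn(1,2) holds_in[OF nn(1,2) h(1)]]
        val_Apply[OF nn(1,2) conjunct1[OF T1] pq(1)] val_Apply[OF nn(1,2) conjunct2[OF T1] pq(1)] by blast
    have d: "Sub D (pair (Base D) (?q \<cdot>\<^bsub>Base D\<^esub> c) (?q \<cdot>\<^bsub>Base D\<^esub> d)) (delta Y) \<in> F"
      using h(2) val_unique[OF nn(1,2) c(1)] val_unique[OF nn(1,2) c(2)]
      unfolding holds_eqv[OF nn(1,2) holds_in[OF nn(1,2) h(2)]]
        val_Apply[OF nn(1,2) conjunct1[OF T2] pq(2)] val_Apply[OF nn(1,2) conjunct2[OF T2] pq(2)] by blast
    have cd: "c \<in> hom (Base D) U ?P" "d \<in> hom (Base D) U ?P" using c val_hom[OF nn(1,2)] by auto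
    \<comment> \<open>Surjective pairing: \<open>c\<close> and \<open>d\<close> are the pairs of
      their projections, which \<open>F\<close> identifies componentwise.\<close>
    have "Sub D (pair (Base D) (pair (Base D) (?p \<cdot>\<^bsub>Base D\<^esub> c) (?q \<cdot>\<^bsub>Base D\<^esub> c))
        (pair (Base D) (?p \<cdot>\<^bsub>Base D\<^esub> d) (?q \<cdot>\<^bsub>Base D\<^esub> d))) (delta ?P) \<in> F"
      using eq_at_pair[OF node_stage[OF nn(1,2)], of "?p \<cdot>\<^bsub>Base D\<^esub> c" X "?p \<cdot>\<^bsub>Base D\<^esub> d" "?q \<cdot>\<^bsub>Base D\<^esub> c" Y "?q \<cdot>\<^bsub>Base D\<^esub> d"]
        c(3) d cd O by (simp add: hom_def)
    then have "Sub D (pair (Base D) c d) (delta ?P) \<in> F" using cd O by (simp add: hom_def)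
    then show "holds n (prod_ob (Base D) ?P ?P) (delta ?P) (Tuple ?P ?P s t)"
      using c unfolding holds_eqv[OF nn] by blast
  qed
next
  fix X A Z t assume X: "X \<in> Ob (Base D)" and A: "A \<in> carrier (Fib D (prod_ob (Base D) X Z))"
    and a: "Ex D (pr2 (Base D) X Z) A \<in> henkin_th W Z t"
  from a show "A \<in> henkin_th W (prod_ob (Base D) X Z) (Tuple X Z (Witness X Z A t) t)"
  proof (rule henkin_th_mono1[rotated])
    fix n U F T \<rho> assume nn: "node n" "n = (U, F, T, \<rho>)" "Tuple X Z (Witness X Z A t) t \<in> T"
      and h: "holds n Z (Ex D (pr2 (Base D) X Z) A) t"
    obtain z where z: "val n Z t z" "Sub D z (Ex D (pr2 (Base D) X Z) A) \<in> F"
      using h unfolding holds_iff[OF nn(1,2)] by blast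
    have T: "Witness X Z A t \<in> T" using Tuple_in[OF nn] by simp
    then have "node_clause U F T \<rho> (Witness X Z A t)" by (rule node_clause_in[OF nn(1,2)])
    then obtain x where "x \<in> hom (Base D) U X" "\<rho> (Witness X Z A t) = Some x" "Sub D (pair (Base D) x z) A \<in> F"
      using z X A unfolding node_clause_def by (auto simp: val_def nn(2) hom_def)
    then show "holds n (prod_ob (Base D) X Z) A (Tuple X Z (Witness X Z A t) t)"
      using T z A unfolding holds_iff[OF nn(1,2)] val_Tuple[OF nn] by (auto simp: val_def nn(2))
  qed
qed

end

text \<open>Realizes \<open>F0\<close> as the type of \<open>Generic\<close>. The sets of nodes that
  interpret a given finite set of terms are nonempty by \<open>node_exists\<close> and closed under
  intersection, so some ultrafilter \<open>W\<close> contains all of them; at every node the type of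
  \<open>Generic\<close> is \<open>F0\<close>.\<close>

lemma henkin_theory_exists: "\<exists>th. henkin_theory D th \<and> th X0 Generic = F0"
proof -
  let ?G = "{{n. node n \<and> S \<subseteq> fst (snd (snd n))} | S. finite S}"
  have "\<exists>W. ultrafilter powerset_lattice W \<and> ?G \<subseteq> W"
  proof (rule ultrafilter_exists[OF powerset_lattice_simps(1), of ?G])
    show "\<bottom>\<^bsub>powerset_lattice\<^esub> \<notin> ?G"
      using node_exists by (fastforce simp: powerset_lattice_simps)
    fix A B assume "A \<in> ?G" "B \<in> ?G"
    then obtain S T where ST: "finite S" "finite T"
      "A = {n. node n \<and> S \<subseteq> fst (snd (snd n))}" "B = {n. node n \<and> T \<subseteq> fst (snd (snd n))}" by blast
    then have "A \<inter> B = {n. node n \<and> S \<union> T \<subseteq> fst (snd (snd n))}" by blast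
    moreover have "finite (S \<union> T)" using ST by simp
    ultimately show "A \<sqinter>\<^bsub>powerset_lattice\<^esub> B \<in> ?G" unfolding powerset_lattice_simps by blast
  qed (auto simp: powerset_lattice_simps)
  then obtain W where W: "ultrafilter powerset_lattice W" "?G \<subseteq> W" by blast
  have WT: "{n. node n \<and> r \<in> fst (snd (snd n))} \<in> W" for r
  proof -
    have "{n. node n \<and> {r} \<subseteq> fst (snd (snd n))} \<in> ?G" by blast
    then show ?thesis using W(2) by auto
  qed
  have h: "holds n X0 \<phi> Generic \<longleftrightarrow> \<phi> \<in> F0" if "node n" for n \<phi>
  proof -
    obtain U F T \<rho> where n: "n = (U, F, T, \<rho>)" by (cases n)
    have g: "Generic \<in> T" using that by (simp add: n node_def)
    then have "node_clause U F T \<rho> Generic" by (rule node_clause_in[OF that n])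
    then obtain g where "g \<in> hom (Base D) U X0" "\<rho> Generic = Some g"
      "\<forall>\<phi>\<in>carrier (Fib D X0). Sub D g \<phi> \<in> F \<longleftrightarrow> \<phi> \<in> F0" by (auto simp: node_clause_def)
    moreover have "F0 \<subseteq> carrier (Fib D X0)" using F0 by (simp add: ultrafilter_def)
    ultimately show ?thesis using g by (auto simp: n holds_def val_def)
  qed
  have N: "{n. node n} \<in> W"
    using WT[of Generic] by (rule ultrafilter_up[OF powerset_lattice_simps(1) W(1)])
      (auto simp: powerset_lattice_simps)
  have "henkin_th W X0 Generic = F0"
  proof (rule equalityI; rule subsetI)
    fix \<phi> assume "\<phi> \<in> henkin_th W X0 Generic"
    then have "{n. node n \<and> holds n X0 \<phi> Generic} \<noteq> {}"
      using W(1) unfolding henkin_th_def ultrafilter_def by (auto simp: powerset_lattice_simps simp del: Collect_empty_eq)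
    then show "\<phi> \<in> F0" using h by auto
  next
    fix \<phi> assume "\<phi> \<in> F0"
    then have "{n. node n \<and> holds n X0 \<phi> Generic} = {n. node n}" using h by auto
    then show "\<phi> \<in> henkin_th W X0 Generic" using N by (simp add: henkin_th_def)
  qed
  then show ?thesis using henkin_theory_henkin_th[OF W(1) WT] by blast
qed

end

end

section \<open>Set-valued semantics\<close>

text \<open>A point lies in the fibre \<open>fib\<close> of some model, so that \<open>El (X \<times> Y)\<close> is the fibre product of
  \<open>El X\<close> and \<open>El Y\<close>: all models are treated at once.\<close>

locale set_semantics =
  fixes D :: "('o, 'a, 'd) doctrine" and El :: "'o \<Rightarrow> 'p set" and act :: "'a \<Rightarrow> 'p \<Rightarrow> 'p"
    and sem :: "'o \<Rightarrow> 'd \<Rightarrow> 'p set" and fib :: "'p \<Rightarrow> 'm"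
  assumes Base_cartesian_category: "cartesian_category (Base D)"
    and act_El: "\<lbrakk>f \<in> hom (Base D) X Y; a \<in> El X\<rbrakk> \<Longrightarrow> act f a \<in> El Y"
    and fib_act: "\<lbrakk>f \<in> hom (Base D) X Y; a \<in> El X\<rbrakk> \<Longrightarrow> fib (act f a) = fib a"
    and act_ide: "\<lbrakk>X \<in> Ob (Base D); a \<in> El X\<rbrakk> \<Longrightarrow> act (ide (Base D) X) a = a"
    and act_Comp: "\<lbrakk>f \<in> hom (Base D) X Y; g \<in> hom (Base D) Y Z; a \<in> El X\<rbrakk> \<Longrightarrow>
      act (g \<cdot>\<^bsub>Base D\<^esub> f) a = act g (act f a)"
    and tuple_exists: "\<lbrakk>X \<in> Ob (Base D); Y \<in> Ob (Base D); a \<in> El X; b \<in> El Y; fib a = fib b\<rbrakk> \<Longrightarrow>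
      \<exists>c\<in>El (prod_ob (Base D) X Y). act (pr1 (Base D) X Y) c = a \<and> act (pr2 (Base D) X Y) c = b"
    and tuple_unique: "\<lbrakk>X \<in> Ob (Base D); Y \<in> Ob (Base D); c \<in> El (prod_ob (Base D) X Y);
      c' \<in> El (prod_ob (Base D) X Y); act (pr1 (Base D) X Y) c = act (pr1 (Base D) X Y) c';
      act (pr2 (Base D) X Y) c = act (pr2 (Base D) X Y) c'\<rbrakk> \<Longrightarrow> c = c'"
    and sem_subset: "\<lbrakk>X \<in> Ob (Base D); A \<in> carrier (Fib D X)\<rbrakk> \<Longrightarrow> sem X A \<subseteq> El X"
    and sem_le: "\<lbrakk>X \<in> Ob (Base D); A \<in> carrier (Fib D X); B \<in> carrier (Fib D X)\<rbrakk> \<Longrightarrow>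
      A \<sqsubseteq>\<^bsub>Fib D X\<^esub> B \<longleftrightarrow> sem X A \<subseteq> sem X B"
    and sem_inject: "\<lbrakk>X \<in> Ob (Base D); A \<in> carrier (Fib D X); B \<in> carrier (Fib D X); sem X A = sem X B\<rbrakk> \<Longrightarrow>
      A = B"
    and sem_top: "X \<in> Ob (Base D) \<Longrightarrow> \<top>\<^bsub>Fib D X\<^esub> \<in> carrier (Fib D X) \<and> sem X \<top>\<^bsub>Fib D X\<^esub> = El X"
    and sem_meet: "\<lbrakk>X \<in> Ob (Base D); A \<in> carrier (Fib D X); B \<in> carrier (Fib D X)\<rbrakk> \<Longrightarrow>
      A \<sqinter>\<^bsub>Fib D X\<^esub> B \<in> carrier (Fib D X) \<and> sem X (A \<sqinter>\<^bsub>Fib D X\<^esub> B) = sem X A \<inter> sem X B"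
    and sem_Sub: "\<lbrakk>f \<in> hom (Base D) X Y; A \<in> carrier (Fib D Y)\<rbrakk> \<Longrightarrow>
      Sub D f A \<in> carrier (Fib D X) \<and> sem X (Sub D f A) = {a \<in> El X. act f a \<in> sem Y A}"
    and image_exists: "\<lbrakk>f \<in> hom (Base D) X Y; A \<in> carrier (Fib D X)\<rbrakk> \<Longrightarrow>
      \<exists>B\<in>carrier (Fib D Y). sem Y B = act f ` sem X A"

sublocale set_semantics \<subseteq> base: cartesian_category "Base D"
  by (rule Base_cartesian_category)

context set_semantics
begin

lemma act_simps [simp]:
  assumes "f \<in> Arr (Base D)" "a \<in> El (Dom (Base D) f)"
  shows "Cod (Base D) f = Y \<Longrightarrow> act f a \<in> El Y" "fib (act f a) = fib a"
    "\<lbrakk>g \<in> Arr (Base D); Dom (Base D) g = Cod (Base D) f\<rbrakk> \<Longrightarrow> act (g \<cdot>\<^bsub>Base D\<^esub> f) a = act g (act f a)"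
  using act_El[of f "Dom (Base D) f" "Cod (Base D) f"] fib_act[of f "Dom (Base D) f" "Cod (Base D) f"]
    act_Comp[of f "Dom (Base D) f" "Cod (Base D) f" g "Cod (Base D) g"] assms
  by (auto simp: hom_def)

declare act_ide [simp]

text \<open>\<open>image_exists\<close> gives a formula for the direct image. It satisfies the
  adjunction because the order is inclusion of point sets, and values of a left adjoint are
  unique.\<close>

lemma sem_Ex:
  assumes f: "f \<in> hom (Base D) X Y" and A: "A \<in> carrier (Fib D X)"
  shows "Ex D f A \<in> carrier (Fib D Y)" "sem Y (Ex D f A) = act f ` sem X A"
proof -
  have ff: "f \<in> Arr (Base D)" "Dom (Base D) f = X" "Cod (Base D) f = Y" "X \<in> Ob (Base D)" "Y \<in> Ob (Base D)"
    using f by (auto simp: hom_def)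
  obtain B where B: "B \<in> carrier (Fib D Y)" "sem Y B = act f ` sem X A" using image_exists[OF f A] by blast
  have adj: "is_left_adjoint_value D f A B' \<longleftrightarrow> B' = B" for B'
  proof -
    have 1: "A \<sqsubseteq>\<^bsub>Fib D X\<^esub> Sub D f Z \<longleftrightarrow> act f ` sem X A \<subseteq> sem Y Z" if "Z \<in> carrier (Fib D Y)" for Z
      using sem_le[of X A "Sub D f Z"] sem_Sub[OF f that] sem_subset[OF ff(4) A] A ff by auto
    have 2: "is_left_adjoint_value D f A B' \<longleftrightarrow> B' \<in> carrier (Fib D Y) \<and>
       (\<forall>Z\<in>carrier (Fib D Y). sem Y B' \<subseteq> sem Y Z \<longleftrightarrow> act f ` sem X A \<subseteq> sem Y Z)"
      unfolding is_left_adjoint_value_def ff by (simp add: 1 sem_le[OF ff(5)] cong: conj_cong)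
    \<comment> \<open>Taking \<open>B\<close> and \<open>B'\<close> themselves for \<open>Z\<close>
      shows that they have the same points.\<close>
    show ?thesis unfolding 2 using B sem_inject[OF ff(5)] by (metis subset_antisym subset_refl)
  qed
  have "Ex D f A = B" unfolding Ex_def using adj by (intro the_equality) blast+
  then show "Ex D f A \<in> carrier (Fib D Y)" "sem Y (Ex D f A) = act f ` sem X A" using B by auto
qed

section \<open>Tuples of points, and relations as sets of pairs\<close>

definition tuple :: "'o \<Rightarrow> 'o \<Rightarrow> 'p \<Rightarrow> 'p \<Rightarrow> 'p" where
  "tuple X Y a b = (THE c. c \<in> El (prod_ob (Base D) X Y) \<and> act (pr1 (Base D) X Y) c = a \<and>
     act (pr2 (Base D) X Y) c = b)"

lemma tuple_simps [simp]:
  assumes "X \<in> Ob (Base D)" "Y \<in> Ob (Base D)" "a \<in> El X" "b \<in> El Y" "fib a = fib b"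
  shows "tuple X Y a b \<in> El (prod_ob (Base D) X Y)"
    "act (pr1 (Base D) X Y) (tuple X Y a b) = a" "act (pr2 (Base D) X Y) (tuple X Y a b) = b"
    "fib (tuple X Y a b) = fib b"
proof -
  have "\<exists>!c. c \<in> El (prod_ob (Base D) X Y) \<and> act (pr1 (Base D) X Y) c = a \<and> act (pr2 (Base D) X Y) c = b"
  proof -
    obtain c where c: "c \<in> El (prod_ob (Base D) X Y)" "act (pr1 (Base D) X Y) c = a" "act (pr2 (Base D) X Y) c = b"
      using tuple_exists[OF assms] by blast
    show ?thesis
    proof (rule ex1I[of _ c])
      fix c' assume c': "c' \<in> El (prod_ob (Base D) X Y) \<and> act (pr1 (Base D) X Y) c' = a \<and> act (pr2 (Base D) X Y) c' = b"
      show "c' = c" by (rule tuple_unique[OF assms(1,2)]) (use c c' in auto)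
    qed (use c in blast)
  qed
  from theI'[OF this] show *: "tuple X Y a b \<in> El (prod_ob (Base D) X Y)"
    "act (pr1 (Base D) X Y) (tuple X Y a b) = a" "act (pr2 (Base D) X Y) (tuple X Y a b) = b"
    by (auto simp: tuple_def)
  show "fib (tuple X Y a b) = fib b"
    using act_simps(2)[of "pr2 (Base D) X Y" "tuple X Y a b"] * assms by simp
qed

lemma tuple_act [simp]:
  assumes "X \<in> Ob (Base D)" "Y \<in> Ob (Base D)" "c \<in> El (prod_ob (Base D) X Y)"
  shows "tuple X Y (act (pr1 (Base D) X Y) c) (act (pr2 (Base D) X Y) c) = c"
  by (rule tuple_unique[OF assms(1,2)]) (use assms in auto)

lemma act_pair [simp]:
  assumes "f \<in> Arr (Base D)" "g \<in> Arr (Base D)" "Dom (Base D) f = Dom (Base D) g" "a \<in> El (Dom (Base D) g)"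
  shows "act (pair (Base D) f g) a = tuple (Cod (Base D) f) (Cod (Base D) g) (act f a) (act g a)"
proof (rule tuple_unique[where X="Cod (Base D) f" and Y="Cod (Base D) g"])
  have "act (pr1 (Base D) (Cod (Base D) f) (Cod (Base D) g)) (act (pair (Base D) f g) a) =
      act (pr1 (Base D) (Cod (Base D) f) (Cod (Base D) g) \<cdot>\<^bsub>Base D\<^esub> pair (Base D) f g) a"
    by (rule act_simps(3)[symmetric]) (use assms in auto)
  then show "act (pr1 (Base D) (Cod (Base D) f) (Cod (Base D) g)) (act (pair (Base D) f g) a) =
    act (pr1 (Base D) (Cod (Base D) f) (Cod (Base D) g)) (tuple (Cod (Base D) f) (Cod (Base D) g) (act f a) (act g a))"
    using assms by simp
  have "act (pr2 (Base D) (Cod (Base D) f) (Cod (Base D) g)) (act (pair (Base D) f g) a) =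
      act (pr2 (Base D) (Cod (Base D) f) (Cod (Base D) g) \<cdot>\<^bsub>Base D\<^esub> pair (Base D) f g) a"
    by (rule act_simps(3)[symmetric]) (use assms in auto)
  then show "act (pr2 (Base D) (Cod (Base D) f) (Cod (Base D) g)) (act (pair (Base D) f g) a) =
    act (pr2 (Base D) (Cod (Base D) f) (Cod (Base D) g)) (tuple (Cod (Base D) f) (Cod (Base D) g) (act f a) (act g a))"
    using assms by simp
qed (use assms in auto)

text \<open>The reading of a formula over a product as a set of pairs, faithful by
  \<open>rel_ext\<close>. Composition, converse, restriction and image of formulas become
  \<open>O\<close>, \<open>\<inverse>\<close>, intersection and Image, so that the calculus of
  relations is inherited from sets.\<close>

definition rsem :: "('o, 'd) rel \<Rightarrow> ('p \<times> 'p) set" where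
  "rsem = (\<lambda>(X, Y, R).
     (\<lambda>c. (act (pr1 (Base D) X Y) c, act (pr2 (Base D) X Y) c)) ` sem (prod_ob (Base D) X Y) R)"

lemma is_relD: "is_rel D (X, Y, R) \<Longrightarrow> X \<in> Ob (Base D) \<and> Y \<in> Ob (Base D) \<and> R \<in> carrier (Fib D (prod_ob (Base D) X Y))"
  by (simp add: is_rel_def)

lemma rsem_iff:
  assumes "is_rel D (X, Y, R)"
  shows "(a, b) \<in> rsem (X, Y, R) \<longleftrightarrow>
    a \<in> El X \<and> b \<in> El Y \<and> fib a = fib b \<and> tuple X Y a b \<in> sem (prod_ob (Base D) X Y) R"
proof
  have XY: "X \<in> Ob (Base D)" "Y \<in> Ob (Base D)" using is_relD[OF assms] by auto
  have s: "sem (prod_ob (Base D) X Y) R \<subseteq> El (prod_ob (Base D) X Y)"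
    using is_relD[OF assms] by (intro sem_subset) auto
  {
    assume "(a, b) \<in> rsem (X, Y, R)"
    then obtain c where c: "c \<in> sem (prod_ob (Base D) X Y) R" "a = act (pr1 (Base D) X Y) c" "b = act (pr2 (Base D) X Y) c"
      by (auto simp: rsem_def)
    then have "c \<in> El (prod_ob (Base D) X Y)" using s by auto
    then show "a \<in> El X \<and> b \<in> El Y \<and> fib a = fib b \<and> tuple X Y a b \<in> sem (prod_ob (Base D) X Y) R"
      using c XY by simp
  next
    assume *: "a \<in> El X \<and> b \<in> El Y \<and> fib a = fib b \<and> tuple X Y a b \<in> sem (prod_ob (Base D) X Y) R"
    show "(a, b) \<in> rsem (X, Y, R)" unfolding rsem_def
      by (simp, rule image_eqI[where x="tuple X Y a b"]) (use * XY in auto)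
  }
qed

lemma rsem_act:
  assumes "is_rel D (X, Y, R)" "c \<in> El (prod_ob (Base D) X Y)"
  shows "(act (pr1 (Base D) X Y) c, act (pr2 (Base D) X Y) c) \<in> rsem (X, Y, R) \<longleftrightarrow> c \<in> sem (prod_ob (Base D) X Y) R"
  using is_relD[OF assms(1)] assms(2) by (simp add: rsem_iff[OF assms(1)])

lemma rel_ext:
  assumes "is_rel D (X, Y, R)" "is_rel D (X, Y, S)" "rsem (X, Y, R) = rsem (X, Y, S)"
  shows "R = S"
proof (rule sem_inject[of "prod_ob (Base D) X Y"])
  have s: "sem (prod_ob (Base D) X Y) R \<subseteq> El (prod_ob (Base D) X Y)" "sem (prod_ob (Base D) X Y) S \<subseteq> El (prod_ob (Base D) X Y)"
    using is_relD[OF assms(1)] is_relD[OF assms(2)] by (auto intro: sem_subset[THEN subsetD])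
  then show "sem (prod_ob (Base D) X Y) R = sem (prod_ob (Base D) X Y) S"
    using rsem_act[OF assms(1)] rsem_act[OF assms(2)] assms(3) by blast
qed (use is_relD[OF assms(1)] is_relD[OF assms(2)] in auto)

lemma rsem_fib: "\<lbrakk>is_rel D (X, Y, R); (a, b) \<in> rsem (X, Y, R)\<rbrakk> \<Longrightarrow> fib a = fib b"
  by (auto simp: rsem_iff)

lemma rel_graph_sem:
  assumes "f \<in> hom (Base D) X Y"
  shows "rel_graph D f = (X, Y, snd (snd (rel_graph D f)))" "is_rel D (rel_graph D f)"
    "rsem (rel_graph D f) = (\<lambda>a. (a, act f a)) ` El X"
proof -
  have f: "f \<in> Arr (Base D)" "Dom (Base D) f = X" "Cod (Base D) f = Y" "X \<in> Ob (Base D)" "Y \<in> Ob (Base D)"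
    using assms by (auto simp: hom_def)
  let ?p = "pair (Base D) (ide (Base D) X) f"
  have p: "?p \<in> hom (Base D) X (prod_ob (Base D) X Y)" using f by (simp add: hom_def)
  have e: "rel_graph D f = (X, Y, Ex D ?p \<top>\<^bsub>Fib D X\<^esub>)" using f by (simp add: rel_graph_def)
  then show "rel_graph D f = (X, Y, snd (snd (rel_graph D f)))" by simp
  show "is_rel D (rel_graph D f)" using f sem_Ex(1)[OF p] sem_top[OF f(4)] by (simp add: e is_rel_def)
  have "(act (pr1 (Base D) X Y) (act ?p a), act (pr2 (Base D) X Y) (act ?p a)) = (a, act f a)" if "a \<in> El X" for a
    using that f by simp
  then show "rsem (rel_graph D f) = (\<lambda>a. (a, act f a)) ` El X"
    using sem_Ex(2)[OF p] sem_top[OF f(4)] by (simp add: e rsem_def image_image)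
qed

lemma rel_id_sem:
  assumes "X \<in> Ob (Base D)"
  shows "rel_id D X = (X, X, snd (snd (rel_id D X)))" "is_rel D (rel_id D X)"
    "rsem (rel_id D X) = Id_on (El X)"
proof -
  have e: "rel_id D X = rel_graph D (ide (Base D) X)"
    using assms by (simp add: rel_id_def rel_graph_def diag_def)
  have i: "ide (Base D) X \<in> hom (Base D) X X" using assms by (simp add: hom_def)
  show "rel_id D X = (X, X, snd (snd (rel_id D X)))" "is_rel D (rel_id D X)"
    "rsem (rel_id D X) = Id_on (El X)"
    unfolding e using rel_graph_sem[OF i] assms by auto
qed

lemma rel_conv_sem:
  assumes "is_rel D (X, Y, R)"
  shows "rel_conv D (X, Y, R) = (Y, X, snd (snd (rel_conv D (X, Y, R))))" "is_rel D (rel_conv D (X, Y, R))"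
    "rsem (rel_conv D (X, Y, R)) = (rsem (X, Y, R))\<inverse>"
proof -
  have XY: "X \<in> Ob (Base D)" "Y \<in> Ob (Base D)" and R: "R \<in> carrier (Fib D (prod_ob (Base D) X Y))"
    using is_relD assms by auto
  let ?p = "pair (Base D) (pr2 (Base D) Y X) (pr1 (Base D) Y X)"
  have p: "?p \<in> hom (Base D) (prod_ob (Base D) Y X) (prod_ob (Base D) X Y)" using XY by (simp add: hom_def)
  have e: "rel_conv D (X, Y, R) = (Y, X, Sub D ?p R)" by (simp add: rel_conv_def)
  then show "rel_conv D (X, Y, R) = (Y, X, snd (snd (rel_conv D (X, Y, R))))" by simp
  show i: "is_rel D (rel_conv D (X, Y, R))" using XY R sem_Sub[OF p] by (simp add: e is_rel_def)
  show "rsem (rel_conv D (X, Y, R)) = (rsem (X, Y, R))\<inverse>"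
  proof (rule Set.set_eqI)
    fix x :: "'p \<times> 'p" obtain b a where x: "x = (b, a)" by (cases x)
    show "x \<in> rsem (rel_conv D (X, Y, R)) \<longleftrightarrow> x \<in> (rsem (X, Y, R))\<inverse>"
    proof (cases "a \<in> El X \<and> b \<in> El Y \<and> fib b = fib a")
      case True
      then show ?thesis
        using XY sem_Sub[OF p R] unfolding x e converse_iff rsem_iff[OF i[unfolded e]] rsem_iff[OF assms] by simp
    next
      case False
      then show ?thesis unfolding x e converse_iff rsem_iff[OF i[unfolded e]] rsem_iff[OF assms] by auto
    qed
  qed
qed

lemma rel_restrict_sem:
  assumes "is_rel D (X, Y, R)" "A \<in> carrier (Fib D X)"
  shows "rel_restrict D (X, Y, R) A = (X, Y, snd (snd (rel_restrict D (X, Y, R) A)))"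
    "is_rel D (rel_restrict D (X, Y, R) A)"
    "rsem (rel_restrict D (X, Y, R) A) = rsem (X, Y, R) \<inter> sem X A \<times> UNIV"
proof -
  have XY: "X \<in> Ob (Base D)" "Y \<in> Ob (Base D)" and R: "R \<in> carrier (Fib D (prod_ob (Base D) X Y))"
    using is_relD assms by auto
  have p: "pr1 (Base D) X Y \<in> hom (Base D) (prod_ob (Base D) X Y) X" using XY by (simp add: hom_def)
  have P: "prod_ob (Base D) X Y \<in> Ob (Base D)" using XY by simp
  note s = sem_Sub[OF p assms(2)] sem_meet[OF P _ R]
  have e: "rel_restrict D (X, Y, R) A = (X, Y, Sub D (pr1 (Base D) X Y) A \<sqinter>\<^bsub>Fib D (prod_ob (Base D) X Y)\<^esub> R)"
    by (simp add: rel_restrict_def)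
  then show "rel_restrict D (X, Y, R) A = (X, Y, snd (snd (rel_restrict D (X, Y, R) A)))" by simp
  show i: "is_rel D (rel_restrict D (X, Y, R) A)" using XY s by (simp add: e is_rel_def)
  show "rsem (rel_restrict D (X, Y, R) A) = rsem (X, Y, R) \<inter> sem X A \<times> UNIV"
  proof (rule Set.set_eqI)
    fix x :: "'p \<times> 'p" obtain a b where x: "x = (a, b)" by (cases x)
    show "x \<in> rsem (rel_restrict D (X, Y, R) A) \<longleftrightarrow> x \<in> rsem (X, Y, R) \<inter> sem X A \<times> UNIV"
    proof (cases "a \<in> El X \<and> b \<in> El Y \<and> fib a = fib b")
      case True
      then show ?thesis
        using XY s unfolding x e Int_iff mem_Times_iff rsem_iff[OF i[unfolded e]] rsem_iff[OF assms(1)] by auto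
    next
      case False
      then show ?thesis unfolding x e Int_iff rsem_iff[OF i[unfolded e]] rsem_iff[OF assms(1)] by auto
    qed
  qed
qed

lemma rel_prod_sem:
  assumes "is_rel D (X, X', R)" "is_rel D (Y, Y', S)"
  shows "rel_prod D (X, X', R) (Y, Y', S) = (prod_ob (Base D) X Y, prod_ob (Base D) X' Y',
      snd (snd (rel_prod D (X, X', R) (Y, Y', S))))"
    "is_rel D (rel_prod D (X, X', R) (Y, Y', S))"
    "(c, c') \<in> rsem (rel_prod D (X, X', R) (Y, Y', S)) \<longleftrightarrow>
      c \<in> El (prod_ob (Base D) X Y) \<and> c' \<in> El (prod_ob (Base D) X' Y') \<and> fib c = fib c' \<and>
      (act (pr1 (Base D) X Y) c, act (pr1 (Base D) X' Y') c') \<in> rsem (X, X', R) \<and>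
      (act (pr2 (Base D) X Y) c, act (pr2 (Base D) X' Y') c') \<in> rsem (Y, Y', S)"
proof -
  let ?B = "Base D"
  have O: "X \<in> Ob ?B" "Y \<in> Ob ?B" "X' \<in> Ob ?B" "Y' \<in> Ob ?B" and R: "R \<in> carrier (Fib D (prod_ob ?B X X'))"
    and S: "S \<in> carrier (Fib D (prod_ob ?B Y Y'))" using is_relD assms by auto
  let ?P = "prod_ob ?B X Y" let ?P' = "prod_ob ?B X' Y'"
  let ?f = "prod_arr ?B (pr1 ?B X Y) (pr1 ?B X' Y')" let ?g = "prod_arr ?B (pr2 ?B X Y) (pr2 ?B X' Y')"
  have fg: "?f \<in> hom ?B (prod_ob ?B ?P ?P') (prod_ob ?B X X')" "?g \<in> hom ?B (prod_ob ?B ?P ?P') (prod_ob ?B Y Y')"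
    using O by (simp_all add: hom_def prod_arr_def)
  have P: "prod_ob ?B ?P ?P' \<in> Ob ?B" using O by simp
  note s = sem_Sub[OF fg(1) R] sem_Sub[OF fg(2) S] sem_meet[OF P]
  have e: "rel_prod D (X, X', R) (Y, Y', S) = (?P, ?P', Sub D ?f R \<sqinter>\<^bsub>Fib D (prod_ob ?B ?P ?P')\<^esub> Sub D ?g S)"
    by (simp add: rel_prod_def Let_def)
  then show "rel_prod D (X, X', R) (Y, Y', S) = (?P, ?P', snd (snd (rel_prod D (X, X', R) (Y, Y', S))))" by simp
  show i: "is_rel D (rel_prod D (X, X', R) (Y, Y', S))" using O s by (simp add: e is_rel_def)
  show "(c, c') \<in> rsem (rel_prod D (X, X', R) (Y, Y', S)) \<longleftrightarrow>
      c \<in> El ?P \<and> c' \<in> El ?P' \<and> fib c = fib c' \<and> (act (pr1 ?B X Y) c, act (pr1 ?B X' Y') c') \<in> rsem (X, X', R) \<and>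
      (act (pr2 ?B X Y) c, act (pr2 ?B X' Y') c') \<in> rsem (Y, Y', S)"
  proof (cases "c \<in> El ?P \<and> c' \<in> El ?P' \<and> fib c = fib c'")
    case True
    then show ?thesis using i O s unfolding e rsem_iff[OF i[unfolded e]] rsem_iff[OF assms(1)] rsem_iff[OF assms(2)]
      by (simp add: prod_arr_def)
  qed (use rsem_iff[OF i[unfolded e]] in \<open>auto simp: e\<close>)
qed

lemma rel_comp_sem:
  assumes "is_rel D (X, Y, R)" "is_rel D (Y, Z, S)"
  shows "rel_comp D (Y, Z, S) (X, Y, R) = (X, Z, snd (snd (rel_comp D (Y, Z, S) (X, Y, R))))"
    "is_rel D (rel_comp D (Y, Z, S) (X, Y, R))"
    "rsem (rel_comp D (Y, Z, S) (X, Y, R)) = rsem (X, Y, R) O rsem (Y, Z, S)"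
proof -
  let ?B = "Base D"
  have O: "X \<in> Ob ?B" "Y \<in> Ob ?B" "Z \<in> Ob ?B" and R: "R \<in> carrier (Fib D (prod_ob ?B X Y))"
    and S: "S \<in> carrier (Fib D (prod_ob ?B Y Z))" using is_relD assms by auto
  let ?XZ = "prod_ob ?B X Z" let ?P = "prod_ob ?B Y ?XZ" let ?y = "pr1 ?B Y ?XZ" let ?q = "pr2 ?B Y ?XZ"
  let ?f = "pair ?B (pr1 ?B X Z \<cdot>\<^bsub>?B\<^esub> ?q) ?y" let ?g = "pair ?B ?y (pr2 ?B X Z \<cdot>\<^bsub>?B\<^esub> ?q)"
  have fg: "?f \<in> hom ?B ?P (prod_ob ?B X Y)" "?g \<in> hom ?B ?P (prod_ob ?B Y Z)" "?q \<in> hom ?B ?P ?XZ"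
    using O by (simp_all add: hom_def)
  have P: "?P \<in> Ob ?B" using O by simp
  note s = sem_Sub[OF fg(1) R] sem_Sub[OF fg(2) S] sem_meet[OF P] sem_Ex[OF fg(3)]
  let ?M = "Sub D ?f R \<sqinter>\<^bsub>Fib D ?P\<^esub> Sub D ?g S"
  have e: "rel_comp D (Y, Z, S) (X, Y, R) = (X, Z, Ex D ?q ?M)"
    by (simp add: rel_comp_def Let_def)
  have M: "sem ?P ?M = {c \<in> El ?P. act ?f c \<in> sem (prod_ob ?B X Y) R \<and> act ?g c \<in> sem (prod_ob ?B Y Z) S}"
    "?M \<in> carrier (Fib D ?P)" using s by auto
  from e show "rel_comp D (Y, Z, S) (X, Y, R) = (X, Z, snd (snd (rel_comp D (Y, Z, S) (X, Y, R))))" by simp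
  show i: "is_rel D (rel_comp D (Y, Z, S) (X, Y, R))" using O s by (simp add: e is_rel_def)
  show "rsem (rel_comp D (Y, Z, S) (X, Y, R)) = rsem (X, Y, R) O rsem (Y, Z, S)"
  proof (intro Set.set_eqI iffI)
    fix x assume "x \<in> rsem (rel_comp D (Y, Z, S) (X, Y, R))"
    then obtain c where c: "c \<in> sem ?P ?M"
      "x = (act (pr1 ?B X Z) (act ?q c), act (pr2 ?B X Z) (act ?q c))"
      by (auto simp: e rsem_def s(5)[OF M(2)])
    then have cE: "c \<in> El ?P" "act ?f c \<in> sem (prod_ob ?B X Y) R" "act ?g c \<in> sem (prod_ob ?B Y Z) S" using M by auto
    then have "(act (pr1 ?B X Z) (act ?q c), act ?y c) \<in> rsem (X, Y, R)"
      "(act ?y c, act (pr2 ?B X Z) (act ?q c)) \<in> rsem (Y, Z, S)"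
      using O by (simp_all add: rsem_iff assms)
    then show "x \<in> rsem (X, Y, R) O rsem (Y, Z, S)" using c by blast
  next
    fix x assume "x \<in> rsem (X, Y, R) O rsem (Y, Z, S)"
    then obtain a b c where x: "x = (a, c)" "(a, b) \<in> rsem (X, Y, R)" "(b, c) \<in> rsem (Y, Z, S)" by auto
    then have abc: "a \<in> El X" "b \<in> El Y" "c \<in> El Z" "fib a = fib b" "fib b = fib c"
      "tuple X Y a b \<in> sem (prod_ob ?B X Y) R" "tuple Y Z b c \<in> sem (prod_ob ?B Y Z) S"
      by (auto simp: rsem_iff assms)
    \<comment> \<open>The three points lie in one fibre, so they assemble into a point of the object
      over which the composite is computed.\<close>
    let ?d = "tuple Y ?XZ b (tuple X Z a c)"
    have "?d \<in> sem ?P ?M" unfolding M using abc O by simp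
    then have "act ?q ?d \<in> sem ?XZ (Ex D ?q ?M)" by (simp add: s(5)[OF M(2)])
    then have "tuple X Z a c \<in> sem ?XZ (Ex D ?q ?M)" using abc O by simp
    then show "x \<in> rsem (rel_comp D (Y, Z, S) (X, Y, R))"
      using abc i unfolding e x(1) by (simp add: rsem_iff)
  qed
qed

lemma rel_image_sem:
  assumes "is_rel D (X, Y, R)" "A \<in> carrier (Fib D X)"
  shows "rel_image D (X, Y, R) A \<in> carrier (Fib D Y)"
    "sem Y (rel_image D (X, Y, R) A) = rsem (X, Y, R) `` sem X A"
proof -
  let ?B = "Base D" let ?P = "prod_ob ?B X Y"
  have O: "X \<in> Ob ?B" "Y \<in> Ob ?B" and R: "R \<in> carrier (Fib D ?P)" using is_relD assms by auto
  have pq: "pr1 ?B X Y \<in> hom ?B ?P X" "pr2 ?B X Y \<in> hom ?B ?P Y" using O by (simp_all add: hom_def)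
  have P: "?P \<in> Ob ?B" using O by simp
  note s = sem_Sub[OF pq(1) assms(2)] sem_meet[OF P R] sem_Ex[OF pq(2)]
  show "rel_image D (X, Y, R) A \<in> carrier (Fib D Y)" using s by (simp add: rel_image_def)
  have "sem Y (rel_image D (X, Y, R) A) = act (pr2 ?B X Y) ` {c \<in> sem ?P R. act (pr1 ?B X Y) c \<in> sem X A}"
    using s sem_subset[OF P R] by (auto simp: rel_image_def)
  also have "\<dots> = rsem (X, Y, R) `` sem X A" by (auto simp: rsem_def)
  finally show "sem Y (rel_image D (X, Y, R) A) = rsem (X, Y, R) `` sem X A" .
qed

lemma rel_dom_sem:
  assumes "is_rel D (X, Y, R)"
  shows "rel_dom D (X, Y, R) \<in> carrier (Fib D X)" "sem X (rel_dom D (X, Y, R)) = Domain (rsem (X, Y, R))"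
    "rel_im D (X, Y, R) \<in> carrier (Fib D Y)" "sem Y (rel_im D (X, Y, R)) = Range (rsem (X, Y, R))"
proof -
  let ?B = "Base D" let ?P = "prod_ob ?B X Y"
  have O: "X \<in> Ob ?B" "Y \<in> Ob ?B" and R: "R \<in> carrier (Fib D ?P)" using is_relD assms by auto
  have pq: "pr1 ?B X Y \<in> hom ?B ?P X" "pr2 ?B X Y \<in> hom ?B ?P Y" using O by (simp_all add: hom_def)
  note s = sem_Ex[OF pq(1) R] sem_Ex[OF pq(2) R]
  show "rel_dom D (X, Y, R) \<in> carrier (Fib D X)" "rel_im D (X, Y, R) \<in> carrier (Fib D Y)"
    using s by (auto simp: rel_dom_def rel_im_def)
  show "sem X (rel_dom D (X, Y, R)) = Domain (rsem (X, Y, R))" using s by (auto simp: rel_dom_def rsem_def image_iff)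
  show "sem Y (rel_im D (X, Y, R)) = Range (rsem (X, Y, R))" using s by (auto simp: rel_im_def rsem_def image_iff)
qed

text \<open>A point of \<open>(X \<times> Y) \<times> Y\<close> is a triple of points in one fibre,
  so the sequent defining single-valuedness is tested triple by triple.\<close>

lemma partial_map_iff:
  assumes "is_rel D (X, Y, R)"
  shows "partial_map D (X, Y, R) \<longleftrightarrow> single_valued (rsem (X, Y, R))"
proof -
  let ?B = "Base D"
  have O: "X \<in> Ob ?B" "Y \<in> Ob ?B" and R: "R \<in> carrier (Fib D (prod_ob ?B X Y))"
    using is_relD assms by auto
  let ?XY = "prod_ob ?B X Y" let ?P = "prod_ob ?B ?XY Y" let ?xy = "pr1 ?B ?XY Y"
  let ?x = "pr1 ?B X Y \<cdot>\<^bsub>?B\<^esub> ?xy" let ?y = "pr2 ?B X Y \<cdot>\<^bsub>?B\<^esub> ?xy" let ?y' = "pr2 ?B ?XY Y"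
  have h: "?xy \<in> hom ?B ?P ?XY" "pair ?B ?x ?y' \<in> hom ?B ?P ?XY" "pair ?B ?y ?y' \<in> hom ?B ?P (prod_ob ?B Y Y)"
    using O by (simp_all add: hom_def)
  have P: "?P \<in> Ob ?B" using O by simp
  have I: "is_rel D (Y, Y, Ex D (diag ?B Y) \<top>\<^bsub>Fib D Y\<^esub>)" "rsem (Y, Y, Ex D (diag ?B Y) \<top>\<^bsub>Fib D Y\<^esub>) = Id_on (El Y)"
    using rel_id_sem[OF O(2)] by (auto simp: rel_id_def)
  have d: "Ex D (diag ?B Y) \<top>\<^bsub>Fib D Y\<^esub> \<in> carrier (Fib D (prod_ob ?B Y Y))" using is_relD[OF I(1)] by simp
  note s = sem_Sub[OF h(1) R] sem_Sub[OF h(2) R] sem_Sub[OF h(3) d] sem_meet[OF P]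
  have "partial_map D (X, Y, R) \<longleftrightarrow> (\<forall>c\<in>El ?P. act ?xy c \<in> sem ?XY R \<and> act (pair ?B ?x ?y') c \<in> sem ?XY R \<longrightarrow>
      act (pair ?B ?y ?y') c \<in> sem (prod_ob ?B Y Y) (Ex D (diag ?B Y) \<top>\<^bsub>Fib D Y\<^esub>))"
    using assms s sem_le[OF P] by (auto simp: partial_map_def Let_def)
  also have "\<dots> \<longleftrightarrow> (\<forall>c\<in>El ?P. (act ?x c, act ?y c) \<in> rsem (X, Y, R) \<and> (act ?x c, act ?y' c) \<in> rsem (X, Y, R) \<longrightarrow>
      (act ?y c, act ?y' c) \<in> Id_on (El Y))"
    using O unfolding I(2)[symmetric] rsem_iff[OF I(1)] rsem_iff[OF assms] by simp
  also have "\<dots> \<longleftrightarrow> single_valued (rsem (X, Y, R))"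
  proof
    assume *: "\<forall>c\<in>El ?P. (act ?x c, act ?y c) \<in> rsem (X, Y, R) \<and> (act ?x c, act ?y' c) \<in> rsem (X, Y, R) \<longrightarrow>
      (act ?y c, act ?y' c) \<in> Id_on (El Y)"
    show "single_valued (rsem (X, Y, R))"
    proof (rule single_valuedI)
      fix a b b' assume ab: "(a, b) \<in> rsem (X, Y, R)" "(a, b') \<in> rsem (X, Y, R)"
      then have "a \<in> El X" "b \<in> El Y" "b' \<in> El Y" "fib a = fib b" "fib b = fib b'" by (auto simp: rsem_iff assms)
      then show "b = b'" using ab O *[rule_format, of "tuple ?XY Y (tuple X Y a b) b'"] by (simp add: Id_on_iff)
    qed
  next
    assume *: "single_valued (rsem (X, Y, R))"
    show "\<forall>c\<in>El ?P. (act ?x c, act ?y c) \<in> rsem (X, Y, R) \<and> (act ?x c, act ?y' c) \<in> rsem (X, Y, R) \<longrightarrow>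
      (act ?y c, act ?y' c) \<in> Id_on (El Y)"
    proof (intro ballI impI)
      fix c assume c: "c \<in> El ?P" and a: "(act ?x c, act ?y c) \<in> rsem (X, Y, R) \<and> (act ?x c, act ?y' c) \<in> rsem (X, Y, R)"
      then have "act ?y c = act ?y' c" using * by (auto dest: single_valuedD)
      moreover have "act ?y' c \<in> El Y" using c O by simp
      ultimately show "(act ?y c, act ?y' c) \<in> Id_on (El Y)" by (auto simp: Id_on_iff)
    qed
  qed
  finally show ?thesis .
qed

end

text \<open>Kept apart from \<open>set_semantics\<close> because the latter is also instantiated by
  the subobject doctrine, for which joins and bottom are computed separately in
  \<open>subs_boolean\<close>.\<close>

locale boolean_semantics = boolean_doctrine D + set_semantics D El act sem fib
  for D :: "('o, 'a, 'd) doctrine" and El :: "'o \<Rightarrow> 'p set" and act :: "'a \<Rightarrow> 'p \<Rightarrow> 'p"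
    and sem :: "'o \<Rightarrow> 'd \<Rightarrow> 'p set" and fib :: "'p \<Rightarrow> 'm" +
  assumes sem_bottom: "X \<in> Ob (Base D) \<Longrightarrow> sem X \<bottom>\<^bsub>Fib D X\<^esub> = {}"
    and sem_join: "\<lbrakk>X \<in> Ob (Base D); A \<in> carrier (Fib D X); B \<in> carrier (Fib D X)\<rbrakk> \<Longrightarrow>
      sem X (A \<squnion>\<^bsub>Fib D X\<^esub> B) = sem X A \<union> sem X B"
begin

lemma complement_sem:
  assumes "X \<in> Ob (Base D)" "A \<in> carrier (Fib D X)"
  obtains B where "B \<in> carrier (Fib D X)" "sem X B = El X - sem X A"
proof -
  interpret L: boolean_lattice "Fib D X" using Fib_boolean assms by blast
  obtain B where B: "B \<in> carrier (Fib D X)" "A \<sqinter>\<^bsub>Fib D X\<^esub> B = \<bottom>\<^bsub>Fib D X\<^esub>" "A \<squnion>\<^bsub>Fib D X\<^esub> B = \<top>\<^bsub>Fib D X\<^esub>"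
    using L.complement_exists[OF assms(2)] by blast
  have "sem X A \<inter> sem X B = {}" using sem_meet[OF assms B(1)] sem_bottom[OF assms(1)] B(2) by simp
  moreover have "sem X A \<union> sem X B = El X" using sem_join[OF assms B(1)] sem_top[OF assms(1)] B(3) by simp
  ultimately show ?thesis using that B(1) by blast
qed

end

section \<open>From Henkin theories to points\<close>

context henkin_theory
begin

abbreviation (input) eqv :: "'o \<Rightarrow> ('o, 'a, 'd) henkin_term \<Rightarrow> ('o, 'a, 'd) henkin_term \<Rightarrow> bool" where
  "eqv X s t \<equiv> delta X \<in> th (prod_ob (Base D) X X) (Tuple X X s t)"

lemma th_top: "\<phi> \<in> th X t \<Longrightarrow> \<top>\<^bsub>Fib D X\<^esub> \<in> th X t"
  using th_ultrafilter[of \<phi> X t] by (simp add: ultrafilter_def)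

lemma eqv_el: "eqv X s t \<Longrightarrow> \<top>\<^bsub>Fib D X\<^esub> \<in> th X s \<and> \<top>\<^bsub>Fib D X\<^esub> \<in> th X t"
  by (rule th_TupleD)

definition cls :: "'o \<Rightarrow> ('o, 'a, 'd) henkin_term \<Rightarrow> ('o, 'a, 'd) henkin_term set" where
  "cls X t = {s. eqv X t s}"

lemma cls_eq_iff: "\<top>\<^bsub>Fib D X\<^esub> \<in> th X s \<Longrightarrow> cls X s = cls X t \<longleftrightarrow> eqv X s t"
  unfolding cls_def using eqv_refl eqv_sym eqv_trans by blast

lemma th_cls: "\<lbrakk>\<phi> \<in> th X s; cls X s = cls X t\<rbrakk> \<Longrightarrow> \<phi> \<in> th X t"
  using eqv_subst cls_eq_iff th_top by blast

lemma eqv_pair: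
  assumes "f \<in> hom (Base D) Z X" "g \<in> hom (Base D) Z Y" "\<top>\<^bsub>Fib D Z\<^esub> \<in> th Z t"
  shows "eqv (prod_ob (Base D) X Y) (Apply (pair (Base D) f g) t) (Tuple X Y (Apply f t) (Apply g t))"
proof -
  have fg: "f \<in> Arr (Base D)" "Dom (Base D) f = Z" "Cod (Base D) f = X" "g \<in> Arr (Base D)"
    "Dom (Base D) g = Z" "Cod (Base D) g = Y" using assms by (auto simp: hom_def)
  then have O: "X \<in> Ob (Base D)" "Y \<in> Ob (Base D)" by auto
  have h: "pair (Base D) f g \<in> hom (Base D) Z (prod_ob (Base D) X Y)"
    "pr1 (Base D) X Y \<in> hom (Base D) (prod_ob (Base D) X Y) X" "pr2 (Base D) X Y \<in> hom (Base D) (prod_ob (Base D) X Y) Y"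
    using fg O by (auto simp: hom_def)
  have el: "\<top>\<^bsub>Fib D X\<^esub> \<in> th X (Apply f t)" "\<top>\<^bsub>Fib D Y\<^esub> \<in> th Y (Apply g t)"
    "\<top>\<^bsub>Fib D (prod_ob (Base D) X Y)\<^esub> \<in> th (prod_ob (Base D) X Y) (Apply (pair (Base D) f g) t)"
    using th_Apply[OF assms(1,3)] th_Apply[OF assms(2,3)] th_Apply[OF h(1) assms(3)] fg O assms(3) by auto
  show ?thesis
  proof (rule eqv_prod[OF O el(3) th_Tuple[OF el(1,2)]])
    have "eqv X (Apply (pr1 (Base D) X Y) (Apply (pair (Base D) f g) t)) (Apply f t)"
      using eqv_sym[OF eqv_Comp[OF h(1,2) assms(3)]] fg by simp
    then show "eqv X (Apply (pr1 (Base D) X Y) (Apply (pair (Base D) f g) t))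
        (Apply (pr1 (Base D) X Y) (Tuple X Y (Apply f t) (Apply g t)))"
      using eqv_trans eqv_sym[OF eqv_pr1[OF el(1,2)]] by blast
    have "eqv Y (Apply (pr2 (Base D) X Y) (Apply (pair (Base D) f g) t)) (Apply g t)"
      using eqv_sym[OF eqv_Comp[OF h(1,3) assms(3)]] fg by simp
    then show "eqv Y (Apply (pr2 (Base D) X Y) (Apply (pair (Base D) f g) t))
        (Apply (pr2 (Base D) X Y) (Tuple X Y (Apply f t) (Apply g t)))"
      using eqv_trans eqv_sym[OF eqv_pr2[OF el(1,2)]] by blast
  qed
qed

text \<open>Witness terms belong to projections. For an arbitrary \<open>f\<close> the formula
  \<open>\<exists>x. A(x) \<and> f(x) = y\<close> is used: it lies above \<open>Ex D f A\<close>,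
  and a witness for it is a preimage of \<open>b\<close> up to equality.\<close>

lemma th_Ex:
  assumes f: "f \<in> hom (Base D) X Y" and A: "A \<in> carrier (Fib D X)" and b: "Ex D f A \<in> th Y b"
  shows "\<exists>a. A \<in> th X a \<and> eqv Y (Apply f a) b"
proof -
  let ?B = "Base D"
  have ff: "f \<in> Arr ?B" "Dom ?B f = X" "Cod ?B f = Y" using f by (auto simp: hom_def)
  then have O: "X \<in> Ob ?B" "Y \<in> Ob ?B" by auto
  let ?p = "pr1 ?B X Y" let ?q = "pr2 ?B X Y" let ?P = "prod_ob ?B X Y"
  let ?G = "Sub D (pair ?B (f \<cdot>\<^bsub>?B\<^esub> ?p) ?q) (delta Y)" let ?M = "Sub D ?p A \<sqinter>\<^bsub>Fib D ?P\<^esub> ?G"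
  let ?g = "pair ?B (ide ?B X) f"
  have c: "Sub D ?p A \<in> carrier (Fib D ?P)" "?G \<in> carrier (Fib D ?P)" "?M \<in> carrier (Fib D ?P)"
    using ff O A by auto
  have "?M \<sqsubseteq>\<^bsub>Fib D ?P\<^esub> Sub D ?q (Ex D ?q ?M)" by (rule le_Sub_Ex) (use c O in auto)
  then have "Sub D ?g ?M \<sqsubseteq>\<^bsub>Fib D X\<^esub> Sub D ?g (Sub D ?q (Ex D ?q ?M))"
    by (rule Sub_mono) (use ff O c in auto)
  moreover have "Sub D ?g (Sub D ?q (Ex D ?q ?M)) = Sub D f (Ex D ?q ?M)" using ff O c by simp
  \<comment> \<open>Along the graph \<open>?g\<close> of \<open>f\<close> the equation in
    \<open>?M\<close> becomes reflexivity, which leaves \<open>A\<close>.\<close>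
  moreover have "Sub D ?g ?M = A"
  proof -
    have "Sub D ?g ?M = Sub D ?g (Sub D ?p A) \<sqinter>\<^bsub>Fib D X\<^esub> Sub D ?g ?G"
      using ff O c Sub_simps(4)[of ?g ?P "Sub D ?p A" ?G] by simp
    also have "Sub D ?g (Sub D ?p A) = A" using ff O A by simp
    also have "Sub D ?g ?G = \<top>\<^bsub>Fib D X\<^esub>" using ff O by simp
    finally show ?thesis using O A by simp
  qed
  ultimately have "A \<sqsubseteq>\<^bsub>Fib D X\<^esub> Sub D f (Ex D ?q ?M)" by simp
  then have "Ex D f A \<sqsubseteq>\<^bsub>Fib D Y\<^esub> Ex D ?q ?M" using Ex_le_iff[of f Y X A] ff O A c by simp
  then have "Ex D ?q ?M \<in> th Y b"
    using ultrafilter_up[OF Fib_boolean[OF O(2)] _ b] th_ultrafilter[OF b] O c by simp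
  from th_Witness[OF O(1) c(3) this] obtain a where a: "?M \<in> th ?P (Tuple X Y a b)" by blast
  have el: "\<top>\<^bsub>Fib D X\<^esub> \<in> th X a" "\<top>\<^bsub>Fib D Y\<^esub> \<in> th Y b" using th_TupleD[OF a] by auto
  have elP: "\<top>\<^bsub>Fib D ?P\<^esub> \<in> th ?P (Tuple X Y a b)" using th_Tuple[OF el] .
  have AG: "Sub D ?p A \<in> th ?P (Tuple X Y a b)" "?G \<in> th ?P (Tuple X Y a b)"
    using a th_ultrafilter[OF a] c unfolding ultrafilter_def by auto
  have h: "?p \<in> hom ?B ?P X" "?q \<in> hom ?B ?P Y" "f \<cdot>\<^bsub>?B\<^esub> ?p \<in> hom ?B ?P Y"
    "pair ?B (f \<cdot>\<^bsub>?B\<^esub> ?p) ?q \<in> hom ?B ?P (prod_ob ?B Y Y)" using ff O by (auto simp: hom_def)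
  have "A \<in> th X (Apply ?p (Tuple X Y a b))" using th_Apply[OF h(1) elP] AG(1) A by simp
  then have 1: "A \<in> th X a" using eqv_subst[OF eqv_pr1[OF el]] by blast
  have "delta Y \<in> th (prod_ob ?B Y Y) (Apply (pair ?B (f \<cdot>\<^bsub>?B\<^esub> ?p) ?q) (Tuple X Y a b))"
    using th_Apply[OF h(4) elP] AG(2) O by simp
  then have "eqv Y (Apply (f \<cdot>\<^bsub>?B\<^esub> ?p) (Tuple X Y a b)) (Apply ?q (Tuple X Y a b))"
    by (rule eqv_subst[OF eqv_pair[OF h(3,2) elP]])
  then have "eqv Y (Apply (f \<cdot>\<^bsub>?B\<^esub> ?p) (Tuple X Y a b)) b"
    by (rule eqv_trans[OF _ eqv_pr2[OF el]])
  moreover have "eqv Y (Apply (f \<cdot>\<^bsub>?B\<^esub> ?p) (Tuple X Y a b)) (Apply f a)"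
    by (rule eqv_trans[OF eqv_Comp[OF h(1) f elP] eqv_Apply[OF eqv_pr1[OF el] f]])
  ultimately have "eqv Y (Apply f a) b" using eqv_sym eqv_trans by blast
  with 1 show ?thesis by blast
qed

end

text \<open>An element of a model together with the model it belongs to, a model being given by its
  theory. Thus \<open>fst\<close> is the fibre map, and only elements of the same model are
  tupled.\<close>

type_synonym ('o, 'a, 'd) henkin_point =
  "('o \<Rightarrow> ('o, 'a, 'd) henkin_term \<Rightarrow> 'd set) \<times> ('o, 'a, 'd) henkin_term set"

context boolean_doctrine
begin

definition henkin_sem :: "'o \<Rightarrow> 'd \<Rightarrow> ('o, 'a, 'd) henkin_point set" where
  "henkin_sem X \<phi> = {(th, henkin_theory.cls D th X t) | th t. henkin_theory D th \<and> \<phi> \<in> th X t}"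

text \<open>Any representative will do by \<open>eqv_Apply\<close>; the sort of the result is read
  from the codomain of \<open>f\<close>.\<close>

definition henkin_act :: "'a \<Rightarrow> ('o, 'a, 'd) henkin_point \<Rightarrow> ('o, 'a, 'd) henkin_point" where
  "henkin_act f p = (fst p, henkin_theory.cls D (fst p) (Cod (Base D) f) (Apply f (SOME t. t \<in> snd p)))"

lemma henkin_act_cls:
  assumes th: "henkin_theory D th" and f: "f \<in> hom (Base D) X Y" and t: "\<top>\<^bsub>Fib D X\<^esub> \<in> th X t"
  shows "henkin_act f (th, henkin_theory.cls D th X t) = (th, henkin_theory.cls D th Y (Apply f t))"
    "\<top>\<^bsub>Fib D Y\<^esub> \<in> th Y (Apply f t)"
proof -
  interpret henkin_theory D th by fact
  let ?s = "SOME s. s \<in> cls X t"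
  have ff: "f \<in> Arr (Base D)" "Dom (Base D) f = X" "Cod (Base D) f = Y" using f by (auto simp: hom_def)
  have "t \<in> cls X t" using eqv_refl[OF t] by (simp add: cls_def)
  then have "?s \<in> cls X t" by (rule someI)
  then have "eqv Y (Apply f t) (Apply f ?s)" using eqv_Apply[OF _ f] by (simp add: cls_def)
  then have "cls Y (Apply f t) = cls Y (Apply f ?s)" using cls_eq_iff eqv_el by blast
  then show "henkin_act f (th, cls X t) = (th, cls Y (Apply f t))" using ff by (simp add: henkin_act_def)
  show "\<top>\<^bsub>Fib D Y\<^esub> \<in> th Y (Apply f t)" using th_Apply[OF f t] t ff by auto
qed

lemma henkin_sem_cls:
  assumes th: "henkin_theory D th" and t: "\<top>\<^bsub>Fib D X\<^esub> \<in> th X t"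
  shows "(th, henkin_theory.cls D th X t) \<in> henkin_sem X \<phi> \<longleftrightarrow> \<phi> \<in> th X t"
proof -
  interpret henkin_theory D th by fact
  show ?thesis unfolding henkin_sem_def using th th_cls by blast
qed

lemma henkin_sem_cases:
  assumes "p \<in> henkin_sem X \<phi>"
  obtains th t where "henkin_theory D th" "p = (th, henkin_theory.cls D th X t)" "\<phi> \<in> th X t" "\<top>\<^bsub>Fib D X\<^esub> \<in> th X t"
proof -
  obtain th t where "henkin_theory D th" "p = (th, henkin_theory.cls D th X t)" "\<phi> \<in> th X t"
    using assms unfolding henkin_sem_def by blast
  then show ?thesis using that henkin_theory.th_top by metis
qed

lemma henkin_sem_subset: "henkin_sem X \<phi> \<subseteq> henkin_sem X \<top>\<^bsub>Fib D X\<^esub>"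
proof
  fix p assume "p \<in> henkin_sem X \<phi>"
  then obtain th t where t: "henkin_theory D th" "p = (th, henkin_theory.cls D th X t)" "\<top>\<^bsub>Fib D X\<^esub> \<in> th X t"
    using henkin_sem_cases by metis
  show "p \<in> henkin_sem X \<top>\<^bsub>Fib D X\<^esub>" unfolding t(2) henkin_sem_cls[OF t(1,3)] by (rule t(3))
qed

text \<open>Completeness. If \<open>A\<close> is not below \<open>B\<close>, some ultrafilter
  contains \<open>A\<close> and the complement of \<open>B\<close>, and in a model where
  \<open>Generic\<close> realizes it, the generic point lies in \<open>A\<close> but not in
  \<open>B\<close>.\<close>

lemma henkin_sem_le:
  assumes X: "X \<in> Ob (Base D)" and c: "A \<in> carrier (Fib D X)" "B \<in> carrier (Fib D X)"
    and sub: "henkin_sem X A \<subseteq> henkin_sem X B"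
  shows "A \<sqsubseteq>\<^bsub>Fib D X\<^esub> B"
proof (rule ccontr)
  assume n: "\<not> A \<sqsubseteq>\<^bsub>Fib D X\<^esub> B"
  interpret L: boolean_lattice "Fib D X" using Fib_boolean[OF X] .
  obtain E where E: "E \<in> carrier (Fib D X)" "B \<sqinter>\<^bsub>Fib D X\<^esub> E = \<bottom>\<^bsub>Fib D X\<^esub>" "B \<squnion>\<^bsub>Fib D X\<^esub> E = \<top>\<^bsub>Fib D X\<^esub>"
    using L.complement_exists[OF c(2)] by blast
  have ne: "A \<sqinter>\<^bsub>Fib D X\<^esub> E \<noteq> \<bottom>\<^bsub>Fib D X\<^esub>"
  proof
    assume z: "A \<sqinter>\<^bsub>Fib D X\<^esub> E = \<bottom>\<^bsub>Fib D X\<^esub>"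
    have "A = A \<sqinter>\<^bsub>Fib D X\<^esub> (B \<squnion>\<^bsub>Fib D X\<^esub> E)" using E(3) X c by simp
    also have "\<dots> = (A \<sqinter>\<^bsub>Fib D X\<^esub> B) \<squnion>\<^bsub>Fib D X\<^esub> \<bottom>\<^bsub>Fib D X\<^esub>"
      using L.meet_join_distrib[OF c E(1)] z by simp
    also have "\<dots> = A \<sqinter>\<^bsub>Fib D X\<^esub> B"
      using L.bottom_join[of "A \<sqinter>\<^bsub>Fib D X\<^esub> B"] c by (simp add: join_comm L.eq_is_equal)
    finally show False using n L.meet_right[OF c] by simp
  qed
  have m: "A \<sqinter>\<^bsub>Fib D X\<^esub> E \<sqinter>\<^bsub>Fib D X\<^esub> (A \<sqinter>\<^bsub>Fib D X\<^esub> E) = A \<sqinter>\<^bsub>Fib D X\<^esub> E"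
    using L.le_iff_join[of "A \<sqinter>\<^bsub>Fib D X\<^esub> E" "A \<sqinter>\<^bsub>Fib D X\<^esub> E"] c E by simp
  have "\<exists>F. ultrafilter (Fib D X) F \<and> {A \<sqinter>\<^bsub>Fib D X\<^esub> E} \<subseteq> F"
    by (rule ultrafilter_exists[OF Fib_boolean[OF X], of "{A \<sqinter>\<^bsub>Fib D X\<^esub> E}"])
      (use ne m c E in auto)
  then obtain F where F: "ultrafilter (Fib D X) F" "A \<sqinter>\<^bsub>Fib D X\<^esub> E \<in> F" by blast
  then have AF: "A \<in> F" "E \<in> F" using c E by (auto simp: ultrafilter_def)
  have BF: "B \<notin> F" using F(1) AF c E unfolding ultrafilter_def by metis
  obtain th where th: "henkin_theory D th" "th X Generic = F" using henkin_theory_exists[OF X F(1)] by blast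
  interpret henkin_theory D th by (rule th)
  have t: "\<top>\<^bsub>Fib D X\<^esub> \<in> th X Generic" using th F by (simp add: ultrafilter_def)
  then show False
    using sub AF BF th(2) henkin_sem_cls[OF th(1) t] by blast
qed

text \<open>Everything is checked in one model at a time from the axioms of a Henkin theory, except
  that the order is reflected; that part needs sufficiently many models and is
  \<open>henkin_sem_le\<close>.\<close>

lemma henkin_semantics:
  "boolean_semantics D (\<lambda>X. henkin_sem X \<top>\<^bsub>Fib D X\<^esub>) henkin_act henkin_sem fst"
proof
  fix f X Y a assume f: "f \<in> hom (Base D) X Y" and "a \<in> henkin_sem X \<top>\<^bsub>Fib D X\<^esub>"
  then obtain th t where t: "henkin_theory D th" "a = (th, henkin_theory.cls D th X t)" "\<top>\<^bsub>Fib D X\<^esub> \<in> th X t"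
    using henkin_sem_cases by metis
  then show "henkin_act f a \<in> henkin_sem Y \<top>\<^bsub>Fib D Y\<^esub>"
    using henkin_act_cls[OF t(1) f t(3)] henkin_sem_cls[OF t(1)] by simp
  show "fst (henkin_act f a) = fst a" by (simp add: henkin_act_def)
  fix g Z assume g: "g \<in> hom (Base D) Y Z"
  interpret henkin_theory D th by (rule t)
  have gf: "g \<cdot>\<^bsub>Base D\<^esub> f \<in> hom (Base D) X Z" using f g by (simp add: hom_def)
  have "cls Z (Apply (g \<cdot>\<^bsub>Base D\<^esub> f) t) = cls Z (Apply g (Apply f t))"
    using eqv_Comp[OF f g t(3)] cls_eq_iff[OF henkin_act_cls(2)[OF t(1) gf t(3)]] by blast
  then show "henkin_act (g \<cdot>\<^bsub>Base D\<^esub> f) a = henkin_act g (henkin_act f a)"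
    using henkin_act_cls[OF t(1) f t(3)] henkin_act_cls[OF t(1) gf t(3)] henkin_act_cls(1)[OF t(1) g] t by simp
next
  fix X a assume X: "X \<in> Ob (Base D)" and "a \<in> henkin_sem X \<top>\<^bsub>Fib D X\<^esub>"
  then obtain th t where t: "henkin_theory D th" "a = (th, henkin_theory.cls D th X t)" "\<top>\<^bsub>Fib D X\<^esub> \<in> th X t"
    using henkin_sem_cases by metis
  interpret henkin_theory D th by (rule t)
  have i: "ide (Base D) X \<in> hom (Base D) X X" using X by (simp add: hom_def)
  have "cls X (Apply (ide (Base D) X) t) = cls X t"
    using eqv_ide[OF t(3)] cls_eq_iff[OF henkin_act_cls(2)[OF t(1) i t(3)]] by blast
  then show "henkin_act (ide (Base D) X) a = a" using henkin_act_cls[OF t(1) i t(3)] t(2) by simp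
next
  fix X Y a b assume O: "X \<in> Ob (Base D)" "Y \<in> Ob (Base D)" and ab: "a \<in> henkin_sem X \<top>\<^bsub>Fib D X\<^esub>"
    "b \<in> henkin_sem Y \<top>\<^bsub>Fib D Y\<^esub>" "fst a = fst b"
  obtain th s where s: "henkin_theory D th" "a = (th, henkin_theory.cls D th X s)" "\<top>\<^bsub>Fib D X\<^esub> \<in> th X s"
    using ab henkin_sem_cases by metis
  obtain t where t: "b = (th, henkin_theory.cls D th Y t)" "\<top>\<^bsub>Fib D Y\<^esub> \<in> th Y t"
    using ab s henkin_sem_cases by (metis fst_conv)
  interpret henkin_theory D th by (rule s)
  let ?P = "prod_ob (Base D) X Y" let ?c = "(th, cls ?P (Tuple X Y s t))"
  have e: "\<top>\<^bsub>Fib D ?P\<^esub> \<in> th ?P (Tuple X Y s t)" using th_Tuple[OF s(3) t(2)] .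
  have p: "pr1 (Base D) X Y \<in> hom (Base D) ?P X" "pr2 (Base D) X Y \<in> hom (Base D) ?P Y" using O by (simp_all add: hom_def)
  have "cls X (Apply (pr1 (Base D) X Y) (Tuple X Y s t)) = cls X s"
    using eqv_pr1[OF s(3) t(2)] cls_eq_iff eqv_el by blast
  moreover have "cls Y (Apply (pr2 (Base D) X Y) (Tuple X Y s t)) = cls Y t"
    using eqv_pr2[OF s(3) t(2)] cls_eq_iff eqv_el by blast
  ultimately have "henkin_act (pr1 (Base D) X Y) ?c = a \<and> henkin_act (pr2 (Base D) X Y) ?c = b"
    using henkin_act_cls[OF s(1) p(1) e] henkin_act_cls[OF s(1) p(2) e] s t by simp
  moreover have "?c \<in> henkin_sem ?P \<top>\<^bsub>Fib D ?P\<^esub>" using henkin_sem_cls[OF s(1) e] e by blast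
  ultimately show "\<exists>c\<in>henkin_sem ?P \<top>\<^bsub>Fib D ?P\<^esub>. henkin_act (pr1 (Base D) X Y) c = a \<and> henkin_act (pr2 (Base D) X Y) c = b"
    by blast
next
  fix X Y c c' let ?P = "prod_ob (Base D) X Y"
  assume O: "X \<in> Ob (Base D)" "Y \<in> Ob (Base D)" and c: "c \<in> henkin_sem ?P \<top>\<^bsub>Fib D ?P\<^esub>" "c' \<in> henkin_sem ?P \<top>\<^bsub>Fib D ?P\<^esub>"
    and e: "henkin_act (pr1 (Base D) X Y) c = henkin_act (pr1 (Base D) X Y) c'"
    "henkin_act (pr2 (Base D) X Y) c = henkin_act (pr2 (Base D) X Y) c'"
  obtain th s where s: "henkin_theory D th" "c = (th, henkin_theory.cls D th ?P s)" "\<top>\<^bsub>Fib D ?P\<^esub> \<in> th ?P s"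
    using c henkin_sem_cases by metis
  \<comment> \<open>Equality of the projections already puts both points into the same
    model.\<close>
  have "fst c' = th" using e(1) s(2) by (simp add: henkin_act_def)
  then obtain t where t: "c' = (th, henkin_theory.cls D th ?P t)" "\<top>\<^bsub>Fib D ?P\<^esub> \<in> th ?P t"
    using c(2) henkin_sem_cases by (metis fst_conv)
  interpret henkin_theory D th by (rule s)
  have p: "pr1 (Base D) X Y \<in> hom (Base D) ?P X" "pr2 (Base D) X Y \<in> hom (Base D) ?P Y" using O by (simp_all add: hom_def)
  have "eqv X (Apply (pr1 (Base D) X Y) s) (Apply (pr1 (Base D) X Y) t)"
    using e(1) cls_eq_iff henkin_act_cls[OF s(1) p(1) s(3)] henkin_act_cls[OF s(1) p(1) t(2)] s(2) t(1) by simp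
  moreover have "eqv Y (Apply (pr2 (Base D) X Y) s) (Apply (pr2 (Base D) X Y) t)"
    using e(2) cls_eq_iff henkin_act_cls[OF s(1) p(2) s(3)] henkin_act_cls[OF s(1) p(2) t(2)] s(2) t(1) by simp
  ultimately have "eqv ?P s t" by (rule eqv_prod[OF O s(3) t(2)])
  then show "c = c'" using s(2,3) t(1) cls_eq_iff by blast
next
  fix X A assume X: "X \<in> Ob (Base D)" and A: "A \<in> carrier (Fib D X)"
  show "henkin_sem X A \<subseteq> henkin_sem X \<top>\<^bsub>Fib D X\<^esub>"
    by (rule henkin_sem_subset)
  fix B assume B: "B \<in> carrier (Fib D X)"
  show "A \<sqsubseteq>\<^bsub>Fib D X\<^esub> B \<longleftrightarrow> henkin_sem X A \<subseteq> henkin_sem X B"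
  proof
    assume le: "A \<sqsubseteq>\<^bsub>Fib D X\<^esub> B"
    show "henkin_sem X A \<subseteq> henkin_sem X B"
    proof
      fix p assume "p \<in> henkin_sem X A"
      then obtain th t where t: "henkin_theory D th" "p = (th, henkin_theory.cls D th X t)" "A \<in> th X t" "\<top>\<^bsub>Fib D X\<^esub> \<in> th X t"
        by (rule henkin_sem_cases)
      interpret henkin_theory D th by (rule t)
      have "B \<in> th X t" using ultrafilter_up[OF Fib_boolean[OF X] _ t(3) le B] th_ultrafilter[OF t(3)] by blast
      then show "p \<in> henkin_sem X B" unfolding t(2) henkin_sem_cls[OF t(1,4)] .
    qed
  qed (rule henkin_sem_le[OF X A B])
  show "A = B" if "henkin_sem X A = henkin_sem X B"
    using Fib_le_antisym[OF henkin_sem_le[OF X A B] henkin_sem_le[OF X B A] X A B] that by blast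
  have bool: "p \<in> henkin_sem X (A \<sqinter>\<^bsub>Fib D X\<^esub> B) \<longleftrightarrow> p \<in> henkin_sem X A \<inter> henkin_sem X B"
    "p \<in> henkin_sem X (A \<squnion>\<^bsub>Fib D X\<^esub> B) \<longleftrightarrow> p \<in> henkin_sem X A \<union> henkin_sem X B"
    if "p \<in> henkin_sem X \<top>\<^bsub>Fib D X\<^esub>" for p
  proof -
    obtain th t where t: "henkin_theory D th" "p = (th, henkin_theory.cls D th X t)" "\<top>\<^bsub>Fib D X\<^esub> \<in> th X t"
      using \<open>p \<in> henkin_sem X \<top>\<^bsub>Fib D X\<^esub>\<close> henkin_sem_cases by metis
    interpret henkin_theory D th by (rule t)
    have u: "ultrafilter (Fib D X) (th X t)" using th_ultrafilter[OF t(3)] by blast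
    show "p \<in> henkin_sem X (A \<sqinter>\<^bsub>Fib D X\<^esub> B) \<longleftrightarrow> p \<in> henkin_sem X A \<inter> henkin_sem X B"
      "p \<in> henkin_sem X (A \<squnion>\<^bsub>Fib D X\<^esub> B) \<longleftrightarrow> p \<in> henkin_sem X A \<union> henkin_sem X B"
      using u A B unfolding t(2) Int_iff Un_iff henkin_sem_cls[OF t(1,3)] ultrafilter_def by auto
  qed
  have sub: "henkin_sem X E \<subseteq> henkin_sem X \<top>\<^bsub>Fib D X\<^esub>" for E
    by (rule henkin_sem_subset)
  show "A \<sqinter>\<^bsub>Fib D X\<^esub> B \<in> carrier (Fib D X) \<and> henkin_sem X (A \<sqinter>\<^bsub>Fib D X\<^esub> B) = henkin_sem X A \<inter> henkin_sem X B"
    using bool(1) sub Fib_meet(1)[OF X A B] by blast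
  show "henkin_sem X (A \<squnion>\<^bsub>Fib D X\<^esub> B) = henkin_sem X A \<union> henkin_sem X B"
    using bool(2) sub by blast
next
  fix X assume X: "X \<in> Ob (Base D)"
  show "\<top>\<^bsub>Fib D X\<^esub> \<in> carrier (Fib D X) \<and> henkin_sem X \<top>\<^bsub>Fib D X\<^esub> = henkin_sem X \<top>\<^bsub>Fib D X\<^esub>" using X by simp
  show "henkin_sem X \<bottom>\<^bsub>Fib D X\<^esub> = {}"
  proof (rule equals0I)
    fix p assume "p \<in> henkin_sem X \<bottom>\<^bsub>Fib D X\<^esub>"
    then obtain th t where "henkin_theory D th" "\<bottom>\<^bsub>Fib D X\<^esub> \<in> th X t"
      using henkin_sem_cases by metis
    then show False using henkin_theory.th_ultrafilter by (metis ultrafilter_def)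
  qed
next
  fix f X Y A assume f: "f \<in> hom (Base D) X Y" and A: "A \<in> carrier (Fib D Y)"
  have ff: "f \<in> Arr (Base D)" "Dom (Base D) f = X" "Cod (Base D) f = Y" using f by (auto simp: hom_def)
  have sub: "henkin_sem X E \<subseteq> henkin_sem X \<top>\<^bsub>Fib D X\<^esub>" for E
    by (rule henkin_sem_subset)
  have "p \<in> henkin_sem X (Sub D f A) \<longleftrightarrow> henkin_act f p \<in> henkin_sem Y A" if p: "p \<in> henkin_sem X \<top>\<^bsub>Fib D X\<^esub>" for p
  proof -
    obtain th t where t: "henkin_theory D th" "p = (th, henkin_theory.cls D th X t)" "\<top>\<^bsub>Fib D X\<^esub> \<in> th X t"
      using p henkin_sem_cases by metis
    interpret henkin_theory D th by (rule t)
    show ?thesis unfolding t(2) henkin_act_cls(1)[OF t(1) f t(3)] henkin_sem_cls[OF t(1,3)]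
        henkin_sem_cls[OF t(1) henkin_act_cls(2)[OF t(1) f t(3)]] using th_Apply[OF f t(3)] A by simp
  qed
  then show "Sub D f A \<in> carrier (Fib D X) \<and>
      henkin_sem X (Sub D f A) = {a \<in> henkin_sem X \<top>\<^bsub>Fib D X\<^esub>. henkin_act f a \<in> henkin_sem Y A}"
    using sub ff A by auto
next
  fix f X Y A assume f: "f \<in> hom (Base D) X Y" and A: "A \<in> carrier (Fib D X)"
  have ff: "f \<in> Arr (Base D)" "Dom (Base D) f = X" "Cod (Base D) f = Y" using f by (auto simp: hom_def)
  have "henkin_sem Y (Ex D f A) = henkin_act f ` henkin_sem X A"
  proof (rule equalityI; rule subsetI)
    fix p assume "p \<in> henkin_sem Y (Ex D f A)"
    then obtain th b where t: "henkin_theory D th" "p = (th, henkin_theory.cls D th Y b)" "Ex D f A \<in> th Y b" "\<top>\<^bsub>Fib D Y\<^esub> \<in> th Y b"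
      by (rule henkin_sem_cases)
    interpret henkin_theory D th by (rule t)
    obtain a where a: "A \<in> th X a" "eqv Y (Apply f a) b" using th_Ex[OF f A t(3)] by blast
    have "henkin_act f (th, cls X a) = p"
      using henkin_act_cls[OF t(1) f th_top[OF a(1)]] cls_eq_iff a(2) t(2) by simp
    moreover have "(th, cls X a) \<in> henkin_sem X A" unfolding henkin_sem_cls[OF t(1) th_top[OF a(1)]] by (rule a(1))
    ultimately show "p \<in> henkin_act f ` henkin_sem X A" by blast
  next
    fix p assume "p \<in> henkin_act f ` henkin_sem X A"
    then obtain q where "q \<in> henkin_sem X A" and p: "p = henkin_act f q" by blast
    then obtain th t where t: "henkin_theory D th" "q = (th, henkin_theory.cls D th X t)" "A \<in> th X t" "\<top>\<^bsub>Fib D X\<^esub> \<in> th X t"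
      using henkin_sem_cases by metis
    interpret henkin_theory D th by (rule t)
    have "A \<sqsubseteq>\<^bsub>Fib D X\<^esub> Sub D f (Ex D f A)" by (rule le_Sub_Ex) (use ff A in auto)
    then have "Sub D f (Ex D f A) \<in> th X t"
      using ultrafilter_up[OF Fib_boolean, of X "th X t", OF _ _ t(3)] th_ultrafilter[OF t(3)] ff A by simp
    then have "Ex D f A \<in> th Y (Apply f t)" using th_Apply[OF f t(4)] ff A by simp
    then show "p \<in> henkin_sem Y (Ex D f A)"
      unfolding p t(2) henkin_act_cls(1)[OF t(1) f t(4)] unfolding henkin_sem_cls[OF t(1) henkin_act_cls(2)[OF t(1) f t(4)]] .
  qed
  then show "\<exists>B\<in>carrier (Fib D Y). henkin_sem Y B = henkin_act f ` henkin_sem X A"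
    by (intro bexI[of _ "Ex D f A"]) (use ff A in auto)
qed

end

section \<open>The syntactic category\<close>

locale doctrine_model = topological_modal_doctrine D CD + boolean_semantics D El act sem fib
  for D :: "('o, 'a, 'd) doctrine" and CD :: "('o, 'd) rel set" and El :: "'o \<Rightarrow> 'p set"
    and act :: "'a \<Rightarrow> 'p \<Rightarrow> 'p" and sem :: "'o \<Rightarrow> 'd \<Rightarrow> 'p set" and fib :: "'p \<Rightarrow> 'm"
begin

section \<open>Definable and tame sets of pairs\<close>

definition definable :: "'o \<Rightarrow> 'o \<Rightarrow> ('p \<times> 'p) set \<Rightarrow> bool" where
  "definable X Y \<rho> \<longleftrightarrow> (\<exists>R. is_rel D (X, Y, R) \<and> rsem (X, Y, R) = \<rho>)"

text \<open>Membership in \<open>CD\<close> up to passing to a subset. Members of \<open>CD\<close>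
  are single-valued, so a tame set of pairs is a member of \<open>CD\<close> cut down to the domain
  of that set. As tameness is inherited by subsets, domains need not be tracked when tame sets are
  composed.\<close>

definition tame :: "'o \<Rightarrow> 'o \<Rightarrow> ('p \<times> 'p) set \<Rightarrow> bool" where
  "tame X Y \<rho> \<longleftrightarrow> (\<exists>R. (X, Y, R) \<in> CD \<and> \<rho> \<subseteq> rsem (X, Y, R))"

lemma CD_rel: "(X, Y, R) \<in> CD \<Longrightarrow> is_rel D (X, Y, R) \<and> single_valued (rsem (X, Y, R))"
  using CD_partial_map[of "(X, Y, R)"] partial_map_iff[of X Y R] by (auto simp: partial_map_def)

lemma definable_fib: "\<lbrakk>definable X Y \<rho>; (a, b) \<in> \<rho>\<rbrakk> \<Longrightarrow> fib a = fib b"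
  using rsem_fib by (auto simp: definable_def)

lemma definable_O: "\<lbrakk>definable X Y \<rho>; definable Y Z \<sigma>\<rbrakk> \<Longrightarrow> definable X Z (\<rho> O \<sigma>)"
  unfolding definable_def using rel_comp_sem by metis

lemma definable_converse: "definable X Y \<rho> \<Longrightarrow> definable Y X (\<rho>\<inverse>)"
  unfolding definable_def using rel_conv_sem by metis

lemma definable_graph: "f \<in> hom (Base D) X Y \<Longrightarrow> definable X Y ((\<lambda>a. (a, act f a)) ` El X)"
  unfolding definable_def using rel_graph_sem by metis

lemma definable_restrict:
  "\<lbrakk>definable X Y \<rho>; A \<in> carrier (Fib D X)\<rbrakk> \<Longrightarrow> definable X Y (\<rho> \<inter> sem X A \<times> UNIV)"
  unfolding definable_def using rel_restrict_sem by metis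

lemma definable_Id_on: "\<lbrakk>X \<in> Ob (Base D); A \<in> carrier (Fib D X)\<rbrakk> \<Longrightarrow> definable X X (Id_on (sem X A))"
proof -
  assume X: "X \<in> Ob (Base D)" and A: "A \<in> carrier (Fib D X)"
  have "definable X X (Id_on (El X))" unfolding definable_def using rel_id_sem[OF X] by metis
  from definable_restrict[OF this A] have "definable X X (Id_on (El X) \<inter> sem X A \<times> UNIV)" .
  moreover have "Id_on (El X) \<inter> sem X A \<times> UNIV = Id_on (sem X A)" using sem_subset[OF X A] by auto
  ultimately show ?thesis by simp
qed

lemma definable_Int:
  assumes "definable X Y \<rho>" "definable X Y \<sigma>"
  shows "definable X Y (\<rho> \<inter> \<sigma>)"
proof -
  obtain R S where R: "is_rel D (X, Y, R)" "rsem (X, Y, R) = \<rho>" and S: "is_rel D (X, Y, S)" "rsem (X, Y, S) = \<sigma>"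
    using assms by (auto simp: definable_def)
  let ?P = "prod_ob (Base D) X Y"
  have c: "?P \<in> Ob (Base D)" "R \<in> carrier (Fib D ?P)" "S \<in> carrier (Fib D ?P)"
    using is_relD[OF R(1)] is_relD[OF S(1)] by auto
  note m = sem_meet[OF c]
  have i: "is_rel D (X, Y, R \<sqinter>\<^bsub>Fib D ?P\<^esub> S)" using m R S by (simp add: is_rel_def)
  have "rsem (X, Y, R \<sqinter>\<^bsub>Fib D ?P\<^esub> S) = \<rho> \<inter> \<sigma>"
    using m by (auto simp: rsem_iff i rsem_iff[OF R(1)] rsem_iff[OF S(1)] R(2)[symmetric] S(2)[symmetric])
  then show ?thesis using i by (auto simp: definable_def)
qed

lemma definable_Domain:
  assumes "definable X Y \<rho>"
  obtains A where "A \<in> carrier (Fib D X)" "sem X A = Domain \<rho>"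
  using assms rel_dom_sem unfolding definable_def by metis

lemma definable_Range:
  assumes "definable X Y \<rho>"
  obtains A where "A \<in> carrier (Fib D Y)" "sem Y A = Range \<rho>"
  using assms rel_dom_sem unfolding definable_def by metis

lemma definable_Image:
  assumes "definable X Y \<rho>" "A \<in> carrier (Fib D X)"
  obtains B where "B \<in> carrier (Fib D Y)" "sem Y B = \<rho> `` sem X A"
  using assms rel_image_sem unfolding definable_def by metis

lemma tame_mono: "\<lbrakk>tame X Y \<rho>; \<sigma> \<subseteq> \<rho>\<rbrakk> \<Longrightarrow> tame X Y \<sigma>"
  unfolding tame_def by blast

lemma tame_O: "\<lbrakk>tame X Y \<rho>; tame Y Z \<sigma>\<rbrakk> \<Longrightarrow> tame X Z (\<rho> O \<sigma>)"
proof -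
  assume "tame X Y \<rho>" "tame Y Z \<sigma>"
  then obtain R S where R: "(X, Y, R) \<in> CD" "\<rho> \<subseteq> rsem (X, Y, R)" and S: "(Y, Z, S) \<in> CD" "\<sigma> \<subseteq> rsem (Y, Z, S)"
    by (auto simp: tame_def)
  let ?T = "rel_comp D (Y, Z, S) (X, Y, R)"
  note c = rel_comp_sem[of X Y R Z S]
  have i: "is_rel D (X, Y, R)" "is_rel D (Y, Z, S)" using CD_rel R S by auto
  have "(X, Z, snd (snd ?T)) \<in> CD" using CD_comp[OF R(1) S(1)] c(1)[OF i] by simp
  moreover have "\<rho> O \<sigma> \<subseteq> rsem (X, Z, snd (snd ?T))" using c(3)[OF i] c(1)[OF i, symmetric] R(2) S(2) by auto
  ultimately show ?thesis by (auto simp: tame_def)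
qed

lemma tame_graph: "f \<in> hom (Base D) X Y \<Longrightarrow> tame X Y ((\<lambda>a. (a, act f a)) ` El X)"
proof -
  assume f: "f \<in> hom (Base D) X Y"
  then have "rel_graph D f \<in> CD" using CD_graph by (simp add: hom_def)
  then show ?thesis unfolding tame_def using rel_graph_sem[OF f] by (metis subset_refl)
qed

lemma tame_Id_on: "\<lbrakk>X \<in> Ob (Base D); A \<subseteq> El X\<rbrakk> \<Longrightarrow> tame X X (Id_on A)"
proof -
  assume X: "X \<in> Ob (Base D)" and A: "A \<subseteq> El X"
  have i: "ide (Base D) X \<in> hom (Base D) X X" using X by (simp add: hom_def)
  show ?thesis by (rule tame_mono[OF tame_graph[OF i]]) (use A X in auto)
qed

lemma tame_prod:
  assumes "tame X X' \<rho>" "tame Y Y' \<sigma>" and "X \<in> Ob (Base D)" "X' \<in> Ob (Base D)" "Y \<in> Ob (Base D)" "Y' \<in> Ob (Base D)"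
  shows "tame (prod_ob (Base D) X Y) (prod_ob (Base D) X' Y')
    {(c, c'). c \<in> El (prod_ob (Base D) X Y) \<and> c' \<in> El (prod_ob (Base D) X' Y') \<and> fib c = fib c' \<and>
      (act (pr1 (Base D) X Y) c, act (pr1 (Base D) X' Y') c') \<in> \<rho> \<and>
      (act (pr2 (Base D) X Y) c, act (pr2 (Base D) X' Y') c') \<in> \<sigma>}"
proof -
  from assms obtain R S where R: "(X, X', R) \<in> CD" "\<rho> \<subseteq> rsem (X, X', R)" and S: "(Y, Y', S) \<in> CD" "\<sigma> \<subseteq> rsem (Y, Y', S)"
    by (auto simp: tame_def)
  have i: "is_rel D (X, X', R)" "is_rel D (Y, Y', S)" using CD_rel R S by auto
  note p = rel_prod_sem[OF i]
  show ?thesis unfolding tame_def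
  proof (rule exI, rule conjI)
    show "(prod_ob (Base D) X Y, prod_ob (Base D) X' Y', snd (snd (rel_prod D (X, X', R) (Y, Y', S)))) \<in> CD"
      using CD_prod[OF R(1) S(1)] p(1) by simp
  qed (use R(2) S(2) p(1)[symmetric] p(3) in auto)
qed

section \<open>Arrows of the syntactic category as functions on points\<close>

abbreviation SA :: "(('o, 'd) formula, ('o, 'd) synt_map) cat" where
  "SA \<equiv> Synt_S4 D CD"

abbreviation pts :: "('o, 'd) formula \<Rightarrow> 'p set" where
  "pts P \<equiv> sem (fst P) (snd P)"

definition gr :: "('o, 'd) synt_map \<Rightarrow> ('p \<times> 'p) set" where
  "gr f = rsem (map_rel f)"

lemma SA_sel: "Ob SA = formulas D" "Dom SA f = fst f" "Cod SA f = fst (snd f)"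
  by (simp_all add: Synt_S4_def Synt_BA_def)

lemma formulas_iff: "P \<in> formulas D \<longleftrightarrow> fst P \<in> Ob (Base D) \<and> snd P \<in> carrier (Fib D (fst P))"
  by (auto simp: formulas_def)

lemma pts_El: "P \<in> formulas D \<Longrightarrow> pts P \<subseteq> El (fst P)"
  by (simp add: formulas_iff sem_subset)

definition cmap :: "('o, 'd) formula \<Rightarrow> ('o, 'd) formula \<Rightarrow> ('p \<times> 'p) set \<Rightarrow> bool" where
  "cmap P Q \<rho> \<longleftrightarrow> P \<in> formulas D \<and> Q \<in> formulas D \<and> definable (fst P) (fst Q) \<rho> \<and>
     tame (fst P) (fst Q) \<rho> \<and> single_valued \<rho> \<and> Domain \<rho> = pts P \<and> Range \<rho> \<subseteq> pts Q"

lemma map_rel_eq: "map_rel f = (fst (fst f), fst (fst (snd f)), snd (snd f))"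
  by (simp add: map_rel_def split_beta)

text \<open>The dictionary between syntax and points. Its only substantial part is that continuity
  means tameness: if \<open>R\<close> has domain \<open>\<phi>\<close> and is contained in a
  single-valued member of \<open>CD\<close>, then it is the restriction of that member to
  \<open>\<phi>\<close>.\<close>

lemma hom_SA_iff:
  "f \<in> hom SA P Q \<longleftrightarrow> f = (P, Q, snd (snd f)) \<and> is_rel D (fst P, fst Q, snd (snd f)) \<and>
     cmap P Q (rsem (fst P, fst Q, snd (snd f)))"
proof -
  obtain P' Q' R where f: "f = (P', Q', R)" by (cases f)
  show ?thesis
  proof (cases "P' = P \<and> Q' = Q \<and> P \<in> formulas D \<and> Q \<in> formulas D \<and> is_rel D (fst P, fst Q, R)")
    case False
    then show ?thesis
      unfolding f hom_def Synt_S4_def Synt_BA_def partial_map_def by (auto simp: cmap_def)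
  next
    case True
    obtain X \<phi> Y \<psi> where P: "P = (X, \<phi>)" and Q: "Q = (Y, \<psi>)" by (cases P, cases Q)
    have i: "is_rel D (X, Y, R)" and F: "X \<in> Ob (Base D)" "\<phi> \<in> carrier (Fib D X)" "Y \<in> Ob (Base D)" "\<psi> \<in> carrier (Fib D Y)"
      using True by (auto simp: P Q formulas_iff)
    note d = rel_dom_sem[OF i]
    have "f \<in> hom SA P Q \<longleftrightarrow> partial_map D (X, Y, R) \<and> rel_dom D (X, Y, R) = \<phi> \<and>
        rel_im D (X, Y, R) \<sqsubseteq>\<^bsub>Fib D Y\<^esub> \<psi> \<and> continuous_map D CD f"
      using True unfolding f P Q hom_def Synt_S4_def Synt_BA_def by auto
    also have "\<dots> \<longleftrightarrow> single_valued (rsem (X, Y, R)) \<and> Domain (rsem (X, Y, R)) = sem X \<phi> \<and>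
        Range (rsem (X, Y, R)) \<subseteq> sem Y \<psi> \<and> continuous_map D CD f"
      using partial_map_iff[OF i] d sem_inject[OF F(1) d(1) F(2)] sem_le[OF F(3) d(3) F(4)] by auto
    also have "\<dots> \<longleftrightarrow> cmap P Q (rsem (X, Y, R))"
    proof -
      have "continuous_map D CD f \<longleftrightarrow> tame X Y (rsem (X, Y, R))"
        if sv: "single_valued (rsem (X, Y, R))" "Domain (rsem (X, Y, R)) = sem X \<phi>"
      proof
        assume "continuous_map D CD f"
        then obtain r \<theta> where r: "r \<in> CD" "\<theta> \<in> carrier (Fib D (fst r))" "map_rel f = rel_restrict D r \<theta>"
          by (auto simp: continuous_map_def)
        obtain X' Y' R' where r': "r = (X', Y', R')" by (cases r)
        have i': "is_rel D (X', Y', R')" using CD_rel r r' by simp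
        note q = rel_restrict_sem[OF i'] r(2)[unfolded r' fst_conv]
        have t: "(X, Y, R) = rel_restrict D (X', Y', R') \<theta>" using r(3) True by (simp add: f P Q r' map_rel_eq)
        then have "(X, Y, R) = (X', Y', snd (snd (rel_restrict D (X', Y', R') \<theta>)))" using q(1)[OF q(4)] by simp
        moreover have "rsem (X, Y, R) \<subseteq> rsem (X', Y', R')" using q(3)[OF q(4)] t by simp
        ultimately have "X' = X" "Y' = Y" "rsem (X, Y, R) \<subseteq> rsem (X', Y', R')" by auto
        then show "tame X Y (rsem (X, Y, R))" using r(1) r' by (auto simp: tame_def)
      next
        assume "tame X Y (rsem (X, Y, R))"
        then obtain R' where R': "(X, Y, R') \<in> CD" "rsem (X, Y, R) \<subseteq> rsem (X, Y, R')" by (auto simp: tame_def)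
        have i': "is_rel D (X, Y, R')" "single_valued (rsem (X, Y, R'))" using CD_rel R' by auto
        note q = rel_restrict_sem[OF i'(1) F(2)]
        \<comment> \<open>A point of \<open>\<phi>\<close> has some value under \<open>R\<close>,
          and single-valuedness of \<open>R'\<close> leaves no room for another.\<close>
        have "rsem (X, Y, R) = rsem (X, Y, R') \<inter> sem X \<phi> \<times> UNIV"
        proof
          show "rsem (X, Y, R) \<subseteq> rsem (X, Y, R') \<inter> sem X \<phi> \<times> UNIV" using R'(2) sv(2) by auto
          show "rsem (X, Y, R') \<inter> sem X \<phi> \<times> UNIV \<subseteq> rsem (X, Y, R)"
          proof clarify
            fix a b assume ab: "(a, b) \<in> rsem (X, Y, R')" "a \<in> sem X \<phi>"
            then obtain c where "(a, c) \<in> rsem (X, Y, R)" using sv(2) by blast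
            then show "(a, b) \<in> rsem (X, Y, R)" using ab R'(2) i'(2) by (metis single_valuedD subsetD)
          qed
        qed
        then have "R = snd (snd (rel_restrict D (X, Y, R') \<phi>))"
          using rel_ext[OF i, of "snd (snd (rel_restrict D (X, Y, R') \<phi>))"] q by simp
        moreover have "map_rel f = (X, Y, R)" using True by (simp add: f P Q map_rel_eq)
        ultimately have "map_rel f = rel_restrict D (X, Y, R') \<phi>" using q(1) by metis
        moreover have "sem X \<phi> \<subseteq> Domain (rsem (X, Y, R'))" using sv(2) R'(2) by blast
        then have "\<phi> \<sqsubseteq>\<^bsub>Fib D X\<^esub> rel_dom D (X, Y, R')"
          using rel_dom_sem[OF i'(1)] sem_le[OF F(1,2)] by simp
        ultimately show "continuous_map D CD f"
          unfolding continuous_map_def using R'(1) F(2) by (metis fst_conv)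
      qed
      then show ?thesis using True i by (auto simp: cmap_def P Q definable_def)
    qed
    finally show ?thesis using True i by (simp add: f P Q)
  qed
qed

lemma gr_hom: "f \<in> hom SA P Q \<Longrightarrow> cmap P Q (gr f)"
  using hom_SA_iff[of f P Q] by (metis gr_def map_rel_eq fst_conv snd_conv)

lemma gr_inject: "\<lbrakk>f \<in> hom SA P Q; g \<in> hom SA P Q; gr f = gr g\<rbrakk> \<Longrightarrow> f = g"
proof -
  assume f: "f \<in> hom SA P Q" and g: "g \<in> hom SA P Q" and e: "gr f = gr g"
  have fe: "f = (P, Q, snd (snd f))" "is_rel D (fst P, fst Q, snd (snd f))" using f hom_SA_iff[of f P Q] by auto
  have ge: "g = (P, Q, snd (snd g))" "is_rel D (fst P, fst Q, snd (snd g))" using g hom_SA_iff[of g P Q] by auto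
  have "map_rel f = (fst P, fst Q, snd (snd f))" "map_rel g = (fst P, fst Q, snd (snd g))"
    using fe(1) ge(1) map_rel_eq by (metis fst_conv snd_conv)+
  then have "snd (snd f) = snd (snd g)" using rel_ext[OF fe(2) ge(2)] e by (simp add: gr_def)
  then show "f = g" using fe(1) ge(1) by metis
qed

lemma hom_exists:
  assumes "cmap P Q \<rho>"
  obtains f where "f \<in> hom SA P Q" "gr f = \<rho>"
proof -
  obtain R where R: "is_rel D (fst P, fst Q, R)" "rsem (fst P, fst Q, R) = \<rho>"
    using assms by (auto simp: cmap_def definable_def)
  have "(P, Q, R) \<in> hom SA P Q" using R assms by (simp add: hom_SA_iff)
  moreover have "gr (P, Q, R) = \<rho>" using R by (simp add: gr_def map_rel_eq)
  ultimately show ?thesis using that by blast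
qed

lemma cmap_O: "\<lbrakk>cmap P Q \<rho>; cmap Q R \<sigma>\<rbrakk> \<Longrightarrow> cmap P R (\<rho> O \<sigma>)"
  unfolding cmap_def by (auto intro: definable_O tame_O single_valued_relcomp; blast)

lemma cmap_Id_on:
  assumes "(X, \<phi>) \<in> formulas D" "(X, \<psi>) \<in> formulas D" "sem X \<phi> \<subseteq> sem X \<psi>"
  shows "cmap (X, \<phi>) (X, \<psi>) (Id_on (sem X \<phi>))"
  using assms sem_subset[of X \<phi>] unfolding cmap_def
  by (auto simp: formulas_iff intro!: definable_Id_on tame_Id_on single_valued_Id_on)

lemma inclusion_map_hom:
  assumes "(X, \<phi>) \<in> formulas D" "(X, \<psi>) \<in> formulas D" "sem X \<phi> \<subseteq> sem X \<psi>"
  shows "inclusion_map D X \<phi> \<psi> \<in> hom SA (X, \<phi>) (X, \<psi>)" "gr (inclusion_map D X \<phi> \<psi>) = Id_on (sem X \<phi>)"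
proof -
  have X: "X \<in> Ob (Base D)" and \<phi>: "\<phi> \<in> carrier (Fib D X)" using assms by (auto simp: formulas_iff)
  note r = rel_id_sem[OF X]
  let ?R = "snd (snd (rel_id D X))"
  have i: "is_rel D (X, X, ?R)" using r by simp
  note q = rel_restrict_sem[OF i \<phi>, unfolded r(1)[symmetric]]
  let ?T = "snd (snd (rel_restrict D (rel_id D X) \<phi>))"
  have t: "is_rel D (X, X, ?T)" "rsem (X, X, ?T) = Id_on (sem X \<phi>)"
    using q r(3) sem_subset[OF X \<phi>] by auto
  then show "inclusion_map D X \<phi> \<psi> \<in> hom SA (X, \<phi>) (X, \<psi>)"
    using cmap_Id_on[OF assms] by (simp add: hom_SA_iff inclusion_map_def)
  show "gr (inclusion_map D X \<phi> \<psi>) = Id_on (sem X \<phi>)"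
    using t by (simp add: gr_def map_rel_def inclusion_map_def)
qed

lemma ide_SA:
  assumes "P \<in> formulas D"
  shows "ide SA P \<in> hom SA P P" "gr (ide SA P) = Id_on (pts P)"
proof -
  have "ide SA P = inclusion_map D (fst P) (snd P) (snd P)"
    by (simp add: Synt_S4_def Synt_BA_def inclusion_map_def split_beta)
  then show "ide SA P \<in> hom SA P P" "gr (ide SA P) = Id_on (pts P)"
    using inclusion_map_hom[of "fst P" "snd P" "snd P"] assms by auto
qed

lemma Comp_SA:
  assumes "f \<in> hom SA P Q" "g \<in> hom SA Q R"
  shows "g \<cdot>\<^bsub>SA\<^esub> f \<in> hom SA P R" "gr (g \<cdot>\<^bsub>SA\<^esub> f) = gr f O gr g"
proof -
  have f: "f = (P, Q, snd (snd f))" "is_rel D (fst P, fst Q, snd (snd f))" using assms(1) hom_SA_iff[of f P Q] by auto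
  have g: "g = (Q, R, snd (snd g))" "is_rel D (fst Q, fst R, snd (snd g))" using assms(2) hom_SA_iff[of g Q R] by auto
  note c = rel_comp_sem[OF f(2) g(2)]
  have m: "map_rel f = (fst P, fst Q, snd (snd f))" "map_rel g = (fst Q, fst R, snd (snd g))"
    using f(1) g(1) map_rel_eq by (metis fst_conv snd_conv)+
  have e: "g \<cdot>\<^bsub>SA\<^esub> f = (P, R, snd (snd (rel_comp D (map_rel g) (map_rel f))))"
  proof -
    have "fst f = P" "fst (snd g) = R" using f(1) g(1) by (metis fst_conv snd_conv)+
    then show ?thesis by (simp add: Synt_S4_def Synt_BA_def)
  qed
  have r: "rsem (fst P, fst R, snd (snd (rel_comp D (map_rel g) (map_rel f)))) = gr f O gr g"
    "is_rel D (fst P, fst R, snd (snd (rel_comp D (map_rel g) (map_rel f))))"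
    using c by (simp_all add: gr_def m)
  then show "g \<cdot>\<^bsub>SA\<^esub> f \<in> hom SA P R"
    using cmap_O[OF gr_hom[OF assms(1)] gr_hom[OF assms(2)]] by (simp add: hom_SA_iff e)
  have "gr (g \<cdot>\<^bsub>SA\<^esub> f) = rsem (fst P, fst R, snd (snd (rel_comp D (map_rel g) (map_rel f))))"
    unfolding gr_def e by (simp add: map_rel_eq[of "(P, R, _)"])
  then show "gr (g \<cdot>\<^bsub>SA\<^esub> f) = gr f O gr g" unfolding r(1) .
qed

lemma Arr_SA: "f \<in> Arr SA \<longleftrightarrow> f \<in> hom SA (Dom SA f) (Cod SA f)"
  by (simp add: hom_def)

lemma category_SA: "category SA"
proof
  fix f assume "f \<in> Arr SA"
  then show "Dom SA f \<in> Ob SA" "Cod SA f \<in> Ob SA"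
    using gr_hom unfolding Arr_SA by (auto simp: cmap_def SA_sel)
next
  fix f X Y assume f: "f \<in> hom SA X Y"
  then have XY: "X \<in> formulas D" "Y \<in> formulas D" using gr_hom by (auto simp: cmap_def)
  have "Domain (gr f) = pts X" "Range (gr f) \<subseteq> pts Y" using gr_hom[OF f] by (auto simp: cmap_def)
  then have d: "Id_on (pts X) O gr f = gr f" "gr f O Id_on (pts Y) = gr f" by auto
  show "ide SA Y \<cdot>\<^bsub>SA\<^esub> f = f"
    by (rule gr_inject[OF Comp_SA(1)[OF f ide_SA(1)[OF XY(2)]] f])
      (use Comp_SA(2)[OF f ide_SA(1)[OF XY(2)]] ide_SA(2)[OF XY(2)] d in simp)
  show "f \<cdot>\<^bsub>SA\<^esub> ide SA X = f"
    by (rule gr_inject[OF Comp_SA(1)[OF ide_SA(1)[OF XY(1)] f] f])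
      (use Comp_SA(2)[OF ide_SA(1)[OF XY(1)] f] ide_SA(2)[OF XY(1)] d in simp)
next
  fix f g h W X Y Z assume f: "f \<in> hom SA W X" and g: "g \<in> hom SA X Y" and h: "h \<in> hom SA Y Z"
  note gf = Comp_SA[OF f g] note hg = Comp_SA[OF g h]
  show "h \<cdot>\<^bsub>SA\<^esub> g \<cdot>\<^bsub>SA\<^esub> f = (h \<cdot>\<^bsub>SA\<^esub> g) \<cdot>\<^bsub>SA\<^esub> f"
    by (rule gr_inject[OF Comp_SA(1)[OF gf(1) h] Comp_SA(1)[OF f hg(1)]])
      (use Comp_SA(2)[OF gf(1) h] Comp_SA(2)[OF f hg(1)] gf hg in auto)
qed (use ide_SA Comp_SA in \<open>auto simp: SA_sel\<close>)

sublocale SA: category SA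
  by (rule category_SA)

definition ap :: "('o, 'd) synt_map \<Rightarrow> 'p \<Rightarrow> 'p" where
  "ap f a = (THE b. (a, b) \<in> gr f)"

lemma hom_formulas: "f \<in> hom SA P Q \<Longrightarrow> P \<in> formulas D \<and> Q \<in> formulas D"
  using gr_hom by (auto simp: cmap_def)

lemma gr_iff:
  assumes "f \<in> hom SA P Q"
  shows "(a, b) \<in> gr f \<longleftrightarrow> a \<in> pts P \<and> b = ap f a"
proof -
  have s: "single_valued (gr f)" "Domain (gr f) = pts P" using gr_hom[OF assms] by (auto simp: cmap_def)
  have "ap f a = b" if "(a, b) \<in> gr f" for a b
    unfolding ap_def using that s(1) by (auto dest: single_valuedD)
  then show ?thesis using s(2) by (metis Domain_iff DomainI)
qed

lemma gr_eq:
  assumes "f \<in> hom SA P Q"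
  shows "gr f = (\<lambda>a. (a, ap f a)) ` pts P"
  using gr_iff[OF assms] by (auto simp: image_iff)

lemma iso_ide_SA:
  assumes "P \<in> formulas D"
  shows "iso SA (ide SA P)"
  using ide_SA(1)[OF assms] by (auto simp: iso_def hom_def intro!: bexI[of _ "ide SA P"])

lemma ap_pts: "\<lbrakk>f \<in> hom SA P Q; a \<in> pts P\<rbrakk> \<Longrightarrow> ap f a \<in> pts Q"
  using gr_hom[of f P Q] gr_iff[of f P Q a "ap f a"] unfolding cmap_def by (auto simp: Range_iff)

lemma fib_ap: "\<lbrakk>f \<in> hom SA P Q; a \<in> pts P\<rbrakk> \<Longrightarrow> fib (ap f a) = fib a"
  using gr_hom[of f P Q] gr_iff[of f P Q a "ap f a"] definable_fib unfolding cmap_def by metis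

lemma ap_inject:
  assumes "f \<in> hom SA P Q" "g \<in> hom SA P Q" "\<And>a. a \<in> pts P \<Longrightarrow> ap f a = ap g a"
  shows "f = g"
  by (rule gr_inject[OF assms(1,2)]) (use gr_eq[OF assms(1)] gr_eq[OF assms(2)] assms(3) in auto)

lemma ap_Comp: "\<lbrakk>f \<in> hom SA P Q; g \<in> hom SA Q R; a \<in> pts P\<rbrakk> \<Longrightarrow> ap (g \<cdot>\<^bsub>SA\<^esub> f) a = ap g (ap f a)"
  using gr_iff[OF Comp_SA(1), of f P Q g R a "ap g (ap f a)"] Comp_SA(2)[of f P Q g R] gr_iff[of f P Q] gr_iff[of g Q R]
    ap_pts[of f P Q a] by (auto simp: relcomp_unfold)

lemma ap_ide: "\<lbrakk>P \<in> formulas D; a \<in> pts P\<rbrakk> \<Longrightarrow> ap (ide SA P) a = a"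
  using gr_iff[OF ide_SA(1), of P a a] ide_SA(2)[of P] by auto

lemma ap_inclusion:
  assumes "(X, \<phi>) \<in> formulas D" "(X, \<psi>) \<in> formulas D" "sem X \<phi> \<subseteq> sem X \<psi>" "a \<in> sem X \<phi>"
  shows "ap (inclusion_map D X \<phi> \<psi>) a = a"
  using gr_iff[OF inclusion_map_hom(1)[OF assms(1-3)], of a a] inclusion_map_hom(2)[OF assms(1-3)] assms(4) by auto

section \<open>Embeddings, surjections and the factorization system\<close>

definition embed :: "('o, 'd) synt_map \<Rightarrow> bool" where
  "embed m \<longleftrightarrow> m \<in> Arr SA \<and> single_valued ((gr m)\<inverse>) \<and> tame (fst (Cod SA m)) (fst (Dom SA m)) ((gr m)\<inverse>)"

lemma embed_inj: "\<lbrakk>embed m; m \<in> hom SA P Q; a \<in> pts P; b \<in> pts P; ap m a = ap m b\<rbrakk> \<Longrightarrow> a = b"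
  using gr_iff[of m P Q] unfolding embed_def by (metis converseI single_valuedD)

text \<open>The converse of \<open>m\<close> is a partial function that is definable and tame. Cut
  down to a formula \<open>\<theta>\<close> inside the image of \<open>m\<close>, it has domain
  \<open>\<theta>\<close>, so it is an arrow.\<close>

lemma embed_inverse:
  assumes m: "embed m" "m \<in> hom SA P Q" and T: "(fst Q, \<theta>) \<in> formulas D" "sem (fst Q) \<theta> \<subseteq> ap m ` pts P"
  obtains u where "u \<in> hom SA (fst Q, \<theta>) P" "\<And>b. b \<in> sem (fst Q) \<theta> \<Longrightarrow> ap m (ap u b) = b"
    "gr u \<subseteq> (gr m)\<inverse>"
proof -
  have PQ: "P \<in> formulas D" "Q \<in> formulas D" using hom_formulas[OF m(2)] by auto
  have d: "Dom SA m = P" "Cod SA m = Q" using m(2) by (auto simp: hom_def)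
  let ?r = "(gr m)\<inverse> \<inter> sem (fst Q) \<theta> \<times> UNIV"
  have "cmap (fst Q, \<theta>) P ?r"
    unfolding cmap_def
  proof (intro conjI)
    show "definable (fst (fst Q, \<theta>)) (fst P) ?r"
      using gr_hom[OF m(2)] T(1) by (auto simp: cmap_def formulas_iff intro!: definable_restrict definable_converse)
    show "tame (fst (fst Q, \<theta>)) (fst P) ?r"
      using m(1) d by (auto simp: embed_def intro: tame_mono)
    show "single_valued ?r" using m(1) by (auto simp: embed_def intro: single_valued_subset[rotated])
    show "Domain ?r = pts (fst Q, \<theta>)" using T(2) by (fastforce simp: Domain_iff gr_iff[OF m(2)])
    show "Range ?r \<subseteq> pts P" using gr_eq[OF m(2)] by auto
  qed (use PQ T in auto)
  then obtain u where u: "u \<in> hom SA (fst Q, \<theta>) P" "gr u = ?r" by (rule hom_exists)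
  have "ap m (ap u b) = b" if "b \<in> sem (fst Q) \<theta>" for b
    using gr_iff[OF u(1), of b "ap u b"] u(2) gr_iff[OF m(2)] that by auto
  then show ?thesis using that u by blast
qed

text \<open>Tameness of the converse is exactly what a bijective arrow needs in order that its
  inverse be continuous.\<close>

lemma iso_iff: "iso SA f \<longleftrightarrow> embed f \<and> Range (gr f) = pts (Cod SA f)"
proof
  assume "iso SA f"
  then obtain g where f: "f \<in> hom SA (Dom SA f) (Cod SA f)" and g: "g \<in> hom SA (Cod SA f) (Dom SA f)"
    and e: "g \<cdot>\<^bsub>SA\<^esub> f = ide SA (Dom SA f)" "f \<cdot>\<^bsub>SA\<^esub> g = ide SA (Cod SA f)"
    by (auto simp: iso_def Arr_SA)
  have o: "Dom SA f \<in> formulas D" "Cod SA f \<in> formulas D" using hom_formulas[OF f] by auto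
  have 1: "ap g (ap f a) = a" if "a \<in> pts (Dom SA f)" for a using ap_Comp[OF f g that] e ap_ide[OF o(1) that] by simp
  have 2: "ap f (ap g b) = b" if "b \<in> pts (Cod SA f)" for b using ap_Comp[OF g f that] e ap_ide[OF o(2) that] by simp
  have "(gr f)\<inverse> = gr g"
    using gr_iff[OF f] gr_iff[OF g] 1 2 ap_pts[OF f] ap_pts[OF g] by auto
  then show "embed f \<and> Range (gr f) = pts (Cod SA f)"
    using f gr_hom[OF g] unfolding embed_def cmap_def Arr_SA by (metis Domain_converse)
next
  assume *: "embed f \<and> Range (gr f) = pts (Cod SA f)"
  then have f: "f \<in> hom SA (Dom SA f) (Cod SA f)" by (auto simp: embed_def Arr_SA)
  have o: "Dom SA f \<in> formulas D" "Cod SA f \<in> formulas D" using hom_formulas[OF f] by auto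
  have r: "pts (Cod SA f) = ap f ` pts (Dom SA f)" using * gr_eq[OF f] by auto
  have T: "(fst (Cod SA f), snd (Cod SA f)) \<in> formulas D" using o by simp
  obtain g where "g \<in> hom SA (fst (Cod SA f), snd (Cod SA f)) (Dom SA f)"
    "\<And>b. b \<in> pts (Cod SA f) \<Longrightarrow> ap f (ap g b) = b"
    using embed_inverse[OF conjunct1[OF *] f T eq_refl[OF r]] by metis
  then have g: "g \<in> hom SA (Cod SA f) (Dom SA f)" "\<And>b. b \<in> pts (Cod SA f) \<Longrightarrow> ap f (ap g b) = b" by simp_all
  have "g \<cdot>\<^bsub>SA\<^esub> f = ide SA (Dom SA f)"
  proof (rule ap_inject[OF Comp_SA(1)[OF f g(1)] ide_SA(1)[OF o(1)]])
    fix a assume a: "a \<in> pts (Dom SA f)"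
    have "ap g (ap f a) = a"
      by (rule embed_inj[OF _ f]) (use * a ap_pts[OF f a] ap_pts[OF g(1)] g(2) in auto)
    then show "ap (g \<cdot>\<^bsub>SA\<^esub> f) a = ap (ide SA (Dom SA f)) a" using ap_Comp[OF f g(1) a] ap_ide[OF o(1) a] by simp
  qed
  moreover have "f \<cdot>\<^bsub>SA\<^esub> g = ide SA (Cod SA f)"
    by (rule ap_inject[OF Comp_SA(1)[OF g(1) f] ide_SA(1)[OF o(2)]])
      (use ap_Comp[OF g(1) f] ap_ide[OF o(2)] g(2) in auto)
  ultimately show "iso SA f" using f g(1) by (auto simp: iso_def Arr_SA)
qed

lemma Synt_E_iff: "e \<in> Synt_E D CD \<longleftrightarrow> e \<in> Arr SA \<and> Range (gr e) = pts (Cod SA e)"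
proof -
  have "rel_im D (map_rel e) = snd (Cod SA e) \<longleftrightarrow> Range (gr e) = pts (Cod SA e)" if "e \<in> Arr SA"
  proof -
    have e: "e \<in> hom SA (Dom SA e) (Cod SA e)" using that by (simp add: Arr_SA)
    let ?Y = "fst (Cod SA e)"
    have i: "is_rel D (fst (Dom SA e), ?Y, snd (snd e))" using e hom_SA_iff by auto
    have m: "map_rel e = (fst (Dom SA e), ?Y, snd (snd e))" by (simp add: map_rel_eq SA_sel)
    note d = rel_dom_sem(3,4)[OF i]
    have o: "?Y \<in> Ob (Base D)" "snd (Cod SA e) \<in> carrier (Fib D ?Y)"
      using hom_formulas[OF e] by (auto simp: formulas_iff)
    show ?thesis using d sem_inject[OF o(1) d(1) o(2)] unfolding gr_def m by auto
  qed
  then show ?thesis by (auto simp: Synt_E_def)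
qed

lemma image_formula:
  assumes "f \<in> hom SA P Q"
  obtains \<theta> where "(fst Q, \<theta>) \<in> formulas D" "sem (fst Q) \<theta> = ap f ` pts P" "sem (fst Q) \<theta> \<subseteq> pts Q"
proof -
  have c: "cmap P Q (gr f)" using gr_hom[OF assms] .
  then have df: "definable (fst P) (fst Q) (gr f)" by (simp add: cmap_def)
  obtain \<theta> where "\<theta> \<in> carrier (Fib D (fst Q))" "sem (fst Q) \<theta> = Range (gr f)"
    using definable_Range[OF df] .
  moreover have "Range (gr f) = ap f ` pts P" using gr_eq[OF assms] by auto
  ultimately show ?thesis using that c by (auto simp: cmap_def formulas_iff)
qed

text \<open>Replaces the closure under isomorphism in \<open>Synt_M\<close> by a condition on
  points. An embedding is isomorphic to the inclusion of its image formula. Conversely, the converse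
  of an arrow isomorphic to an inclusion lies in a composite of three relations that are
  single-valued and tame, and so has these properties itself.\<close>

lemma Synt_M_iff: "m \<in> Synt_M D CD \<longleftrightarrow> embed m"
proof
  assume "embed m"
  then have m: "m \<in> hom SA (Dom SA m) (Cod SA m)" by (simp add: embed_def Arr_SA)
  let ?P = "Dom SA m" let ?Q = "Cod SA m"
  have o: "?P \<in> formulas D" "?Q \<in> formulas D" using hom_formulas[OF m] by auto
  obtain \<theta> where \<theta>: "(fst ?Q, \<theta>) \<in> formulas D" "sem (fst ?Q) \<theta> = ap m ` pts ?P" "sem (fst ?Q) \<theta> \<subseteq> pts ?Q"
    using image_formula[OF m] .
  have sub: "sem (fst ?Q) \<theta> \<subseteq> ap m ` pts ?P" using \<theta>(2) by simp
  obtain u where u: "u \<in> hom SA (fst ?Q, \<theta>) ?P" "\<And>b. b \<in> sem (fst ?Q) \<theta> \<Longrightarrow> ap m (ap u b) = b" "gr u \<subseteq> (gr m)\<inverse>"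
    using embed_inverse[OF \<open>embed m\<close> m \<theta>(1) sub] by metis
  let ?i = "inclusion_map D (fst ?Q) \<theta> (snd ?Q)"
  have ih: "?i \<in> hom SA (fst ?Q, \<theta>) ?Q" using inclusion_map_hom(1)[of "fst ?Q" \<theta> "snd ?Q"] \<theta> o by simp
  have gu: "gr u = (gr m)\<inverse>"
  proof
    show "(gr m)\<inverse> \<subseteq> gr u"
    proof clarify
      fix b a assume "(a, b) \<in> gr m"
      then have ab: "a \<in> pts ?P" "b = ap m a" using gr_iff[OF m] by auto
      then have b: "b \<in> sem (fst ?Q) \<theta>" using \<theta>(2) by auto
      have "ap u b = a" by (rule embed_inj[OF \<open>embed m\<close> m]) (use ab b u(2) ap_pts[OF u(1)] in auto)
      then show "(b, a) \<in> gr u" using gr_iff[OF u(1)] b by auto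
    qed
  qed (rule u(3))
  have "iso SA u"
    unfolding iso_iff embed_def
  proof (intro conjI)
    show "single_valued ((gr u)\<inverse>)" using gr_hom[OF m] by (simp add: gu cmap_def)
    show "tame (fst (Cod SA u)) (fst (Dom SA u)) ((gr u)\<inverse>)"
      using gr_hom[OF m] u(1) by (auto simp: gu cmap_def hom_def)
    show "Range (gr u) = pts (Cod SA u)" using gr_hom[OF m] u(1) by (auto simp: gu cmap_def hom_def)
  qed (use u(1) in \<open>simp add: hom_def\<close>)
  moreover have "iso SA (ide SA ?Q)" using iso_ide_SA[OF o(2)] .
  moreover have "m \<cdot>\<^bsub>SA\<^esub> u = ide SA ?Q \<cdot>\<^bsub>SA\<^esub> ?i"
  proof (rule ap_inject[OF Comp_SA(1)[OF u(1) m] Comp_SA(1)[OF ih ide_SA(1)[OF o(2)]]])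
    fix a assume a: "a \<in> pts (fst ?Q, \<theta>)"
    have "ap ?i a = a" by (rule ap_inclusion) (use a \<theta> o in auto)
    then show "ap (m \<cdot>\<^bsub>SA\<^esub> u) a = ap (ide SA ?Q \<cdot>\<^bsub>SA\<^esub> ?i) a"
      using ap_Comp[OF u(1) m a] ap_Comp[OF ih ide_SA(1)[OF o(2)] a] ap_ide[OF o(2), of a] u(2) a \<theta>(3) by auto
  qed
  moreover have "?i \<in> inclusion_maps D"
    unfolding inclusion_maps_def using \<theta> o sem_le[of "fst ?Q" \<theta> "snd ?Q"]
    by (intro CollectI exI[of _ "fst ?Q"] exI[of _ \<theta>] exI[of _ "snd ?Q"]) (simp add: formulas_iff)
  ultimately show "m \<in> Synt_M D CD"
    unfolding Synt_M_def Let_def using m u(1) ih ide_SA(1)[OF o(2)]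
    by (intro CollectI conjI bexI[of _ ?i] exI[of _ u] exI[of _ "ide SA ?Q"]) (simp_all add: hom_def)
next
  assume "m \<in> Synt_M D CD"
  then obtain i u v where ma: "m \<in> Arr SA" and i: "i \<in> inclusion_maps D" and u: "u \<in> hom SA (Dom SA i) (Dom SA m)" "iso SA u"
    and v: "v \<in> hom SA (Cod SA i) (Cod SA m)" "iso SA v" and e: "m \<cdot>\<^bsub>SA\<^esub> u = v \<cdot>\<^bsub>SA\<^esub> i"
    by (auto simp: Synt_M_def Let_def)
  have m: "m \<in> hom SA (Dom SA m) (Cod SA m)" using ma by (simp add: Arr_SA)
  obtain X \<phi> \<psi> where i': "i = inclusion_map D X \<phi> \<psi>" "X \<in> Ob (Base D)" "\<phi> \<in> carrier (Fib D X)"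
    "\<psi> \<in> carrier (Fib D X)" "\<phi> \<sqsubseteq>\<^bsub>Fib D X\<^esub> \<psi>" using i by (auto simp: inclusion_maps_def)
  have ih: "i \<in> hom SA (X, \<phi>) (X, \<psi>)" "gr i = Id_on (sem X \<phi>)"
    using inclusion_map_hom[of X \<phi> \<psi>] i' sem_le[of X \<phi> \<psi>] by (auto simp: formulas_iff)
  have di: "Dom SA i = (X, \<phi>)" "Cod SA i = (X, \<psi>)" using ih by (auto simp: hom_def)
  have U: "embed u" "Range (gr u) = pts (Dom SA m)" and V: "embed v" using u v by (auto simp: iso_iff hom_def)
  have g: "gr u O gr m = gr i O gr v"
    using Comp_SA(2)[OF u(1) m] Comp_SA(2)[OF ih(1) v(1)[unfolded di]] e by simp
  \<comment> \<open>Surjectivity of \<open>u\<close> enters here: every point in the domain of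
    \<open>m\<close> comes from a point of the inclusion.\<close>
  have "gr m \<subseteq> (gr u)\<inverse> O gr i O gr v"
  proof
    fix x assume x: "x \<in> gr m"
    obtain a b where ab: "x = (a, b)" by (cases x)
    then have "a \<in> Range (gr u)" using U(2) gr_iff[OF m] x by auto
    then obtain c where "(c, a) \<in> gr u" by blast
    then show "x \<in> (gr u)\<inverse> O gr i O gr v" using g x ab by blast
  qed
  then have s: "(gr m)\<inverse> \<subseteq> (gr v)\<inverse> O (gr i)\<inverse> O gr u" by blast
  have uu: "single_valued (gr u)" "tame (fst (Dom SA i)) (fst (Dom SA m)) (gr u)" using gr_hom[OF u(1)] by (auto simp: cmap_def)
  have vv: "single_valued ((gr v)\<inverse>)" "tame (fst (Cod SA m)) (fst (Cod SA i)) ((gr v)\<inverse>)"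
    using V v(1) by (auto simp: embed_def hom_def)
  have ii: "single_valued ((gr i)\<inverse>)" "tame X X ((gr i)\<inverse>)"
    using ih(2) tame_Id_on[OF i'(2) sem_subset[OF i'(2,3)]] by auto
  show "embed m" unfolding embed_def
  proof (intro conjI)
    show "single_valued ((gr m)\<inverse>)"
      by (rule single_valued_subset[OF s]) (intro single_valued_relcomp uu vv ii)
    show "tame (fst (Cod SA m)) (fst (Dom SA m)) ((gr m)\<inverse>)"
      by (rule tame_mono[OF _ s]) (use tame_O[OF vv(2)] tame_O[OF ii(2)] uu(2) di in auto)
  qed (rule ma)
qed

lemma embed_inclusion:
  assumes "(X, \<phi>) \<in> formulas D" "(X, \<psi>) \<in> formulas D" "sem X \<phi> \<subseteq> sem X \<psi>"
  shows "embed (inclusion_map D X \<phi> \<psi>)"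
  using inclusion_map_hom[OF assms] tame_Id_on[of X "sem X \<phi>"] sem_subset[of X \<phi>] assms(1)
  by (auto simp: embed_def hom_def formulas_iff)

lemma embed_Comp:
  assumes "embed f" "embed g" "f \<in> hom SA P Q" "g \<in> hom SA Q R"
  shows "embed (g \<cdot>\<^bsub>SA\<^esub> f)"
proof -
  have "(gr (g \<cdot>\<^bsub>SA\<^esub> f))\<inverse> = (gr g)\<inverse> O (gr f)\<inverse>" using Comp_SA(2)[OF assms(3,4)] by auto
  then show ?thesis using assms Comp_SA(1)[OF assms(3,4)] unfolding embed_def
    by (auto simp: hom_def intro: single_valued_relcomp tame_O)
qed

lemma hom_factor:
  assumes f: "f \<in> hom SA P Q" and T: "(fst Q, \<theta>) \<in> formulas D" "ap f ` pts P \<subseteq> sem (fst Q) \<theta>"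
  obtains e where "e \<in> hom SA P (fst Q, \<theta>)" "gr e = gr f" "\<And>a. ap e a = ap f a"
proof -
  have "cmap P (fst Q, \<theta>) (gr f)"
    using gr_hom[OF f] T gr_eq[OF f] by (auto simp: cmap_def)
  then obtain e where "e \<in> hom SA P (fst Q, \<theta>)" "gr e = gr f" by (rule hom_exists)
  then show ?thesis using that by (simp add: ap_def)
qed

text \<open>Arrows factor through their image formula. For the diagonal of a square, the inverse of
  \<open>m\<close> is applied to the image of \<open>g\<close>; the filler is unique because
  embeddings are injective on points.\<close>

lemma factorization_system_SA: "orthogonal_factorization_system SA (Synt_E D CD) (Synt_M D CD)"
proof
  show "Synt_E D CD \<subseteq> Arr SA" "Synt_M D CD \<subseteq> Arr SA"
    by (auto simp: Synt_E_iff Synt_M_iff embed_def)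
  fix f
  show "f \<in> Synt_E D CD" "f \<in> Synt_M D CD" if "iso SA f"
    using that by (auto simp: iso_iff Synt_E_iff Synt_M_iff embed_def)
  show "g \<cdot>\<^bsub>SA\<^esub> f \<in> Synt_M D CD" if "f \<in> Synt_M D CD" "g \<in> Synt_M D CD" "Dom SA g = Cod SA f" for g
    using embed_Comp[of f g "Dom SA f" "Cod SA f" "Cod SA g"] that by (auto simp: Synt_M_iff embed_def hom_def)
  show "g \<cdot>\<^bsub>SA\<^esub> f \<in> Synt_E D CD" if "f \<in> Synt_E D CD" "g \<in> Synt_E D CD" "Dom SA g = Cod SA f" for g
  proof -
    have f: "f \<in> hom SA (Dom SA f) (Cod SA f)" "Range (gr f) = pts (Cod SA f)"
      and g: "g \<in> hom SA (Cod SA f) (Cod SA g)" "Range (gr g) = pts (Cod SA g)"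
      using that by (auto simp: Synt_E_iff hom_def)
    have "Range (gr f O gr g) = pts (Cod SA g)" using f(2) g(2) gr_iff[OF g(1)] by blast
    then show ?thesis using Comp_SA[OF f(1) g(1)] by (auto simp: Synt_E_iff hom_def)
  qed
  show "\<exists>e\<in>Synt_E D CD. \<exists>m\<in>Synt_M D CD. Dom SA m = Cod SA e \<and> f = m \<cdot>\<^bsub>SA\<^esub> e" if "f \<in> Arr SA"
  proof -
    let ?P = "Dom SA f" let ?Q = "Cod SA f"
    have f: "f \<in> hom SA ?P ?Q" using that by (simp add: Arr_SA)
    have o: "?P \<in> formulas D" "?Q \<in> formulas D" using hom_formulas[OF f] by auto
    obtain \<theta> where \<theta>: "(fst ?Q, \<theta>) \<in> formulas D" "sem (fst ?Q) \<theta> = ap f ` pts ?P" "sem (fst ?Q) \<theta> \<subseteq> pts ?Q"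
      using image_formula[OF f] .
    obtain e where e: "e \<in> hom SA ?P (fst ?Q, \<theta>)" "gr e = gr f" "\<And>a. ap e a = ap f a"
      using hom_factor[OF f \<theta>(1) eq_refl[OF \<theta>(2)[symmetric]]] by metis
    let ?i = "inclusion_map D (fst ?Q) \<theta> (snd ?Q)"
    have ih: "?i \<in> hom SA (fst ?Q, \<theta>) ?Q" "gr ?i = Id_on (sem (fst ?Q) \<theta>)" "embed ?i"
      using inclusion_map_hom[of "fst ?Q" \<theta> "snd ?Q"] embed_inclusion[of "fst ?Q" \<theta> "snd ?Q"] \<theta> o by simp_all
    have "e \<in> Synt_E D CD" using e \<theta>(2) gr_eq[OF f] by (auto simp: Synt_E_iff hom_def)
    moreover have "f = ?i \<cdot>\<^bsub>SA\<^esub> e"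
      by (rule gr_inject[OF f Comp_SA(1)[OF e(1) ih(1)]])
        (use Comp_SA(2)[OF e(1) ih(1)] ih(2) e(2) gr_eq[OF f] \<theta>(2) in auto)
    moreover have "Dom SA ?i = Cod SA e" using e(1) ih(1) by (simp add: hom_def)
    ultimately show ?thesis using ih(3)
      by (intro bexI[of _ e] bexI[of _ ?i]) (simp_all add: Synt_M_iff)
  qed
next
  fix e m f g
  assume "e \<in> Synt_E D CD" "m \<in> Synt_M D CD" and f: "f \<in> hom SA (Dom SA e) (Dom SA m)"
    and g: "g \<in> hom SA (Cod SA e) (Cod SA m)" and c: "m \<cdot>\<^bsub>SA\<^esub> f = g \<cdot>\<^bsub>SA\<^esub> e"
  then have e: "e \<in> hom SA (Dom SA e) (Cod SA e)" "Range (gr e) = pts (Cod SA e)"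
    and m: "embed m" "m \<in> hom SA (Dom SA m) (Cod SA m)"
    by (auto simp: Synt_E_iff Synt_M_iff embed_def Arr_SA)
  let ?P = "Dom SA m" let ?Q = "Cod SA m" let ?W = "Cod SA e"
  have mf: "ap m (ap f a) = ap g (ap e a)" if "a \<in> pts (Dom SA e)" for a
    using ap_Comp[OF f m(2) that] ap_Comp[OF e(1) g that] c by simp
  have es: "\<exists>a\<in>pts (Dom SA e). b = ap e a" if "b \<in> pts ?W" for b
    using that e(2) gr_iff[OF e(1)] by (auto simp: Range_iff set_eq_iff)
  obtain \<theta> where \<theta>: "(fst ?Q, \<theta>) \<in> formulas D" "sem (fst ?Q) \<theta> = ap g ` pts ?W" "sem (fst ?Q) \<theta> \<subseteq> pts ?Q"
    using image_formula[OF g] .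
  \<comment> \<open>The surjectivity of \<open>e\<close> forces the image of \<open>g\<close> into
    the image of \<open>m\<close>, and this is what \<open>embed_inverse\<close> requires.\<close>
  have sub: "sem (fst ?Q) \<theta> \<subseteq> ap m ` pts ?P"
  proof
    fix y assume "y \<in> sem (fst ?Q) \<theta>"
    then obtain b where b: "b \<in> pts ?W" "y = ap g b" using \<theta>(2) by auto
    obtain a where a: "a \<in> pts (Dom SA e)" "b = ap e a" using es[OF b(1)] by auto
    then show "y \<in> ap m ` pts ?P" using mf[OF a(1)] b ap_pts[OF f a(1)] by force
  qed
  obtain u where u: "u \<in> hom SA (fst ?Q, \<theta>) ?P" "\<And>b. b \<in> sem (fst ?Q) \<theta> \<Longrightarrow> ap m (ap u b) = b"
    using embed_inverse[OF m \<theta>(1) sub] by metis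
  obtain g' where g': "g' \<in> hom SA ?W (fst ?Q, \<theta>)" "\<And>a. ap g' a = ap g a"
    using hom_factor[OF g \<theta>(1) eq_refl[OF \<theta>(2)[symmetric]]] by metis
  let ?d = "u \<cdot>\<^bsub>SA\<^esub> g'"
  have d: "?d \<in> hom SA ?W ?P" using Comp_SA(1)[OF g'(1) u(1)] .
  have md: "m \<cdot>\<^bsub>SA\<^esub> ?d = g"
  proof (rule ap_inject[OF Comp_SA(1)[OF d m(2)] g])
    fix b assume b: "b \<in> pts ?W"
    then have "ap g b \<in> sem (fst ?Q) \<theta>" using \<theta>(2) by simp
    then show "ap (m \<cdot>\<^bsub>SA\<^esub> ?d) b = ap g b"
      using ap_Comp[OF d m(2) b] ap_Comp[OF g'(1) u(1) b] g'(2) u(2) by simp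
  qed
  have uniq: "k = k'" if "k \<in> hom SA ?W ?P" "k' \<in> hom SA ?W ?P" "m \<cdot>\<^bsub>SA\<^esub> k = g" "m \<cdot>\<^bsub>SA\<^esub> k' = g" for k k'
  proof (rule ap_inject[OF that(1,2)])
    fix a assume a: "a \<in> pts ?W"
    show "ap k a = ap k' a"
      by (rule embed_inj[OF m]) (use ap_pts[OF that(1) a] ap_pts[OF that(2) a] ap_Comp[OF that(1) m(2) a]
        ap_Comp[OF that(2) m(2) a] that in auto)
  qed
  have "?d \<cdot>\<^bsub>SA\<^esub> e = f"
  proof (rule ap_inject[OF Comp_SA(1)[OF e(1) d] f])
    fix a assume a: "a \<in> pts (Dom SA e)"
    have ea: "ap e a \<in> pts ?W" using ap_pts[OF e(1) a] .
    show "ap (?d \<cdot>\<^bsub>SA\<^esub> e) a = ap f a"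
    proof (rule embed_inj[OF m])
      show "ap (?d \<cdot>\<^bsub>SA\<^esub> e) a \<in> pts ?P" "ap f a \<in> pts ?P" using ap_pts[OF Comp_SA(1)[OF e(1) d] a] ap_pts[OF f a] by auto
      show "ap m (ap (?d \<cdot>\<^bsub>SA\<^esub> e) a) = ap m (ap f a)"
        using ap_Comp[OF e(1) d a] ap_Comp[OF d m(2) ea] md mf[OF a] by simp
    qed
  qed
  then show "\<exists>!d. d \<in> hom SA ?W ?P \<and> d \<cdot>\<^bsub>SA\<^esub> e = f \<and> m \<cdot>\<^bsub>SA\<^esub> d = g"
    using d md uniq by blast
qed

end

text \<open>The product of the objects of the diagram is formed by adding one factor at a time; then
  equalizers impose the commutation conditions one arrow at a time.\<close>

lemma (in cartesian_category) has_finite_limits_if_terminal_equalizers: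
  assumes terminal: "I \<in> Ob C" "\<And>Q. Q \<in> Ob C \<Longrightarrow> \<exists>!h. h \<in> hom C Q I"
    and equalizers: "\<And>P Q f g. \<lbrakk>f \<in> hom C P Q; g \<in> hom C P Q\<rbrakk> \<Longrightarrow> \<exists>m. is_equalizer C f g m"
  shows "has_finite_limits C"
  unfolding has_finite_limits_def
proof (intro allI impI)
  fix J :: "(nat, nat) cat" and Fo Fa
  assume J: "category J \<and> finite (Ob J) \<and> finite (Arr J) \<and> is_functor J C Fo Fa"
  interpret J: category J using J by blast
  have Fo: "Fo i \<in> Ob C" if "i \<in> Ob J" for i using J that by (simp add: is_functor_def)
  have Fa: "Fa u \<in> hom C (Fo (Dom J u)) (Fo (Cod J u))" if "u \<in> Arr J" for u
    using J that by (simp add: is_functor_def)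
  \<comment> \<open>The universal property with legs for the objects in \<open>S\<close> and
    commutation for the arrows in \<open>U\<close>. A limit of the diagram is the case
    \<open>S = Ob J\<close>, \<open>U = Arr J\<close>, reached by induction on \<open>S\<close> and
    then on \<open>U\<close>.\<close>
  define lim where "lim S U P p \<longleftrightarrow> P \<in> Ob C \<and> (\<forall>i\<in>S. p i \<in> hom C P (Fo i)) \<and>
      (\<forall>u\<in>U. Fa u \<cdot> p (Dom J u) = p (Cod J u)) \<and>
      (\<forall>Q q. Q \<in> Ob C \<longrightarrow> (\<forall>i\<in>S. q i \<in> hom C Q (Fo i)) \<longrightarrow> (\<forall>u\<in>U. Fa u \<cdot> q (Dom J u) = q (Cod J u)) \<longrightarrow>
        (\<exists>!h. h \<in> hom C Q P \<and> (\<forall>i\<in>S. p i \<cdot> h = q i)))" for S U P p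
  have "\<exists>P p. lim S {} P p" if "finite S" "S \<subseteq> Ob J" for S
    using that
  proof (induction S)
    case empty
    have "lim {} {} I p" for p unfolding lim_def using terminal by simp
    then show ?case by blast
  next
    case (insert i S)
    then obtain P p where P: "lim S {} P p" by auto
    have PO: "P \<in> Ob C" "Fo i \<in> Ob C" using P Fo insert by (auto simp: lim_def)
    let ?P = "prod_ob C P (Fo i)"
    let ?p = "\<lambda>j. if j = i then pr2 C P (Fo i) else p j \<cdot> pr1 C P (Fo i)"
    have ph: "p j \<in> Arr C" "Dom C (p j) = P" "Cod C (p j) = Fo j" if "j \<in> S" for j
      using P that by (auto simp: lim_def hom_def)
    have "lim (insert i S) {} ?P ?p"
      unfolding lim_def
    proof (intro conjI allI impI ballI)
      show "?P \<in> Ob C" using PO by simp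
      show "?p j \<in> hom C ?P (Fo j)" if "j \<in> insert i S" for j
        using that PO ph by (auto simp: hom_def)
      fix Q q assume Q: "Q \<in> Ob C" and q: "\<forall>j\<in>insert i S. q j \<in> hom C Q (Fo j)"
      have "\<exists>!h. h \<in> hom C Q P \<and> (\<forall>j\<in>S. p j \<cdot> h = q j)"
        using P Q q unfolding lim_def by simp
      then obtain h where h: "h \<in> hom C Q P" "\<forall>j\<in>S. p j \<cdot> h = q j"
        and hu: "\<And>h'. \<lbrakk>h' \<in> hom C Q P; \<forall>j\<in>S. p j \<cdot> h' = q j\<rbrakk> \<Longrightarrow> h' = h" by metis
      have qi: "q i \<in> hom C Q (Fo i)" using q by simp
      let ?h = "pair C h (q i)"
      have hh: "h \<in> Arr C" "Dom C h = Q" "Cod C h = P" "q i \<in> Arr C" "Dom C (q i) = Q" "Cod C (q i) = Fo i"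
        using h qi by (auto simp: hom_def)
      show "\<exists>!h. h \<in> hom C Q ?P \<and> (\<forall>j\<in>insert i S. ?p j \<cdot> h = q j)"
      proof (rule ex1I[of _ ?h])
        have "(p j \<cdot> pr1 C P (Fo i)) \<cdot> ?h = q j" if "j \<in> S" for j
          using h that ph[OF that] hh PO by simp
        then show "?h \<in> hom C Q ?P \<and> (\<forall>j\<in>insert i S. ?p j \<cdot> ?h = q j)"
          using hh PO insert.hyps by (auto simp: hom_def)
        fix k assume k: "k \<in> hom C Q ?P \<and> (\<forall>j\<in>insert i S. ?p j \<cdot> k = q j)"
        then have kk: "k \<in> Arr C" "Dom C k = Q" "Cod C k = ?P" by (auto simp: hom_def)
        have k1: "pr1 C P (Fo i) \<cdot> k = h"
        proof (rule hu)
          show "pr1 C P (Fo i) \<cdot> k \<in> hom C Q P" using kk PO by (simp add: hom_def)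
          show "\<forall>j\<in>S. p j \<cdot> pr1 C P (Fo i) \<cdot> k = q j"
          proof
            fix j assume j: "j \<in> S"
            then have "j \<noteq> i" using insert.hyps by auto
            then have "(p j \<cdot> pr1 C P (Fo i)) \<cdot> k = q j" using k j by auto
            then show "p j \<cdot> pr1 C P (Fo i) \<cdot> k = q j" using ph[OF j] kk PO by simp
          qed
        qed
        have k2: "pr2 C P (Fo i) \<cdot> k = q i" using k by auto
        show "k = ?h"
          by (rule prod_arr_eq_ext[where X=P and Y="Fo i"]) (use k1 k2 kk hh PO in simp_all)
      qed
    qed auto
    then show ?case by blast
  qed
  then obtain P0 p0 where P0: "lim (Ob J) {} P0 p0" using J by blast
  have "\<exists>P p. lim (Ob J) U P p" if "finite U" "U \<subseteq> Arr J" for U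
    using that
  proof (induction U)
    case empty then show ?case using P0 by blast
  next
    case (insert u U)
    then obtain P p where P: "lim (Ob J) U P p" by auto
    have u: "u \<in> Arr J" "Dom J u \<in> Ob J" "Cod J u \<in> Ob J" using insert by auto
    have ph: "p j \<in> Arr C" "Dom C (p j) = P" "Cod C (p j) = Fo j" if "j \<in> Ob J" for j
      using P that by (auto simp: lim_def hom_def)
    have Fu: "Fa v \<in> Arr C" "Dom C (Fa v) = Fo (Dom J v)" "Cod C (Fa v) = Fo (Cod J v)" if "v \<in> Arr J" for v
      using Fa[OF that] by (auto simp: hom_def)
    let ?f = "Fa u \<cdot> p (Dom J u)" let ?g = "p (Cod J u)"
    have fg: "?f \<in> hom C P (Fo (Cod J u))" "?g \<in> hom C P (Fo (Cod J u))"
      using ph u Fu by (auto simp: hom_def)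
    obtain m where m: "is_equalizer C ?f ?g m" using equalizers[OF fg] by blast
    let ?E = "Dom C m" let ?p = "\<lambda>j. p j \<cdot> m"
    have mm: "m \<in> Arr C" "Cod C m = P" "?f \<cdot> m = ?g \<cdot> m"
      using m fg by (auto simp: is_equalizer_def hom_def)
    have mu: "\<exists>!k. k \<in> hom C W ?E \<and> m \<cdot> k = h" if "h \<in> hom C W P" "?f \<cdot> h = ?g \<cdot> h" for W h
      using m that mm(2) unfolding is_equalizer_def by metis
    have as: "Fa v \<cdot> p (Dom J v) \<cdot> h = (Fa v \<cdot> p (Dom J v)) \<cdot> h" if "v \<in> Arr J" "h \<in> Arr C" "Cod C h = P" for v h
      using Fu[OF that(1)] ph[of "Dom J v"] that by simp
    have as2: "(p j \<cdot> m) \<cdot> k = p j \<cdot> m \<cdot> k" if "j \<in> Ob J" "k \<in> Arr C" "Cod C k = ?E" for j k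
      using ph[OF that(1)] mm that by simp
    have eqU: "Fa v \<cdot> p (Dom J v) = p (Cod J v)" if "v \<in> U" for v using P that by (simp add: lim_def)
    have "lim (Ob J) (insert u U) ?E ?p"
      unfolding lim_def
    proof (intro conjI allI impI ballI)
      show "?E \<in> Ob C" using mm by simp
      show "?p j \<in> hom C ?E (Fo j)" if "j \<in> Ob J" for j using ph[OF that] mm by (simp add: hom_def)
      show "Fa v \<cdot> p (Dom J v) \<cdot> m = p (Cod J v) \<cdot> m" if "v \<in> insert u U" for v
        using that as[of v m] mm eqU insert.prems by auto
      fix Q q assume Q: "Q \<in> Ob C" and q: "\<forall>j\<in>Ob J. q j \<in> hom C Q (Fo j)"
        and qU: "\<forall>v\<in>insert u U. Fa v \<cdot> q (Dom J v) = q (Cod J v)"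
      have "\<exists>!h. h \<in> hom C Q P \<and> (\<forall>j\<in>Ob J. p j \<cdot> h = q j)"
        using P Q q qU unfolding lim_def by simp
      then obtain h where h: "h \<in> hom C Q P" "\<forall>j\<in>Ob J. p j \<cdot> h = q j"
        and hu: "\<And>h'. \<lbrakk>h' \<in> hom C Q P; \<forall>j\<in>Ob J. p j \<cdot> h' = q j\<rbrakk> \<Longrightarrow> h' = h" by metis
      have "?f \<cdot> h = ?g \<cdot> h"
        using as[of u h] h u qU by (simp add: hom_def)
      from mu[OF h(1) this] obtain k where k: "k \<in> hom C Q ?E" "m \<cdot> k = h"
        and ku: "\<And>k'. \<lbrakk>k' \<in> hom C Q ?E; m \<cdot> k' = h\<rbrakk> \<Longrightarrow> k' = k" by metis
      show "\<exists>!h. h \<in> hom C Q ?E \<and> (\<forall>j\<in>Ob J. (p j \<cdot> m) \<cdot> h = q j)"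
      proof (rule ex1I[of _ k])
        show "k \<in> hom C Q ?E \<and> (\<forall>j\<in>Ob J. (p j \<cdot> m) \<cdot> k = q j)"
          using k h as2 by (simp add: hom_def)
        fix k' assume k': "k' \<in> hom C Q ?E \<and> (\<forall>j\<in>Ob J. (p j \<cdot> m) \<cdot> k' = q j)"
        have "m \<cdot> k' = h"
          by (rule hu) (use k' mm as2 in \<open>auto simp: hom_def\<close>)
        then show "k' = k" using ku k' by blast
      qed
    qed
    then show ?case by blast
  qed
  then obtain P p where P: "lim (Ob J) (Arr J) P p" using J by blast
  have "is_limit J C Fo Fa P p"
    unfolding is_limit_def is_cone_def
  proof (intro conjI allI impI)
    fix Q q assume "Q \<in> Ob C \<and> (\<forall>i\<in>Ob J. q i \<in> hom C Q (Fo i)) \<and> (\<forall>u\<in>Arr J. Fa u \<cdot> q (Dom J u) = q (Cod J u))"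
    then show "\<exists>!h. h \<in> hom C Q P \<and> (\<forall>i\<in>Ob J. p i \<cdot> h = q i)"
      using P unfolding lim_def by simp
  qed (use P in \<open>auto simp: lim_def\<close>)
  then show "\<exists>P p. is_limit J C Fo Fa P p" by blast
qed

section \<open>Finite limits of the syntactic category\<close>

context doctrine_model
begin

lemma hom_of_function:
  assumes "P \<in> formulas D" "Q \<in> formulas D" "definable (fst P) (fst Q) \<rho>" "tame (fst P) (fst Q) \<rho>"
    and \<rho>: "\<rho> = (\<lambda>a. (a, F a)) ` pts P" and F: "\<And>a. a \<in> pts P \<Longrightarrow> F a \<in> pts Q"
  obtains f where "f \<in> hom SA P Q" "\<And>a. a \<in> pts P \<Longrightarrow> ap f a = F a"
proof -
  have "cmap P Q \<rho>"
    unfolding cmap_def using assms by (auto simp: single_valued_def)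
  then obtain f where f: "f \<in> hom SA P Q" "gr f = \<rho>" by (rule hom_exists)
  have "ap f a = F a" if "a \<in> pts P" for a
    using gr_iff[OF f(1), of a "F a"] f(2) that unfolding \<rho> by auto
  then show ?thesis using that f by blast
qed

lemma hom_of_base_arrow:
  assumes f: "f \<in> hom (Base D) (fst P) (fst Q)" and "P \<in> formulas D" "Q \<in> formulas D"
    and "\<And>a. a \<in> pts P \<Longrightarrow> act f a \<in> pts Q"
  obtains g where "g \<in> hom SA P Q" "\<And>a. a \<in> pts P \<Longrightarrow> ap g a = act f a"
proof (rule hom_of_function[of P Q "(\<lambda>a. (a, act f a)) ` pts P" "act f"])
  have sub: "pts P \<subseteq> El (fst P)" using assms pts_El by blast
  have "(\<lambda>a. (a, act f a)) ` pts P = (\<lambda>a. (a, act f a)) ` El (fst P) \<inter> pts P \<times> UNIV" using sub by auto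
  then show "definable (fst P) (fst Q) ((\<lambda>a. (a, act f a)) ` pts P)"
    using definable_restrict[OF definable_graph[OF f], of "snd P"] assms by (simp add: formulas_iff)
  show "tame (fst P) (fst Q) ((\<lambda>a. (a, act f a)) ` pts P)"
    by (rule tame_mono[OF tame_graph[OF f]]) (use sub in auto)
qed (use assms that in auto)

lemma SA_terminal:
  obtains I where "I \<in> Ob SA" "\<And>Q. Q \<in> Ob SA \<Longrightarrow> \<exists>!h. h \<in> hom SA Q I"
proof -
  have "\<exists>P. P \<in> Ob (Base D) \<and> (\<forall>Q. Q \<in> Ob (Base D) \<longrightarrow> (\<exists>!h. h \<in> hom (Base D) Q P))"
    using Base_cartesian[unfolded has_finite_products_def, THEN spec, of 0] by auto
  then obtain I where I: "I \<in> Ob (Base D)" and un: "\<And>Q. Q \<in> Ob (Base D) \<Longrightarrow> \<exists>!h. h \<in> hom (Base D) Q I" by blast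
  let ?I = "(I, \<top>\<^bsub>Fib D I\<^esub>)"
  have IF: "?I \<in> formulas D" using I by (simp add: formulas_iff)
  have Ip: "sem I \<top>\<^bsub>Fib D I\<^esub> = El I" using sem_top[OF I] by simp
  \<comment> \<open>The two projections of \<open>I \<times> I\<close> are arrows into a terminal
    object and therefore equal, so each fibre contains at most one point of
    \<open>I\<close>.\<close>
  have sub: "a = b" if "a \<in> El I" "b \<in> El I" "fib a = fib b" for a b
  proof -
    have "pr1 (Base D) I I = pr2 (Base D) I I"
    proof -
      have "pr1 (Base D) I I \<in> hom (Base D) (prod_ob (Base D) I I) I" "pr2 (Base D) I I \<in> hom (Base D) (prod_ob (Base D) I I) I"
        using I by (simp_all add: hom_def)
      then show ?thesis using un[of "prod_ob (Base D) I I"] I by auto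
    qed
    then show ?thesis using tuple_simps(2,3)[OF I I that] by simp
  qed
  have "\<exists>!h. h \<in> hom SA Q ?I" if "Q \<in> Ob SA" for Q
  proof -
    have Q: "Q \<in> formulas D" using that by (simp add: SA_sel)
    obtain t where t: "t \<in> hom (Base D) (fst Q) I" using un[of "fst Q"] Q by (auto simp: formulas_iff)
    have "\<exists>h. h \<in> hom SA Q ?I"
    proof (rule hom_of_base_arrow[of t Q ?I])
      show "t \<in> hom (Base D) (fst Q) (fst ?I)" using t by simp
      show "act t a \<in> pts ?I" if "a \<in> pts Q" for a using act_El[OF t] pts_El[OF Q] that Ip by auto
    qed (use Q IF in blast)+
    then obtain h where h: "h \<in> hom SA Q ?I" by blast
    have "k = h" if k: "k \<in> hom SA Q ?I" for k
    proof (rule ap_inject[OF k h])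
      fix a assume a: "a \<in> pts Q"
      show "ap k a = ap h a"
        by (rule sub) (use ap_pts[OF k a] ap_pts[OF h a] fib_ap[OF k a] fib_ap[OF h a] Ip in auto)
    qed
    then show ?thesis using h by blast
  qed
  then show ?thesis using that[of ?I] IF by (simp add: SA_sel)
qed

text \<open>A product whose underlying base object is known. The product \<open>prod_ob SA\<close>
  is an arbitrary choice, and its underlying object may be a different one.\<close>

definition prodF :: "('o, 'd) formula \<Rightarrow> ('o, 'd) formula \<Rightarrow> ('o, 'd) formula" where
  "prodF P Q = (prod_ob (Base D) (fst P) (fst Q),
     Sub D (pr1 (Base D) (fst P) (fst Q)) (snd P) \<sqinter>\<^bsub>Fib D (prod_ob (Base D) (fst P) (fst Q))\<^esub>
     Sub D (pr2 (Base D) (fst P) (fst Q)) (snd Q))"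

lemma prodF:
  assumes "P \<in> formulas D" "Q \<in> formulas D"
  shows "prodF P Q \<in> formulas D" "fst (prodF P Q) = prod_ob (Base D) (fst P) (fst Q)"
    "pts (prodF P Q) = {c \<in> El (prod_ob (Base D) (fst P) (fst Q)).
       act (pr1 (Base D) (fst P) (fst Q)) c \<in> pts P \<and> act (pr2 (Base D) (fst P) (fst Q)) c \<in> pts Q}"
proof -
  let ?X = "fst P" let ?Y = "fst Q" let ?Z = "prod_ob (Base D) ?X ?Y"
  have O: "?X \<in> Ob (Base D)" "?Y \<in> Ob (Base D)" and c: "snd P \<in> carrier (Fib D ?X)" "snd Q \<in> carrier (Fib D ?Y)"
    using assms by (auto simp: formulas_iff)
  have pq: "pr1 (Base D) ?X ?Y \<in> hom (Base D) ?Z ?X" "pr2 (Base D) ?X ?Y \<in> hom (Base D) ?Z ?Y"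
    using O by (simp_all add: hom_def)
  have Z: "?Z \<in> Ob (Base D)" using O by simp
  note s = sem_Sub[OF pq(1) c(1)] sem_Sub[OF pq(2) c(2)] sem_meet[OF Z]
  show "prodF P Q \<in> formulas D" using s Z by (simp add: prodF_def formulas_iff)
  show "fst (prodF P Q) = prod_ob (Base D) (fst P) (fst Q)" by (simp add: prodF_def)
  show "pts (prodF P Q) = {c \<in> El ?Z. act (pr1 (Base D) ?X ?Y) c \<in> pts P \<and> act (pr2 (Base D) ?X ?Y) c \<in> pts Q}"
    using s by (auto simp: prodF_def)
qed

text \<open>The graph is definable by conditions on the two projections. Tameness takes another
  route, since converses of projections are not single-valued in general: duplicate the argument
  along the diagonal of the base, then apply the product of the two members of \<open>CD\<close>
  that contain \<open>f\<close> and \<open>g\<close>.\<close>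

lemma hom_pair:
  assumes f: "f \<in> hom SA W P" and g: "g \<in> hom SA W Q"
  obtains h where "h \<in> hom SA W (prodF P Q)" "\<And>a. a \<in> pts W \<Longrightarrow> ap h a = tuple (fst P) (fst Q) (ap f a) (ap g a)"
proof -
  let ?X = "fst P" let ?Y = "fst Q" let ?Z = "prod_ob (Base D) ?X ?Y" let ?V = "fst W"
  let ?p = "pr1 (Base D) ?X ?Y" let ?q = "pr2 (Base D) ?X ?Y"
  have F: "W \<in> formulas D" "P \<in> formulas D" "Q \<in> formulas D" using hom_formulas f g by auto
  then have O: "?X \<in> Ob (Base D)" "?Y \<in> Ob (Base D)" "?V \<in> Ob (Base D)" by (auto simp: formulas_iff)
  have pq: "?p \<in> hom (Base D) ?Z ?X" "?q \<in> hom (Base D) ?Z ?Y" using O by (simp_all add: hom_def)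
  have t: "tuple ?X ?Y (ap f a) (ap g a) \<in> El ?Z" "act ?p (tuple ?X ?Y (ap f a) (ap g a)) = ap f a"
    "act ?q (tuple ?X ?Y (ap f a) (ap g a)) = ap g a" "fib (tuple ?X ?Y (ap f a) (ap g a)) = fib a" if "a \<in> pts W" for a
    using tuple_simps[OF O(1,2), of "ap f a" "ap g a"] ap_pts[OF f that] ap_pts[OF g that] fib_ap[OF f that] fib_ap[OF g that]
      pts_El[OF F(2)] pts_El[OF F(3)] by auto
  let ?\<rho> = "(\<lambda>a. (a, tuple ?X ?Y (ap f a) (ap g a))) ` pts W"
  show ?thesis
  proof (rule hom_of_function[of W "prodF P Q" ?\<rho> "\<lambda>a. tuple ?X ?Y (ap f a) (ap g a)"])
    have "?\<rho> = (gr f O ((\<lambda>c. (c, act ?p c)) ` El ?Z)\<inverse>) \<inter> (gr g O ((\<lambda>c. (c, act ?q c)) ` El ?Z)\<inverse>)" (is "_ = ?R")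
    proof
      show "?\<rho> \<subseteq> ?R"
      proof clarify
        fix a assume a: "a \<in> pts W"
        have "(a, ap f a) \<in> gr f" "(a, ap g a) \<in> gr g" using a gr_iff[OF f] gr_iff[OF g] by auto
        moreover have "(ap f a, tuple ?X ?Y (ap f a) (ap g a)) \<in> ((\<lambda>c. (c, act ?p c)) ` El ?Z)\<inverse>"
          "(ap g a, tuple ?X ?Y (ap f a) (ap g a)) \<in> ((\<lambda>c. (c, act ?q c)) ` El ?Z)\<inverse>"
          using t[OF a] by (auto simp: image_iff)
        ultimately show "(a, tuple ?X ?Y (ap f a) (ap g a)) \<in> ?R" by blast
      qed
      show "?R \<subseteq> ?\<rho>"
      proof
        fix x assume x: "x \<in> ?R"
        obtain a c where ac: "x = (a, c)" by (cases x)
        with x have "(a, act ?p c) \<in> gr f" "(a, act ?q c) \<in> gr g" "c \<in> El ?Z" by auto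
        moreover from this have "c = tuple ?X ?Y (ap f a) (ap g a)"
          using gr_iff[OF f] gr_iff[OF g] tuple_act[OF O(1,2), of c] by simp
        ultimately show "x \<in> ?\<rho>" using gr_iff[OF f] ac by auto
      qed
    qed
    moreover have "definable ?V ?Z ?R"
      using gr_hom[OF f] gr_hom[OF g] pq
      by (intro definable_Int definable_O definable_converse definable_graph) (auto simp: cmap_def)
    ultimately show "definable ?V (fst (prodF P Q)) ?\<rho>" using prodF(2)[OF F(2,3)] by simp
    let ?d = "diag (Base D) ?V" let ?VV = "prod_ob (Base D) ?V ?V"
    have d: "?d \<in> hom (Base D) ?V ?VV" using O by (simp add: diag_def hom_def)
    let ?T = "{(c, c'). c \<in> El ?VV \<and> c' \<in> El ?Z \<and> fib c = fib c' \<and>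
      (act (pr1 (Base D) ?V ?V) c, act ?p c') \<in> gr f \<and> (act (pr2 (Base D) ?V ?V) c, act ?q c') \<in> gr g}"
    have "tame ?V ?Z ((\<lambda>a. (a, act ?d a)) ` El ?V O ?T)"
      using gr_hom[OF f] gr_hom[OF g]
      by (intro tame_O[OF tame_graph[OF d] tame_prod[OF _ _ O(3,1,3,2)]]) (simp_all add: cmap_def)
    moreover have "?\<rho> \<subseteq> (\<lambda>a. (a, act ?d a)) ` El ?V O ?T"
    proof clarify
      fix a assume a: "a \<in> pts W"
      have aE: "a \<in> El ?V" using a pts_El[OF F(1)] by auto
      have da: "act ?d a = tuple ?V ?V a a" using aE O by (simp add: diag_def)
      have "(act ?d a, tuple ?X ?Y (ap f a) (ap g a)) \<in> ?T"
        using t[OF a] a gr_iff[OF f] gr_iff[OF g] aE O unfolding da by simp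
      then show "(a, tuple ?X ?Y (ap f a) (ap g a)) \<in> (\<lambda>a. (a, act ?d a)) ` El ?V O ?T" using aE by blast
    qed
    ultimately show "tame ?V (fst (prodF P Q)) ?\<rho>" using prodF(2)[OF F(2,3)] tame_mono by simp
    show "tuple ?X ?Y (ap f a) (ap g a) \<in> pts (prodF P Q)" if "a \<in> pts W" for a
      using t[OF that] ap_pts[OF f that] ap_pts[OF g that] prodF(3)[OF F(2,3)] by simp
  qed (use F prodF that in auto)
qed

lemma prodF_projections:
  assumes "P \<in> formulas D" "Q \<in> formulas D"
  obtains p q where "p \<in> hom SA (prodF P Q) P" "q \<in> hom SA (prodF P Q) Q"
    "\<And>c. c \<in> pts (prodF P Q) \<Longrightarrow> ap p c = act (pr1 (Base D) (fst P) (fst Q)) c"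
    "\<And>c. c \<in> pts (prodF P Q) \<Longrightarrow> ap q c = act (pr2 (Base D) (fst P) (fst Q)) c"
    "is_product SA P Q (prodF P Q) p q"
proof -
  let ?X = "fst P" let ?Y = "fst Q" let ?Z = "prod_ob (Base D) ?X ?Y"
  let ?p = "pr1 (Base D) ?X ?Y" let ?q = "pr2 (Base D) ?X ?Y"
  have O: "?X \<in> Ob (Base D)" "?Y \<in> Ob (Base D)" using assms by (auto simp: formulas_iff)
  have pq: "?p \<in> hom (Base D) (fst (prodF P Q)) ?X" "?q \<in> hom (Base D) (fst (prodF P Q)) ?Y"
    using O prodF[OF assms] by (simp_all add: hom_def)
  obtain p where p: "p \<in> hom SA (prodF P Q) P" "\<And>c. c \<in> pts (prodF P Q) \<Longrightarrow> ap p c = act ?p c"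
    by (rule hom_of_base_arrow[OF pq(1) prodF(1)[OF assms] assms(1)]) (use prodF[OF assms] in auto)
  obtain q where q: "q \<in> hom SA (prodF P Q) Q" "\<And>c. c \<in> pts (prodF P Q) \<Longrightarrow> ap q c = act ?q c"
    by (rule hom_of_base_arrow[OF pq(2) prodF(1)[OF assms] assms(2)]) (use prodF[OF assms] in auto)
  have "is_product SA P Q (prodF P Q) p q"
    unfolding is_product_def
  proof (intro conjI allI ballI)
    fix W f g assume f: "f \<in> hom SA W P" and g: "g \<in> hom SA W Q"
    obtain h where h: "h \<in> hom SA W (prodF P Q)" "\<And>a. a \<in> pts W \<Longrightarrow> ap h a = tuple ?X ?Y (ap f a) (ap g a)"
      using hom_pair[OF f g] by blast
    have t: "act ?p (ap h a) = ap f a" "act ?q (ap h a) = ap g a" if "a \<in> pts W" for a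
      using tuple_simps[OF O(1,2), of "ap f a" "ap g a"] ap_pts[OF f that] ap_pts[OF g that] fib_ap[OF f that] fib_ap[OF g that]
      pts_El[OF assms(1)] pts_El[OF assms(2)] h(2)[OF that] by auto
    have "p \<cdot>\<^bsub>SA\<^esub> h = f"
      by (rule ap_inject[OF Comp_SA(1)[OF h(1) p(1)] f]) (use ap_Comp[OF h(1) p(1)] p(2) ap_pts[OF h(1)] t in auto)
    moreover have "q \<cdot>\<^bsub>SA\<^esub> h = g"
      by (rule ap_inject[OF Comp_SA(1)[OF h(1) q(1)] g]) (use ap_Comp[OF h(1) q(1)] q(2) ap_pts[OF h(1)] t in auto)
    moreover have "k = h" if k: "k \<in> hom SA W (prodF P Q)" "p \<cdot>\<^bsub>SA\<^esub> k = f" "q \<cdot>\<^bsub>SA\<^esub> k = g" for k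
    proof (rule ap_inject[OF k(1) h(1)])
      fix a assume a: "a \<in> pts W"
      have "act ?p (ap k a) = ap f a" "act ?q (ap k a) = ap g a"
        using ap_Comp[OF k(1) p(1) a] ap_Comp[OF k(1) q(1) a] p(2) q(2) ap_pts[OF k(1) a] k by auto
      then show "ap k a = ap h a"
        using t[OF a] ap_pts[OF k(1) a] ap_pts[OF h(1) a] prodF(3)[OF assms] tuple_unique[OF O] by auto
    qed
    ultimately show "\<exists>!h. h \<in> hom SA W (prodF P Q) \<and> p \<cdot>\<^bsub>SA\<^esub> h = f \<and> q \<cdot>\<^bsub>SA\<^esub> h = g"
      using h(1) by blast
  qed (use p q in auto)
  then show ?thesis using that p q by blast
qed

lemma cartesian_SA: "cartesian_category SA"
proof
  fix P Q assume "P \<in> Ob SA" "Q \<in> Ob SA"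
  then show "\<exists>R p q. is_product SA P Q R p q" using prodF_projections[of P Q] by (metis SA_sel(1))
qed

sublocale SA: cartesian_category SA
  by (rule cartesian_SA)

text \<open>The points where \<open>f\<close> and \<open>g\<close> agree form the domain of the
  intersection of their graphs, which is definable. That some equalizer is an inclusion is what
  later makes regular monomorphisms embeddings.\<close>

lemma equalizer_SA:
  assumes f: "f \<in> hom SA P Q" and g: "g \<in> hom SA P Q"
  obtains \<theta> where "(fst P, \<theta>) \<in> formulas D" "sem (fst P) \<theta> = {a \<in> pts P. ap f a = ap g a}"
    "is_equalizer SA f g (inclusion_map D (fst P) \<theta> (snd P))"
proof -
  have F: "P \<in> formulas D" using hom_formulas f by auto
  have "definable (fst P) (fst Q) (gr f \<inter> gr g)"
    using gr_hom[OF f] gr_hom[OF g] by (intro definable_Int) (auto simp: cmap_def)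
  then obtain \<theta> where "\<theta> \<in> carrier (Fib D (fst P))" "sem (fst P) \<theta> = Domain (gr f \<inter> gr g)" by (rule definable_Domain)
  moreover have "Domain (gr f \<inter> gr g) = {a \<in> pts P. ap f a = ap g a}"
    using gr_iff[OF f] gr_iff[OF g] by (auto simp: Domain_iff)
  ultimately have \<theta>: "(fst P, \<theta>) \<in> formulas D" "sem (fst P) \<theta> = {a \<in> pts P. ap f a = ap g a}"
    using F by (auto simp: formulas_iff)
  let ?i = "inclusion_map D (fst P) \<theta> (snd P)"
  have i: "?i \<in> hom SA (fst P, \<theta>) P" "\<And>a. a \<in> sem (fst P) \<theta> \<Longrightarrow> ap ?i a = a"
    using inclusion_map_hom(1)[of "fst P" \<theta> "snd P"] ap_inclusion[of "fst P" \<theta> "snd P"] \<theta> F by auto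
  have d: "Dom SA ?i = (fst P, \<theta>)" "Cod SA ?i = P" "?i \<in> Arr SA" using i(1) by (auto simp: hom_def)
  have eq1: "f \<cdot>\<^bsub>SA\<^esub> ?i = g \<cdot>\<^bsub>SA\<^esub> ?i"
    by (rule ap_inject[OF Comp_SA(1)[OF i(1) f] Comp_SA(1)[OF i(1) g]])
      (use ap_Comp[OF i(1) f] ap_Comp[OF i(1) g] i(2) \<theta>(2) in auto)
  have eq2: "\<exists>!k. k \<in> hom SA W (fst P, \<theta>) \<and> ?i \<cdot>\<^bsub>SA\<^esub> k = h"
    if h: "h \<in> hom SA W P" "f \<cdot>\<^bsub>SA\<^esub> h = g \<cdot>\<^bsub>SA\<^esub> h" for W h
  proof -
    have "ap f (ap h a) = ap g (ap h a)" if "a \<in> pts W" for a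
      using ap_Comp[OF h(1) f that] ap_Comp[OF h(1) g that] h(2) by simp
    then have sub: "ap h ` pts W \<subseteq> sem (fst P) \<theta>" using ap_pts[OF h(1)] \<theta>(2) by auto
    obtain k where k: "k \<in> hom SA W (fst P, \<theta>)" "\<And>a. ap k a = ap h a"
      using hom_factor[OF h(1) \<theta>(1) sub] by metis
    have "?i \<cdot>\<^bsub>SA\<^esub> k = h"
      by (rule ap_inject[OF Comp_SA(1)[OF k(1) i(1)] h(1)]) (use ap_Comp[OF k(1) i(1)] i(2) k(2) sub in auto)
    moreover have "k' = k" if k': "k' \<in> hom SA W (fst P, \<theta>)" "?i \<cdot>\<^bsub>SA\<^esub> k' = h" for k'
      by (rule ap_inject[OF k'(1) k(1)]) (use ap_Comp[OF k'(1) i(1)] i(2) k(2) k'(2) ap_pts[OF k'(1)] in auto)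
    ultimately show ?thesis using k(1) by blast
  qed
  have "is_equalizer SA f g ?i"
    unfolding is_equalizer_def d
  proof (intro conjI allI ballI impI)
    show "\<exists>!k. k \<in> hom SA W (fst P, \<theta>) \<and> ?i \<cdot>\<^bsub>SA\<^esub> k = h"
      if "h \<in> hom SA W P" "f \<cdot>\<^bsub>SA\<^esub> h = g \<cdot>\<^bsub>SA\<^esub> h" for W h using eq2[OF that] .
  qed (use d f g eq1 in \<open>simp_all add: hom_def\<close>)
  then show ?thesis using that \<theta> by blast
qed

lemma has_finite_limits_SA: "has_finite_limits SA"
proof -
  obtain I where I: "I \<in> Ob SA" "\<And>Q. Q \<in> Ob SA \<Longrightarrow> \<exists>!h. h \<in> hom SA Q I" by (rule SA_terminal) blast
  show ?thesis
  proof (rule SA.has_finite_limits_if_terminal_equalizers[OF I])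
    fix P Q f g assume "f \<in> hom SA P Q" "g \<in> hom SA P Q"
    then show "\<exists>m. is_equalizer SA f g m" by (rule equalizer_SA) blast
  qed
qed

section \<open>Regular monomorphisms, and stability under pullback\<close>

lemma embedI:
  assumes m: "m \<in> hom SA P Q" and k: "k \<in> hom SA (fst Q, \<theta>) P"
    and km: "\<And>a. a \<in> pts P \<Longrightarrow> ap m a \<in> sem (fst Q) \<theta> \<and> ap k (ap m a) = a"
  shows "embed m"
proof -
  \<comment> \<open>A retraction defined on a formula containing the image includes the converse of
    \<open>m\<close>, which thereby becomes single-valued and tame.\<close>
  have s: "(gr m)\<inverse> \<subseteq> gr k" using gr_iff[OF m] gr_iff[OF k] km by auto
  have "single_valued (gr k)" "tame (fst Q) (fst P) (gr k)" using gr_hom[OF k] by (auto simp: cmap_def)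
  then have "single_valued ((gr m)\<inverse>)" "tame (fst Q) (fst P) ((gr m)\<inverse>)"
    using s by (auto intro: single_valued_subset tame_mono)
  then show ?thesis using m by (auto simp: embed_def hom_def)
qed

abbreviation img :: "('o, 'd) synt_map \<Rightarrow> 'p set" where
  "img m \<equiv> ap m ` pts (Dom SA m)"

lemma embed_hom: "embed m \<Longrightarrow> m \<in> hom SA (Dom SA m) (Cod SA m)"
  by (simp add: embed_def Arr_SA)

text \<open>Containment of images is enough for a factorization, since \<open>m\<close> has a
  continuous inverse on its image.\<close>

lemma embed_factor:
  assumes m: "embed m" "m \<in> hom SA P Q" and h: "h \<in> hom SA W Q" "ap h ` pts W \<subseteq> ap m ` pts P"
  obtains u where "u \<in> hom SA W P" "m \<cdot>\<^bsub>SA\<^esub> u = h"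
proof -
  obtain \<theta> where \<theta>: "(fst Q, \<theta>) \<in> formulas D" "sem (fst Q) \<theta> = ap m ` pts P" "sem (fst Q) \<theta> \<subseteq> pts Q"
    using image_formula[OF m(2)] .
  obtain v where v: "v \<in> hom SA (fst Q, \<theta>) P" "\<And>b. b \<in> sem (fst Q) \<theta> \<Longrightarrow> ap m (ap v b) = b"
    using embed_inverse[OF m \<theta>(1) eq_refl[OF \<theta>(2)]] by metis
  have "ap h ` pts W \<subseteq> sem (fst Q) \<theta>" using h(2) \<theta>(2) by simp
  then obtain h' where h': "h' \<in> hom SA W (fst Q, \<theta>)" "\<And>a. ap h' a = ap h a"
    using hom_factor[OF h(1) \<theta>(1)] by metis
  have u: "v \<cdot>\<^bsub>SA\<^esub> h' \<in> hom SA W P" using Comp_SA(1)[OF h'(1) v(1)] .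
  have "m \<cdot>\<^bsub>SA\<^esub> (v \<cdot>\<^bsub>SA\<^esub> h') = h"
  proof (rule ap_inject[OF Comp_SA(1)[OF u m(2)] h(1)])
    fix a assume a: "a \<in> pts W"
    have "ap h a \<in> sem (fst Q) \<theta>" using ap_pts[OF h'(1) a] h'(2) by simp
    then show "ap (m \<cdot>\<^bsub>SA\<^esub> (v \<cdot>\<^bsub>SA\<^esub> h')) a = ap h a"
      using ap_Comp[OF u m(2) a] ap_Comp[OF h'(1) v(1) a] h'(2) v(2) by simp
  qed
  then show ?thesis using that u by blast
qed

lemma embed_cancel:
  assumes m: "embed m" "m \<in> hom SA P Q" and k: "k \<in> hom SA W P" "k' \<in> hom SA W P" "m \<cdot>\<^bsub>SA\<^esub> k = m \<cdot>\<^bsub>SA\<^esub> k'"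
  shows "k = k'"
proof (rule ap_inject[OF k(1,2)])
  fix a assume a: "a \<in> pts W"
  show "ap k a = ap k' a"
    by (rule embed_inj[OF m]) (use ap_pts[OF k(1) a] ap_pts[OF k(2) a] ap_Comp[OF k(1) m(2) a]
      ap_Comp[OF k(2) m(2) a] k in auto)
qed

text \<open>A given equalizer is compared with the one that is an inclusion; the comparison arrow
  \<open>k\<close> inverts \<open>m\<close> on a formula that contains the image of
  \<open>m\<close>.\<close>

lemma regular_mono_embed:
  assumes "regular_mono SA m"
  shows "embed m"
proof -
  obtain f g where e: "is_equalizer SA f g m" using assms by (auto simp: regular_mono_def)
  let ?P = "Cod SA m" let ?E = "Dom SA m"
  have m: "m \<in> hom SA ?E ?P" and f: "f \<in> hom SA ?P (Cod SA f)" and g: "g \<in> hom SA ?P (Cod SA f)"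
    and fgm: "f \<cdot>\<^bsub>SA\<^esub> m = g \<cdot>\<^bsub>SA\<^esub> m"
    using e by (simp_all add: is_equalizer_def hom_def)
  have un: "\<exists>!k. k \<in> hom SA W ?E \<and> m \<cdot>\<^bsub>SA\<^esub> k = h"
    if "h \<in> hom SA W ?P" "f \<cdot>\<^bsub>SA\<^esub> h = g \<cdot>\<^bsub>SA\<^esub> h" for W h
    using e that unfolding is_equalizer_def by blast
  obtain \<theta> where \<theta>: "(fst ?P, \<theta>) \<in> formulas D" "sem (fst ?P) \<theta> = {a \<in> pts ?P. ap f a = ap g a}"
    "is_equalizer SA f g (inclusion_map D (fst ?P) \<theta> (snd ?P))" using equalizer_SA[OF f g] .
  let ?i = "inclusion_map D (fst ?P) \<theta> (snd ?P)"
  have F: "?P \<in> formulas D" "?E \<in> formulas D" using hom_formulas[OF m] by auto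
  have i: "?i \<in> hom SA (fst ?P, \<theta>) ?P" "\<And>a. a \<in> sem (fst ?P) \<theta> \<Longrightarrow> ap ?i a = a"
    using inclusion_map_hom(1)[of "fst ?P" \<theta> "snd ?P"] ap_inclusion[of "fst ?P" \<theta> "snd ?P"] \<theta>(1,2) F by auto
  have "f \<cdot>\<^bsub>SA\<^esub> ?i = g \<cdot>\<^bsub>SA\<^esub> ?i" using \<theta>(3) by (simp add: is_equalizer_def)
  from un[OF i(1) this] obtain k where k: "k \<in> hom SA (fst ?P, \<theta>) ?E" "m \<cdot>\<^bsub>SA\<^esub> k = ?i" by blast
  have "ap f (ap m a) = ap g (ap m a)" if "a \<in> pts ?E" for a
    using ap_Comp[OF m f that] ap_Comp[OF m g that] fgm by simp
  then have sub: "ap m ` pts ?E \<subseteq> sem (fst ?P) \<theta>" using ap_pts[OF m] \<theta>(2) by auto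
  obtain m' where m': "m' \<in> hom SA ?E (fst ?P, \<theta>)" "\<And>a. ap m' a = ap m a"
    using hom_factor[OF m \<theta>(1) sub] by metis
  have km: "k \<cdot>\<^bsub>SA\<^esub> m' \<in> hom SA ?E ?E" using Comp_SA(1)[OF m'(1) k(1)] .
  have "m \<cdot>\<^bsub>SA\<^esub> (k \<cdot>\<^bsub>SA\<^esub> m') = m"
  proof (rule ap_inject[OF Comp_SA(1)[OF km m] m])
    fix a assume a: "a \<in> pts ?E"
    have "ap m (ap k (ap m' a)) = ap m a"
      using ap_Comp[OF k(1) m ap_pts[OF m'(1) a]] k(2) i(2) m'(2) sub a by auto
    then show "ap (m \<cdot>\<^bsub>SA\<^esub> (k \<cdot>\<^bsub>SA\<^esub> m')) a = ap m a"
      using ap_Comp[OF km m a] ap_Comp[OF m'(1) k(1) a] by simp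
  qed
  moreover have "m \<cdot>\<^bsub>SA\<^esub> ide SA ?E = m" using m by (auto simp: hom_def)
  ultimately have "k \<cdot>\<^bsub>SA\<^esub> m' = ide SA ?E" using un[OF m fgm] km ide_SA(1)[OF F(2)] by blast
  then have "ap k (ap m a) = a" if "a \<in> pts ?E" for a
    using ap_Comp[OF m'(1) k(1) that] m'(2) ap_ide[OF F(2) that] by simp
  then show ?thesis using embedI[OF m k(1)] sub by blast
qed

lemma preimage_formula:
  assumes f: "f \<in> hom SA P Q" and T: "\<psi> \<in> carrier (Fib D (fst Q))"
  obtains \<theta> where "(fst P, \<theta>) \<in> formulas D" "sem (fst P) \<theta> = {a \<in> pts P. ap f a \<in> sem (fst Q) \<psi>}"
proof -
  have "definable (fst Q) (fst P) ((gr f)\<inverse>)"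
    using gr_hom[OF f] by (intro definable_converse) (auto simp: cmap_def)
  from definable_Image[OF this T] obtain \<theta> where
    "\<theta> \<in> carrier (Fib D (fst P))" "sem (fst P) \<theta> = (gr f)\<inverse> `` sem (fst Q) \<psi>" .
  moreover have "(gr f)\<inverse> `` sem (fst Q) \<psi> = {a \<in> pts P. ap f a \<in> sem (fst Q) \<psi>}"
    using gr_iff[OF f] by auto
  ultimately show ?thesis using that hom_formulas[OF f] by (auto simp: formulas_iff)
qed

text \<open>The inclusion of the preimage formula is part of a commuting square and so factors
  through the given pullback by some \<open>w\<close>. This \<open>w\<close> inverts
  \<open>p\<close>, which makes \<open>p\<close> an embedding with the preimage as its
  image.\<close>

lemma pullback_embed:
  assumes m: "embed m" and pb: "is_pullback SA f m p q"
  shows "embed p" "Cod SA p = Dom SA f" "img p = {a \<in> pts (Dom SA f). ap f a \<in> img m}"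
proof -
  let ?A = "Dom SA f" let ?B = "Dom SA m" let ?C = "Cod SA m" let ?P = "Dom SA p"
  have mh: "m \<in> hom SA ?B ?C" using embed_hom[OF m] .
  have f: "f \<in> hom SA ?A ?C" and p: "p \<in> hom SA ?P ?A" and q: "q \<in> hom SA ?P ?B" and fp: "f \<cdot>\<^bsub>SA\<^esub> p = m \<cdot>\<^bsub>SA\<^esub> q"
    using pb by (simp_all add: is_pullback_def hom_def)
  have un: "\<exists>!u. u \<in> hom SA W ?P \<and> p \<cdot>\<^bsub>SA\<^esub> u = h \<and> q \<cdot>\<^bsub>SA\<^esub> u = k"
    if "h \<in> hom SA W ?A" "k \<in> hom SA W ?B" "f \<cdot>\<^bsub>SA\<^esub> h = m \<cdot>\<^bsub>SA\<^esub> k" for W h k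
    using pb that unfolding is_pullback_def by blast
  have F: "?A \<in> formulas D" "?P \<in> formulas D" using hom_formulas p by auto
  show "Cod SA p = Dom SA f" using p by (simp add: hom_def)
  obtain \<psi> where \<psi>: "(fst ?C, \<psi>) \<in> formulas D" "sem (fst ?C) \<psi> = img m" "sem (fst ?C) \<psi> \<subseteq> pts ?C"
    using image_formula[OF mh] .
  obtain \<theta> where \<theta>: "(fst ?A, \<theta>) \<in> formulas D" "sem (fst ?A) \<theta> = {a \<in> pts ?A. ap f a \<in> img m}"
    using preimage_formula[OF f, of \<psi>] \<psi> by (auto simp: formulas_iff)
  let ?i = "inclusion_map D (fst ?A) \<theta> (snd ?A)"
  have i: "?i \<in> hom SA (fst ?A, \<theta>) ?A" "\<And>a. a \<in> sem (fst ?A) \<theta> \<Longrightarrow> ap ?i a = a"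
    using inclusion_map_hom(1)[of "fst ?A" \<theta> "snd ?A"] ap_inclusion[of "fst ?A" \<theta> "snd ?A"] \<theta> F by auto
  have "ap (f \<cdot>\<^bsub>SA\<^esub> ?i) ` pts (fst ?A, \<theta>) \<subseteq> img m" using ap_Comp[OF i(1) f] i(2) \<theta>(2) by auto
  then obtain k where k: "k \<in> hom SA (fst ?A, \<theta>) ?B" "m \<cdot>\<^bsub>SA\<^esub> k = f \<cdot>\<^bsub>SA\<^esub> ?i"
    using embed_factor[OF m mh Comp_SA(1)[OF i(1) f]] by blast
  obtain w where w: "w \<in> hom SA (fst ?A, \<theta>) ?P" "p \<cdot>\<^bsub>SA\<^esub> w = ?i" "q \<cdot>\<^bsub>SA\<^esub> w = k"
    using un[OF i(1) k(1) k(2)[symmetric]] by blast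
  have "ap f (ap p a) = ap m (ap q a)" if "a \<in> pts ?P" for a
    using ap_Comp[OF p f that] ap_Comp[OF q mh that] fp by simp
  then have sub: "img p \<subseteq> sem (fst ?A) \<theta>" using ap_pts[OF p] ap_pts[OF q] \<theta>(2) by auto
  obtain p' where p': "p' \<in> hom SA ?P (fst ?A, \<theta>)" "\<And>a. ap p' a = ap p a"
    using hom_factor[OF p \<theta>(1) sub] by metis
  let ?u = "w \<cdot>\<^bsub>SA\<^esub> p'"
  have u: "?u \<in> hom SA ?P ?P" using Comp_SA(1)[OF p'(1) w(1)] .
  have "p \<cdot>\<^bsub>SA\<^esub> ?u = p"
  proof (rule ap_inject[OF Comp_SA(1)[OF u p] p])
    fix a assume a: "a \<in> pts ?P"
    show "ap (p \<cdot>\<^bsub>SA\<^esub> ?u) a = ap p a"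
      using ap_Comp[OF u p a] ap_Comp[OF p'(1) w(1) a] ap_Comp[OF w(1) p ap_pts[OF p'(1) a]] w(2) i(2) p'(2) sub a by auto
  qed
  moreover have "q \<cdot>\<^bsub>SA\<^esub> ?u = q"
  proof (rule embed_cancel[OF m mh Comp_SA(1)[OF u q] q])
    show "m \<cdot>\<^bsub>SA\<^esub> (q \<cdot>\<^bsub>SA\<^esub> ?u) = m \<cdot>\<^bsub>SA\<^esub> q"
      using SA.Comp_assoc[OF u q mh] SA.Comp_assoc[OF u p f] fp calculation by simp
  qed
  moreover have "ide SA ?P \<in> hom SA ?P ?P" "p \<cdot>\<^bsub>SA\<^esub> ide SA ?P = p" "q \<cdot>\<^bsub>SA\<^esub> ide SA ?P = q"
    using ide_SA(1)[OF F(2)] p q by (auto simp: hom_def)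
  ultimately have uide: "?u = ide SA ?P" using un[OF p q fp] u by blast
  have "ap w (ap p a) = a" if "a \<in> pts ?P" for a
    using ap_Comp[OF p'(1) w(1) that] p'(2) uide ap_ide[OF F(2) that] by simp
  then show "embed p" using embedI[OF p w(1)] sub by blast
  have "sem (fst ?A) \<theta> \<subseteq> img p"
  proof
    fix a assume a: "a \<in> sem (fst ?A) \<theta>"
    then have "ap p (ap w a) = a" using ap_Comp[OF w(1) p, of a] w(2) i(2) by simp
    then show "a \<in> img p" using ap_pts[OF w(1), of a] a by force
  qed
  then show "img p = {a \<in> pts ?A. ap f a \<in> img m}" using sub \<theta>(2) by blast
qed

text \<open>The counterpart of \<open>pullback_embed\<close>: every embedding with the right image
  is a pullback. Together they make \<open>subobj_pullback\<close> a whole isomorphism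
  class.\<close>

lemma embed_pullback:
  assumes m: "embed m" "m \<in> hom SA B C" and f: "f \<in> hom SA A C" and n: "embed n" "n \<in> hom SA N A"
    and img: "ap n ` pts N = {a \<in> pts A. ap f a \<in> ap m ` pts B}"
  shows "\<exists>q. is_pullback SA f m n q"
proof -
  have fn: "f \<cdot>\<^bsub>SA\<^esub> n \<in> hom SA N C" using Comp_SA(1)[OF n(2) f] .
  have "ap (f \<cdot>\<^bsub>SA\<^esub> n) ` pts N \<subseteq> ap m ` pts B" using ap_Comp[OF n(2) f] img by auto
  then obtain q where q: "q \<in> hom SA N B" "m \<cdot>\<^bsub>SA\<^esub> q = f \<cdot>\<^bsub>SA\<^esub> n"
    using embed_factor[OF m fn] by blast
  have un: "\<exists>!u. u \<in> hom SA W N \<and> n \<cdot>\<^bsub>SA\<^esub> u = h \<and> q \<cdot>\<^bsub>SA\<^esub> u = k"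
    if h: "h \<in> hom SA W A" and k: "k \<in> hom SA W B" and e: "f \<cdot>\<^bsub>SA\<^esub> h = m \<cdot>\<^bsub>SA\<^esub> k" for W h k
  proof -
    have "ap f (ap h a) = ap m (ap k a)" if "a \<in> pts W" for a
      using ap_Comp[OF h f that] ap_Comp[OF k m(2) that] e by simp
    then have "ap h ` pts W \<subseteq> ap n ` pts N" using img ap_pts[OF h] ap_pts[OF k] by auto
    then obtain u where u: "u \<in> hom SA W N" "n \<cdot>\<^bsub>SA\<^esub> u = h" using embed_factor[OF n h] by blast
    have "q \<cdot>\<^bsub>SA\<^esub> u = k"
    proof (rule embed_cancel[OF m Comp_SA(1)[OF u(1) q(1)] k])
      show "m \<cdot>\<^bsub>SA\<^esub> (q \<cdot>\<^bsub>SA\<^esub> u) = m \<cdot>\<^bsub>SA\<^esub> k"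
        using SA.Comp_assoc[OF u(1) q(1) m(2)] SA.Comp_assoc[OF u(1) n(2) f] q(2) u(2) e by simp
    qed
    then show ?thesis using u embed_cancel[OF n] by metis
  qed
  have "is_pullback SA f m n q"
    unfolding is_pullback_def
  proof (intro conjI allI ballI impI)
    show "\<exists>!u. u \<in> hom SA W (Dom SA n) \<and> n \<cdot>\<^bsub>SA\<^esub> u = h \<and> q \<cdot>\<^bsub>SA\<^esub> u = k"
      if "h \<in> hom SA W (Dom SA f)" "k \<in> hom SA W (Dom SA m)" "f \<cdot>\<^bsub>SA\<^esub> h = m \<cdot>\<^bsub>SA\<^esub> k" for W h k
      using un[of h W k] that m(2) f n(2) by (simp add: hom_def)
  qed (use m(2) f n(2) q in \<open>simp_all add: hom_def\<close>)
  then show ?thesis by blast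
qed

text \<open>Points are lifted through a concrete cone, the equalizer inside the product formula.
  Above \<open>a\<close> it contains the tuple of \<open>a\<close> with a preimage of
  \<open>f a\<close> under \<open>e\<close>, and the cone factors through \<open>p\<close>.\<close>

lemma pullback_surjection:
  assumes e: "e \<in> Synt_E D CD" and pb: "is_pullback SA f e p q"
  shows "p \<in> Synt_E D CD"
proof -
  let ?A = "Dom SA f" let ?B = "Dom SA e" let ?C = "Cod SA e" let ?P = "Dom SA p"
  have eh: "e \<in> hom SA ?B ?C" and es: "Range (gr e) = pts ?C" using e by (auto simp: Synt_E_iff Arr_SA)
  have f: "f \<in> hom SA ?A ?C" and p: "p \<in> hom SA ?P ?A" and q: "q \<in> hom SA ?P ?B"
    using pb by (simp_all add: is_pullback_def hom_def)
  have un: "\<exists>!u. u \<in> hom SA W ?P \<and> p \<cdot>\<^bsub>SA\<^esub> u = h \<and> q \<cdot>\<^bsub>SA\<^esub> u = k"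
    if "h \<in> hom SA W ?A" "k \<in> hom SA W ?B" "f \<cdot>\<^bsub>SA\<^esub> h = e \<cdot>\<^bsub>SA\<^esub> k" for W h k
    using pb that unfolding is_pullback_def by blast
  have F: "?A \<in> formulas D" "?B \<in> formulas D" using hom_formulas f eh by auto
  have O: "fst ?A \<in> Ob (Base D)" "fst ?B \<in> Ob (Base D)" using F by (auto simp: formulas_iff)
  let ?R = "prodF ?A ?B"
  obtain r s where rs: "r \<in> hom SA ?R ?A" "s \<in> hom SA ?R ?B"
    "\<And>c. c \<in> pts ?R \<Longrightarrow> ap r c = act (pr1 (Base D) (fst ?A) (fst ?B)) c"
    "\<And>c. c \<in> pts ?R \<Longrightarrow> ap s c = act (pr2 (Base D) (fst ?A) (fst ?B)) c"
    using prodF_projections[OF F] by metis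
  have fr: "f \<cdot>\<^bsub>SA\<^esub> r \<in> hom SA ?R ?C" and es': "e \<cdot>\<^bsub>SA\<^esub> s \<in> hom SA ?R ?C"
    using Comp_SA(1)[OF rs(1) f] Comp_SA(1)[OF rs(2) eh] by auto
  obtain \<theta> where \<theta>: "(fst ?R, \<theta>) \<in> formulas D"
    "sem (fst ?R) \<theta> = {a \<in> pts ?R. ap (f \<cdot>\<^bsub>SA\<^esub> r) a = ap (e \<cdot>\<^bsub>SA\<^esub> s) a}"
    "is_equalizer SA (f \<cdot>\<^bsub>SA\<^esub> r) (e \<cdot>\<^bsub>SA\<^esub> s) (inclusion_map D (fst ?R) \<theta> (snd ?R))" using equalizer_SA[OF fr es'] .
  let ?i = "inclusion_map D (fst ?R) \<theta> (snd ?R)"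
  have RF: "?R \<in> formulas D" using prodF(1)[OF F] .
  have i: "?i \<in> hom SA (fst ?R, \<theta>) ?R" "\<And>a. a \<in> sem (fst ?R) \<theta> \<Longrightarrow> ap ?i a = a"
    using inclusion_map_hom(1)[of "fst ?R" \<theta> "snd ?R"] ap_inclusion[of "fst ?R" \<theta> "snd ?R"] \<theta>(1,2) RF by auto
  have h: "r \<cdot>\<^bsub>SA\<^esub> ?i \<in> hom SA (fst ?R, \<theta>) ?A" and k: "s \<cdot>\<^bsub>SA\<^esub> ?i \<in> hom SA (fst ?R, \<theta>) ?B"
    using Comp_SA(1)[OF i(1) rs(1)] Comp_SA(1)[OF i(1) rs(2)] by auto
  have "f \<cdot>\<^bsub>SA\<^esub> (r \<cdot>\<^bsub>SA\<^esub> ?i) = e \<cdot>\<^bsub>SA\<^esub> (s \<cdot>\<^bsub>SA\<^esub> ?i)"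
    using \<theta>(3) SA.Comp_assoc[OF i(1) rs(1) f] SA.Comp_assoc[OF i(1) rs(2) eh] by (simp add: is_equalizer_def)
  from un[OF h k this] obtain u where u: "u \<in> hom SA (fst ?R, \<theta>) ?P" "p \<cdot>\<^bsub>SA\<^esub> u = r \<cdot>\<^bsub>SA\<^esub> ?i" by blast
  have "a \<in> Range (gr p)" if a: "a \<in> pts ?A" for a
  proof -
    have "ap f a \<in> Range (gr e)" using es ap_pts[OF f a] by simp
    then obtain b where b: "b \<in> pts ?B" "ap f a = ap e b" using gr_iff[OF eh] by (auto simp: Range_iff)
    have fb: "fib a = fib b" using fib_ap[OF f a] fib_ap[OF eh b(1)] b(2) by simp
    let ?c = "tuple (fst ?A) (fst ?B) a b"
    have t: "?c \<in> El (prod_ob (Base D) (fst ?A) (fst ?B))" "act (pr1 (Base D) (fst ?A) (fst ?B)) ?c = a"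
      "act (pr2 (Base D) (fst ?A) (fst ?B)) ?c = b"
      using tuple_simps[OF O, of a b] a b(1) fb pts_El[OF F(1)] pts_El[OF F(2)] by auto
    have cR: "?c \<in> pts ?R" using t a b prodF(3)[OF F] by simp
    have c: "?c \<in> sem (fst ?R) \<theta>" using cR \<theta>(2) ap_Comp[OF rs(1) f cR] ap_Comp[OF rs(2) eh cR] rs(3,4)[OF cR] t b(2) by simp
    have "ap p (ap u ?c) = ap r (ap ?i ?c)"
      using ap_Comp[OF u(1) p, of ?c] ap_Comp[OF i(1) rs(1), of ?c] u(2) c by simp
    then have "ap p (ap u ?c) = a" using i(2)[OF c] rs(3)[OF cR] t by simp
    then show ?thesis using gr_iff[OF p] ap_pts[OF u(1), of ?c] c by (auto simp: Range_iff)
  qed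
  moreover have "Range (gr p) \<subseteq> pts ?A" using gr_hom[OF p] by (simp add: cmap_def)
  ultimately show ?thesis using p by (auto simp: Synt_E_iff hom_def)
qed

section \<open>Subobjects and their modality\<close>

text \<open>Embeddings with the same image factor through each other, and by cancellation the two
  factorizations are inverse. A subobject is therefore determined by its set of points.\<close>

lemma subobj_class_iff:
  assumes m: "embed m"
  shows "subobj_class SA (Synt_M D CD) m = {n. embed n \<and> Cod SA n = Cod SA m \<and> img n = img m}"
proof (rule Set.set_eqI)
  fix n
  show "n \<in> subobj_class SA (Synt_M D CD) m \<longleftrightarrow> n \<in> {n. embed n \<and> Cod SA n = Cod SA m \<and> img n = img m}"
  proof
    assume "n \<in> subobj_class SA (Synt_M D CD) m"
    then obtain u where n: "embed n" "Cod SA n = Cod SA m" and u: "u \<in> hom SA (Dom SA m) (Dom SA n)" "iso SA u"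
      "n \<cdot>\<^bsub>SA\<^esub> u = m" by (auto simp: subobj_class_def Synt_M_iff)
    have "ap u ` pts (Dom SA m) = pts (Dom SA n)"
      using u(2) gr_eq[OF u(1)] u(1) by (auto simp: iso_iff hom_def)
    moreover have "ap m a = ap n (ap u a)" if "a \<in> pts (Dom SA m)" for a
      using ap_Comp[OF u(1) embed_hom[OF n(1)] that] u(3) by simp
    ultimately have "img n = img m" by force
    then show "n \<in> {n. embed n \<and> Cod SA n = Cod SA m \<and> img n = img m}" using n by simp
  next
    assume "n \<in> {n. embed n \<and> Cod SA n = Cod SA m \<and> img n = img m}"
    then have n: "embed n" and c: "Cod SA n = Cod SA m" and e: "img n = img m" by auto
    have mh: "m \<in> hom SA (Dom SA m) (Cod SA m)" using embed_hom[OF m] .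
    have nh: "n \<in> hom SA (Dom SA n) (Cod SA m)" using embed_hom[OF n] c by simp
    have o: "Dom SA m \<in> formulas D" "Dom SA n \<in> formulas D" using hom_formulas mh nh by auto
    obtain u where u: "u \<in> hom SA (Dom SA m) (Dom SA n)" "n \<cdot>\<^bsub>SA\<^esub> u = m"
      using embed_factor[OF n nh mh] e by blast
    obtain v where v: "v \<in> hom SA (Dom SA n) (Dom SA m)" "m \<cdot>\<^bsub>SA\<^esub> v = n"
      using embed_factor[OF m mh nh] e by blast
    have vu: "v \<cdot>\<^bsub>SA\<^esub> u = ide SA (Dom SA m)"
      by (rule embed_cancel[OF m mh Comp_SA(1)[OF u(1) v(1)] ide_SA(1)[OF o(1)]])
        (use SA.Comp_assoc[OF u(1) v(1) mh] SA.Comp_ide_right[OF mh] u(2) v(2) in simp)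
    have uv: "u \<cdot>\<^bsub>SA\<^esub> v = ide SA (Dom SA n)"
      by (rule embed_cancel[OF n nh Comp_SA(1)[OF v(1) u(1)] ide_SA(1)[OF o(2)]])
        (use SA.Comp_assoc[OF v(1) u(1) nh] SA.Comp_ide_right[OF nh] u(2) v(2) in simp)
    have "iso SA u"
      unfolding iso_def by (intro conjI bexI[of _ v]) (use u(1) v(1) uv vu in \<open>simp_all add: hom_def\<close>)
    then show "n \<in> subobj_class SA (Synt_M D CD) m"
      unfolding subobj_class_def using n c u by (auto simp: Synt_M_iff)
  qed
qed

abbreviation subs :: "('o, 'd) formula \<Rightarrow> ('o, 'd) synt_map set set" where
  "subs P \<equiv> carrier (subobj_order SA (Synt_M D CD) P)"

definition ssem :: "('o, 'd) synt_map set \<Rightarrow> 'p set" where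
  "ssem A = (\<Union>n\<in>A. img n)"

lemma ssem_class: "embed m \<Longrightarrow> ssem (subobj_class SA (Synt_M D CD) m) = img m"
  unfolding ssem_def subobj_class_iff by blast

lemma subs_class: "\<lbrakk>embed m; Cod SA m = P\<rbrakk> \<Longrightarrow> subobj_class SA (Synt_M D CD) m \<in> subs P"
  by (auto simp: subobj_order_def Synt_M_iff)

lemma subs_cases:
  assumes "A \<in> subs P"
  obtains m where "embed m" "Cod SA m = P" "A = subobj_class SA (Synt_M D CD) m" "img m = ssem A"
proof -
  obtain m where "embed m" "Cod SA m = P" "A = subobj_class SA (Synt_M D CD) m"
    using assms by (auto simp: subobj_order_def Synt_M_iff)
  then show ?thesis using that ssem_class by blast
qed

lemma subs_mem:
  assumes "A \<in> subs P"
  shows "n \<in> A \<longleftrightarrow> embed n \<and> Cod SA n = P \<and> img n = ssem A"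
proof -
  obtain m where "embed m" "Cod SA m = P" "A = subobj_class SA (Synt_M D CD) m" "img m = ssem A"
    using subs_cases[OF assms] .
  then show ?thesis using subobj_class_iff[of m] by auto
qed

lemma subs_inject:
  assumes "A \<in> subs P" "B \<in> subs P" "ssem A = ssem B"
  shows "A = B"
  using subs_mem[OF assms(1)] subs_mem[OF assms(2)] assms(3) by blast

lemma subs_le:
  assumes A: "A \<in> subs P" and B: "B \<in> subs P"
  shows "A \<sqsubseteq>\<^bsub>subobj_order SA (Synt_M D CD) P\<^esub> B \<longleftrightarrow> ssem A \<subseteq> ssem B"
proof
  assume "A \<sqsubseteq>\<^bsub>subobj_order SA (Synt_M D CD) P\<^esub> B"
  then obtain m n u where mn: "m \<in> A" "n \<in> B" and u: "u \<in> hom SA (Dom SA m) (Dom SA n)" "n \<cdot>\<^bsub>SA\<^esub> u = m"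
    unfolding subobj_order_def by auto
  have n: "embed n" "img n = ssem B" "img m = ssem A" using mn subs_mem[OF A] subs_mem[OF B] by auto
  show "ssem A \<subseteq> ssem B"
    unfolding n(2,3)[symmetric] using ap_Comp[OF u(1) embed_hom[OF n(1)]] u(2) ap_pts[OF u(1)] by auto
next
  assume sub: "ssem A \<subseteq> ssem B"
  obtain m where m: "embed m" "Cod SA m = P" "img m = ssem A" using subs_cases[OF A] by metis
  obtain n where n: "embed n" "Cod SA n = P" "img n = ssem B" using subs_cases[OF B] by metis
  have "m \<in> A" "n \<in> B" using m n subs_mem[OF A] subs_mem[OF B] by auto
  moreover obtain u where "u \<in> hom SA (Dom SA m) (Dom SA n)" "n \<cdot>\<^bsub>SA\<^esub> u = m"
    using embed_factor[OF n(1), of "Dom SA n" P m "Dom SA m"] embed_hom[OF m(1)] embed_hom[OF n(1)] m n sub by metis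
  ultimately show "A \<sqsubseteq>\<^bsub>subobj_order SA (Synt_M D CD) P\<^esub> B"
    unfolding subobj_order_def by auto
qed

lemma subs_formula:
  assumes "A \<in> subs P"
  obtains \<theta> where "(fst P, \<theta>) \<in> formulas D" "sem (fst P) \<theta> = ssem A" "ssem A \<subseteq> pts P"
proof -
  obtain m where m: "embed m" "Cod SA m = P" "img m = ssem A" using subs_cases[OF assms] by metis
  have "m \<in> hom SA (Dom SA m) P" using embed_hom[OF m(1)] m(2) by simp
  then show ?thesis using image_formula[of m "Dom SA m" P] that m(3) by metis
qed

lemma inclusion_subobj:
  assumes "P \<in> formulas D" "(fst P, \<theta>) \<in> formulas D" "sem (fst P) \<theta> \<subseteq> pts P"
  shows "inclusion_subobj D CD P \<theta> \<in> subs P" "ssem (inclusion_subobj D CD P \<theta>) = sem (fst P) \<theta>"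
proof -
  let ?i = "inclusion_map D (fst P) \<theta> (snd P)"
  have e: "embed ?i" using embed_inclusion[of "fst P" \<theta> "snd P"] assms by simp
  have i: "?i \<in> hom SA (fst P, \<theta>) P" using inclusion_map_hom(1)[of "fst P" \<theta> "snd P"] assms by simp
  have "ap ?i a = a" if "a \<in> sem (fst P) \<theta>" for a using ap_inclusion[of "fst P" \<theta> "snd P" a] assms that by simp
  then have img: "img ?i = sem (fst P) \<theta>" using i by (auto simp: hom_def)
  have c: "inclusion_subobj D CD P \<theta> = subobj_class SA (Synt_M D CD) ?i"
    by (simp add: inclusion_subobj_def split_beta)
  show "inclusion_subobj D CD P \<theta> \<in> subs P" unfolding c using subs_class[OF e] i by (simp add: hom_def)
  show "ssem (inclusion_subobj D CD P \<theta>) = sem (fst P) \<theta>" unfolding c ssem_class[OF e] by (rule img)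
qed

text \<open>Stated for any order record with this carrier and order because it is applied to
  \<open>subobj_order\<close> and also to the fibres of the subobject doctrine, which carry a
  modality in addition.\<close>

lemma subs_boolean:
  assumes P: "P \<in> formulas D" and L: "carrier L = subs P" "eq L = (=)" "le L = le (subobj_order SA (Synt_M D CD) P)"
  shows "boolean_lattice L"
    "\<lbrakk>A \<in> subs P; B \<in> subs P\<rbrakk> \<Longrightarrow> ssem (A \<sqinter>\<^bsub>L\<^esub> B) = ssem A \<inter> ssem B"
    "\<lbrakk>A \<in> subs P; B \<in> subs P\<rbrakk> \<Longrightarrow> ssem (A \<squnion>\<^bsub>L\<^esub> B) = ssem A \<union> ssem B"
    "ssem \<top>\<^bsub>L\<^esub> = pts P" "ssem \<bottom>\<^bsub>L\<^esub> = {}"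
proof -
  let ?T = "inclusion_subobj D CD P (snd P)"
  have T: "?T \<in> subs P" "ssem ?T = pts P" using inclusion_subobj[OF P, of "snd P"] P by auto
  have X: "fst P \<in> Ob (Base D)" using P by (simp add: formulas_iff)
  have l: "A \<sqsubseteq>\<^bsub>L\<^esub> B \<longleftrightarrow> ssem A \<subseteq> ssem B" if "A \<in> carrier L" "B \<in> carrier L" for A B
    using subs_le that L by metis
  have i: "A = B" if "A \<in> carrier L" "B \<in> carrier L" "ssem A = ssem B" for A B
    using subs_inject that L by metis
  have t: "?T \<in> carrier L" using T L by simp
  have s: "ssem A \<subseteq> ssem ?T" if "A \<in> carrier L" for A
    using subs_formula[of A P] that L T by metis
  have m: "\<exists>E\<in>carrier L. ssem E = ssem A \<inter> ssem B" if AB: "A \<in> carrier L" "B \<in> carrier L" for A B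
  proof -
    obtain \<alpha> where a: "(fst P, \<alpha>) \<in> formulas D" "sem (fst P) \<alpha> = ssem A" "ssem A \<subseteq> pts P"
      using subs_formula AB L by metis
    obtain \<beta> where b: "(fst P, \<beta>) \<in> formulas D" "sem (fst P) \<beta> = ssem B" "ssem B \<subseteq> pts P"
      using subs_formula AB L by metis
    have "\<alpha> \<in> carrier (Fib D (fst P))" "\<beta> \<in> carrier (Fib D (fst P))" using a b by (auto simp: formulas_iff)
    note g = sem_meet[OF X this]
    have sub: "ssem A \<inter> ssem B \<subseteq> pts P" using a(3) by blast
    show ?thesis
      by (rule bexI[of _ "inclusion_subobj D CD P (\<alpha> \<sqinter>\<^bsub>Fib D (fst P)\<^esub> \<beta>)"])
        (use inclusion_subobj[OF P, of "\<alpha> \<sqinter>\<^bsub>Fib D (fst P)\<^esub> \<beta>"] g X a b L sub in \<open>auto simp: formulas_iff\<close>)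
  qed
  have c: "\<exists>E\<in>carrier L. ssem E = ssem ?T - ssem A" if A: "A \<in> carrier L" for A
  proof -
    obtain \<alpha> where a: "(fst P, \<alpha>) \<in> formulas D" "sem (fst P) \<alpha> = ssem A" "ssem A \<subseteq> pts P"
      using subs_formula A L by metis
    have ac: "\<alpha> \<in> carrier (Fib D (fst P))" and pc: "snd P \<in> carrier (Fib D (fst P))" using a P by (auto simp: formulas_iff)
    obtain \<beta> where b: "\<beta> \<in> carrier (Fib D (fst P))" "sem (fst P) \<beta> = El (fst P) - sem (fst P) \<alpha>"
      using complement_sem[OF X ac] .
    \<comment> \<open>Complements come from the whole fibre over \<open>fst P\<close> and are cut
      down to \<open>P\<close>.\<close>
    let ?\<gamma> = "snd P \<sqinter>\<^bsub>Fib D (fst P)\<^esub> \<beta>"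
    note g = sem_meet[OF X pc b(1)]
    have gs: "sem (fst P) ?\<gamma> = pts P - ssem A" using g b a pts_El[OF P] by auto
    have "(fst P, ?\<gamma>) \<in> formulas D" using g X by (simp add: formulas_iff)
    then show ?thesis
      using inclusion_subobj[OF P, of ?\<gamma>] gs T L by (intro bexI[of _ "inclusion_subobj D CD P ?\<gamma>"]) auto
  qed
  note B = boolean_lattice_of_field_of_sets[where s=ssem and L=L and T="?T", OF L(2) l i t s m c]
  show "boolean_lattice L" by (rule B(1))
  show "ssem (A \<sqinter>\<^bsub>L\<^esub> B) = ssem A \<inter> ssem B" if "A \<in> subs P" "B \<in> subs P"
    by (rule B(2)) (use that L in simp_all)
  show "ssem (A \<squnion>\<^bsub>L\<^esub> B) = ssem A \<union> ssem B" if "A \<in> subs P" "B \<in> subs P"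
    by (rule B(3)) (use that L in simp_all)
  show "ssem \<top>\<^bsub>L\<^esub> = pts P" by (rule trans[OF B(4) T(2)])
  show "ssem \<bottom>\<^bsub>L\<^esub> = {}" by (rule B(5))
qed

text \<open>The class of pullbacks is identified with the class of the inclusion of the preimage
  formula, one inclusion by \<open>pullback_embed\<close> and the other by
  \<open>embed_pullback\<close>.\<close>

lemma subobj_pullback_sem:
  assumes f: "f \<in> hom SA P Q" and A: "A \<in> subs Q"
  shows "subobj_pullback SA f A \<in> subs P" "ssem (subobj_pullback SA f A) = {a \<in> pts P. ap f a \<in> ssem A}"
proof -
  obtain \<psi> where \<psi>: "(fst Q, \<psi>) \<in> formulas D" "sem (fst Q) \<psi> = ssem A" "ssem A \<subseteq> pts Q"
    using subs_formula[OF A] .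
  obtain \<theta> where \<theta>: "(fst P, \<theta>) \<in> formulas D" "sem (fst P) \<theta> = {a \<in> pts P. ap f a \<in> ssem A}"
    using preimage_formula[OF f, of \<psi>] \<psi> by (auto simp: formulas_iff)
  have P: "P \<in> formulas D" using hom_formulas[OF f] by simp
  have df: "Dom SA f = P" using f by (simp add: hom_def)
  let ?B = "inclusion_subobj D CD P \<theta>"
  have B: "?B \<in> subs P" "ssem ?B = {a \<in> pts P. ap f a \<in> ssem A}"
    using inclusion_subobj[OF P \<theta>(1)] \<theta>(2) by auto
  obtain m where m: "embed m" "Cod SA m = Q" "img m = ssem A" using subs_cases[OF A] by metis
  have mh: "m \<in> hom SA (Dom SA m) Q" using embed_hom[OF m(1)] m(2) by simp
  have mA: "m \<in> A" using m subs_mem[OF A] by blast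
  have "subobj_pullback SA f A = ?B"
  proof (rule Set.set_eqI)
    fix n
    show "n \<in> subobj_pullback SA f A \<longleftrightarrow> n \<in> ?B"
    proof
      assume "n \<in> subobj_pullback SA f A"
      then obtain k q where k: "k \<in> A" "is_pullback SA f k n q" unfolding subobj_pullback_def by auto
      have "embed k" "img k = ssem A" using k(1) subs_mem[OF A] by auto
      then show "n \<in> ?B" using pullback_embed[OF _ k(2)] subs_mem[OF B(1)] B(2) df by simp
    next
      assume "n \<in> ?B"
      then have n: "embed n" "Cod SA n = P" "img n = {a \<in> pts P. ap f a \<in> img m}"
        using subs_mem[OF B(1)] B(2) m by auto
      have nh: "n \<in> hom SA (Dom SA n) P" using embed_hom[OF n(1)] n(2) by simp
      have "\<exists>q. is_pullback SA f m n q" by (rule embed_pullback[OF m(1) mh f n(1) nh n(3)])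
      then show "n \<in> subobj_pullback SA f A" using mA unfolding subobj_pullback_def by blast
    qed
  qed
  then show "subobj_pullback SA f A \<in> subs P" "ssem (subobj_pullback SA f A) = {a \<in> pts P. ap f a \<in> ssem A}"
    using B by simp_all
qed

lemma f_boolean_category_SA: "f_boolean_category SA (Synt_E D CD) (Synt_M D CD)"
proof (intro f_boolean_category.intro factorization_system_SA f_boolean_category_axioms.intro)
  show "has_finite_limits SA" by (rule has_finite_limits_SA)
  show "monomorphism SA m" if "m \<in> Synt_M D CD" for m
  proof -
    have m: "embed m" using that by (simp add: Synt_M_iff)
    show ?thesis
      unfolding monomorphism_def
    proof (intro conjI allI ballI impI)
      show "m \<in> Arr SA" using m by (simp add: embed_def)
    qed (rule embed_cancel[OF m embed_hom[OF m]])
  qed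
  show "m \<in> Synt_M D CD" if "regular_mono SA m" for m
    using regular_mono_embed[OF that] by (simp add: Synt_M_iff)
  show "p \<in> Synt_E D CD" if "e \<in> Synt_E D CD" "is_pullback SA f e p q" for e f p q
    by (rule pullback_surjection[OF that])
  show "p \<in> Synt_M D CD" if "m \<in> Synt_M D CD" "is_pullback SA f m p q" for m f p q
    using pullback_embed(1)[OF _ that(2)] that(1) by (simp add: Synt_M_iff)
  show "boolean_lattice (subobj_order SA (Synt_M D CD) P)" if "P \<in> Ob SA" for P
    by (rule subs_boolean(1)) (use that in \<open>simp_all add: SA_sel subobj_order_def\<close>)
  fix f P Q assume f: "f \<in> hom SA P Q"
  then have F: "P \<in> formulas D" "Q \<in> formulas D" using hom_formulas by auto
  let ?LP = "subobj_order SA (Synt_M D CD) P" let ?LQ = "subobj_order SA (Synt_M D CD) Q"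
  have e: "eq ?LP = (=)" "eq ?LQ = (=)" by (simp_all add: subobj_order_def)
  note BP = subs_boolean[OF F(1) refl e(1) refl] note BQ = subs_boolean[OF F(2) refl e(2) refl]
  interpret LP: boolean_lattice ?LP by (rule BP(1))
  interpret LQ: boolean_lattice ?LQ by (rule BQ(1))
  note p = subobj_pullback_sem[OF f]
  show "boolean_hom ?LQ ?LP (subobj_pullback SA f)"
    unfolding boolean_hom_def
  proof (intro conjI ballI)
    show "subobj_pullback SA f \<in> subs Q \<rightarrow> subs P" using p by auto
    show "subobj_pullback SA f \<top>\<^bsub>?LQ\<^esub> = \<top>\<^bsub>?LP\<^esub>"
      by (rule subs_inject[where P=P]) (use p BP(4) BQ(4) ap_pts[OF f] in auto)
    show "subobj_pullback SA f \<bottom>\<^bsub>?LQ\<^esub> = \<bottom>\<^bsub>?LP\<^esub>"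
      by (rule subs_inject[where P=P]) (use p BP(5) BQ(5) in auto)
    fix A B assume A: "A \<in> subs Q" and B: "B \<in> subs Q"
    show "subobj_pullback SA f (A \<sqinter>\<^bsub>?LQ\<^esub> B) = subobj_pullback SA f A \<sqinter>\<^bsub>?LP\<^esub> subobj_pullback SA f B"
      by (rule subs_inject[where P=P]) (use p A B BP(2) BQ(2) in auto)
    show "subobj_pullback SA f (A \<squnion>\<^bsub>?LQ\<^esub> B) = subobj_pullback SA f A \<squnion>\<^bsub>?LP\<^esub> subobj_pullback SA f B"
      by (rule subs_inject[where P=P]) (use p A B BP(3) BQ(3) in auto)
  qed
qed

section \<open>The subobject doctrine and its points\<close>

abbreviation SD :: "(('o, 'd) formula, ('o, 'd) synt_map, ('o, 'd) synt_map set) doctrine" where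
  "SD \<equiv> subobj_doctrine SA (Synt_M D CD) (Synt_dia D CD)"

lemma SD_sel [simp]: "Base SD = SA" "carrier (Fib SD P) = subs P" "eq (Fib SD P) = (=)"
    "le (Fib SD P) = le (subobj_order SA (Synt_M D CD) P)" "Sub SD = subobj_pullback SA"
    "dia (Fib SD P) = Synt_dia D CD P"
  by (simp_all add: subobj_doctrine_def)

text \<open>The second instance of the semantics, by which the calculus of relations over subobjects
  is also computed with sets of pairs. Tuples need an argument: the chosen product is compared with
  \<open>prodF\<close>, whose points are tuples by construction.\<close>

lemma set_semantics_SD: "set_semantics SD pts ap (\<lambda>P. ssem) fib"
proof (rule set_semantics.intro)
  show "cartesian_category (Base SD)" using cartesian_SA by simp
next
  fix f P Q a assume "f \<in> hom (Base SD) P Q" and a: "a \<in> pts P"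
  then have f: "f \<in> hom SA P Q" by simp
  show "ap f a \<in> pts Q" "fib (ap f a) = fib a" using ap_pts[OF f a] fib_ap[OF f a] by auto
  show "ap (g \<cdot>\<^bsub>Base SD\<^esub> f) a = ap g (ap f a)" if "g \<in> hom (Base SD) Q R" for g R
    using ap_Comp[OF f _ a] that by simp
next
  fix P a assume "P \<in> Ob (Base SD)" "a \<in> pts P"
  then show "ap (ide (Base SD) P) a = a" using ap_ide by (simp add: SA_sel)
next
  fix P Q assume "P \<in> Ob (Base SD)" "Q \<in> Ob (Base SD)"
  then have F: "P \<in> formulas D" "Q \<in> formulas D" by (simp_all add: SA_sel)
  have FO: "P \<in> Ob SA" "Q \<in> Ob SA" using F by (simp_all add: SA_sel)
  have O: "fst P \<in> Ob (Base D)" "fst Q \<in> Ob (Base D)" using F by (simp_all add: formulas_iff)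
  obtain p q where pq: "p \<in> hom SA (prodF P Q) P" "q \<in> hom SA (prodF P Q) Q"
    "\<And>c. c \<in> pts (prodF P Q) \<Longrightarrow> ap p c = act (pr1 (Base D) (fst P) (fst Q)) c"
    "\<And>c. c \<in> pts (prodF P Q) \<Longrightarrow> ap q c = act (pr2 (Base D) (fst P) (fst Q)) c"
    "is_product SA P Q (prodF P Q) p q" by (rule prodF_projections[OF F]) (rule that)
  let ?R = "prod_ob SA P Q" let ?p = "pr1 SA P Q" let ?q = "pr2 SA P Q"
  have R: "?p \<in> hom SA ?R P" "?q \<in> hom SA ?R Q" using FO by (simp_all add: hom_def)
  have RF: "?R \<in> formulas D" using hom_formulas[OF R(1)] by simp
  have j: "pair SA p q \<in> hom SA (prodF P Q) ?R" "?p \<cdot>\<^bsub>SA\<^esub> pair SA p q = p" "?q \<cdot>\<^bsub>SA\<^esub> pair SA p q = q"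
    using pq(1,2) by (simp_all add: hom_def)
  obtain k where k: "k \<in> hom SA ?R (prodF P Q)" "\<And>a. a \<in> pts ?R \<Longrightarrow> ap k a = tuple (fst P) (fst Q) (ap ?p a) (ap ?q a)"
    by (rule hom_pair[OF R]) (rule that)
  {
    fix a b assume a: "a \<in> pts P" and b: "b \<in> pts Q" and e: "fib a = fib b"
    let ?c = "tuple (fst P) (fst Q) a b"
    have "a \<in> El (fst P)" "b \<in> El (fst Q)" using a b pts_El F by blast+
    note t = tuple_simps[OF O this e]
    have c: "?c \<in> pts (prodF P Q)" "act (pr1 (Base D) (fst P) (fst Q)) ?c = a" "act (pr2 (Base D) (fst P) (fst Q)) ?c = b"
      using t a b by (simp_all add: prodF(3)[OF F])
    have "ap ?p (ap (pair SA p q) ?c) = a" "ap ?q (ap (pair SA p q) ?c) = b"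
      using ap_Comp[OF j(1) R(1) c(1)] ap_Comp[OF j(1) R(2) c(1)] j pq(3,4)[OF c(1)] c by auto
    then show "\<exists>c\<in>pts (prod_ob (Base SD) P Q). ap (pr1 (Base SD) P Q) c = a \<and> ap (pr2 (Base SD) P Q) c = b"
      using ap_pts[OF j(1) c(1)] by auto
  next
    fix c c' assume cc: "c \<in> pts (prod_ob (Base SD) P Q)" "c' \<in> pts (prod_ob (Base SD) P Q)"
      "ap (pr1 (Base SD) P Q) c = ap (pr1 (Base SD) P Q) c'" "ap (pr2 (Base SD) P Q) c = ap (pr2 (Base SD) P Q) c'"
    have pk: "p \<cdot>\<^bsub>SA\<^esub> k = ?p" "q \<cdot>\<^bsub>SA\<^esub> k = ?q"
    proof -
      have t: "act (pr1 (Base D) (fst P) (fst Q)) (ap k a) = ap ?p a" "act (pr2 (Base D) (fst P) (fst Q)) (ap k a) = ap ?q a"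
        if "a \<in> pts ?R" for a
        using tuple_simps[OF O, of "ap ?p a" "ap ?q a"] ap_pts[OF R(1) that] ap_pts[OF R(2) that] fib_ap[OF R(1) that]
          fib_ap[OF R(2) that] pts_El[OF F(1)] pts_El[OF F(2)] k(2)[OF that] by auto
      show "p \<cdot>\<^bsub>SA\<^esub> k = ?p"
        by (rule ap_inject[OF Comp_SA(1)[OF k(1) pq(1)] R(1)]) (use ap_Comp[OF k(1) pq(1)] pq(3) ap_pts[OF k(1)] t in auto)
      show "q \<cdot>\<^bsub>SA\<^esub> k = ?q"
        by (rule ap_inject[OF Comp_SA(1)[OF k(1) pq(2)] R(2)]) (use ap_Comp[OF k(1) pq(2)] pq(4) ap_pts[OF k(1)] t in auto)
    qed
    \<comment> \<open>So \<open>k\<close> is injective on points. Since \<open>k\<close> is computed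
      from the two projections of a point, these determine the point.\<close>
    have jk: "pair SA p q \<cdot>\<^bsub>SA\<^esub> k = ide SA ?R"
    proof (rule SA.prod_arr_eq_ext[where X=P and Y=Q])
      show "?p \<cdot>\<^bsub>SA\<^esub> (pair SA p q \<cdot>\<^bsub>SA\<^esub> k) = ?p \<cdot>\<^bsub>SA\<^esub> ide SA ?R"
        using SA.Comp_assoc[OF k(1) j(1) R(1)] j(2) pk(1) SA.Comp_ide_right[OF R(1)] by simp
      show "?q \<cdot>\<^bsub>SA\<^esub> (pair SA p q \<cdot>\<^bsub>SA\<^esub> k) = ?q \<cdot>\<^bsub>SA\<^esub> ide SA ?R"
        using SA.Comp_assoc[OF k(1) j(1) R(2)] j(3) pk(2) SA.Comp_ide_right[OF R(2)] by simp
    qed (use Comp_SA(1)[OF k(1) j(1)] ide_SA(1)[OF RF] FO in \<open>simp_all add: hom_def\<close>)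
    have "ap k c = ap k c'" using k(2) cc by simp
    moreover have "ap (pair SA p q) (ap k d) = d" if "d \<in> pts ?R" for d
      using ap_Comp[OF k(1) j(1) that] jk ap_ide[OF RF that] by simp
    ultimately show "c = c'" using cc(1,2) by (metis SD_sel(1))
  }
next
  fix P A assume "P \<in> Ob (Base SD)" "A \<in> carrier (Fib SD P)"
  then have P: "P \<in> formulas D" and A: "A \<in> subs P" by (simp_all add: SA_sel)
  show "ssem A \<subseteq> pts P" using subs_formula[OF A] by blast
  note B = subs_boolean[OF P, of "Fib SD P", OF SD_sel(2,3,4)]
  interpret L: boolean_lattice "Fib SD P" by (rule B(1))
  fix A' assume "A' \<in> carrier (Fib SD P)"
  then have A': "A' \<in> subs P" by simp
  show "A \<sqsubseteq>\<^bsub>Fib SD P\<^esub> A' \<longleftrightarrow> ssem A \<subseteq> ssem A'" using subs_le[OF A A'] by simp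
  show "A = A'" if "ssem A = ssem A'" by (rule subs_inject[OF A A' that])
  show "A \<sqinter>\<^bsub>Fib SD P\<^esub> A' \<in> carrier (Fib SD P) \<and> ssem (A \<sqinter>\<^bsub>Fib SD P\<^esub> A') = ssem A \<inter> ssem A'"
    using B(2)[OF A A'] L.meet_closed[of A A'] A A' by simp
next
  fix P assume "P \<in> Ob (Base SD)"
  then have P: "P \<in> formulas D" by (simp add: SA_sel)
  note B = subs_boolean[OF P, of "Fib SD P", OF SD_sel(2,3,4)]
  interpret L: boolean_lattice "Fib SD P" by (rule B(1))
  show "\<top>\<^bsub>Fib SD P\<^esub> \<in> carrier (Fib SD P) \<and> ssem \<top>\<^bsub>Fib SD P\<^esub> = pts P"
    using B(4) L.top_closed by simp
next
  fix f P Q A assume "f \<in> hom (Base SD) P Q" "A \<in> carrier (Fib SD Q)"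
  then show "Sub SD f A \<in> carrier (Fib SD P) \<and> ssem (Sub SD f A) = {a \<in> pts P. ap f a \<in> ssem A}"
    using subobj_pullback_sem[of f P Q A] by simp
next
  fix f P Q A assume "f \<in> hom (Base SD) P Q" "A \<in> carrier (Fib SD P)"
  then have f: "f \<in> hom SA P Q" and A: "A \<in> subs P" by simp_all
  \<comment> \<open>The image of a subobject is the image formula of \<open>f\<close> composed with
    a representing embedding.\<close>
  obtain m where m: "embed m" "Cod SA m = P" "img m = ssem A" using subs_cases[OF A] by metis
  have mh: "m \<in> hom SA (Dom SA m) P" using embed_hom[OF m(1)] m(2) by simp
  obtain \<theta> where \<theta>: "(fst Q, \<theta>) \<in> formulas D" "sem (fst Q) \<theta> = ap (f \<cdot>\<^bsub>SA\<^esub> m) ` pts (Dom SA m)" "sem (fst Q) \<theta> \<subseteq> pts Q"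
    using image_formula[OF Comp_SA(1)[OF mh f]] .
  have "ap (f \<cdot>\<^bsub>SA\<^esub> m) ` pts (Dom SA m) = ap f ` img m" using ap_Comp[OF mh f] by auto
  moreover have "Q \<in> formulas D" using hom_formulas[OF f] by simp
  ultimately show "\<exists>B\<in>carrier (Fib SD Q). ssem B = ap f ` ssem A"
    using inclusion_subobj[of Q \<theta>] \<theta> m(3) by (intro bexI[of _ "inclusion_subobj D CD Q \<theta>"]) auto
qed

sublocale sd: set_semantics SD pts ap "\<lambda>P. ssem" fib
  by (rule set_semantics_SD)

section \<open>The modality along arrows and along embeddings\<close>

lemma dia_sem:
  assumes X: "X \<in> Ob (Base D)" and A: "A \<in> carrier (Fib D X)"
  shows "\<diamond>\<^bsub>Fib D X\<^esub> A \<in> carrier (Fib D X)" "sem X A \<subseteq> sem X (\<diamond>\<^bsub>Fib D X\<^esub> A)"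
    "\<diamond>\<^bsub>Fib D X\<^esub> (\<diamond>\<^bsub>Fib D X\<^esub> A) = \<diamond>\<^bsub>Fib D X\<^esub> A" "sem X (\<diamond>\<^bsub>Fib D X\<^esub> \<bottom>\<^bsub>Fib D X\<^esub>) = {}"
    "B \<in> carrier (Fib D X) \<Longrightarrow> sem X (\<diamond>\<^bsub>Fib D X\<^esub> (A \<squnion>\<^bsub>Fib D X\<^esub> B)) = sem X (\<diamond>\<^bsub>Fib D X\<^esub> A) \<union> sem X (\<diamond>\<^bsub>Fib D X\<^esub> B)"
    "\<lbrakk>B \<in> carrier (Fib D X); sem X A \<subseteq> sem X B\<rbrakk> \<Longrightarrow> sem X (\<diamond>\<^bsub>Fib D X\<^esub> A) \<subseteq> sem X (\<diamond>\<^bsub>Fib D X\<^esub> B)"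
proof -
  interpret L: S4_modal_algebra "Fib D X" using Fib_S4[OF X] .
  show c: "\<diamond>\<^bsub>Fib D X\<^esub> A \<in> carrier (Fib D X)" using L.dia_closed[OF A] .
  show "sem X A \<subseteq> sem X (\<diamond>\<^bsub>Fib D X\<^esub> A)" using L.dia_increasing[OF A] sem_le[OF X A c] by simp
  show "\<diamond>\<^bsub>Fib D X\<^esub> (\<diamond>\<^bsub>Fib D X\<^esub> A) = \<diamond>\<^bsub>Fib D X\<^esub> A" using L.dia_idem[OF A] .
  show "sem X (\<diamond>\<^bsub>Fib D X\<^esub> \<bottom>\<^bsub>Fib D X\<^esub>) = {}" using L.dia_bottom sem_bottom[OF X] by simp
  show j: "sem X (\<diamond>\<^bsub>Fib D X\<^esub> (A \<squnion>\<^bsub>Fib D X\<^esub> B)) = sem X (\<diamond>\<^bsub>Fib D X\<^esub> A) \<union> sem X (\<diamond>\<^bsub>Fib D X\<^esub> B)"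
    if "B \<in> carrier (Fib D X)" for B
    using L.dia_join[OF A that] sem_join[OF X c L.dia_closed[OF that]] by simp
  show "sem X (\<diamond>\<^bsub>Fib D X\<^esub> A) \<subseteq> sem X (\<diamond>\<^bsub>Fib D X\<^esub> B)" if B: "B \<in> carrier (Fib D X)" "sem X A \<subseteq> sem X B"
  proof -
    have "sem X (A \<squnion>\<^bsub>Fib D X\<^esub> B) = sem X B" using sem_join[OF X A B(1)] B(2) by blast
    then have "A \<squnion>\<^bsub>Fib D X\<^esub> B = B" using sem_inject[OF X _ B(1)] L.join_closed[OF A B(1)] by blast
    then show ?thesis using j[OF B(1)] by auto
  qed
qed

text \<open>Resolves the description in \<open>Synt_dia\<close>: among the formulas below
  \<open>snd P\<close>, the points of the subobject determine \<open>\<psi>\<close>.\<close>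

lemma Synt_dia_sem:
  assumes A: "A \<in> subs P" and \<psi>: "\<psi> \<in> carrier (Fib D (fst P))" "sem (fst P) \<psi> = ssem A"
  shows "Synt_dia D CD P A \<in> subs P" "ssem (Synt_dia D CD P A) = pts P \<inter> sem (fst P) (\<diamond>\<^bsub>Fib D (fst P)\<^esub> \<psi>)"
proof -
  obtain m where m: "embed m" "Cod SA m = P" using subs_cases[OF A] by metis
  have P: "P \<in> formulas D" using hom_formulas[OF embed_hom[OF m(1)]] m(2) by simp
  let ?X = "fst P"
  have X: "?X \<in> Ob (Base D)" and pc: "snd P \<in> carrier (Fib D ?X)" using P by (auto simp: formulas_iff)
  have sub: "ssem A \<subseteq> pts P" using subs_formula[OF A] by blast
  have i: "inclusion_subobj D CD P \<chi> \<in> subs P \<and> ssem (inclusion_subobj D CD P \<chi>) = sem ?X \<chi>"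
    if "\<chi> \<in> carrier (Fib D ?X)" "sem ?X \<chi> \<subseteq> pts P" for \<chi>
    using inclusion_subobj[OF P, of \<chi>] that X by (simp add: formulas_iff)
  have the: "(THE \<chi>. \<chi> \<in> carrier (Fib D ?X) \<and> \<chi> \<sqsubseteq>\<^bsub>Fib D ?X\<^esub> snd P \<and> inclusion_subobj D CD (?X, snd P) \<chi> = A) = \<psi>"
  proof (rule the_equality)
    show "\<psi> \<in> carrier (Fib D ?X) \<and> \<psi> \<sqsubseteq>\<^bsub>Fib D ?X\<^esub> snd P \<and> inclusion_subobj D CD (?X, snd P) \<psi> = A"
      using \<psi> sub sem_le[OF X \<psi>(1) pc] i[OF \<psi>(1)] subs_inject[OF _ A] by simp
    fix \<chi> assume c: "\<chi> \<in> carrier (Fib D ?X) \<and> \<chi> \<sqsubseteq>\<^bsub>Fib D ?X\<^esub> snd P \<and> inclusion_subobj D CD (?X, snd P) \<chi> = A"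
    then have "sem ?X \<chi> \<subseteq> pts P" using sem_le[OF X conjunct1[OF c] pc] by blast
    then have "sem ?X \<chi> = ssem A" using i[of \<chi>] c by simp
    then show "\<chi> = \<psi>" using sem_inject[OF X _ \<psi>(1)] c \<psi>(2) by simp
  qed
  have e: "Synt_dia D CD P A = inclusion_subobj D CD P (snd P \<sqinter>\<^bsub>Fib D ?X\<^esub> \<diamond>\<^bsub>Fib D ?X\<^esub> \<psi>)"
    using the by (simp add: Synt_dia_def split_beta)
  have "snd P \<sqinter>\<^bsub>Fib D ?X\<^esub> \<diamond>\<^bsub>Fib D ?X\<^esub> \<psi> \<in> carrier (Fib D ?X) \<and>
      sem ?X (snd P \<sqinter>\<^bsub>Fib D ?X\<^esub> \<diamond>\<^bsub>Fib D ?X\<^esub> \<psi>) = pts P \<inter> sem ?X (\<diamond>\<^bsub>Fib D ?X\<^esub> \<psi>)"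
    using sem_meet[OF X pc dia_sem(1)[OF X \<psi>(1)]] .
  then show "Synt_dia D CD P A \<in> subs P" "ssem (Synt_dia D CD P A) = pts P \<inter> sem ?X (\<diamond>\<^bsub>Fib D ?X\<^esub> \<psi>)"
    using i[of "snd P \<sqinter>\<^bsub>Fib D ?X\<^esub> \<diamond>\<^bsub>Fib D ?X\<^esub> \<psi>"] unfolding e by auto
qed

text \<open>Continuity is the loop condition for the loop \<open>R, R\<^sup>-\<^sup>1\<close>, with \<open>R\<close> the partial map extending \<open>f\<close>.\<close>

lemma dia_image:
  assumes f: "f \<in> hom SA P Q" and \<theta>: "\<theta> \<in> carrier (Fib D (fst P))" and \<psi>: "\<psi> \<in> carrier (Fib D (fst Q))"
    and sub: "\<And>a. a \<in> sem (fst P) \<theta> \<Longrightarrow> a \<in> pts P \<and> ap f a \<in> sem (fst Q) \<psi>"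
    and x: "x \<in> pts P" "x \<in> sem (fst P) (\<diamond>\<^bsub>Fib D (fst P)\<^esub> \<theta>)"
  shows "ap f x \<in> sem (fst Q) (\<diamond>\<^bsub>Fib D (fst Q)\<^esub> \<psi>)"
proof -
  let ?X = "fst P" let ?Y = "fst Q"
  have O: "?X \<in> Ob (Base D)" "?Y \<in> Ob (Base D)" using hom_formulas[OF f] by (auto simp: formulas_iff)
  have "tame ?X ?Y (gr f)" using gr_hom[OF f] by (simp add: cmap_def)
  then obtain R where R: "(?X, ?Y, R) \<in> CD" "gr f \<subseteq> rsem (?X, ?Y, R)" by (auto simp: tame_def)
  have i: "is_rel D (?X, ?Y, R)" using CD_rel[OF R(1)] by simp
  note c = rel_conv_sem[OF i]
  let ?V = "rel_conv D (?X, ?Y, R)"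
  have iV: "is_rel D (?Y, ?X, snd (snd ?V))" using c by simp
  have "acceptable_loop D CD ?Y ([(?X, ?Y, R)] @ [] @ [?V])"
    by (rule acceptable_loop.conjugate[OF acceptable_loop.empty[OF O(1)] R(1)])
  then have le: "dia_loop D [(?X, ?Y, R), ?V] \<psi> \<sqsubseteq>\<^bsub>Fib D ?Y\<^esub> \<diamond>\<^bsub>Fib D ?Y\<^esub> \<psi>"
    using LC \<psi> unfolding loop_condition_def by simp
  \<comment> \<open>\<open>?A\<close> is the preimage of \<open>\<psi>\<close> under
    \<open>R\<close>, and \<open>?B\<close> the image under \<open>R\<close> of its closure. The
    loop condition bounds the closure of \<open>?B\<close> by that of \<open>\<psi>\<close>, and
    \<open>ap f x\<close> lies in \<open>?B\<close> because \<open>\<theta>\<close> is contained in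
    \<open>?A\<close>.\<close>
  let ?A = "rel_image D ?V \<psi>"
  have A: "?A \<in> carrier (Fib D ?X)" "sem ?X ?A = (rsem (?X, ?Y, R))\<inverse> `` sem ?Y \<psi>"
    using rel_image_sem[OF iV \<psi>] c by simp_all
  let ?B = "rel_image D (?X, ?Y, R) (\<diamond>\<^bsub>Fib D ?X\<^esub> ?A)"
  have B: "?B \<in> carrier (Fib D ?Y)" "sem ?Y ?B = rsem (?X, ?Y, R) `` sem ?X (\<diamond>\<^bsub>Fib D ?X\<^esub> ?A)"
    using rel_image_sem[OF i dia_sem(1)[OF O(1) A(1)]] by simp_all
  have "fst (snd ?V) = ?X" using c(1) by (metis fst_conv snd_conv)
  then have "dia_loop D [(?X, ?Y, R), ?V] \<psi> = \<diamond>\<^bsub>Fib D ?Y\<^esub> ?B" by (simp add: dia_loop_def)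
  then have "sem ?Y (\<diamond>\<^bsub>Fib D ?Y\<^esub> ?B) \<subseteq> sem ?Y (\<diamond>\<^bsub>Fib D ?Y\<^esub> \<psi>)"
    using le sem_le[OF O(2) dia_sem(1)[OF O(2) B(1)] dia_sem(1)[OF O(2) \<psi>]] by simp
  moreover have "sem ?Y ?B \<subseteq> sem ?Y (\<diamond>\<^bsub>Fib D ?Y\<^esub> ?B)" by (rule dia_sem(2)[OF O(2) B(1)])
  moreover have "sem ?X \<theta> \<subseteq> sem ?X ?A"
  proof
    fix a assume a: "a \<in> sem ?X \<theta>"
    then have "(a, ap f a) \<in> rsem (?X, ?Y, R)" using sub[OF a] gr_iff[OF f] R(2) by auto
    then show "a \<in> sem ?X ?A" using sub[OF a] A(2) by auto
  qed
  then have "x \<in> sem ?X (\<diamond>\<^bsub>Fib D ?X\<^esub> ?A)" using dia_sem(6)[OF O(1) \<theta> A(1)] x(2) by auto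
  moreover have "(x, ap f x) \<in> rsem (?X, ?Y, R)" using x(1) gr_iff[OF f] R(2) by auto
  ultimately show ?thesis using B(2) by blast
qed

lemma Synt_dia_continuous:
  assumes f: "f \<in> hom SA P Q" and A: "A \<in> subs P" and B: "B \<in> subs Q" and sub: "ap f ` ssem A \<subseteq> ssem B"
  shows "ap f ` ssem (Synt_dia D CD P A) \<subseteq> ssem (Synt_dia D CD Q B)"
proof -
  obtain \<alpha> where a: "(fst P, \<alpha>) \<in> formulas D" "sem (fst P) \<alpha> = ssem A" "ssem A \<subseteq> pts P" using subs_formula[OF A] .
  obtain \<beta> where b: "(fst Q, \<beta>) \<in> formulas D" "sem (fst Q) \<beta> = ssem B" "ssem B \<subseteq> pts Q" using subs_formula[OF B] .
  have c: "\<alpha> \<in> carrier (Fib D (fst P))" "\<beta> \<in> carrier (Fib D (fst Q))" using a b by (auto simp: formulas_iff)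
  show ?thesis
    unfolding Synt_dia_sem(2)[OF A c(1) a(2)] Synt_dia_sem(2)[OF B c(2) b(2)]
    using dia_image[OF f c] ap_pts[OF f] a b sub by blast
qed

text \<open>This is \<open>dia_image\<close> for the inverse of \<open>m\<close> on its image. Here
  the tameness of the converse of an embedding acts on the modality: the modality of a subobject is
  induced from the ambient object.\<close>

lemma Synt_dia_embedding:
  assumes m: "embed m" "m \<in> hom SA P Q" and A: "A \<in> subs P" and B: "B \<in> subs Q" and sub: "ssem B = ap m ` ssem A"
    and x: "x \<in> pts P" "ap m x \<in> ssem (Synt_dia D CD Q B)"
  shows "x \<in> ssem (Synt_dia D CD P A)"
proof -
  obtain \<alpha> where a: "(fst P, \<alpha>) \<in> formulas D" "sem (fst P) \<alpha> = ssem A" "ssem A \<subseteq> pts P" using subs_formula[OF A] .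
  obtain \<beta> where b: "(fst Q, \<beta>) \<in> formulas D" "sem (fst Q) \<beta> = ssem B" "ssem B \<subseteq> pts Q" using subs_formula[OF B] .
  have c: "\<alpha> \<in> carrier (Fib D (fst P))" "\<beta> \<in> carrier (Fib D (fst Q))" using a b by (auto simp: formulas_iff)
  obtain \<tau> where t: "(fst Q, \<tau>) \<in> formulas D" "sem (fst Q) \<tau> = ap m ` pts P" "sem (fst Q) \<tau> \<subseteq> pts Q"
    using image_formula[OF m(2)] .
  obtain u where u: "u \<in> hom SA (fst Q, \<tau>) P" "\<And>b. b \<in> sem (fst Q) \<tau> \<Longrightarrow> ap m (ap u b) = b"
    using embed_inverse[OF m t(1) eq_refl[OF t(2)]] by metis
  have um: "ap u (ap m y) = y" if "y \<in> pts P" for y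
    by (rule embed_inj[OF m]) (use that u(2) ap_pts[OF u(1), of "ap m y"] t(2) in auto)
  have "ap u (ap m x) \<in> sem (fst P) (\<diamond>\<^bsub>Fib D (fst P)\<^esub> \<alpha>)"
  proof (rule dia_image[OF u(1) _ c(1)])
    show "\<beta> \<in> carrier (Fib D (fst (fst Q, \<tau>)))" using c by simp
    show "y \<in> pts (fst Q, \<tau>) \<and> ap u y \<in> sem (fst P) \<alpha>" if "y \<in> sem (fst (fst Q, \<tau>)) \<beta>" for y
    proof -
      have "y \<in> ap m ` ssem A" using that b(2) sub by simp
      then obtain z where z: "z \<in> ssem A" "y = ap m z" by blast
      then show ?thesis using um[of z] a t(2) by auto
    qed
    show "ap m x \<in> pts (fst Q, \<tau>)" using x(1) t(2) by simp
    show "ap m x \<in> sem (fst (fst Q, \<tau>)) (\<diamond>\<^bsub>Fib D (fst (fst Q, \<tau>))\<^esub> \<beta>)"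
      using x(2) Synt_dia_sem(2)[OF B c(2) b(2)] by simp
  qed
  then show ?thesis using um[OF x(1)] x(1) Synt_dia_sem(2)[OF A c(1) a(2)] by simp
qed

lemma S4_modal_algebra_SD:
  assumes P: "P \<in> formulas D"
  shows "S4_modal_algebra (Fib SD P)"
proof -
  note B = subs_boolean[OF P, of "Fib SD P", OF SD_sel(2,3,4)]
  interpret L: boolean_lattice "Fib SD P" by (rule B(1))
  let ?X = "fst P"
  have X: "?X \<in> Ob (Base D)" using P by (simp add: formulas_iff)
  have rep: "\<exists>\<alpha>. \<alpha> \<in> carrier (Fib D ?X) \<and> sem ?X \<alpha> = ssem A \<and> ssem A \<subseteq> pts P" if "A \<in> subs P" for A
    using subs_formula[OF that] by (metis formulas_iff snd_conv fst_conv)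
  show ?thesis
  proof
    fix A assume "A \<in> carrier (Fib SD P)"
    then have A: "A \<in> subs P" by simp
    obtain \<alpha> where a: "\<alpha> \<in> carrier (Fib D ?X)" "sem ?X \<alpha> = ssem A" "ssem A \<subseteq> pts P" using rep[OF A] by blast
    note d = Synt_dia_sem[OF A a(1,2)]
    show "\<diamond>\<^bsub>Fib SD P\<^esub> A \<in> carrier (Fib SD P)" using d by simp
    show "A \<sqsubseteq>\<^bsub>Fib SD P\<^esub> \<diamond>\<^bsub>Fib SD P\<^esub> A"
      using subs_le[OF A d(1)] d(2) a dia_sem(2)[OF X a(1)] by simp
    obtain \<gamma> where g: "\<gamma> \<in> carrier (Fib D ?X)" "sem ?X \<gamma> = ssem (Synt_dia D CD P A)" using rep[OF d(1)] by blast
    note dd = Synt_dia_sem[OF d(1) g]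
    \<comment> \<open>\<open>\<phi> \<and> \<diamond>(\<phi> \<and> \<diamond>\<alpha>)\<close> is
      below \<open>\<phi> \<and> \<diamond>\<diamond>\<alpha>\<close>, and the double closure
      collapses in the fibre of the doctrine.\<close>
    have "sem ?X (\<diamond>\<^bsub>Fib D ?X\<^esub> \<gamma>) \<subseteq> sem ?X (\<diamond>\<^bsub>Fib D ?X\<^esub> (\<diamond>\<^bsub>Fib D ?X\<^esub> \<alpha>))"
      by (rule dia_sem(6)[OF X g(1) dia_sem(1)[OF X a(1)]]) (use g d in auto)
    then have "ssem (Synt_dia D CD P (Synt_dia D CD P A)) \<subseteq> ssem (Synt_dia D CD P A)"
      unfolding dd(2) d(2) dia_sem(3)[OF X a(1)] by blast
    moreover have "ssem (Synt_dia D CD P A) \<subseteq> ssem (Synt_dia D CD P (Synt_dia D CD P A))"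
      unfolding dd(2) using g d(2) dia_sem(2)[OF X g(1)] by auto
    ultimately show "\<diamond>\<^bsub>Fib SD P\<^esub> (\<diamond>\<^bsub>Fib SD P\<^esub> A) = \<diamond>\<^bsub>Fib SD P\<^esub> A"
      using subs_inject[OF dd(1) d(1)] by simp
    fix A' assume "A' \<in> carrier (Fib SD P)"
    then have A': "A' \<in> subs P" by simp
    obtain \<beta> where b: "\<beta> \<in> carrier (Fib D ?X)" "sem ?X \<beta> = ssem A'" using rep[OF A'] by blast
    note d' = Synt_dia_sem[OF A' b]
    have J: "A \<squnion>\<^bsub>Fib SD P\<^esub> A' \<in> subs P" using L.join_closed[of A A'] A A' by simp
    have jb: "\<alpha> \<squnion>\<^bsub>Fib D ?X\<^esub> \<beta> \<in> carrier (Fib D ?X)" using Fib_meet(4)[OF X a(1) b(1)] .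
    have js: "sem ?X (\<alpha> \<squnion>\<^bsub>Fib D ?X\<^esub> \<beta>) = ssem (A \<squnion>\<^bsub>Fib SD P\<^esub> A')"
      using sem_join[OF X a(1) b(1)] B(3)[OF A A'] a b by simp
    note dj = Synt_dia_sem[OF J jb js]
    have J': "Synt_dia D CD P A \<squnion>\<^bsub>Fib SD P\<^esub> Synt_dia D CD P A' \<in> subs P"
      using L.join_closed[of "Synt_dia D CD P A" "Synt_dia D CD P A'"] d(1) d'(1) by simp
    have "Synt_dia D CD P (A \<squnion>\<^bsub>Fib SD P\<^esub> A') = Synt_dia D CD P A \<squnion>\<^bsub>Fib SD P\<^esub> Synt_dia D CD P A'"
      by (rule subs_inject[OF dj(1) J'])
        (use dj(2) d(2) d'(2) B(3)[OF d(1) d'(1)] dia_sem(5)[OF X a(1) b(1)] in auto)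
    then show "\<diamond>\<^bsub>Fib SD P\<^esub> (A \<squnion>\<^bsub>Fib SD P\<^esub> A') = \<diamond>\<^bsub>Fib SD P\<^esub> A \<squnion>\<^bsub>Fib SD P\<^esub> \<diamond>\<^bsub>Fib SD P\<^esub> A'" by simp
  next
    have b: "\<bottom>\<^bsub>Fib SD P\<^esub> \<in> subs P" using L.bottom_closed by simp
    have "sem ?X \<bottom>\<^bsub>Fib D ?X\<^esub> = ssem \<bottom>\<^bsub>Fib SD P\<^esub>" using sem_bottom[OF X] B(5) by simp
    note d = Synt_dia_sem[OF b Fib_top(2)[OF X] this]
    have "Synt_dia D CD P \<bottom>\<^bsub>Fib SD P\<^esub> = \<bottom>\<^bsub>Fib SD P\<^esub>"
      by (rule subs_inject[OF d(1) b]) (use d(2) dia_sem(4)[OF X Fib_top(2)[OF X]] B(5) in auto)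
    then show "\<diamond>\<^bsub>Fib SD P\<^esub> \<bottom>\<^bsub>Fib SD P\<^esub> = \<bottom>\<^bsub>Fib SD P\<^esub>" by simp
  qed
qed

lemma modal_category_SA: "modal_category SA (Synt_E D CD) (Synt_M D CD) (Synt_dia D CD)"
proof (intro modal_category.intro f_boolean_category_SA modal_category_axioms.intro)
  show "modal_algebra (Fib SD P)" if "P \<in> Ob SA" for P
    using S4_modal_algebra_SD[of P] that S4_modal_algebra.axioms(1) by (auto simp: SA_sel)
next
  fix f P Q A assume f: "f \<in> hom SA P Q" and A: "A \<in> subs Q"
  note p = subobj_pullback_sem[OF f A]
  obtain \<beta> where b: "(fst Q, \<beta>) \<in> formulas D" "sem (fst Q) \<beta> = ssem A" "ssem A \<subseteq> pts Q" using subs_formula[OF A] .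
  obtain \<alpha> where a: "(fst P, \<alpha>) \<in> formulas D" "sem (fst P) \<alpha> = ssem (subobj_pullback SA f A)" "ssem (subobj_pullback SA f A) \<subseteq> pts P"
    using subs_formula[OF p(1)] .
  have dA: "Synt_dia D CD Q A \<in> subs Q" by (rule Synt_dia_sem(1)[OF A _ b(2)]) (use b in \<open>simp add: formulas_iff\<close>)
  have ac: "\<alpha> \<in> carrier (Fib D (fst P))" using a by (simp add: formulas_iff)
  note dp = Synt_dia_sem[OF p(1) ac a(2)]
  have "ap f ` ssem (Synt_dia D CD P (subobj_pullback SA f A)) \<subseteq> ssem (Synt_dia D CD Q A)"
    by (rule Synt_dia_continuous[OF f p(1) A]) (use p(2) in auto)
  then show "Synt_dia D CD P (subobj_pullback SA f A) \<sqsubseteq>\<^bsub>subobj_order SA (Synt_M D CD) P\<^esub>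
      subobj_pullback SA f (Synt_dia D CD Q A)"
    unfolding subs_le[OF dp(1) subobj_pullback_sem(1)[OF f dA]] subobj_pullback_sem(2)[OF f dA]
    using dp(2) by auto
next
  fix m P Q A assume "m \<in> Synt_M D CD" and mh: "m \<in> hom SA P Q" and A: "A \<in> subs P"
  then have m: "embed m" by (simp add: Synt_M_iff)
  have E: "Ex SD m A \<in> subs Q" "ssem (Ex SD m A) = ap m ` ssem A" using sd.sem_Ex[of m P Q A] mh A by simp_all
  obtain \<alpha> where a: "(fst P, \<alpha>) \<in> formulas D" "sem (fst P) \<alpha> = ssem A" using subs_formula[OF A] .
  obtain \<beta> where b: "(fst Q, \<beta>) \<in> formulas D" "sem (fst Q) \<beta> = ssem (Ex SD m A)" using subs_formula[OF E(1)] .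
  have dA: "Synt_dia D CD P A \<in> subs P" "ssem (Synt_dia D CD P A) \<subseteq> pts P"
    using Synt_dia_sem[OF A _ a(2)] a by (auto simp: formulas_iff)
  have dE: "Synt_dia D CD Q (Ex SD m A) \<in> subs Q"
    by (rule Synt_dia_sem(1)[OF E(1) _ b(2)]) (use b in \<open>simp add: formulas_iff\<close>)
  note p = subobj_pullback_sem[OF mh dE]
  show "Synt_dia D CD P A = subobj_pullback SA m (Synt_dia D CD Q (Ex SD m A))"
  proof (rule subs_inject[OF dA(1) p(1)])
    have "ap m ` ssem (Synt_dia D CD P A) \<subseteq> ssem (Synt_dia D CD Q (Ex SD m A))"
      by (rule Synt_dia_continuous[OF mh A E(1)]) (use E(2) in auto)
    then show "ssem (Synt_dia D CD P A) = ssem (subobj_pullback SA m (Synt_dia D CD Q (Ex SD m A)))"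
      unfolding p(2) using dA(2) Synt_dia_embedding[OF m mh A E] by auto
  qed
qed

end

section \<open>Acceptable loops\<close>

context set_semantics
begin

text \<open>Follows the order in which loops are written, outermost relation first: \<open>X\<close>
  is the target of the head and \<open>Y\<close> the source of the last member, so a loop with
  anchor \<open>X\<close> should be a chain from \<open>X\<close> to \<open>X\<close>.\<close>

primrec rel_chain :: "'o \<Rightarrow> ('o, 'd) rel list \<Rightarrow> 'o \<Rightarrow> bool" where
  "rel_chain X [] Y \<longleftrightarrow> X = Y \<and> Y \<in> Ob (Base D)"
| "rel_chain X (r # b) Y \<longleftrightarrow> is_rel D r \<and> fst (snd r) = X \<and> rel_chain (fst r) b Y"

text \<open>The composite runs from \<open>Y\<close> to the target of the head. The object
  \<open>Y\<close> is an argument because the empty composite is the identity of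
  \<open>Y\<close>.\<close>

primrec rsems :: "'o \<Rightarrow> ('o, 'd) rel list \<Rightarrow> ('p \<times> 'p) set" where
  "rsems Y [] = Id_on (El Y)"
| "rsems Y (r # b) = rsems Y b O rsem r"

lemma rsem_El: "\<lbrakk>is_rel D r; (a, b) \<in> rsem r\<rbrakk> \<Longrightarrow> a \<in> El (fst r) \<and> b \<in> El (fst (snd r)) \<and> fib a = fib b"
  by (cases r) (auto simp: rsem_iff)

lemma rel_chain_append: "rel_chain X (b @ c) Z \<longleftrightarrow> (\<exists>Y. rel_chain X b Y \<and> rel_chain Y c Z)"
proof (induction b arbitrary: X)
  case Nil
  have "X \<in> Ob (Base D)" if "rel_chain X c Z" for X
    using that by (cases c) (auto simp: is_rel_def)
  then show ?case by auto
qed auto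

lemma rel_chain_Ob: "rel_chain X b Y \<Longrightarrow> X \<in> Ob (Base D) \<and> Y \<in> Ob (Base D)"
  by (induction b arbitrary: X) (auto simp: is_rel_def)

lemma rel_chain_end: "rel_chain X b Y \<Longrightarrow> Y = (if b = [] then X else fst (last b))"
  by (induction b arbitrary: X) auto

lemma rsems_El:
  "\<lbrakk>rel_chain X b Y; (a', a) \<in> rsems Y b\<rbrakk> \<Longrightarrow> a' \<in> El Y \<and> a \<in> El X \<and> fib a' = fib a"
proof (induction b arbitrary: X a)
  case (Cons r b)
  from Cons.prems obtain a1 where a1: "(a', a1) \<in> rsems Y b" "(a1, a) \<in> rsem r" by auto
  from Cons.prems(1) have "rel_chain (fst r) b Y" "is_rel D r" "fst (snd r) = X" by auto
  with Cons.IH[of "fst r" a1] a1 rsem_El[of r a1 a] show ?case by auto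
qed auto

lemma rsems_append: "rel_chain Y c Z \<Longrightarrow> rel_chain X b Y \<Longrightarrow> rsems Z (b @ c) = rsems Z c O rsems Y b"
proof (induction b arbitrary: X)
  case Nil
  then have "rsems Z c O Id_on (El Y) = rsems Z c"
    using rsems_El[of Y c Z] by (auto simp: relcomp_unfold Id_on_iff set_eq_iff)
  then show ?case by simp
next
  case (Cons r b)
  then show ?case using Cons.IH[of "fst r"] by auto
qed

lemma rel_chain_replicate_id: "Y \<in> Ob (Base D) \<Longrightarrow> rel_chain Y (replicate n (rel_id D Y)) Y"
proof (induction n)
  case (Suc n)
  then show ?case using rel_id_sem(1,2)[of Y] by (metis replicate_Suc rel_chain.simps(2) fst_conv snd_conv)
qed simp

lemma rsems_replicate_id: "Y \<in> Ob (Base D) \<Longrightarrow> rsems Y (replicate n (rel_id D Y)) = Id_on (El Y)"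
  by (induction n) (auto simp: rel_id_sem(3))

text \<open>A path of intermediate points through \<open>b\<close> and one through \<open>c\<close>
  are tupled step by step. This needs equal lengths, and end points in one fibre; the intermediate
  points then lie in that fibre too.\<close>

lemma rsems_map2_rel_prod:
  assumes "length b = length c" "rel_chain X b X'" "rel_chain Y c Y'" "(a', a) \<in> rsems X' b" "(e', e) \<in> rsems Y' c"
    "fib a = fib e"
  shows "(tuple X' Y' a' e', tuple X Y a e) \<in> rsems (prod_ob (Base D) X' Y') (map2 (rel_prod D) b c) \<and>
    rel_chain (prod_ob (Base D) X Y) (map2 (rel_prod D) b c) (prod_ob (Base D) X' Y')"
  using assms
proof (induction b c arbitrary: X Y a e rule: list_induct2)
  case Nil
  then show ?case by auto
next
  case (Cons r b s c)
  obtain X1 R where r: "r = (X1, X, R)" "is_rel D (X1, X, R)" and b: "rel_chain X1 b X'"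
    using Cons.prems(1) by (cases r) auto
  obtain Y1 S where s: "s = (Y1, Y, S)" "is_rel D (Y1, Y, S)" and c: "rel_chain Y1 c Y'"
    using Cons.prems(2) by (cases s) auto
  obtain a1 where a1: "(a', a1) \<in> rsems X' b" "(a1, a) \<in> rsem (X1, X, R)" using Cons.prems(3) r by auto
  obtain e1 where e1: "(e', e1) \<in> rsems Y' c" "(e1, e) \<in> rsem (Y1, Y, S)" using Cons.prems(4) s by auto
  have O: "X1 \<in> Ob (Base D)" "X \<in> Ob (Base D)" "Y1 \<in> Ob (Base D)" "Y \<in> Ob (Base D)" using r s is_relD by auto
  have m: "a1 \<in> El X1" "a \<in> El X" "fib a1 = fib a" "e1 \<in> El Y1" "e \<in> El Y" "fib e1 = fib e"
    using a1(2) e1(2) r(2) s(2) by (auto simp: rsem_iff)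
  have f: "fib a1 = fib e1" using m Cons.prems(5) by simp
  note IH = Cons.IH[OF b c a1(1) e1(1) f]
  note p = rel_prod_sem[OF r(2) s(2)]
  have "(tuple X1 Y1 a1 e1, tuple X Y a e) \<in> rsem (rel_prod D (X1, X, R) (Y1, Y, S))"
    using p(3) m f Cons.prems(5) a1(2) e1(2) O by simp
  moreover have "fst (rel_prod D (X1, X, R) (Y1, Y, S)) = prod_ob (Base D) X1 Y1"
    "fst (snd (rel_prod D (X1, X, R) (Y1, Y, S))) = prod_ob (Base D) X Y"
    using p(1) by (metis fst_conv snd_conv)+
  ultimately show ?case using IH p(2) unfolding r(1) s(1) by auto
qed

lemma rel_chain_map2:
  assumes "length b = length c" "rel_chain X b X'" "rel_chain Y c Y'"
  shows "rel_chain (prod_ob (Base D) X Y) (map2 (rel_prod D) b c) (prod_ob (Base D) X' Y')"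
  using assms
proof (induction b c arbitrary: X Y rule: list_induct2)
  case Nil
  then show ?case by simp
next
  case (Cons r b s c)
  obtain X1 R where r: "r = (X1, X, R)" "is_rel D (X1, X, R)" and b: "rel_chain X1 b X'"
    using Cons.prems(1) by (cases r) auto
  obtain Y1 S where s: "s = (Y1, Y, S)" "is_rel D (Y1, Y, S)" and c: "rel_chain Y1 c Y'"
    using Cons.prems(2) by (cases s) auto
  note p = rel_prod_sem[OF r(2) s(2)]
  have "fst (rel_prod D (X1, X, R) (Y1, Y, S)) = prod_ob (Base D) X1 Y1"
    "fst (snd (rel_prod D (X1, X, R) (Y1, Y, S))) = prod_ob (Base D) X Y"
    using p(1) by (metis fst_conv snd_conv)+
  then show ?case using Cons.IH[OF b c] p(2) unfolding r(1) s(1) by simp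
qed

text \<open>Repeated use of the rule \<open>identity\<close> at one position. Products require loops
  of equal length, and padding provides it without changing composites.\<close>

lemma acceptable_loop_pad:
  assumes "acceptable_loop D CD Z (s @ t)" "Y = (if s = [] then Z else fst (last s))"
  shows "acceptable_loop D CD Z (s @ replicate n (rel_id D Y) @ t)"
proof (induction n)
  case (Suc n)
  have "acceptable_loop D CD Z (s @ [rel_id D Y] @ replicate n (rel_id D Y) @ t)"
    using acceptable_loop.identity[OF Suc.IH] assms(2) by simp
  then show ?case by simp
qed (use assms in simp)

end

context doctrine_model
begin

text \<open>An acceptable loop of \<open>SA\<close> is dominated, along continuous maps \<open>h\<close> into formulas of the
  doctrine, by an acceptable loop of the doctrine: \<open>simulates h w b h'\<close> says that \<open>b\<close> splits into
  blocks, one for each member of \<open>w\<close>, whose composites contain its images along the maps. Blocks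
  instead of single relations are needed because a product in \<open>SA\<close> is the product formula only
  up to isomorphism, and conjugation by that isomorphism lengthens the loop.\<close>

primrec simulates :: "('o, 'd) synt_map \<Rightarrow> (('o, 'd) formula, ('o, 'd) synt_map set) rel list \<Rightarrow>
    ('o, 'd) rel list \<Rightarrow> ('o, 'd) synt_map \<Rightarrow> bool" where
  "simulates h [] b h' \<longleftrightarrow> b = [] \<and> h' = h \<and> h \<in> Arr SA"
| "simulates h (r # w) b h' \<longleftrightarrow> h \<in> Arr SA \<and> is_rel SD r \<and> Dom SA h = fst (snd r) \<and>
     (\<exists>k b1 b2. b = b1 @ b2 \<and> Dom SA k = fst r \<and>
        rel_chain (fst (Cod SA h)) b1 (fst (Cod SA k)) \<and>
        (\<forall>(a', a)\<in>sd.rsem r. (ap k a', ap h a) \<in> rsems (fst (Cod SA k)) b1) \<and> simulates k w b2 h')"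

lemma simulates_Cons:
  assumes "h \<in> Arr SA" "is_rel SD r" "Dom SA h = fst (snd r)" "Dom SA k = fst r"
    "rel_chain (fst (Cod SA h)) b1 (fst (Cod SA k))"
    "\<And>a' a. (a', a) \<in> sd.rsem r \<Longrightarrow> (ap k a', ap h a) \<in> rsems (fst (Cod SA k)) b1" "simulates k w b2 h'"
  shows "simulates h (r # w) (b1 @ b2) h'"
  unfolding simulates.simps(2) using assms by blast

lemma simulates_Arr: "simulates h w b h' \<Longrightarrow> h \<in> Arr SA \<and> h' \<in> Arr SA"
  by (induction w arbitrary: h b) auto

lemma simulates_chain: "simulates h w b h' \<Longrightarrow> rel_chain (fst (Cod SA h)) b (fst (Cod SA h'))"
proof (induction w arbitrary: h b)
  case Nil
  then have "Cod SA h \<in> formulas D" using SA.Cod_Ob[of h] by (simp add: SA_sel)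
  then show ?case using Nil by (simp add: formulas_iff)
next
  case (Cons r w)
  then obtain k b1 b2 where *: "b = b1 @ b2" "rel_chain (fst (Cod SA h)) b1 (fst (Cod SA k))" "simulates k w b2 h'"
    unfolding simulates.simps(2) by (elim conjE exE)
  then show ?case unfolding *(1) rel_chain_append using Cons.IH[of k b2] by metis
qed

text \<open>A simulation can be cut wherever the simulated loop is cut, with a map \<open>k\<close>
  at the cut. Read in the other direction, simulations that share \<open>k\<close> are
  concatenated.\<close>

lemma simulates_append:
  "simulates h (u @ v) b h' \<longleftrightarrow> (\<exists>k b1 b2. b = b1 @ b2 \<and> simulates h u b1 k \<and> simulates k v b2 h')"
proof (induction u arbitrary: h b)
  case Nil
  then show ?case using simulates_Arr[of h v b h'] by (auto simp del: split_paired_Ex)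
next
  case (Cons r u)
  show ?case (is "?L \<longleftrightarrow> ?R")
  proof
    assume ?L
    then obtain k b1 b2 where *: "h \<in> Arr SA" "is_rel SD r" "Dom SA h = fst (snd r)" "b = b1 @ b2" "Dom SA k = fst r"
      "rel_chain (fst (Cod SA h)) b1 (fst (Cod SA k))"
      "\<forall>(a', a)\<in>sd.rsem r. (ap k a', ap h a) \<in> rsems (fst (Cod SA k)) b1" "simulates k (u @ v) b2 h'"
      unfolding append_Cons simulates.simps(2) by (elim conjE exE)
    then obtain k' b3 b4 where "b2 = b3 @ b4" "simulates k u b3 k'" "simulates k' v b4 h'" using Cons.IH by blast
    moreover from this * have "simulates h (r # u) (b1 @ b3) k'" by (simp del: split_paired_Ex) blast
    ultimately show ?R using *(4) by (metis append_assoc)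
  next
    assume ?R
    then obtain k' c b4 where b: "b = c @ b4" and s: "simulates h (r # u) c k'" and v: "simulates k' v b4 h'" by blast
    from s obtain k b1 b2 where *: "h \<in> Arr SA" "is_rel SD r" "Dom SA h = fst (snd r)" "c = b1 @ b2" "Dom SA k = fst r"
      "rel_chain (fst (Cod SA h)) b1 (fst (Cod SA k))"
      "\<forall>(a', a)\<in>sd.rsem r. (ap k a', ap h a) \<in> rsems (fst (Cod SA k)) b1" "simulates k u b2 k'"
      unfolding simulates.simps(2) by (elim conjE exE)
    have "simulates k (u @ v) (b2 @ b4) h'" using Cons.IH *(8) v by blast
    then show ?L using * b unfolding append_Cons simulates.simps(2)
      by (intro conjI exI[of _ k] exI[of _ b1] exI[of _ "b2 @ b4"]) simp_all
  qed
qed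

lemma simulates_end: "simulates h w b h' \<Longrightarrow> Dom SA h' = (if w = [] then Dom SA h else fst (last w))"
proof (induction w arbitrary: h b)
  case (Cons r w)
  then obtain k b2 where "Dom SA k = fst r" "simulates k w b2 h'" by auto
  with Cons.IH[OF this(2)] show ?case by simp
qed simp

text \<open>Puts \<open>S\<close> into the first block, which replaces the starting map
  \<open>h\<close> by \<open>g\<close>. The simulated loop is nonempty because an empty one has no
  block to receive \<open>S\<close>.\<close>

lemma simulates_front:
  assumes s: "simulates h (r # w) b h'" and S: "is_rel D S" "fst S = fst (Cod SA h)" "fst (snd S) = fst (Cod SA g)"
    and g: "g \<in> Arr SA" "Dom SA g = Dom SA h" and hg: "\<And>a. a \<in> pts (Dom SA h) \<Longrightarrow> (ap h a, ap g a) \<in> rsem S"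
  shows "simulates g (r # w) (S # b) h'"
proof -
  from s obtain k b1 b2 where *: "h \<in> Arr SA" "is_rel SD r" "Dom SA h = fst (snd r)" "b = b1 @ b2" "Dom SA k = fst r"
      "rel_chain (fst (Cod SA h)) b1 (fst (Cod SA k))"
      "\<forall>(a', a)\<in>sd.rsem r. (ap k a', ap h a) \<in> rsems (fst (Cod SA k)) b1" "simulates k w b2 h'"
      unfolding simulates.simps(2) by (elim conjE exE)
  have "\<forall>(a', a)\<in>sd.rsem r. (ap k a', ap g a) \<in> rsems (fst (Cod SA k)) (S # b1)"
  proof clarify
    fix a' a assume a: "(a', a) \<in> sd.rsem r"
    then have "a \<in> pts (Dom SA h)" using sd.rsem_El[OF *(2) a] *(3) by simp
    from hg[OF this] *(7) a show "(ap k a', ap g a) \<in> rsems (fst (Cod SA k)) (S # b1)" by auto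
  qed
  moreover have "rel_chain (fst (Cod SA g)) (S # b1) (fst (Cod SA k))" using * S by simp
  ultimately show ?thesis unfolding simulates.simps(2) using * g
    by (intro conjI exI[of _ k] exI[of _ "S # b1"] exI[of _ b2]) simp_all
qed

text \<open>The mirror image of \<open>simulates_front\<close>: \<open>S\<close> joins the last
  block and the final map changes. The induction walks to that block.\<close>

lemma simulates_back:
  assumes "simulates h w b h'" "w \<noteq> []" and S: "is_rel D S" "fst S = fst (Cod SA g)" "fst (snd S) = fst (Cod SA h')"
    and g: "g \<in> Arr SA" "Dom SA g = Dom SA h'" and gh: "\<And>a. a \<in> pts (Dom SA h') \<Longrightarrow> (ap g a, ap h' a) \<in> rsem S"
  shows "simulates h w (b @ [S]) g"
  using assms(1,2)
proof (induction w arbitrary: h b)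
  case (Cons r w)
  from Cons.prems(1) obtain k b1 b2 where *: "h \<in> Arr SA" "is_rel SD r" "Dom SA h = fst (snd r)" "b = b1 @ b2" "Dom SA k = fst r"
      "rel_chain (fst (Cod SA h)) b1 (fst (Cod SA k))"
      "\<forall>(a', a)\<in>sd.rsem r. (ap k a', ap h a) \<in> rsems (fst (Cod SA k)) b1" "simulates k w b2 h'"
      unfolding simulates.simps(2) by (elim conjE exE)
  show ?case
  proof (cases "w = []")
    case True
    then have k: "h' = k" "b2 = []" using *(8) by auto
    have gO: "fst (Cod SA g) \<in> Ob (Base D)" using SA.Cod_Ob[OF g(1)] by (simp add: SA_sel formulas_iff)
    have c1: "rel_chain (fst (Cod SA k)) [S] (fst (Cod SA g))" using S k gO by simp
    have r: "rsems (fst (Cod SA g)) (b1 @ [S]) = rsems (fst (Cod SA g)) [S] O rsems (fst (Cod SA k)) b1"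
      by (rule rsems_append[OF c1 *(6)])
    have "(ap g a', ap h a) \<in> rsems (fst (Cod SA g)) (b1 @ [S])" if a: "(a', a) \<in> sd.rsem r" for a' a
    proof -
      have "a' \<in> pts (Dom SA h')" using sd.rsem_El[OF *(2) a] *(5) k by simp
      then have e: "(ap g a', ap k a') \<in> rsem S" using gh k by simp
      then have "ap g a' \<in> El (fst (Cod SA g))" using rsem_El[OF S(1) e] S(2) by simp
      then have "(ap g a', ap k a') \<in> rsems (fst (Cod SA g)) [S]" using e by auto
      then show ?thesis unfolding r using *(7) a by auto
    qed
    moreover have "rel_chain (fst (Cod SA h)) (b1 @ [S]) (fst (Cod SA g))" using *(6) c1 rel_chain_append by blast
    ultimately show ?thesis unfolding simulates.simps True using * g k
      by (intro conjI exI[of _ g] exI[of _ "b1 @ [S]"] exI[of _ "[]"]) auto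
  next
    case False
    have "simulates k w (b2 @ [S]) g" by (rule Cons.IH[OF *(8) False])
    then show ?thesis unfolding simulates.simps using *
      by (intro conjI exI[of _ k] exI[of _ b1] exI[of _ "b2 @ [S]"]) simp_all
  qed
qed simp

text \<open>Closures only add points, so what is reached from \<open>B\<close> through the block
  lies in \<open>dia_loop D b B\<close>. For closed \<open>B\<close> this value is itself closed,
  the outermost operation being a closure or the block being empty; hence it also contains the
  closure of \<open>E\<close>.\<close>

lemma dia_rsems:
  assumes "rel_chain X b Y" "B \<in> carrier (Fib D Y)" "\<diamond>\<^bsub>Fib D Y\<^esub> B = B" "E \<in> carrier (Fib D X)"
    "sem X E \<subseteq> rsems Y b `` sem Y B"
  shows "dia_loop D b B \<in> carrier (Fib D X)" "\<diamond>\<^bsub>Fib D X\<^esub> (dia_loop D b B) = dia_loop D b B"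
    "sem X (\<diamond>\<^bsub>Fib D X\<^esub> E) \<subseteq> sem X (dia_loop D b B)"
proof -
  have *: "dia_loop D b B \<in> carrier (Fib D X) \<and> \<diamond>\<^bsub>Fib D X\<^esub> (dia_loop D b B) = dia_loop D b B \<and>
     rsems Y b `` sem Y B \<subseteq> sem X (dia_loop D b B)"
    using assms(1)
  proof (induction b arbitrary: X)
    case Nil
    then show ?case using assms(2,3) by (auto simp: dia_loop_def)
  next
    case (Cons r b)
    obtain X1 R where r: "r = (X1, X, R)" "is_rel D (X1, X, R)" and b: "rel_chain X1 b Y"
      using Cons.prems by (cases r) auto
    note IH = Cons.IH[OF b]
    note i = rel_image_sem[OF r(2) conjunct1[OF IH]]
    have X: "X \<in> Ob (Base D)" using is_relD[OF r(2)] by simp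
    have e: "dia_loop D (r # b) B = \<diamond>\<^bsub>Fib D X\<^esub> (rel_image D r (dia_loop D b B))"
      by (simp add: dia_loop_def r(1))
    note d = dia_sem(1-3)[OF X i(1)]
    have "rsems Y (r # b) `` sem Y B \<subseteq> sem X (rel_image D r (dia_loop D b B))"
      using IH i(2) unfolding r(1) by auto
    then show ?case using d unfolding e unfolding r(1) by auto
  qed
  then show "dia_loop D b B \<in> carrier (Fib D X)" "\<diamond>\<^bsub>Fib D X\<^esub> (dia_loop D b B) = dia_loop D b B" by auto
  have X: "X \<in> Ob (Base D)" using rel_chain_Ob[OF assms(1)] by simp
  show "sem X (\<diamond>\<^bsub>Fib D X\<^esub> E) \<subseteq> sem X (dia_loop D b B)"
    using dia_sem(6)[OF X assms(4), of "dia_loop D b B"] * assms(5) by auto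
qed

lemma dia_loop_append: "dia_loop D' (b @ c) B = dia_loop D' b (dia_loop D' c B)"
  by (simp add: dia_loop_def)

text \<open>Induction from the inner end of the loop. For one member \<open>r\<close>, continuity of
  \<open>h\<close> sends the closure of the image under \<open>r\<close> into the closure of a
  formula \<open>\<psi>\<close>; the points of \<open>\<psi>\<close> are reached through the block
  \<open>b1\<close> from what the rest of the loop gives; and \<open>dia_rsems\<close> absorbs the
  closure into the block.\<close>

lemma simulates_dia_loop:
  assumes "simulates h w b h'" "A \<in> subs (Dom SA h')" "B \<in> carrier (Fib D (fst (Cod SA h')))"
    "\<diamond>\<^bsub>Fib D (fst (Cod SA h'))\<^esub> B = B" "ap h' ` ssem A \<subseteq> sem (fst (Cod SA h')) B"
  shows "dia_loop SD w A \<in> subs (Dom SA h) \<and>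
    ap h ` ssem (dia_loop SD w A) \<subseteq> sem (fst (Cod SA h)) (dia_loop D b B)"
  using assms(1)
proof (induction w arbitrary: h b)
  case Nil
  then show ?case using assms(2-) by (simp add: dia_loop_def)
next
  case (Cons r w)
  from Cons.prems obtain k b1 b2 where *: "h \<in> Arr SA" "is_rel SD r" "Dom SA h = fst (snd r)" "b = b1 @ b2" "Dom SA k = fst r"
      "rel_chain (fst (Cod SA h)) b1 (fst (Cod SA k))"
      "\<forall>(a', a)\<in>sd.rsem r. (ap k a', ap h a) \<in> rsems (fst (Cod SA k)) b1" "simulates k w b2 h'"
      unfolding simulates.simps(2) by (elim conjE exE)
  note IH = Cons.IH[OF *(8)]
  let ?E = "dia_loop SD w A" let ?F = "dia_loop D b2 B" let ?P = "fst (snd r)"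
  have h: "h \<in> hom SA ?P (Cod SA h)" using *(1,3) by (simp add: hom_def)
  have e: "dia_loop SD (r # w) A = Synt_dia D CD ?P (rel_image SD r ?E)" by (simp add: dia_loop_def)
  have r: "r = (fst r, ?P, snd (snd r))" by simp
  have i: "rel_image SD r ?E \<in> subs ?P" "ssem (rel_image SD r ?E) = sd.rsem r `` ssem ?E"
    using sd.rel_image_sem[of "fst r" ?P "snd (snd r)" ?E] *(2,5) IH r by simp_all
  obtain \<theta> where t: "(fst ?P, \<theta>) \<in> formulas D" "sem (fst ?P) \<theta> = ssem (rel_image SD r ?E)" "ssem (rel_image SD r ?E) \<subseteq> pts ?P"
    using subs_formula[OF i(1)] .
  have tc: "\<theta> \<in> carrier (Fib D (fst ?P))" using t by (simp add: formulas_iff)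
  have ih: "embed (inclusion_map D (fst ?P) \<theta> (snd ?P))" "inclusion_map D (fst ?P) \<theta> (snd ?P) \<in> hom SA (fst ?P, \<theta>) ?P"
    using embed_inclusion[of "fst ?P" \<theta> "snd ?P"] inclusion_map_hom(1)[of "fst ?P" \<theta> "snd ?P"] t hom_formulas[OF h] by simp_all
  let ?Y = "fst (Cod SA h)"
  \<comment> \<open>The subobject obtained by applying \<open>r\<close> is represented by
    \<open>\<theta>\<close>; its image under \<open>h\<close> is turned into a formula of the
    doctrine, so that the modality of \<open>D\<close> applies to it.\<close>
  obtain \<psi> where p: "(?Y, \<psi>) \<in> formulas D" "sem ?Y \<psi> = ap (h \<cdot>\<^bsub>SA\<^esub> inclusion_map D (fst ?P) \<theta> (snd ?P)) ` sem (fst ?P) \<theta>"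
    using image_formula[OF Comp_SA(1)[OF ih(2) h]] by (metis fst_conv snd_conv)
  have "ap (inclusion_map D (fst ?P) \<theta> (snd ?P)) a = a" if "a \<in> sem (fst ?P) \<theta>" for a
    using ap_inclusion[of "fst ?P" \<theta> "snd ?P" a] t hom_formulas[OF h] that by simp
  then have ps: "sem ?Y \<psi> = ap h ` ssem (rel_image SD r ?E)"
    unfolding p(2) using ap_Comp[OF ih(2) h] t(2) by auto
  have pc: "\<psi> \<in> carrier (Fib D ?Y)" using p by (simp add: formulas_iff)
  note d = Synt_dia_sem[OF i(1) tc t(2)]
  have F: "?F \<in> carrier (Fib D (fst (Cod SA k)))" "\<diamond>\<^bsub>Fib D (fst (Cod SA k))\<^esub> ?F = ?F"
  proof -
    have c: "rel_chain (fst (Cod SA k)) b2 (fst (Cod SA h'))" using simulates_chain[OF *(8)] .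
    have O: "fst (Cod SA k) \<in> Ob (Base D)" using rel_chain_Ob[OF c] by simp
    \<comment> \<open>The first two conclusions of \<open>dia_rsems\<close> are wanted here, so
      bottom is taken for \<open>E\<close>.\<close>
    show "?F \<in> carrier (Fib D (fst (Cod SA k)))" "\<diamond>\<^bsub>Fib D (fst (Cod SA k))\<^esub> ?F = ?F"
      using dia_rsems(1,2)[OF c assms(3,4) Fib_top(2)[OF O]] sem_bottom[OF O] by auto
  qed
  have sub: "sem ?Y \<psi> \<subseteq> rsems (fst (Cod SA k)) b1 `` sem (fst (Cod SA k)) ?F"
  proof
    fix y assume "y \<in> sem ?Y \<psi>"
    then obtain a' a where a: "a' \<in> ssem ?E" "(a', a) \<in> sd.rsem r" "y = ap h a" using ps i(2) by auto
    have "ap k a' \<in> sem (fst (Cod SA k)) ?F" using IH a(1) by auto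
    then show "y \<in> rsems (fst (Cod SA k)) b1 `` sem (fst (Cod SA k)) ?F" using *(7) a by auto
  qed
  have "ap h x \<in> sem ?Y (dia_loop D b B)" if x: "x \<in> ssem (dia_loop SD (r # w) A)" for x
  proof -
    have x': "x \<in> pts ?P" "x \<in> sem (fst ?P) (\<diamond>\<^bsub>Fib D (fst ?P)\<^esub> \<theta>)" using x d(2) unfolding e by auto
    \<comment> \<open>Continuity of \<open>h\<close> in the form \<open>dia_image\<close>.\<close>
    have "ap h x \<in> sem ?Y (\<diamond>\<^bsub>Fib D ?Y\<^esub> \<psi>)"
      by (rule dia_image[OF h tc pc _ x']) (use ps t in auto)
    then show ?thesis using dia_rsems(3)[OF *(6) F pc sub] unfolding *(4) dia_loop_append by auto
  qed
  then show ?case using d(1) *(3) unfolding e by auto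
qed

text \<open>As a set of pairs, the partial map \<open>(d, t)\<close> lies in the inverse of the
  embedding \<open>d\<close> followed by \<open>t\<close>. Both factors are tame, so some member of
  \<open>CD\<close> contains it and can take its place in a conjugation.\<close>

lemma span_partial_map_sem:
  assumes "(P, Q, F) \<in> span_partial_maps SA (Synt_M D CD)"
  shows "is_rel SD (P, Q, F)" "tame (fst P) (fst Q) (sd.rsem (P, Q, F))"
proof -
  obtain d t where d: "embed d" "Cod SA d = P" and t: "t \<in> Arr SA" "Cod SA t = Q" "Dom SA d = Dom SA t"
    and F: "F = subobj_class SA (Synt_M D CD) (pair SA d t)"
    using assms unfolding span_partial_maps_def Synt_M_iff by auto
  let ?W = "Dom SA t"
  have dh: "d \<in> hom SA ?W P" and th: "t \<in> hom SA ?W Q" using embed_hom[OF d(1)] d t by (auto simp: hom_def)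
  have PQ: "P \<in> Ob SA" "Q \<in> Ob SA" using hom_formulas dh th by (auto simp: SA_sel)
  let ?w = "pair SA d t" let ?R = "prod_ob SA P Q"
  have w: "?w \<in> hom SA ?W ?R" "pr1 SA P Q \<cdot>\<^bsub>SA\<^esub> ?w = d" "pr2 SA P Q \<cdot>\<^bsub>SA\<^esub> ?w = t"
    using dh th by (simp_all add: hom_def)
  have p: "pr1 SA P Q \<in> hom SA ?R P" "pr2 SA P Q \<in> hom SA ?R Q" using PQ by (simp_all add: hom_def)
  have apw: "ap (pr1 SA P Q) (ap ?w a) = ap d a" "ap (pr2 SA P Q) (ap ?w a) = ap t a" if "a \<in> pts ?W" for a
    using ap_Comp[OF w(1) p(1) that] ap_Comp[OF w(1) p(2) that] w by simp_all
  \<comment> \<open>\<open>pair SA d t\<close> is an embedding because \<open>d\<close> is one: a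
    preimage is recovered from the first projection.\<close>
  have s: "(gr ?w)\<inverse> \<subseteq> gr (pr1 SA P Q) O (gr d)\<inverse>"
  proof clarify
    fix a c assume "(a, c) \<in> gr ?w"
    then have a: "a \<in> pts ?W" "c = ap ?w a" using gr_iff[OF w(1)] by auto
    then have "(c, ap d a) \<in> gr (pr1 SA P Q)" "(a, ap d a) \<in> gr d"
      using gr_iff[OF p(1)] gr_iff[OF dh] apw ap_pts[OF w(1)] by auto
    then show "(c, a) \<in> gr (pr1 SA P Q) O (gr d)\<inverse>" by auto
  qed
  have "embed ?w"
    unfolding embed_def
  proof (intro conjI)
    show "?w \<in> Arr SA" using w(1) by (simp add: hom_def)
    have "single_valued (gr (pr1 SA P Q) O (gr d)\<inverse>)"
      using gr_hom[OF p(1)] d(1) by (auto simp: cmap_def embed_def intro: single_valued_relcomp)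
    then show "single_valued ((gr ?w)\<inverse>)" using s by (rule single_valued_subset[rotated])
    have "tame (fst ?R) (fst ?W) (gr (pr1 SA P Q) O (gr d)\<inverse>)"
      using gr_hom[OF p(1)] d t by (auto simp: cmap_def embed_def intro: tame_O)
    then show "tame (fst (Cod SA ?w)) (fst (Dom SA ?w)) ((gr ?w)\<inverse>)"
      using s w(1) tame_mono by (auto simp: hom_def)
  qed
  then have Fs: "F \<in> subs ?R" "ssem F = img ?w" using subs_class ssem_class w(1) unfolding F by (auto simp: hom_def)
  show "is_rel SD (P, Q, F)" using Fs PQ by (simp add: is_rel_def)
  have "sd.rsem (P, Q, F) \<subseteq> (gr d)\<inverse> O gr t"
  proof
    fix x assume "x \<in> sd.rsem (P, Q, F)"
    then obtain c where c: "c \<in> ssem F" "x = (ap (pr1 SA P Q) c, ap (pr2 SA P Q) c)" by (auto simp: sd.rsem_def)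
    obtain a where "a \<in> pts ?W" "c = ap ?w a" using c(1) Fs(2) w(1) by (auto simp: hom_def)
    then show "x \<in> (gr d)\<inverse> O gr t" using c(2) apw gr_iff[OF dh] gr_iff[OF th] by auto
  qed
  moreover have "tame (fst P) (fst Q) ((gr d)\<inverse> O gr t)"
    using gr_hom[OF th] d t by (auto simp: cmap_def embed_def intro: tame_O)
  ultimately show "tame (fst P) (fst Q) (sd.rsem (P, Q, F))" using tame_mono by blast
qed

section \<open>Comparison of products, and simulation of acceptable loops\<close>

lemma hom_tensor:
  assumes h: "h \<in> Arr SA" and k: "k \<in> Arr SA"
  shows "\<exists>t. t \<in> hom SA (prod_ob SA (Dom SA h) (Dom SA k)) (prodF (Cod SA h) (Cod SA k)) \<and>
    (\<forall>c\<in>pts (prod_ob SA (Dom SA h) (Dom SA k)). ap t c = tuple (fst (Cod SA h)) (fst (Cod SA k))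
       (ap h (ap (pr1 SA (Dom SA h) (Dom SA k)) c)) (ap k (ap (pr2 SA (Dom SA h) (Dom SA k)) c)))"
proof -
  let ?P = "Dom SA h" let ?Q = "Dom SA k" let ?R = "prod_ob SA ?P ?Q"
  have hk: "h \<in> hom SA ?P (Cod SA h)" "k \<in> hom SA ?Q (Cod SA k)" using h k by (auto simp: hom_def)
  have p: "pr1 SA ?P ?Q \<in> hom SA ?R ?P" "pr2 SA ?P ?Q \<in> hom SA ?R ?Q" using h k by (simp_all add: hom_def)
  obtain t where t: "t \<in> hom SA ?R (prodF (Cod SA h) (Cod SA k))"
    "\<And>c. c \<in> pts ?R \<Longrightarrow> ap t c = tuple (fst (Cod SA h)) (fst (Cod SA k)) (ap (h \<cdot>\<^bsub>SA\<^esub> pr1 SA ?P ?Q) c) (ap (k \<cdot>\<^bsub>SA\<^esub> pr2 SA ?P ?Q) c)"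
    by (rule hom_pair[OF Comp_SA(1)[OF p(1) hk(1)] Comp_SA(1)[OF p(2) hk(2)]]) (rule that)
  then show ?thesis using ap_Comp[OF p(1) hk(1)] ap_Comp[OF p(2) hk(2)] by (intro exI[of _ t]) simp
qed

text \<open>The product of two arrows, but with \<open>prodF\<close> as its target in place of the
  chosen product. Its codomain then lies over the product of the base objects, where products of
  relations of the doctrine live. A choice operator fixes it as a function of \<open>h\<close> and
  \<open>k\<close>.\<close>

definition tensor :: "('o, 'd) synt_map \<Rightarrow> ('o, 'd) synt_map \<Rightarrow> ('o, 'd) synt_map" where
  "tensor h k = (SOME t. t \<in> hom SA (prod_ob SA (Dom SA h) (Dom SA k)) (prodF (Cod SA h) (Cod SA k)) \<and>
    (\<forall>c\<in>pts (prod_ob SA (Dom SA h) (Dom SA k)). ap t c = tuple (fst (Cod SA h)) (fst (Cod SA k))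
       (ap h (ap (pr1 SA (Dom SA h) (Dom SA k)) c)) (ap k (ap (pr2 SA (Dom SA h) (Dom SA k)) c))))"

lemma tensor:
  assumes "h \<in> Arr SA" "k \<in> Arr SA"
  shows "tensor h k \<in> hom SA (prod_ob SA (Dom SA h) (Dom SA k)) (prodF (Cod SA h) (Cod SA k))"
    "c \<in> pts (prod_ob SA (Dom SA h) (Dom SA k)) \<Longrightarrow> ap (tensor h k) c = tuple (fst (Cod SA h)) (fst (Cod SA k))
       (ap h (ap (pr1 SA (Dom SA h) (Dom SA k)) c)) (ap k (ap (pr2 SA (Dom SA h) (Dom SA k)) c))"
    "tensor h k \<in> Arr SA" "Dom SA (tensor h k) = prod_ob SA (Dom SA h) (Dom SA k)"
    "fst (Cod SA (tensor h k)) = prod_ob (Base D) (fst (Cod SA h)) (fst (Cod SA k))"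
proof -
  have F: "Cod SA h \<in> formulas D" "Cod SA k \<in> formulas D" using assms SA.Cod_Ob by (auto simp: SA_sel)
  from someI_ex[OF hom_tensor[OF assms]]
  show t: "tensor h k \<in> hom SA (prod_ob SA (Dom SA h) (Dom SA k)) (prodF (Cod SA h) (Cod SA k))"
    and "c \<in> pts (prod_ob SA (Dom SA h) (Dom SA k)) \<Longrightarrow> ap (tensor h k) c = tuple (fst (Cod SA h)) (fst (Cod SA k))
       (ap h (ap (pr1 SA (Dom SA h) (Dom SA k)) c)) (ap k (ap (pr2 SA (Dom SA h) (Dom SA k)) c))"
    unfolding tensor_def by auto
  show "tensor h k \<in> Arr SA" "Dom SA (tensor h k) = prod_ob SA (Dom SA h) (Dom SA k)"
    "fst (Cod SA (tensor h k)) = prod_ob (Base D) (fst (Cod SA h)) (fst (Cod SA k))"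
    using t prodF(2)[OF F] by (auto simp: hom_def)
qed

text \<open>The comparison from the chosen product to the product formula. The pairing of the
  projections of \<open>prodF\<close> is its continuous retraction, and \<open>embedI\<close>
  applies.\<close>

lemma embed_tensor_ide:
  assumes P: "P \<in> formulas D" and Q: "Q \<in> formulas D"
  shows "embed (tensor (ide SA P) (ide SA Q))"
proof -
  let ?R = "prod_ob SA P Q" let ?t = "tensor (ide SA P) (ide SA Q)"
  have PQ: "P \<in> Ob SA" "Q \<in> Ob SA" using P Q by (simp_all add: SA_sel)
  have O: "fst P \<in> Ob (Base D)" "fst Q \<in> Ob (Base D)" using P Q by (simp_all add: formulas_iff)
  have i: "ide SA P \<in> Arr SA" "ide SA Q \<in> Arr SA" "Dom SA (ide SA P) = P" "Dom SA (ide SA Q) = Q"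
    "Cod SA (ide SA P) = P" "Cod SA (ide SA Q) = Q" using PQ by simp_all
  note t = tensor[OF i(1,2), unfolded i(3-6)]
  have R: "pr1 SA P Q \<in> hom SA ?R P" "pr2 SA P Q \<in> hom SA ?R Q" using PQ by (simp_all add: hom_def)
  obtain p q where pq: "p \<in> hom SA (prodF P Q) P" "q \<in> hom SA (prodF P Q) Q"
    "\<And>c. c \<in> pts (prodF P Q) \<Longrightarrow> ap p c = act (pr1 (Base D) (fst P) (fst Q)) c"
    "\<And>c. c \<in> pts (prodF P Q) \<Longrightarrow> ap q c = act (pr2 (Base D) (fst P) (fst Q)) c"
    "is_product SA P Q (prodF P Q) p q" by (rule prodF_projections[OF P Q]) (rule that)
  let ?j = "pair SA p q"
  have j: "?j \<in> hom SA (prodF P Q) ?R" "pr1 SA P Q \<cdot>\<^bsub>SA\<^esub> ?j = p" "pr2 SA P Q \<cdot>\<^bsub>SA\<^esub> ?j = q"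
    using pq(1,2) by (simp_all add: hom_def)
  have j': "?j \<in> hom SA (fst (prodF P Q), snd (prodF P Q)) ?R" using j(1) by simp
  show ?thesis
  proof (rule embedI[OF t(1) j'])
    fix c assume c: "c \<in> pts ?R"
    have tc: "ap ?t c \<in> pts (prodF P Q)" using ap_pts[OF t(1) c] .
    have e: "ap ?t c = tuple (fst P) (fst Q) (ap (pr1 SA P Q) c) (ap (pr2 SA P Q) c)"
      using t(2)[OF c] ap_ide[OF P] ap_ide[OF Q] ap_pts[OF R(1) c] ap_pts[OF R(2) c] by simp
    have "ap (pr1 SA P Q) c \<in> El (fst P)" "ap (pr2 SA P Q) c \<in> El (fst Q)" "fib (ap (pr1 SA P Q) c) = fib (ap (pr2 SA P Q) c)"
      using ap_pts[OF R(1) c] ap_pts[OF R(2) c] pts_El[OF P] pts_El[OF Q] fib_ap[OF R(1) c] fib_ap[OF R(2) c] by auto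
    note a = tuple_simps[OF O this]
    have "ap ?j (ap ?t c) = c"
    proof (rule sd.tuple_unique[of P Q])
      show "ap (pr1 (Base SD) P Q) (ap ?j (ap ?t c)) = ap (pr1 (Base SD) P Q) c"
        using ap_Comp[OF j(1) R(1) tc] j(2) pq(3)[OF tc] a(2) e by simp
      show "ap (pr2 (Base SD) P Q) (ap ?j (ap ?t c)) = ap (pr2 (Base SD) P Q) c"
        using ap_Comp[OF j(1) R(2) tc] j(3) pq(4)[OF tc] a(3) e by simp
    qed (use PQ c ap_pts[OF j(1) tc] in simp_all)
    then show "ap ?t c \<in> sem (fst (prodF P Q)) (snd (prodF P Q)) \<and> ap ?j (ap ?t c) = c" using tc by simp
  qed
qed

text \<open>Blocks for corresponding members of \<open>u\<close> and \<open>v\<close> may differ in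
  length, while the product rule pairs loops member by member; so the shorter block is padded.
  Padding must keep the whole loop acceptable, not just the block. Therefore the induction carries
  prefixes \<open>s\<close> and \<open>t\<close> of equal length that have already been
  treated.\<close>

lemma simulates_product:
  assumes "length u = length v" "simulates h u b h'" "simulates k v c k'"
    "acceptable_loop D CD X (s @ b)" "acceptable_loop D CD Y (t @ c)" "length s = length t"
    "fst (Cod SA h) = (if s = [] then X else fst (last s))" "fst (Cod SA k) = (if t = [] then Y else fst (last t))"
  shows "\<exists>b' c'. acceptable_loop D CD X (s @ b') \<and> acceptable_loop D CD Y (t @ c') \<and> length b' = length c' \<and>
    simulates (tensor h k) (map2 (rel_prod SD) u v) (map2 (rel_prod D) b' c') (tensor h' k')"
  using assms
proof (induction u v arbitrary: h k b c s t rule: list_induct2)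
  case Nil
  then show ?case using tensor(3) by (intro exI[of _ "[]"]) auto
next
  case (Cons r u q v)
  from Cons.prems(1) obtain l b1 b2 where r: "h \<in> Arr SA" "is_rel SD r" "Dom SA h = fst (snd r)" "b = b1 @ b2" "Dom SA l = fst r"
      "rel_chain (fst (Cod SA h)) b1 (fst (Cod SA l))"
      "\<forall>(a', a)\<in>sd.rsem r. (ap l a', ap h a) \<in> rsems (fst (Cod SA l)) b1" "simulates l u b2 h'"
      unfolding simulates.simps(2) by (elim conjE exE)
  from Cons.prems(2) obtain m c1 c2 where q: "k \<in> Arr SA" "is_rel SD q" "Dom SA k = fst (snd q)" "c = c1 @ c2" "Dom SA m = fst q"
      "rel_chain (fst (Cod SA k)) c1 (fst (Cod SA m))"
      "\<forall>(a', a)\<in>sd.rsem q. (ap m a', ap k a) \<in> rsems (fst (Cod SA m)) c1" "simulates m v c2 k'"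
      unfolding simulates.simps(2) by (elim conjE exE)
  have lm: "l \<in> Arr SA" "m \<in> Arr SA" using simulates_Arr r(8) q(8) by auto
  let ?X = "fst (Cod SA l)" let ?Y = "fst (Cod SA m)"
  have O: "?X \<in> Ob (Base D)" "?Y \<in> Ob (Base D)" using rel_chain_Ob r(6) q(6) by auto
  \<comment> \<open>Subtraction is truncated, so at most one block is padded. The identities go to
    the end of the block, on the object \<open>?X\<close> or \<open>?Y\<close> where its chain
    stops.\<close>
  let ?b = "b1 @ replicate (length c1 - length b1) (rel_id D ?X)"
  let ?c = "c1 @ replicate (length b1 - length c1) (rel_id D ?Y)"
  have len: "length ?b = length ?c" by simp
  have cb: "rel_chain (fst (Cod SA h)) ?b ?X" "rel_chain (fst (Cod SA k)) ?c ?Y"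
    using r(6) q(6) rel_chain_replicate_id[OF O(1)] rel_chain_replicate_id[OF O(2)] unfolding rel_chain_append by blast+
  have sb: "rsems ?X ?b = rsems ?X b1" "rsems ?Y ?c = rsems ?Y c1"
  proof -
    have "rsems ?X ?b = Id_on (El ?X) O rsems ?X b1"
      using rsems_append[OF rel_chain_replicate_id[OF O(1)] r(6)] rsems_replicate_id[OF O(1)] by simp
    also have "\<dots> = rsems ?X b1" using rsems_El[OF r(6)] by (auto simp: relcomp_unfold Id_on_iff)
    finally show "rsems ?X ?b = rsems ?X b1" .
    have "rsems ?Y ?c = Id_on (El ?Y) O rsems ?Y c1"
      using rsems_append[OF rel_chain_replicate_id[OF O(2)] q(6)] rsems_replicate_id[OF O(2)] by simp
    also have "\<dots> = rsems ?Y c1" using rsems_El[OF q(6)] by (auto simp: relcomp_unfold Id_on_iff)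
    finally show "rsems ?Y ?c = rsems ?Y c1" .
  qed
  have end1: "?X = (if s @ b1 = [] then X else fst (last (s @ b1)))"
    using rel_chain_end[OF r(6)] Cons.prems(6) by (auto split: if_splits)
  have end2: "?Y = (if t @ c1 = [] then Y else fst (last (t @ c1)))"
    using rel_chain_end[OF q(6)] Cons.prems(7) by (auto split: if_splits)
  have endb: "?X = (if s @ ?b = [] then X else fst (last (s @ ?b)))"
    using rel_chain_end[OF cb(1)] Cons.prems(6) by (auto split: if_splits)
  have endc: "?Y = (if t @ ?c = [] then Y else fst (last (t @ ?c)))"
    using rel_chain_end[OF cb(2)] Cons.prems(7) by (auto split: if_splits)
  have ab: "acceptable_loop D CD X ((s @ ?b) @ b2)"
    using acceptable_loop_pad[of CD X "s @ b1" b2 ?X "length c1 - length b1"] Cons.prems(3) r(4) end1 by simp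
  have ac: "acceptable_loop D CD Y ((t @ ?c) @ c2)"
    using acceptable_loop_pad[of CD Y "t @ c1" c2 ?Y "length b1 - length c1"] Cons.prems(4) q(4) end2 by simp
  have "length (s @ ?b) = length (t @ ?c)" using Cons.prems(5) by simp
  from Cons.IH[OF r(8) q(8) ab ac this endb endc] obtain b' c' where
    IH: "acceptable_loop D CD X ((s @ ?b) @ b')" "acceptable_loop D CD Y ((t @ ?c) @ c')" "length b' = length c'"
      "simulates (tensor l m) (map2 (rel_prod SD) u v) (map2 (rel_prod D) b' c') (tensor h' k')" by blast
  have zip: "map2 (rel_prod D) (?b @ b') (?c @ c') = map2 (rel_prod D) ?b ?c @ map2 (rel_prod D) b' c'"
    by (simp only: zip_append[OF len] map_append)
  obtain P1 P R where rr: "r = (P1, P, R)" by (cases r)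
  obtain Q1 Q S where qq: "q = (Q1, Q, S)" by (cases q)
  note pr = sd.rel_prod_sem[of P1 P R Q1 Q S, OF r(2)[unfolded rr] q(2)[unfolded qq], unfolded SD_sel(1)]
  note T = tensor[OF r(1) q(1)] note T' = tensor[OF lm]
  have d: "Dom SA h = P" "Dom SA k = Q" "Dom SA l = P1" "Dom SA m = Q1" using r q rr qq by auto
  have PQ: "P \<in> Ob SA" "Q \<in> Ob SA" "P1 \<in> Ob SA" "Q1 \<in> Ob SA"
    using r(2) q(2) by (auto simp: rr qq is_rel_def)
  have blk: "(ap (tensor l m) e', ap (tensor h k) e) \<in> rsems (fst (Cod SA (tensor l m))) (map2 (rel_prod D) ?b ?c)"
    if e: "(e', e) \<in> sd.rsem (rel_prod SD r q)" for e' e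
  proof -
    have m: "e' \<in> pts (prod_ob SA P1 Q1)" "e \<in> pts (prod_ob SA P Q)" "fib e' = fib e"
      "(ap (pr1 SA P1 Q1) e', ap (pr1 SA P Q) e) \<in> sd.rsem r" "(ap (pr2 SA P1 Q1) e', ap (pr2 SA P Q) e) \<in> sd.rsem q"
      using e pr(3) unfolding rr qq by auto
    have 1: "(ap l (ap (pr1 SA P1 Q1) e'), ap h (ap (pr1 SA P Q) e)) \<in> rsems ?X ?b" using m(4) r(7) sb by auto
    have 2: "(ap m (ap (pr2 SA P1 Q1) e'), ap k (ap (pr2 SA P Q) e)) \<in> rsems ?Y ?c" using m(5) q(7) sb by auto
    have pp: "pr1 SA P Q \<in> hom SA (prod_ob SA P Q) P" "pr2 SA P Q \<in> hom SA (prod_ob SA P Q) Q"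
      using PQ by (simp_all add: hom_def)
    have hk: "h \<in> hom SA P (Cod SA h)" "k \<in> hom SA Q (Cod SA k)" using r(1) q(1) d by (auto simp: hom_def)
    have f: "fib (ap h (ap (pr1 SA P Q) e)) = fib (ap k (ap (pr2 SA P Q) e))"
      using fib_ap[OF hk(1) ap_pts[OF pp(1) m(2)]] fib_ap[OF hk(2) ap_pts[OF pp(2) m(2)]]
        fib_ap[OF pp(1) m(2)] fib_ap[OF pp(2) m(2)] by simp
    show "(ap (tensor l m) e', ap (tensor h k) e) \<in> rsems (fst (Cod SA (tensor l m))) (map2 (rel_prod D) ?b ?c)"
      using rsems_map2_rel_prod[OF len cb 1 2 f] T(2)[of e] T'(2)[of e'] T'(5) m d by simp
  qed
  have chain: "rel_chain (prod_ob (Base D) (fst (Cod SA h)) (fst (Cod SA k))) (map2 (rel_prod D) ?b ?c) (prod_ob (Base D) ?X ?Y)"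
    by (rule rel_chain_map2[OF len cb])
  have "simulates (tensor h k) (map2 (rel_prod SD) (r # u) (q # v)) (map2 (rel_prod D) (?b @ b') (?c @ c')) (tensor h' k')"
    unfolding zip list.map zip_Cons_Cons prod.case
  proof (rule simulates_Cons[where k = "tensor l m"])
    show "tensor h k \<in> Arr SA" by (rule T(3))
    show "is_rel SD (rel_prod SD r q)" unfolding rr qq by (rule pr(2))
    show "Dom SA (tensor h k) = fst (snd (rel_prod SD r q))" "Dom SA (tensor l m) = fst (rel_prod SD r q)"
      using T(4) T'(4) d by (simp_all add: rr qq Defs.rel_prod_def Let_def)
    show "rel_chain (fst (Cod SA (tensor h k))) (map2 (rel_prod D) ?b ?c) (fst (Cod SA (tensor l m)))"
      unfolding T(5) T'(5) by (rule chain)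
    show "(ap (tensor l m) e', ap (tensor h k) e) \<in> rsems (fst (Cod SA (tensor l m))) (map2 (rel_prod D) ?b ?c)"
      if "(e', e) \<in> sd.rsem (rel_prod SD r q)" for e' e
      using blk[OF that] .
    show "simulates (tensor l m) (map2 (rel_prod SD) u v) (map2 (rel_prod D) b' c') (tensor h' k')" by (rule IH(4))
  qed
  then show ?case using IH(1-3) len
    by (intro exI[of _ "?b @ b'"] exI[of _ "?c @ c'"]) simp
qed

text \<open>Induction over the rules, with the identity of the anchor as first and last map. A loop
  at \<open>P\<close> thus corresponds to a loop at \<open>fst P\<close>, and simulations at one
  anchor can be concatenated.\<close>

lemma acceptable_loop_simulated:
  assumes "acceptable_loop SD (span_partial_maps SA (Synt_M D CD)) P w"
  shows "P \<in> formulas D \<and> (\<exists>b. acceptable_loop D CD (fst P) b \<and> simulates (ide SA P) w b (ide SA P))"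
  using assms
proof induction
  case (empty P)
  then have P: "P \<in> formulas D" "ide SA P \<in> Arr SA" by (simp_all add: SA_sel ide_SA(1)[unfolded hom_def])
  then have "acceptable_loop D CD (fst P) []" by (intro acceptable_loop.empty) (simp add: formulas_iff)
  then show ?case using P by (intro conjI exI[of _ "[]"]) simp_all
next
  case (identity P u v)
  then obtain b where P: "P \<in> formulas D" and b: "acceptable_loop D CD (fst P) b" "simulates (ide SA P) (u @ v) b (ide SA P)" by blast
  then obtain k b1 b2 where k: "b = b1 @ b2" "simulates (ide SA P) u b1 k" "simulates k v b2 (ide SA P)"
    unfolding simulates_append by blast
  have dP: "Dom SA (ide SA P) = P" using ide_SA(1)[OF P] by (simp add: hom_def)
  let ?Q = "if u = [] then P else fst (last u)"
  have dk: "Dom SA k = ?Q" using simulates_end[OF k(2)] dP by simp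
  have kA: "k \<in> Arr SA" using simulates_Arr[OF k(2)] by simp
  then have F: "?Q \<in> Ob SA" "Cod SA k \<in> formulas D" using SA.Dom_Ob[OF kA] SA.Cod_Ob[OF kA] dk by (simp_all add: SA_sel)
  note i = sd.rel_id_sem[of ?Q, unfolded SD_sel(1), OF F(1)]
  have kh: "k \<in> hom SA ?Q (Cod SA k)" using kA dk by (simp add: hom_def)
  have q: "fst (rel_id SD ?Q) = ?Q" "fst (snd (rel_id SD ?Q)) = ?Q" by (simp_all only: rel_id_def fst_conv snd_conv)
  \<comment> \<open>An identity relation is simulated by an empty block, so the loop
    \<open>b\<close> of the doctrine does not change. The place of insertion is a block boundary by
    \<open>simulates_append\<close>.\<close>
  have "simulates k (rel_id SD ?Q # v) ([] @ b2) (ide SA P)"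
  proof (rule simulates_Cons[where k = k])
    show "(ap k a', ap k a) \<in> rsems (fst (Cod SA k)) []" if "(a', a) \<in> sd.rsem (rel_id SD ?Q)" for a' a
    proof -
      from that have "a' = a" "a \<in> pts ?Q" unfolding i(3) by blast+
      then show ?thesis using ap_pts[OF kh] pts_El[OF F(2)] unfolding rsems.simps by blast
    qed
    show "rel_chain (fst (Cod SA k)) [] (fst (Cod SA k))" using F(2) by (simp add: formulas_iff)
    show "Dom SA k = fst (snd (rel_id SD ?Q))" "Dom SA k = fst (rel_id SD ?Q)" unfolding q by (rule dk)+
  qed (rule kA i(2) k(3))+
  then have "simulates k ([rel_id SD ?Q] @ v) b2 (ide SA P)" by simp
  then have "simulates (ide SA P) (u @ [rel_id SD ?Q] @ v) b (ide SA P)"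
    unfolding simulates_append[of _ u] using k by blast
  then show ?case using P b by blast
next
  case (concat P u v)
  then obtain b c where b: "P \<in> formulas D" "acceptable_loop D CD (fst P) b" "simulates (ide SA P) u b (ide SA P)"
    and c: "acceptable_loop D CD (fst P) c" "simulates (ide SA P) v c (ide SA P)" by (elim conjE exE)
  have "simulates (ide SA P) (u @ v) (b @ c) (ide SA P)" unfolding simulates_append using b(3) c(2) by blast
  with acceptable_loop.concat[OF b(2) c(1)] b(1) show ?case by blast
next
  case (conjugate P w Q f)
  then obtain b where P: "P \<in> formulas D" and b: "acceptable_loop D CD (fst P) b" "simulates (ide SA P) w b (ide SA P)" by blast
  note f = span_partial_map_sem[OF conjugate.hyps(2)]
  \<comment> \<open>The partial map of the syntactic category is replaced by a member of
    \<open>CD\<close> that contains it; the converse of that member then contains the converse of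
    the partial map.\<close>
  obtain R where R: "(fst P, fst Q, R) \<in> CD" "sd.rsem (P, Q, f) \<subseteq> rsem (fst P, fst Q, R)" using f(2) by (auto simp: tame_def)
  have iR: "is_rel D (fst P, fst Q, R)" using CD_rel[OF R(1)] by simp
  note cR = rel_conv_sem[OF iR]
  note cf = sd.rel_conv_sem[OF f(1)]
  have Q: "Q \<in> formulas D" using f(1) by (simp add: is_rel_def SA_sel)
  have hP: "ide SA P \<in> Arr SA" "Dom SA (ide SA P) = P" "Cod SA (ide SA P) = P" using ide_SA(1)[OF P] by (auto simp: hom_def)
  have hQ: "ide SA Q \<in> Arr SA" "Dom SA (ide SA Q) = Q" "Cod SA (ide SA Q) = Q" using ide_SA(1)[OF Q] by (auto simp: hom_def)
  have O: "fst P \<in> Ob (Base D)" "fst Q \<in> Ob (Base D)" using P Q by (simp_all add: formulas_iff)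
  have E: "a' \<in> pts P \<and> a \<in> pts Q" if "(a', a) \<in> sd.rsem (P, Q, f)" for a' a using sd.rsem_El[OF f(1) that] by simp
  have "simulates (ide SA Q) [(P, Q, f)] [(fst P, fst Q, R)] (ide SA P)"
  proof -
    have "\<forall>(a', a)\<in>sd.rsem (P, Q, f). (ap (ide SA P) a', ap (ide SA Q) a) \<in> rsems (fst P) [(fst P, fst Q, R)]"
      using E ap_ide[OF P] ap_ide[OF Q] R(2) pts_El[OF P] by (fastforce simp: relcomp_unfold Id_on_iff)
    then show ?thesis using hP hQ f(1) iR O
      by (simp del: split_paired_Ex)
  qed
  moreover have "simulates (ide SA P) [rel_conv SD (P, Q, f)] [rel_conv D (fst P, fst Q, R)] (ide SA Q)"
  proof -
    have s: "fst (rel_conv SD (P, Q, f)) = Q" "fst (snd (rel_conv SD (P, Q, f))) = P"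
      "fst (rel_conv D (fst P, fst Q, R)) = fst Q" "fst (snd (rel_conv D (fst P, fst Q, R))) = fst P"
      using cf(1) cR(1) by (metis fst_conv snd_conv)+
    have "\<forall>(a', a)\<in>sd.rsem (rel_conv SD (P, Q, f)). (ap (ide SA Q) a', ap (ide SA P) a) \<in> rsems (fst Q) [rel_conv D (fst P, fst Q, R)]"
      using E ap_ide[OF P] ap_ide[OF Q] R(2) pts_El[OF Q] unfolding cf(3) by (fastforce simp: relcomp_unfold Id_on_iff cR(3))
    then show ?thesis using hP hQ cf(2) cR(2) O s
      by (simp del: split_paired_Ex)
  qed
  ultimately have "simulates (ide SA Q) ([(P, Q, f)] @ w @ [rel_conv SD (P, Q, f)])
      ([(fst P, fst Q, R)] @ b @ [rel_conv D (fst P, fst Q, R)]) (ide SA Q)"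
    unfolding simulates_append using b(2) by blast
  moreover have "acceptable_loop D CD (fst Q) ([(fst P, fst Q, R)] @ b @ [rel_conv D (fst P, fst Q, R)])"
    by (rule acceptable_loop.conjugate[OF b(1) R(1)])
  ultimately show ?case using Q by blast
next
  case (product P u Q v)
  then obtain b c where P: "P \<in> formulas D" and b: "acceptable_loop D CD (fst P) b" "simulates (ide SA P) u b (ide SA P)"
    and Q: "Q \<in> formulas D" and c: "acceptable_loop D CD (fst Q) c" "simulates (ide SA Q) v c (ide SA Q)" by blast
  have hP: "ide SA P \<in> Arr SA" "Dom SA (ide SA P) = P" "Cod SA (ide SA P) = P" using ide_SA(1)[OF P] by (auto simp: hom_def)
  have hQ: "ide SA Q \<in> Arr SA" "Dom SA (ide SA Q) = Q" "Cod SA (ide SA Q) = Q" using ide_SA(1)[OF Q] by (auto simp: hom_def)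
  let ?R = "prod_ob SA P Q" let ?X = "prod_ob (Base D) (fst P) (fst Q)" let ?t = "tensor (ide SA P) (ide SA Q)"
  have PQ: "P \<in> Ob SA" "Q \<in> Ob SA" using P Q by (simp_all add: SA_sel)
  have R: "?R \<in> formulas D" using SA.pr_simps(1)[OF PQ] by (simp add: SA_sel)
  have hR: "ide SA ?R \<in> Arr SA" "Dom SA (ide SA ?R) = ?R" "Cod SA (ide SA ?R) = ?R" using ide_SA(1)[OF R] by (auto simp: hom_def)
  have O: "fst ?R \<in> Ob (Base D)" using R by (simp add: formulas_iff)
  note t = tensor[OF hP(1) hQ(1), unfolded hP(2,3) hQ(2,3)]
  obtain b' c' where bc: "acceptable_loop D CD (fst P) b'" "acceptable_loop D CD (fst Q) c'" "length b' = length c'"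
    "simulates ?t (map2 (rel_prod SD) u v) (map2 (rel_prod D) b' c') ?t"
    using simulates_product[OF product.hyps(3) b(2) c(2), of "fst P" "[]" "fst Q" "[]"] b(1) c(1) hP hQ by auto
  let ?w = "map2 (rel_prod SD) u v" let ?b = "map2 (rel_prod D) b' c'"
  have acc: "acceptable_loop D CD ?X ?b" by (rule acceptable_loop.product[OF bc(1-3)])
  have Base: "prod_ob (Base SD) P Q = ?R" by simp
  show ?case
  \<comment> \<open>With an empty product loop there is no block into which the comparison could be
    put; the empty loop of the doctrine serves instead.\<close>
  proof (cases "?w = []")
    case True
    have "acceptable_loop D CD (fst ?R) []" by (rule acceptable_loop.empty[OF O])
    moreover have "simulates (ide SA ?R) ?w [] (ide SA ?R)" unfolding True using hR by simp
    ultimately show ?thesis unfolding Base using R by blast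
  next
    case False
    have e: "embed ?t" by (rule embed_tensor_ide[OF P Q])
    have th: "?t \<in> hom SA ?R (Cod SA ?t)" using t by (simp add: hom_def)
    \<comment> \<open>\<open>V\<close> contains the inverse of the comparison \<open>?t\<close>.
      Conjugation by \<open>V\<close> moves the simulating loop from the product of the base objects
      to the base object of the chosen product, as the \<open>product\<close> rule of the syntactic
      category demands.\<close>
    obtain V where V: "(?X, fst ?R, V) \<in> CD" "(gr ?t)\<inverse> \<subseteq> rsem (?X, fst ?R, V)"
      using e t by (auto simp: embed_def tame_def)
    have iV: "is_rel D (?X, fst ?R, V)" using CD_rel[OF V(1)] by simp
    note cV = rel_conv_sem[OF iV]
    have m: "(ap ?t a, ap (ide SA ?R) a) \<in> rsem (?X, fst ?R, V)" if "a \<in> pts ?R" for a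
      using gr_iff[OF th, of a "ap ?t a"] that V(2) ap_ide[OF R that] by auto
    obtain r w' where w: "?w = r # w'" using False by (cases ?w) auto
    have front: "simulates (ide SA ?R) ?w ((?X, fst ?R, V) # ?b) ?t"
      unfolding w by (rule simulates_front[OF bc(4)[unfolded w] iV]) (use t hR m in simp_all)
    have "simulates (ide SA ?R) ?w (((?X, fst ?R, V) # ?b) @ [rel_conv D (?X, fst ?R, V)]) (ide SA ?R)"
    proof (rule simulates_back[OF front False cV(2)])
      have "fst (rel_conv D (?X, fst ?R, V)) = fst ?R" "fst (snd (rel_conv D (?X, fst ?R, V))) = ?X"
        using cV(1) by (metis fst_conv snd_conv)+
      then show "fst (rel_conv D (?X, fst ?R, V)) = fst (Cod SA (ide SA ?R))"
        "fst (snd (rel_conv D (?X, fst ?R, V))) = fst (Cod SA ?t)" using t hR by simp_all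
      show "(ap (ide SA ?R) a, ap ?t a) \<in> rsem (rel_conv D (?X, fst ?R, V))" if "a \<in> pts (Dom SA ?t)" for a
        unfolding cV(3) using m[of a] that t(4) by simp
    qed (use t hR in simp_all)
    moreover have "acceptable_loop D CD (fst ?R) ([(?X, fst ?R, V)] @ ?b @ [rel_conv D (?X, fst ?R, V)])"
      by (rule acceptable_loop.conjugate[OF acc V(1)])
    ultimately show ?thesis unfolding Base using R by (intro conjI exI) (assumption, simp, simp)
  qed
qed

section \<open>The loop condition and the product condition\<close>

lemma loop_condition_SD: "loop_condition SD (span_partial_maps SA (Synt_M D CD))"
  unfolding loop_condition_def
proof (intro allI impI ballI)
  fix P w A assume w: "acceptable_loop SD (span_partial_maps SA (Synt_M D CD)) P w" and "A \<in> carrier (Fib SD P)"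
  then have A: "A \<in> subs P" by simp
  obtain b where P: "P \<in> formulas D" and b: "acceptable_loop D CD (fst P) b" "simulates (ide SA P) w b (ide SA P)"
    using acceptable_loop_simulated[OF w] by blast
  have h: "Dom SA (ide SA P) = P" "Cod SA (ide SA P) = P" using ide_SA(1)[OF P] by (auto simp: hom_def)
  have X: "fst P \<in> Ob (Base D)" using P by (simp add: formulas_iff)
  obtain \<alpha> where a: "(fst P, \<alpha>) \<in> formulas D" "sem (fst P) \<alpha> = ssem A" "ssem A \<subseteq> pts P" using subs_formula[OF A] .
  have ac: "\<alpha> \<in> carrier (Fib D (fst P))" using a by (simp add: formulas_iff)
  \<comment> \<open>The simulating loop is applied to the closure of \<open>\<alpha>\<close>, since
    \<open>simulates_dia_loop\<close> starts from a closed formula. Nothing is lost: the bound it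
    yields is the closure of \<open>?B\<close>, which is \<open>?B\<close> again.\<close>
  let ?B = "\<diamond>\<^bsub>Fib D (fst P)\<^esub> \<alpha>"
  note d = dia_sem[OF X ac]
  have "ap (ide SA P) ` ssem A \<subseteq> sem (fst P) ?B" using ap_ide[OF P] a(2,3) d(2)
    by (simp add: image_subset_iff subset_iff)
  from simulates_dia_loop[OF b(2), unfolded h, OF A d(1,3) this]
  have l: "dia_loop SD w A \<in> subs P" "ap (ide SA P) ` ssem (dia_loop SD w A) \<subseteq> sem (fst P) (dia_loop D b ?B)" by auto
  have lp: "ssem (dia_loop SD w A) \<subseteq> pts P" using subs_formula[OF l(1)] by blast
  have "dia_loop D b ?B \<sqsubseteq>\<^bsub>Fib D (fst P)\<^esub> \<diamond>\<^bsub>Fib D (fst P)\<^esub> ?B"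
    using LC b(1) d(1) unfolding loop_condition_def by blast
  moreover have "dia_loop D b ?B \<in> carrier (Fib D (fst P))"
  proof -
    have "rel_chain (fst P) b (fst P)" using simulates_chain[OF b(2)] h by simp
    from dia_rsems(1)[OF this d(1,3) Fib_top(2)[OF X]] show ?thesis using sem_bottom[OF X] by simp
  qed
  ultimately have "sem (fst P) (dia_loop D b ?B) \<subseteq> sem (fst P) ?B"
    using sem_le[OF X, of "dia_loop D b ?B" ?B] d(1,3) by simp
  then have "ssem (dia_loop SD w A) \<subseteq> pts P \<inter> sem (fst P) ?B" using l(2) lp ap_ide[OF P] by force
  moreover note dd = Synt_dia_sem[OF A ac a(2)]
  ultimately show "dia_loop SD w A \<sqsubseteq>\<^bsub>Fib SD P\<^esub> \<diamond>\<^bsub>Fib SD P\<^esub> A"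
    using subs_le[OF l(1) dd(1)] dd(2) by simp
qed

text \<open>The condition of \<open>D\<close> speaks about the product of the base objects. It is
  transported to the chosen product by the comparison \<open>?t\<close>, which reflects closures by
  \<open>Synt_dia_embedding\<close>.\<close>

lemma product_condition_SD: "product_condition SD"
  unfolding product_condition_def Let_def
proof (intro ballI)
  fix P Q A B assume "P \<in> Ob (Base SD)" "Q \<in> Ob (Base SD)" "A \<in> carrier (Fib SD P)" "B \<in> carrier (Fib SD Q)"
  then have PQ: "P \<in> Ob SA" "Q \<in> Ob SA" and A: "A \<in> subs P" and B: "B \<in> subs Q" by simp_all
  then have P: "P \<in> formulas D" and Q: "Q \<in> formulas D" by (simp_all add: SA_sel)
  have O: "fst P \<in> Ob (Base D)" "fst Q \<in> Ob (Base D)" using P Q by (simp_all add: formulas_iff)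
  let ?R = "prod_ob SA P Q" let ?p = "pr1 SA P Q" let ?q = "pr2 SA P Q"
  have R: "?p \<in> hom SA ?R P" "?q \<in> hom SA ?R Q" using PQ by (simp_all add: hom_def)
  have RF: "?R \<in> formulas D" using hom_formulas[OF R(1)] by simp
  obtain \<alpha> where a: "(fst P, \<alpha>) \<in> formulas D" "sem (fst P) \<alpha> = ssem A" "ssem A \<subseteq> pts P" using subs_formula[OF A] .
  obtain \<beta> where b: "(fst Q, \<beta>) \<in> formulas D" "sem (fst Q) \<beta> = ssem B" "ssem B \<subseteq> pts Q" using subs_formula[OF B] .
  have c: "\<alpha> \<in> carrier (Fib D (fst P))" "\<beta> \<in> carrier (Fib D (fst Q))" using a b by (auto simp: formulas_iff)
  note dA = Synt_dia_sem[OF A c(1) a(2)] note dB = Synt_dia_sem[OF B c(2) b(2)]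
  let ?i = "ide SA P" let ?j = "ide SA Q" let ?t = "tensor ?i ?j"
  have i: "?i \<in> Arr SA" "?j \<in> Arr SA" "Dom SA ?i = P" "Dom SA ?j = Q" "Cod SA ?i = P" "Cod SA ?j = Q" using PQ by simp_all
  note t = tensor[OF i(1,2), unfolded i(3-6)]
  have e: "embed ?t" by (rule embed_tensor_ide[OF P Q])
  have th: "?t \<in> hom SA ?R (prodF P Q)" by (rule t(1))
  let ?X = "prod_ob (Base D) (fst P) (fst Q)"
  let ?bp = "pr1 (Base D) (fst P) (fst Q)" let ?bq = "pr2 (Base D) (fst P) (fst Q)"
  have X: "?X \<in> Ob (Base D)" and bpq: "?bp \<in> hom (Base D) ?X (fst P)" "?bq \<in> hom (Base D) ?X (fst Q)"
    using O by (simp_all add: hom_def)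
  have tc: "ap ?t z \<in> El ?X \<and> act ?bp (ap ?t z) = ap ?p z \<and> act ?bq (ap ?t z) = ap ?q z" if z: "z \<in> pts ?R" for z
  proof -
    have "ap ?t z = tuple (fst P) (fst Q) (ap ?p z) (ap ?q z)"
      using t(2)[OF z] ap_ide[OF P] ap_ide[OF Q] ap_pts[OF R(1) z] ap_pts[OF R(2) z] by simp
    moreover have "ap ?p z \<in> El (fst P)" "ap ?q z \<in> El (fst Q)" "fib (ap ?p z) = fib (ap ?q z)"
      using ap_pts[OF R(1) z] ap_pts[OF R(2) z] pts_El[OF P] pts_El[OF Q] fib_ap[OF R(1) z] fib_ap[OF R(2) z] by auto
    ultimately show ?thesis using tuple_simps[OF O] by simp
  qed
  let ?\<gamma> = "Sub D ?bp \<alpha> \<sqinter>\<^bsub>Fib D ?X\<^esub> Sub D ?bq \<beta>"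
  note sa = sem_Sub[OF bpq(1) c(1)] note sb = sem_Sub[OF bpq(2) c(2)]
  have g: "?\<gamma> \<in> carrier (Fib D ?X)" "sem ?X ?\<gamma> = {d \<in> El ?X. act ?bp d \<in> ssem A \<and> act ?bq d \<in> ssem B}"
    using sem_meet[OF X conjunct1[OF sa] conjunct1[OF sb]] sa sb a(2) b(2) by auto
  note dsa = sem_Sub[OF bpq(1) dia_sem(1)[OF O(1) c(1)]] note dsb = sem_Sub[OF bpq(2) dia_sem(1)[OF O(2) c(2)]]
  have "Sub D ?bp (\<diamond>\<^bsub>Fib D (fst P)\<^esub> \<alpha>) \<sqinter>\<^bsub>Fib D ?X\<^esub> Sub D ?bq (\<diamond>\<^bsub>Fib D (fst Q)\<^esub> \<beta>) \<sqsubseteq>\<^bsub>Fib D ?X\<^esub> \<diamond>\<^bsub>Fib D ?X\<^esub> ?\<gamma>"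
    using PI O c unfolding product_condition_def Let_def by blast
  then have pi: "sem ?X (Sub D ?bp (\<diamond>\<^bsub>Fib D (fst P)\<^esub> \<alpha>)) \<inter> sem ?X (Sub D ?bq (\<diamond>\<^bsub>Fib D (fst Q)\<^esub> \<beta>)) \<subseteq> sem ?X (\<diamond>\<^bsub>Fib D ?X\<^esub> ?\<gamma>)"
    using sem_le[OF X _ dia_sem(1)[OF X g(1)]] sem_meet[OF X conjunct1[OF dsa] conjunct1[OF dsb]] by simp
  note pA = subobj_pullback_sem[OF R(1) A] note pB = subobj_pullback_sem[OF R(2) B]
  note pdA = subobj_pullback_sem[OF R(1) dA(1)] note pdB = subobj_pullback_sem[OF R(2) dB(1)]
  let ?L = "Fib SD ?R"
  note BL = subs_boolean[OF RF, of ?L, OF SD_sel(2,3,4)]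
  interpret L: boolean_lattice ?L by (rule BL(1))
  let ?M = "subobj_pullback SA ?p A \<sqinter>\<^bsub>?L\<^esub> subobj_pullback SA ?q B"
  have M: "?M \<in> subs ?R" "ssem ?M = {z \<in> pts ?R. ap ?p z \<in> ssem A \<and> ap ?q z \<in> ssem B}"
    using L.meet_closed[of "subobj_pullback SA ?p A" "subobj_pullback SA ?q B"] BL(2)[OF pA(1) pB(1)] pA pB by auto
  let ?N = "subobj_pullback SA ?p (Synt_dia D CD P A) \<sqinter>\<^bsub>?L\<^esub> subobj_pullback SA ?q (Synt_dia D CD Q B)"
  have N: "?N \<in> subs ?R" "ssem ?N = {z \<in> pts ?R. ap ?p z \<in> ssem (Synt_dia D CD P A) \<and> ap ?q z \<in> ssem (Synt_dia D CD Q B)}"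
    using L.meet_closed[of "subobj_pullback SA ?p (Synt_dia D CD P A)" "subobj_pullback SA ?q (Synt_dia D CD Q B)"]
      BL(2)[OF pdA(1) pdB(1)] pdA pdB by auto
  have PF: "prodF P Q \<in> formulas D" "fst (prodF P Q) = ?X" using prodF[OF P Q] by auto
  have gsub: "sem ?X ?\<gamma> \<subseteq> pts (prodF P Q)" using g(2) a(3) b(3) prodF(3)[OF P Q] by auto
  let ?G = "inclusion_subobj D CD (prodF P Q) ?\<gamma>"
  have G: "?G \<in> subs (prodF P Q)" "ssem ?G = sem ?X ?\<gamma>"
    using inclusion_subobj[OF PF(1), of ?\<gamma>] g(1) gsub X PF(2) by (auto simp: formulas_iff)
  \<comment> \<open>Under \<open>?t\<close> the meet \<open>?M\<close> of the two preimages
    corresponds to the formula \<open>?\<gamma>\<close>. A point of \<open>?\<gamma>\<close> is hit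
    because its two projections can be tupled in the chosen product.\<close>
  have tM: "ssem ?G = ap ?t ` ssem ?M"
  proof
    show "ap ?t ` ssem ?M \<subseteq> ssem ?G" using M(2) G(2) g(2) tc by auto
    show "ssem ?G \<subseteq> ap ?t ` ssem ?M"
    proof
      fix d assume "d \<in> ssem ?G"
      then have d: "d \<in> El ?X" "act ?bp d \<in> ssem A" "act ?bq d \<in> ssem B" using G(2) g(2) by auto
      have "fib (act ?bp d) = fib (act ?bq d)" using d(1) O by simp
      moreover have "act ?bp d \<in> pts P" "act ?bq d \<in> pts Q" using d a b by auto
      ultimately obtain z where z: "z \<in> pts ?R" "ap ?p z = act ?bp d" "ap ?q z = act ?bq d"
        using sd.tuple_exists[of P Q "act ?bp d" "act ?bq d"] PQ by auto
      have "ap ?t z = d"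
        by (rule tuple_unique[OF O]) (use tc[OF z(1)] z d in auto)
      then show "d \<in> ap ?t ` ssem ?M" using z d M(2) by auto
    qed
  qed
  note dG = Synt_dia_sem[OF G(1), of ?\<gamma>]
  have "z \<in> ssem (Synt_dia D CD ?R ?M)" if z: "z \<in> ssem ?N" for z
  proof (rule Synt_dia_embedding[OF e th M(1) G(1) tM])
    have z': "z \<in> pts ?R" "ap ?p z \<in> sem (fst P) (\<diamond>\<^bsub>Fib D (fst P)\<^esub> \<alpha>)" "ap ?q z \<in> sem (fst Q) (\<diamond>\<^bsub>Fib D (fst Q)\<^esub> \<beta>)"
      using z N(2) dA(2) dB(2) by auto
    show "z \<in> pts ?R" by (rule z'(1))
    have "ap ?t z \<in> sem ?X (\<diamond>\<^bsub>Fib D ?X\<^esub> ?\<gamma>)" using pi dsa dsb tc[OF z'(1)] z' by auto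
    then show "ap ?t z \<in> ssem (Synt_dia D CD (prodF P Q) ?G)"
      using dG(2) ap_pts[OF th z'(1)] g(1) G(2) PF(2) by simp
  qed
  moreover obtain \<mu> where mu: "(fst ?R, \<mu>) \<in> formulas D" "sem (fst ?R) \<mu> = ssem ?M" using subs_formula[OF M(1)] .
  have dM: "Synt_dia D CD ?R ?M \<in> subs ?R" by (rule Synt_dia_sem(1)[OF M(1) _ mu(2)]) (use mu(1) in \<open>simp add: formulas_iff\<close>)
  ultimately have "?N \<sqsubseteq>\<^bsub>subobj_order SA (Synt_M D CD) ?R\<^esub> Synt_dia D CD ?R ?M"
    using subs_le[OF N(1) dM] by blast
  then show "Sub SD (pr1 (Base SD) P Q) (\<diamond>\<^bsub>Fib SD P\<^esub> A) \<sqinter>\<^bsub>Fib SD (prod_ob (Base SD) P Q)\<^esub> Sub SD (pr2 (Base SD) P Q) (\<diamond>\<^bsub>Fib SD Q\<^esub> B)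
      \<sqsubseteq>\<^bsub>Fib SD (prod_ob (Base SD) P Q)\<^esub> \<diamond>\<^bsub>Fib SD (prod_ob (Base SD) P Q)\<^esub>
        (Sub SD (pr1 (Base SD) P Q) A \<sqinter>\<^bsub>Fib SD (prod_ob (Base SD) P Q)\<^esub> Sub SD (pr2 (Base SD) P Q) B)"
    by simp
qed

lemma topological_modal_category_SA: "topological_modal_category SA (Synt_E D CD) (Synt_M D CD) (Synt_dia D CD)"
  by (intro topological_modal_category.intro modal_category_SA topological_modal_category_axioms.intro
      S4_modal_algebra_SD product_condition_SD loop_condition_SD) (simp add: SA_sel)

end

theorem proposition5p13:
  fixes D :: "('o, 'a, 'd) doctrine" and CD :: "('o, 'd) rel set"
  assumes "topological_modal_doctrine D CD"
  shows "topological_modal_category (Synt_S4 D CD) (Synt_E D CD) (Synt_M D CD) (Synt_dia D CD)"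
proof -
  interpret topological_modal_doctrine D CD by fact
  interpret boolean_semantics D "\<lambda>X. henkin_sem X \<top>\<^bsub>Fib D X\<^esub>" henkin_act henkin_sem fst
    by (rule henkin_semantics)
  interpret doctrine_model D CD "\<lambda>X. henkin_sem X \<top>\<^bsub>Fib D X\<^esub>" henkin_act henkin_sem fst ..
  show ?thesis by (rule topological_modal_category_SA)
qed

end
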